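(* For every $k\in\mathbb{N}$, the $k$-th exact eigenvalue $\lambda=\lambda_k$ of the Schrödinger eigenvalue problem, the $k$-th Crouzeix–Raviart eigenvalue $\lambda_{\mathrm{CR}}=\lambda_{\mathrm{CR}(k)}$, and the first Crouzeix–Raviart eigenvalue $\mu=\lambda_{\mathrm{CR}(1)}$ satisfy $$\mathrm{GLB}_{\mu}:=\frac{\lambda_{\mathrm{CR}}}{1+\big(\sqrt{\varepsilon}+\sqrt{\delta/\mu}\big)^2\lambda_{\mathrm{CR}}}\le\lambda .$$
   Context: Let $\Omega\subset\mathbb{R}^n$, $n\ge2$, be a polyhedral bounded Lipschitz domain and $V\in L^\infty(\Omega)$ with $\operatorname{ess\,inf}_\Omega V=0$. Write $(v,w)_V:=\int_\Omega V v w\,dx$. The exact eigenvalues $0<\lambda_1\le\lambda_2\le\dots$ (counted with multiplicity) are those of: find $(\lambda,u)\in\mathbb{R}_+\times H_0^1(\Omega)$, $u\ne0$, with $\int_\Omega\nabla u\cdot\nabla v\,dx+(u,v)_V=\lambda\int_\Omega uv\,dx$ for all $v\in H^1_0(\Omega)$. $\mathcal{T}$ is a regular (face-to-face) triangulation of $\Omega$ into non-degenerate compact $n$-simplices, $h_T:=\operatorname{diam}(T)$, $h_{\mathcal T}|_T:=h_T$, $\mathcal F$ is the set of all faces, $\mathcal F(\Omega)$ the set of interior faces, $\operatorname{mid}(F)$ the barycenter of $F$. The jump $[v]_F$ of a piecewise continuous function is the difference of the traces from the two adjacent simplices if $F$ is interior and the trace $v|_F$ if $F\subset\partial\Omega$.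 $P_1(\mathcal T)$ is the space of piecewise affine functions and $\mathrm{CR}_0^1(\mathcal T):=\{v\in P_1(\mathcal T): [v]_F(\operatorname{mid}(F))=0\ \forall F\in\mathcal F\}$. Let $a_{\mathrm{pw}}(v,w):=\sum_{T\in\mathcal T}\int_T\nabla v\cdot\nabla w\,dx$. The Crouzeix–Raviart eigenvalues $0<\lambda_{\mathrm{CR}(1)}\le\dots\le\lambda_{\mathrm{CR}(N)}$, $N=\dim\mathrm{CR}_0^1(\mathcal T)$, are those of: find $(\lambda_h,u_h)\in\mathbb{R}_+\times\mathrm{CR}_0^1(\mathcal T)$, $u_h\neq0$, with $a_{\mathrm{pw}}(u_h,v_h)+(u_h,v_h)_V=\lambda_h\int_\Omega u_hv_h\,dx$ for all $v_h\in\mathrm{CR}_0^1(\mathcal T)$. Convention: $\lambda_{\mathrm{CR}(k)}=+\infty$ for $k>N$, and the bound is then read as its limit for $\lambda_{\mathrm{CR}}\to\infty$ (with $\delta/\mu=0$ if $\mu=+\infty$). Interpolation: for $F\in\mathcal F(\Omega)$ let $\psi_F\in\mathrm{CR}^1_0(\mathcal T)$ be the function equal to $1$ at $\operatorname{mid}(F)$ and $0$ at the midpoints of all other faces, and $I_{\mathrm{CR}}v:=\sum_{F\in\mathcal F(\Omega)}\big(|F|^{-1}\int_Fv\,ds\big)\psi_F$. The constant $\kappa_{\mathrm{CR}}>0$ is such that $\|v-I_{\mathrm{CR}}v\|_{L^2(T)}\le\kappa_{\mathrm{CR}}h_T\|\nabla(v-I_{\mathrm{CR}}v)\|_{L^2(T)}$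 for all $v\in H^1_0(\Omega)$, $T\in\mathcal T$ (admissible choices are $\kappa_{\mathrm{CR}}=0.1893$ for $n=2$ and $\kappa_{\mathrm{CR}}^2=\pi^{-2}+\frac1{2n(n+1)(n+2)}$ for all $n\ge2$). Set $\varepsilon:=\|\kappa_{\mathrm{CR}}^2h_{\mathcal T}^2\|_{L^\infty(\Omega)}$ and $\delta:=\|\kappa_{\mathrm{CR}}^2h_{\mathcal T}^2V\|_{L^\infty(\Omega)}$. *)

theory Defs
  imports "HOL-Analysis.Analysis" "HOL-Probability.Essential_Supremum"
begin

section \<open>Lebesgue and Sobolev spaces\<close>

text \<open>
  Elements of function spaces are represented by functions on the whole space. Two functions
  that agree almost everywhere represent the same element.
\<close>

definition L2_space :: "'a measure \<Rightarrow> ('a \<Rightarrow> 'b::euclidean_space) set" where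
  "L2_space M = {f. f \<in> borel_measurable M \<and> integrable M (\<lambda>x. (norm (f x))\<^sup>2)}"

definition L2_norm :: "'a measure \<Rightarrow> ('a \<Rightarrow> 'b::euclidean_space) \<Rightarrow> real" where
  "L2_norm M f = sqrt (LINT x|M. (norm (f x))\<^sup>2)"

definition Linf_space :: "'a measure \<Rightarrow> ('a \<Rightarrow> real) set" where
  "Linf_space M = {f. f \<in> borel_measurable M \<and> esssup M (\<lambda>x. ereal \<bar>f x\<bar>) < \<infinity>}"

definition Linf_norm :: "'a measure \<Rightarrow> ('a \<Rightarrow> real) \<Rightarrow> real" where
  "Linf_norm M f = real_of_ereal (esssup M (\<lambda>x. ereal \<bar>f x\<bar>))"

definition essinf :: "'a measure \<Rightarrow> ('a \<Rightarrow> ereal) \<Rightarrow> ereal" where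
  "essinf M f = - esssup M (\<lambda>x. - f x)"

definition partial_deriv :: "'a::euclidean_space \<Rightarrow> ('a \<Rightarrow> real) \<Rightarrow> 'a \<Rightarrow> real" where
  "partial_deriv b f x = frechet_derivative f (at x) b"

text \<open>Infinite differentiability: every iterated partial derivative is differentiable.\<close>

definition smooth :: "('a::euclidean_space \<Rightarrow> real) \<Rightarrow> bool" where
  "smooth f \<longleftrightarrow>
    (\<forall>bs. set bs \<subseteq> Basis \<longrightarrow> (\<forall>x. fold partial_deriv bs f differentiable (at x)))"

definition test_functions :: "'a::euclidean_space set \<Rightarrow> ('a \<Rightarrow> real) set" where
  "test_functions U =
    {\<phi>. smooth \<phi> \<and> compact (closure {x. \<phi> x \<noteq> 0}) \<and> closure {x. \<phi> x \<noteq> 0} \<subseteq> U}"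

definition has_weak_gradient ::
    "'a::euclidean_space set \<Rightarrow> ('a \<Rightarrow> real) \<Rightarrow> ('a \<Rightarrow> 'a) \<Rightarrow> bool" where
  "has_weak_gradient U u g \<longleftrightarrow>
    u \<in> L2_space (lebesgue_on U) \<and> g \<in> L2_space (lebesgue_on U) \<and>
    (\<forall>\<phi>\<in>test_functions U. \<forall>b\<in>Basis.
       (LINT x|lebesgue_on U. u x * partial_deriv b \<phi> x) = - (LINT x|lebesgue_on U. (g x \<bullet> b) * \<phi> x))"

definition weak_gradient :: "'a::euclidean_space set \<Rightarrow> ('a \<Rightarrow> real) \<Rightarrow> 'a \<Rightarrow> 'a" where
  "weak_gradient U u = (SOME g. has_weak_gradient U u g)"

definition H1 :: "'a::euclidean_space set \<Rightarrow> ('a \<Rightarrow> real) set" where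
  "H1 U = {u. \<exists>g. has_weak_gradient U u g}"

definition grad_inner ::
    "'a::euclidean_space set \<Rightarrow> ('a \<Rightarrow> real) \<Rightarrow> ('a \<Rightarrow> real) \<Rightarrow> real" where
  "grad_inner U v w = (LINT x|lebesgue_on U. weak_gradient U v x \<bullet> weak_gradient U w x)"

definition H1_norm :: "'a::euclidean_space set \<Rightarrow> ('a \<Rightarrow> real) \<Rightarrow> real" where
  "H1_norm U u =
    sqrt ((L2_norm (lebesgue_on U) u)\<^sup>2 + (L2_norm (lebesgue_on U) (weak_gradient U u))\<^sup>2)"

definition H1_approx ::
    "'a::euclidean_space set \<Rightarrow> (nat \<Rightarrow> 'a \<Rightarrow> real) \<Rightarrow> ('a \<Rightarrow> real) \<Rightarrow> bool" where
  "H1_approx U \<phi> u \<longleftrightarrow>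
    (\<forall>j. \<phi> j \<in> test_functions U) \<and> (\<lambda>j. H1_norm U (\<lambda>x. u x - \<phi> j x)) \<longlonglongrightarrow> 0"

definition H10 :: "'a::euclidean_space set \<Rightarrow> ('a \<Rightarrow> real) set" where
  "H10 U = {u \<in> H1 U. \<exists>\<phi>. H1_approx U \<phi> u}"


section \<open>Eigenvalues counted with multiplicity\<close>

text \<open>
  \<open>W\<close> is a space of functions and \<open>a\<close> a symmetric bilinear form on it; the eigenvalue problem is
  \<open>a u v = \<nu> * (u, v)\<close> for all \<open>v \<in> W\<close>, with the inner product of \<open>L\<^sup>2(M)\<close> on the right.
\<close>

definition eigenspace ::
    "'a measure \<Rightarrow> ('a \<Rightarrow> real) set \<Rightarrow> (('a \<Rightarrow> real) \<Rightarrow> ('a \<Rightarrow> real) \<Rightarrow> real) \<Rightarrow> real \<Rightarrow>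
     ('a \<Rightarrow> real) set" where
  "eigenspace M W a \<nu> = {u \<in> W. \<forall>v\<in>W. a u v = \<nu> * (LINT x|M. u x * v x)}"

definition eigenvalues ::
    "'a measure \<Rightarrow> ('a \<Rightarrow> real) set \<Rightarrow> (('a \<Rightarrow> real) \<Rightarrow> ('a \<Rightarrow> real) \<Rightarrow> real) \<Rightarrow> real set" where
  "eigenvalues M W a =
    {\<nu>. \<nu> > 0 \<and> (\<exists>u\<in>eigenspace M W a \<nu>. \<not> (AE x in M. u x = 0))}"

definition ae_independent :: "'a measure \<Rightarrow> nat \<Rightarrow> (nat \<Rightarrow> 'a \<Rightarrow> real) \<Rightarrow> bool" where
  "ae_independent M m u \<longleftrightarrow>
    (\<forall>c. (AE x in M. (\<Sum>i<m. c i * u i x) = 0) \<longrightarrow> (\<forall>i<m. c i = 0))"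

text \<open>The dimension of a linear space of functions modulo almost everywhere equality.\<close>

definition ae_dim :: "'a measure \<Rightarrow> ('a \<Rightarrow> real) set \<Rightarrow> enat" where
  "ae_dim M E = Sup {enat m | m. \<exists>u. (\<forall>i<m. u i \<in> E) \<and> ae_independent M m u}"

text \<open>
  The number of eigenvalues up to \<open>t\<close>, each counted as often as the dimension of its eigenspace.
  The supremum over finite sets is the sum over all of them, which may be infinite.
\<close>

definition eigenvalue_count ::
    "'a measure \<Rightarrow> ('a \<Rightarrow> real) set \<Rightarrow> (('a \<Rightarrow> real) \<Rightarrow> ('a \<Rightarrow> real) \<Rightarrow> real) \<Rightarrow> real \<Rightarrow> enat" where
  "eigenvalue_count M W a t =
    (SUP \<Lambda>\<in>{\<Lambda>. finite \<Lambda> \<and> \<Lambda> \<subseteq> eigenvalues M W a \<inter> {..t}}.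
       \<Sum>\<nu>\<in>\<Lambda>. ae_dim M (eigenspace M W a \<nu>))"

text \<open>
  The \<open>k\<close>-th entry (\<open>k \<ge> 1\<close>) of the nondecreasing list of eigenvalues, repeated according to
  multiplicity, is the least \<open>t\<close> up to which there are at least \<open>k\<close> eigenvalues. It is \<open>\<infinity>\<close> if the
  list has fewer than \<open>k\<close> entries (infimum of the empty set).
\<close>

definition kth_eigenvalue ::
    "'a measure \<Rightarrow> ('a \<Rightarrow> real) set \<Rightarrow> (('a \<Rightarrow> real) \<Rightarrow> ('a \<Rightarrow> real) \<Rightarrow> real) \<Rightarrow> nat \<Rightarrow> ereal" where
  "kth_eigenvalue M W a k = (INF t\<in>{t. enat k \<le> eigenvalue_count M W a t}. ereal t)"

lemma kth_eigenvalue_eqI: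
  assumes "enat k \<le> eigenvalue_count M W a \<nu>"
    and "\<And>t. t < \<nu> \<Longrightarrow> eigenvalue_count M W a t < enat k"
  shows "kth_eigenvalue M W a k = ereal \<nu>"
  unfolding kth_eigenvalue_def
proof (rule antisym)
  show "(INF t\<in>{t. enat k \<le> eigenvalue_count M W a t}. ereal t) \<le> ereal \<nu>"
    using assms(1) by (intro INF_lower) auto
  show "ereal \<nu> \<le> (INF t\<in>{t. enat k \<le> eigenvalue_count M W a t}. ereal t)"
    using assms(2) by (intro INF_greatest) (auto simp: not_less[symmetric])
qed


section \<open>Domains and triangulations\<close>

text \<open>
  Near each boundary point, in suitable Cartesian coordinates with last axis \<open>e\<close>, the domain is
  the set of points strictly above the graph of a Lipschitz function.
\<close>

definition bounded_lipschitz_domain :: "'a::euclidean_space set \<Rightarrow> bool" where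
  "bounded_lipschitz_domain \<Omega> \<longleftrightarrow>
    open \<Omega> \<and> connected \<Omega> \<and> \<Omega> \<noteq> {} \<and> bounded \<Omega> \<and>
    (\<forall>x\<in>frontier \<Omega>. \<exists>U e L (\<gamma> :: 'a \<Rightarrow> real).
       open U \<and> x \<in> U \<and> norm e = 1 \<and> L-lipschitz_on UNIV \<gamma> \<and>
       \<Omega> \<inter> U = {y \<in> U. \<gamma> (y - (y \<bullet> e) *\<^sub>R e) < y \<bullet> e})"

definition polyhedral :: "'a::euclidean_space set \<Rightarrow> bool" where
  "polyhedral \<Omega> \<longleftrightarrow> (\<exists>\<P>. finite \<P> \<and> (\<forall>P\<in>\<P>. polytope P) \<and> closure \<Omega> = \<Union>\<P>)"

definition regular_triangulation :: "'a::euclidean_space set \<Rightarrow> 'a set set \<Rightarrow> bool" where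
  "regular_triangulation \<Omega> \<T> \<longleftrightarrow>
    triangulation \<T> \<and> (\<forall>T\<in>\<T>. int DIM('a) simplex T) \<and> \<Union>\<T> = closure \<Omega>"

definition mesh_faces :: "'a::euclidean_space set set \<Rightarrow> 'a set set" where
  "mesh_faces \<T> = {F. \<exists>T\<in>\<T>. F facet_of T}"

definition interior_faces :: "'a::euclidean_space set \<Rightarrow> 'a set set \<Rightarrow> 'a set set" where
  "interior_faces \<Omega> \<T> = {F \<in> mesh_faces \<T>. \<not> F \<subseteq> frontier \<Omega>}"

definition mesh_size :: "'a::euclidean_space set set \<Rightarrow> 'a \<Rightarrow> real" where
  "mesh_size \<T> x = (\<Sum>T\<in>\<T>. diameter T * indicator (interior T) x)"

definition mid :: "'a::euclidean_space set \<Rightarrow> 'a" where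
  "mid F = (\<Sum>x | x extreme_point_of F. x) /\<^sub>R real (card {x. x extreme_point_of F})"

text \<open>
  The \<open>(n-1)\<close>-dimensional surface measure on a facet \<open>F\<close>: a Borel subset of \<open>F\<close> is measured by the
  volume of the right prism of height 1 over it (1/2 on either side of the hyperplane).
\<close>

definition surface_measure :: "'a::euclidean_space set \<Rightarrow> 'a measure" where
  "surface_measure F =
    distr (restrict_space lborel
             {x. closest_point (affine hull F) x \<in> F \<and> infdist x (affine hull F) \<le> 1/2})
          borel (closest_point (affine hull F))"


section \<open>The Crouzeix--Raviart space\<close>

definition P1 :: "'a::euclidean_space set set \<Rightarrow> ('a \<Rightarrow> real) set" where
  "P1 \<T> = {v. \<forall>T\<in>\<T>. \<exists>a b. \<forall>x\<in>interior T. v x = a \<bullet> x + b}"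

text \<open>
  The trace of a piecewise continuous function from within \<open>T\<close>. Values on the boundaries of the
  simplices, a null set, are irrelevant throughout.
\<close>

definition trace_from :: "'a::euclidean_space set \<Rightarrow> ('a \<Rightarrow> real) \<Rightarrow> 'a \<Rightarrow> real" where
  "trace_from T v x = Lim (at x within interior T) v"

definition T_plus :: "'a::euclidean_space set set \<Rightarrow> 'a set \<Rightarrow> 'a set" where
  "T_plus \<T> F = (SOME T. T \<in> \<T> \<and> F facet_of T)"

definition T_minus :: "'a::euclidean_space set set \<Rightarrow> 'a set \<Rightarrow> 'a set" where
  "T_minus \<T> F = (SOME T. T \<in> \<T> \<and> F facet_of T \<and> T \<noteq> T_plus \<T> F)"

definition jump ::
    "'a::euclidean_space set \<Rightarrow> 'a set set \<Rightarrow> ('a \<Rightarrow> real) \<Rightarrow> 'a set \<Rightarrow> 'a \<Rightarrow> real" where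
  "jump \<Omega> \<T> v F x =
    (if F \<in> interior_faces \<Omega> \<T>
     then trace_from (T_plus \<T> F) v x - trace_from (T_minus \<T> F) v x
     else trace_from (T_plus \<T> F) v x)"

definition CR10 :: "'a::euclidean_space set \<Rightarrow> 'a set set \<Rightarrow> ('a \<Rightarrow> real) set" where
  "CR10 \<Omega> \<T> = {v \<in> P1 \<T>. \<forall>F\<in>mesh_faces \<T>. jump \<Omega> \<T> v F (mid F) = 0}"

definition a_pw ::
    "'a::euclidean_space set set \<Rightarrow> ('a \<Rightarrow> real) \<Rightarrow> ('a \<Rightarrow> real) \<Rightarrow> real" where
  "a_pw \<T> v w = (\<Sum>T\<in>\<T>. grad_inner (interior T) v w)"

definition CR_basis ::
    "'a::euclidean_space set \<Rightarrow> 'a set set \<Rightarrow> 'a set \<Rightarrow> 'a \<Rightarrow> real" where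
  "CR_basis \<Omega> \<T> F =
    (SOME \<psi>. \<psi> \<in> CR10 \<Omega> \<T> \<and>
       (\<forall>T\<in>\<T>. \<forall>E. E facet_of T \<longrightarrow> trace_from T \<psi> (mid E) = (if E = F then 1 else 0)))"

text \<open>
  The trace on a face \<open>F\<close> of a function in \<open>H10 \<Omega>\<close>: the continuous extension to \<open>H10 \<Omega>\<close> of the
  restriction map from the test functions to \<open>L\<^sup>2(F)\<close>.
\<close>

definition H10_trace ::
    "'a::euclidean_space set \<Rightarrow> 'a set \<Rightarrow> ('a \<Rightarrow> real) \<Rightarrow> 'a \<Rightarrow> real" where
  "H10_trace \<Omega> F v =
    (SOME g. g \<in> L2_space (surface_measure F) \<and>
       (\<exists>\<phi>. H1_approx \<Omega> \<phi> v \<and>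
            (\<lambda>j. L2_norm (surface_measure F) (\<lambda>x. \<phi> j x - g x)) \<longlonglongrightarrow> 0))"

definition face_mean ::
    "'a::euclidean_space set \<Rightarrow> 'a set \<Rightarrow> ('a \<Rightarrow> real) \<Rightarrow> real" where
  "face_mean \<Omega> F v =
    (LINT x|surface_measure F. H10_trace \<Omega> F v x) / measure (surface_measure F) F"

definition I_CR ::
    "'a::euclidean_space set \<Rightarrow> 'a set set \<Rightarrow> ('a \<Rightarrow> real) \<Rightarrow> 'a \<Rightarrow> real" where
  "I_CR \<Omega> \<T> v x = (\<Sum>F\<in>interior_faces \<Omega> \<T>. face_mean \<Omega> F v * CR_basis \<Omega> \<T> F x)"


section \<open>The eigenvalue problems and the bound\<close>

definition V_inner ::
    "'a::euclidean_space set \<Rightarrow> ('a \<Rightarrow> real) \<Rightarrow> ('a \<Rightarrow> real) \<Rightarrow> ('a \<Rightarrow> real) \<Rightarrow> real" where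
  "V_inner \<Omega> V v w = (LINT x|lebesgue_on \<Omega>. V x * v x * w x)"

definition exact_eigenvalue ::
    "'a::euclidean_space set \<Rightarrow> ('a \<Rightarrow> real) \<Rightarrow> nat \<Rightarrow> ereal" where
  "exact_eigenvalue \<Omega> V =
    kth_eigenvalue (lebesgue_on \<Omega>) (H10 \<Omega>) (\<lambda>u v. grad_inner \<Omega> u v + V_inner \<Omega> V u v)"

definition CR_eigenvalue ::
    "'a::euclidean_space set \<Rightarrow> 'a set set \<Rightarrow> ('a \<Rightarrow> real) \<Rightarrow> nat \<Rightarrow> ereal" where
  "CR_eigenvalue \<Omega> \<T> V =
    kth_eigenvalue (lebesgue_on \<Omega>) (CR10 \<Omega> \<T>) (\<lambda>u v. a_pw \<T> u v + V_inner \<Omega> V u v)"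

text \<open>
  For \<open>lam = \<infinity>\<close> the value is the limit of \<open>x / (1 + c * x)\<close> as \<open>x\<close> tends to infinity, and
  \<open>\<delta> / \<mu>\<close> is read as 0 for \<open>\<mu> = \<infinity>\<close>.
\<close>

definition GLB :: "real \<Rightarrow> real \<Rightarrow> ereal \<Rightarrow> ereal \<Rightarrow> real" where
  "GLB \<epsilon> \<delta> \<mu> lam =
    (let q = (if \<mu> = \<infinity> then 0 else \<delta> / real_of_ereal \<mu>);
         c = (sqrt \<epsilon> + sqrt q)\<^sup>2
     in if lam = \<infinity> then 1 / c else real_of_ereal lam / (1 + c * real_of_ereal lam))"

end

theory Submission
  imports Defs
begin

text \<open>
  Let \<open>G u\<close> be the projection of \<open>u \<in> H10 \<Omega>\<close> onto the Crouzeix--Raviart space with respect to the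
  discrete energy \<open>a_pw + V_inner\<close>, whose norm is written \<open>|||.|||\<close>, and let \<open>e = u - I_CR u\<close>.
  Since \<open>e\<close> is \<open>a_pw\<close>-orthogonal to the discrete space, \<open>|||G u - I_CR u|||\<^sup>2\<close> is at most \<open>(e, e)_V\<close>,
  so \<open>\<parallel>u - G u\<parallel> \<le> \<parallel>e\<parallel> + |||G u - I_CR u||| / sqrt \<mu> \<le> (sqrt \<epsilon> + sqrt (\<delta> / \<mu>)) \<parallel>grad e\<parallel>\<close>
  and \<open>\<parallel>grad e\<parallel> \<le> |||u - G u|||\<close>. On the image under \<open>G\<close> of the span of the first \<open>k\<close> exact
  eigenfunctions this bounds the discrete Rayleigh quotient, and the discrete min-max principle
  gives the claim.

  The orthogonality of \<open>e\<close> says that the face means of \<open>u\<close> determine the mean of its gradient on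
  each simplex. For test functions this is the divergence theorem for constant fields along the
  edges; it extends to \<open>H10 \<Omega>\<close> by a trace inequality.
\<close>

section \<open>Spectral bases and the min-max principle\<close>

text \<open>Eigenvalues are defined by counting dimensions of eigenspaces, not by a min-max formula.
  On the exact side, k counted eigenfunctions span a space with Rayleigh quotient at most t, and
  this is all that is taken from the exact problem; a spectral basis is built only on the
  finite-dimensional discrete side. Both problems live in one space of functions that are H1 on
  every simplex, where \<open>a_pw\<close> restricts to either energy. Weak gradients, traces and
  basis functions are picked by choice, hence the work on almost everywhere uniqueness and on
  independence of the approximating sequence. The bound is what Young's inequality gives with its
  optimal weight; when that weight leaves (0,1), the bound is below t anyway. Dividing by \<mu>
  requires a definite discrete energy, although V may vanish and Crouzeix-Raviart functions are
  discontinuous. This is where the geometry of the triangulation enters. The surface measure uses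
  prisms normal to a face, while integration along edges produces oblique cylinders. A linear change
  of variables relates them, and its Jacobian cancels in averages over faces.\<close>

lemma homogeneous_system_nontrivial:
  fixes a :: "'i \<Rightarrow> 'j \<Rightarrow> real"
  assumes "finite I" "finite J" "card I < card J"
  shows "\<exists>c. (\<exists>j\<in>J. c j \<noteq> 0) \<and> (\<forall>i\<in>I. (\<Sum>j\<in>J. a i j * c j) = 0)"
  using assms
proof (induction I arbitrary: J a rule: finite_induct)
  case empty
  then have "J \<noteq> {}" by auto
  then show ?case by (intro exI[of _ "\<lambda>_. 1"]) auto
next
  case (insert i I)
  show ?case
  proof (cases "\<forall>j\<in>J. a i j = 0")
    case True
    have "card I < card J" using insert by auto
    from insert.IH[OF insert.prems(1) this, of a] obtain c
      where "\<exists>j\<in>J. c j \<noteq> 0" "\<forall>i\<in>I. (\<Sum>j\<in>J. a i j * c j) = 0" by blast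
    then show ?thesis using True by (intro exI[of _ c]) auto
  next
    case False
    then obtain j0 where j0: "j0 \<in> J" "a i j0 \<noteq> 0" by auto
    let ?J = "J - {j0}"
    have "card I < card ?J" using insert j0 by auto
    \<comment> \<open>Gaussian elimination: row \<open>i\<close> with pivot \<open>a i j0\<close>
      removes the unknown \<open>j0\<close> from the other rows, and \<open>c' j0\<close> is then
      solved from row \<open>i\<close>.\<close>
    from insert.IH[of ?J, OF _ this, of "\<lambda>i' j. a i' j - a i' j0 * a i j / a i j0"] insert.prems
    obtain c where c: "\<exists>j\<in>?J. c j \<noteq> 0"
        "\<forall>i'\<in>I. (\<Sum>j\<in>?J. (a i' j - a i' j0 * a i j / a i j0) * c j) = 0" by auto
    define s where "s = (\<Sum>j\<in>?J. a i j * c j)"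
    define c' where "c' = c(j0 := - s / a i j0)"
    have split: "(\<Sum>j\<in>J. a r j * c' j) = a r j0 * (- s / a i j0) + (\<Sum>j\<in>?J. a r j * c j)" for r
      using j0 insert.prems by (subst sum.remove[of J j0]) (auto simp: c'_def intro!: sum.cong)
    have "(\<Sum>j\<in>J. a i j * c' j) = 0" using j0 by (simp add: split s_def[symmetric])
    moreover have "(\<Sum>j\<in>J. a r j * c' j) = 0" if "r \<in> I" for r
    proof -
      have "0 = (\<Sum>j\<in>?J. a r j * c j - a r j0 / a i j0 * (a i j * c j))"
        using c(2) that by (auto simp: algebra_simps)
      also have "\<dots> = (\<Sum>j\<in>?J. a r j * c j) - a r j0 / a i j0 * s"
        by (simp only: sum_subtractf sum_distrib_left[symmetric] s_def)
      finally show ?thesis by (simp add: split)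
    qed
    moreover have "\<exists>j\<in>J. c' j \<noteq> 0" using c(1) by (auto simp: c'_def)
    ultimately show ?thesis by (intro exI[of _ c']) auto
  qed
qed

section \<open>Semidefinite symmetric forms on spaces of functions\<close>

abbreviation lincomb :: "nat \<Rightarrow> (nat \<Rightarrow> real) \<Rightarrow> (nat \<Rightarrow> 'a \<Rightarrow> real) \<Rightarrow> 'a \<Rightarrow> real" where
  "lincomb m c u \<equiv> (\<lambda>x. \<Sum>i<m. c i * u i x)"

definition lin_closed :: "('a \<Rightarrow> real) set \<Rightarrow> bool" where
  "lin_closed X \<longleftrightarrow> (\<lambda>x. 0) \<in> X \<and> (\<forall>u\<in>X. \<forall>v\<in>X. \<forall>c d. (\<lambda>x. c * u x + d * v x) \<in> X)"

lemma lin_closedD: "lin_closed X \<Longrightarrow> u \<in> X \<Longrightarrow> v \<in> X \<Longrightarrow> (\<lambda>x. c * u x + d * v x) \<in> X"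
  by (auto simp: lin_closed_def)

lemma lin_closed_scale: "lin_closed X \<Longrightarrow> u \<in> X \<Longrightarrow> (\<lambda>x. c * u x) \<in> X"
  using lin_closedD[of X u u c 0] by simp

lemma lin_closed_diff: "lin_closed X \<Longrightarrow> u \<in> X \<Longrightarrow> v \<in> X \<Longrightarrow> (\<lambda>x. u x - v x) \<in> X"
  using lin_closedD[of X u v 1 "-1"] by simp

lemma lin_closed_lincomb:
  "lin_closed X \<Longrightarrow> (\<And>i. i < m \<Longrightarrow> u i \<in> X) \<Longrightarrow> lincomb m c u \<in> X"
proof (induction m)
  case 0 then show ?case by (simp add: lin_closed_def)
next
  case (Suc m)
  then show ?case using lin_closedD[of X "lincomb m c u" "u m" 1 "c m"] by simp
qed

text \<open>Only semidefinite, because the forms in use are: \<open>a_pw\<close> vanishes on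
  piecewise constants and the L2 inner product on null functions. Linearity is asked on
  \<open>D\<close> alone, since integrals are additive only where integrability is known.\<close>

locale sym_form =
  fixes D :: "('a \<Rightarrow> real) set" and A :: "('a \<Rightarrow> real) \<Rightarrow> ('a \<Rightarrow> real) \<Rightarrow> real"
  assumes lin: "lin_closed D"
    and sym: "u \<in> D \<Longrightarrow> v \<in> D \<Longrightarrow> A u v = A v u"
    and left: "u \<in> D \<Longrightarrow> v \<in> D \<Longrightarrow> w \<in> D \<Longrightarrow> A (\<lambda>x. c * u x + d * v x) w = c * A u w + d * A v w"
    and nonneg: "u \<in> D \<Longrightarrow> 0 \<le> A u u"
begin

lemma right: "u \<in> D \<Longrightarrow> v \<in> D \<Longrightarrow> w \<in> D \<Longrightarrow> A w (\<lambda>x. c * u x + d * v x) = c * A w u + d * A w v"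
  using left sym lin_closedD[OF lin] by simp

lemma scale_left: "u \<in> D \<Longrightarrow> w \<in> D \<Longrightarrow> A (\<lambda>x. c * u x) w = c * A u w"
  using left[of u u w c 0] by simp

lemma scale_right: "u \<in> D \<Longrightarrow> w \<in> D \<Longrightarrow> A w (\<lambda>x. c * u x) = c * A w u"
  using right[of u u w c 0] by simp

lemma diff_left: "u \<in> D \<Longrightarrow> v \<in> D \<Longrightarrow> w \<in> D \<Longrightarrow> A (\<lambda>x. u x - v x) w = A u w - A v w"
  using left[of u v w 1 "-1"] by simp

lemma diff_right: "u \<in> D \<Longrightarrow> v \<in> D \<Longrightarrow> w \<in> D \<Longrightarrow> A w (\<lambda>x. u x - v x) = A w u - A w v"
  using right[of u v w 1 "-1"] by simp

lemma add_left: "u \<in> D \<Longrightarrow> v \<in> D \<Longrightarrow> w \<in> D \<Longrightarrow> A (\<lambda>x. u x + v x) w = A u w + A v w"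
  using left[of u v w 1 1] by simp

lemma lincomb_left:
  assumes "\<And>i. i < m \<Longrightarrow> u i \<in> D" "w \<in> D"
  shows "A (lincomb m c u) w = (\<Sum>i<m. c i * A (u i) w)"
  using assms
proof (induction m)
  case 0
  then show ?case using left[of w w w 0 0] by simp
next
  case (Suc m)
  have "lincomb m c u \<in> D" using Suc by (intro lin_closed_lincomb lin) auto
  then show ?case using left[of "lincomb m c u" "u m" w 1 "c m"] Suc by simp
qed

lemma lincomb_right:
  assumes "\<And>i. i < m \<Longrightarrow> u i \<in> D" "w \<in> D"
  shows "A w (lincomb m c u) = (\<Sum>i<m. c i * A w (u i))"
proof -
  have "lincomb m c u \<in> D" using assms by (intro lin_closed_lincomb lin) auto
  then have "A w (lincomb m c u) = A (lincomb m c u) w" using sym assms by blast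
  also have "\<dots> = (\<Sum>i<m. c i * A (u i) w)" using assms by (rule lincomb_left)
  finally show ?thesis using sym assms by (auto intro!: sum.cong)
qed

lemma lincomb_square:
  assumes "\<And>i. i < m \<Longrightarrow> u i \<in> D"
  shows "A (lincomb m c u) (lincomb m c u) = (\<Sum>i<m. \<Sum>j<m. c i * c j * A (u i) (u j))"
proof -
  have "lincomb m c u \<in> D" using assms by (intro lin_closed_lincomb lin) auto
  then show ?thesis using assms
    by (subst lincomb_left) (auto simp: lincomb_right sum_distrib_left mult_ac intro!: sum.cong)
qed

lemma quadratic:
  assumes "u \<in> D" "v \<in> D"
  shows "A (\<lambda>x. c * u x + d * v x) (\<lambda>x. c * u x + d * v x) = c\<^sup>2 * A u u + 2 * c * d * A u v + d\<^sup>2 * A v v"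
proof -
  have "(\<lambda>x. c * u x + d * v x) \<in> D" using assms lin by (simp add: lin_closedD)
  then show ?thesis using assms
    by (simp add: left right sym[OF assms(2,1)] power2_eq_square algebra_simps)
qed

lemma Cauchy_Schwarz:
  assumes "u \<in> D" "v \<in> D"
  shows "(A u v)\<^sup>2 \<le> A u u * A v v"
proof -
  have *: "0 \<le> c\<^sup>2 * A u u + 2 * c * d * A u v + d\<^sup>2 * A v v" for c d
    using nonneg[of "\<lambda>x. c * u x + d * v x"] assms lin by (simp add: quadratic lin_closedD)
  show ?thesis
  proof (cases "A v v = 0")
    case False
    then have pos: "A v v > 0" using nonneg[OF assms(2)] by simp
    have "0 \<le> (A v v)\<^sup>2 * A u u + 2 * A v v * (- A u v) * A u v + (- A u v)\<^sup>2 * A v v"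
      by (rule *)
    also have "\<dots> = A v v * (A u u * A v v - (A u v)\<^sup>2)"
      by (simp add: power2_eq_square algebra_simps)
    finally show ?thesis using pos by (simp add: zero_le_mult_iff)
  next
    case True
    have "A u v = 0"
    proof (rule ccontr)
      assume n: "A u v \<noteq> 0"
      \<comment> \<open>With \<open>A v v = 0\<close> the quadratic is affine in \<open>d\<close>;
        this value makes it equal to -1.\<close>
      define d where "d = - (A u u + 1) / (2 * A u v)"
      show False using *[of 1 d] n True by (simp add: d_def field_simps)
    qed
    then show ?thesis using True by simp
  qed
qed

end

text \<open>\<open>null\<close> lets \<open>A\<close> pass to almost everywhere classes, on which
  the L2 inner product is definite. It is not automatic: the weak gradient of each representative is
  chosen separately.\<close>

locale form_pair = sym_form D A
  for M :: "'a measure" and D :: "('a \<Rightarrow> real) set" and A +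
  assumes L2: "u \<in> D \<Longrightarrow> u \<in> L2_space M"
    and null: "u \<in> D \<Longrightarrow> v \<in> D \<Longrightarrow> (AE x in M. u x = 0) \<Longrightarrow> A u v = 0"

lemma L2_space_mult_integrable:
  fixes u v :: "'a \<Rightarrow> real"
  assumes "u \<in> L2_space M" "v \<in> L2_space M"
  shows "integrable M (\<lambda>x. u x * v x)"
proof (rule Bochner_Integration.integrable_bound)
  show "integrable M (\<lambda>x. (u x)\<^sup>2 + (v x)\<^sup>2)"
    using assms by (auto simp: L2_space_def)
  show "(\<lambda>x. u x * v x) \<in> borel_measurable M" using assms by (auto simp: L2_space_def)
  have "\<bar>a * b\<bar> \<le> a\<^sup>2 + b\<^sup>2" for a b :: real
  proof -
    have "0 \<le> (a + b)\<^sup>2" "0 \<le> (a - b)\<^sup>2" "0 \<le> a\<^sup>2" "0 \<le> b\<^sup>2" by simp_all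
    then show ?thesis by (simp only: power2_sum power2_diff abs_le_iff) linarith
  qed
  then show "AE x in M. norm (u x * v x) \<le> norm ((u x)\<^sup>2 + (v x)\<^sup>2)" by simp
qed

abbreviation L2_inner :: "'a measure \<Rightarrow> ('a \<Rightarrow> real) \<Rightarrow> ('a \<Rightarrow> real) \<Rightarrow> real" where
  "L2_inner M u v \<equiv> LINT x|M. u x * v x"

lemma L2_inner_self_eq_0:
  assumes "u \<in> L2_space M"
  shows "L2_inner M u u = 0 \<longleftrightarrow> (AE x in M. u x = 0)"
proof -
  have "integrable M (\<lambda>x. u x * u x)" using assms by (intro L2_space_mult_integrable)
  then show ?thesis by (subst integral_nonneg_eq_0_iff_AE) auto
qed

lemma eigenspace_cong:
  assumes "\<And>u v. u \<in> W \<Longrightarrow> v \<in> W \<Longrightarrow> a u v = a' u v"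
  shows "eigenspace M W a = eigenspace M W a'"
  using assms by (auto simp: eigenspace_def fun_eq_iff)

lemma kth_eigenvalue_cong:
  assumes "\<And>u v. u \<in> W \<Longrightarrow> v \<in> W \<Longrightarrow> a u v = a' u v"
  shows "kth_eigenvalue M W a k = kth_eigenvalue M W a' k"
  using eigenspace_cong[where M = M, OF assms]
  by (simp add: kth_eigenvalue_def eigenvalue_count_def eigenvalues_def)

text \<open>If every member of the supremum were below \<open>m\<close>, the supremum would be at
  most \<open>m - 1\<close>. So some independent family has at least \<open>m\<close> elements, and
  it is truncated by extending coefficients with 0.\<close>

lemma ae_dim_geD:
  assumes "enat m \<le> ae_dim M E"
  obtains u where "\<And>i. i < m \<Longrightarrow> u i \<in> E" "ae_independent M m u"
proof -
  have "\<exists>m'\<ge>m. \<exists>u. (\<forall>i<m'. u i \<in> E) \<and> ae_independent M m' u"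
  proof (rule ccontr)
    assume n: "\<not> ?thesis"
    show False
    proof (cases m)
      case 0 then show False using n by (auto simp: ae_independent_def)
    next
      case (Suc l)
      have "ae_dim M E \<le> enat l" unfolding ae_dim_def
        using n Suc by (intro Sup_least) (force simp: not_less_eq_eq)
      then show False using assms Suc by (metis Suc_ile_eq enat_ord_simps(2) le_less_trans lessI not_le)
    qed
  qed
  then obtain m' u where *: "m' \<ge> m" "\<forall>i<m'. u i \<in> E" "ae_independent M m' u" by auto
  have "ae_independent M m u"
    unfolding ae_independent_def
  proof (intro allI impI)
    fix c i assume c: "AE x in M. (\<Sum>i<m. c i * u i x) = 0" and i: "i < m"
    have "(\<Sum>i<m'. (if i < m then c i else 0) * u i x) = (\<Sum>i<m. c i * u i x)" for x
      using *(1) by (intro sum.mono_neutral_cong_right) auto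
    then have "AE x in M. lincomb m' (\<lambda>i. if i < m then c i else 0) u x = 0" using c by simp
    from *(3)[unfolded ae_independent_def, rule_format, OF this] show "c i = 0" using i *(1) by (metis less_le_trans)
  qed
  then show thesis using *(1,2) by (intro that[of u]) auto
qed

lemma ae_dim_geI:
  assumes "\<And>i. i < m \<Longrightarrow> u i \<in> E" "ae_independent M m u"
  shows "enat m \<le> ae_dim M E"
  unfolding ae_dim_def using assms by (intro Sup_upper) auto

text \<open>Tychonoff's theorem for the function type, used below for a box of coefficient
  vectors.\<close>

lemma compact_PiE_UNIV:
  fixes S :: "'i \<Rightarrow> 'b::topological_space set"
  assumes "\<And>i. compact (S i)"
  shows "compact (Pi UNIV S)"
proof -
  have "compactin (product_topology (\<lambda>i. euclidean) UNIV) (PiE UNIV S)"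
    using assms by (subst compactin_PiE) (auto simp: compactin_euclidean_iff)
  then show ?thesis
    by (simp add: euclidean_product_topology compactin_euclidean_iff PiE_UNIV_domain)
qed

text \<open>Yields families of maximal length, from which bases are obtained by showing that any
  defect would allow one more element.\<close>

lemma maximal_natE:
  assumes "P 0" "\<And>m. P m \<Longrightarrow> m \<le> (N::nat)"
  obtains m where "P m" "\<not> P (Suc m)"
proof (rule ccontr)
  assume n: "\<not> thesis"
  have "P m" for m using assms(1) n that by (induction m) auto
  from assms(2)[OF this[of "Suc N"]] show False by simp
qed

section \<open>Orthonormal families and the finite-dimensional spectral theorem\<close>

context form_pair
begin

abbreviation "B \<equiv> L2_inner M"

lemma integrable_mult: "u \<in> D \<Longrightarrow> v \<in> D \<Longrightarrow> integrable M (\<lambda>x. u x * v x)"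
  using L2 by (intro L2_space_mult_integrable)

sublocale B: sym_form D B
proof
  show "lin_closed D" by (rule lin)
  show "B u v = B v u" for u v by (simp add: mult.commute)
  show "B (\<lambda>x. c * u x + d * v x) w = c * B u w + d * B v w"
    if "u \<in> D" "v \<in> D" "w \<in> D" for u v w c d
    using integrable_mult[OF that(1,3)] integrable_mult[OF that(2,3)]
    by (simp add: distrib_right mult.assoc)
  show "0 \<le> B u u" for u by (intro integral_nonneg_AE) auto
qed

lemma B_eq_0: "u \<in> D \<Longrightarrow> B u u = 0 \<longleftrightarrow> (AE x in M. u x = 0)"
  using L2 by (intro L2_inner_self_eq_0)

lemma B_null: "(AE x in M. u x = 0) \<Longrightarrow> B u v = 0"
  by (intro integral_eq_zero_AE) auto

lemma cong_AE:
  assumes "u \<in> D" "u' \<in> D" "v \<in> D" "AE x in M. u x = u' x"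
  shows "A u v = A u' v" "A v u = A v u'"
proof -
  have "A (\<lambda>x. u x - u' x) v = 0" "A (\<lambda>x. u x - u' x) v = 0"
    using assms by (auto intro!: null lin_closed_diff lin)
  then show "A u v = A u' v" using assms by (simp add: diff_left)
  then show "A v u = A v u'" using assms sym by simp
qed

definition orthonormal :: "nat \<Rightarrow> (nat \<Rightarrow> 'a \<Rightarrow> real) \<Rightarrow> bool" where
  "orthonormal m e \<longleftrightarrow> (\<forall>i<m. e i \<in> D) \<and> (\<forall>i<m. \<forall>j<m. B (e i) (e j) = (if i = j then 1 else 0))"

lemma orthonormal_coeff:
  assumes "orthonormal m e" "i < m"
  shows "B (lincomb m c e) (e i) = c i"
proof -
  have "B (lincomb m c e) (e i) = (\<Sum>j<m. c j * B (e j) (e i))"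
    using assms by (intro B.lincomb_left) (auto simp: orthonormal_def)
  also have "\<dots> = (\<Sum>j<m. if j = i then c i else 0)"
    using assms by (intro sum.cong) (auto simp: orthonormal_def)
  finally show ?thesis using assms by simp
qed

lemma orthonormal_ae_independent: "orthonormal m e \<Longrightarrow> ae_independent M m e"
  unfolding ae_independent_def
proof (intro allI impI)
  fix c i assume o: "orthonormal m e" and c: "AE x in M. lincomb m c e x = 0" and i: "i < m"
  have "B (lincomb m c e) (e i) = 0" using c by (rule B_null)
  then show "c i = 0" using orthonormal_coeff[OF o i] by simp
qed

lemma orthonormal_Suc:
  assumes "orthonormal m e" "g \<in> D" "B g g = 1" "\<And>i. i < m \<Longrightarrow> B g (e i) = 0"
  shows "orthonormal (Suc m) (e(m := g))"
  using assms by (auto simp: orthonormal_def less_Suc_eq mult.commute)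

lemma residual:
  assumes "orthonormal m e" "v \<in> D"
  defines "r \<equiv> (\<lambda>x. v x - (\<Sum>i<m. B v (e i) * e i x))"
  shows "r \<in> D" "\<And>i. i < m \<Longrightarrow> B r (e i) = 0"
proof -
  have s: "lincomb m (\<lambda>i. B v (e i)) e \<in> D"
    using assms(1) by (intro lin_closed_lincomb lin) (auto simp: orthonormal_def)
  show "r \<in> D" unfolding r_def using s assms(2) by (intro lin_closed_diff lin)
  show "B r (e i) = 0" if "i < m" for i
  proof -
    have "B r (e i) = B v (e i) - B (lincomb m (\<lambda>i. B v (e i)) e) (e i)"
      unfolding r_def using s assms that by (intro B.diff_left) (auto simp: orthonormal_def)
    then show ?thesis using orthonormal_coeff[OF assms(1) that] by simp
  qed
qed

lemma normalise:
  assumes "u \<in> D" "\<not> (AE x in M. u x = 0)"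
  obtains c where "c \<noteq> 0" "B (\<lambda>x. c * u x) (\<lambda>x. c * u x) = 1"
proof -
  have "B u u > 0" using assms B_eq_0 B.nonneg[of u] by (simp add: less_le)
  moreover have "B (\<lambda>x. c * u x) (\<lambda>x. c * u x) = c * (c * B u u)" for c
    using assms(1) B.scale_left B.scale_right lin_closed_scale[OF lin] by simp
  ultimately show thesis by (intro that[of "1 / sqrt (B u u)"]) auto
qed

definition finite_dim :: "('a \<Rightarrow> real) set \<Rightarrow> bool" where
  "finite_dim X \<longleftrightarrow> (\<exists>N. \<forall>m u. (\<forall>i<m. u i \<in> X) \<longrightarrow> ae_independent M m u \<longrightarrow> m \<le> N)"

text \<open>A longest orthonormal family in \<open>Y\<close>: if some \<open>v\<close> had a
  residual that is not null, the normalised residual would extend the family.\<close>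

lemma orthonormal_basis_exists:
  assumes "Y \<subseteq> D" "lin_closed Y" "finite_dim Y"
  obtains m f where "orthonormal m f" "\<And>i. i < m \<Longrightarrow> f i \<in> Y"
    "\<And>v. v \<in> Y \<Longrightarrow> AE x in M. v x = (\<Sum>i<m. B v (f i) * f i x)"
proof -
  from assms(3) obtain N where N: "\<And>m u. (\<forall>i<m. u i \<in> Y) \<Longrightarrow> ae_independent M m u \<Longrightarrow> m \<le> N"
    by (auto simp: finite_dim_def)
  obtain m where m: "\<exists>f. orthonormal m f \<and> (\<forall>i<m. f i \<in> Y)"
      "\<not> (\<exists>f. orthonormal (Suc m) f \<and> (\<forall>i<Suc m. f i \<in> Y))"
    by (rule maximal_natE[of "\<lambda>m. \<exists>f. orthonormal m f \<and> (\<forall>i<m. f i \<in> Y)" N])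
       (auto simp: orthonormal_def[of 0] intro: N orthonormal_ae_independent)
  then obtain f where f: "orthonormal m f" "\<forall>i<m. f i \<in> Y" by blast
  show thesis
  proof (rule that[OF f(1)])
    show "f i \<in> Y" if "i < m" for i using f that by simp
    fix v assume v: "v \<in> Y"
    define r where "r = (\<lambda>x. v x - (\<Sum>i<m. B v (f i) * f i x))"
    have r: "r \<in> D" "\<And>i. i < m \<Longrightarrow> B r (f i) = 0"
      using residual[OF f(1), of v] v assms(1) by (auto simp: r_def)
    have rY: "r \<in> Y" unfolding r_def using v f(2) assms(2)
      by (intro lin_closed_diff lin_closed_lincomb) auto
    have "AE x in M. r x = 0"
    proof (rule ccontr)
      assume "\<not> ?thesis"
      from normalise[OF r(1) this] obtain c where
        c: "c \<noteq> 0" "B (\<lambda>x. c * r x) (\<lambda>x. c * r x) = 1" by blast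
      have "orthonormal (Suc m) (f(m := (\<lambda>x. c * r x)))"
        using c r f(1) B.scale_left lin_closed_scale[OF lin]
        by (intro orthonormal_Suc) (auto simp: orthonormal_def)
      moreover have "\<forall>i<Suc m. (f(m := (\<lambda>x. c * r x))) i \<in> Y"
        using f(2) rY lin_closed_scale[OF assms(2)] by (auto simp: less_Suc_eq)
      ultimately show False using m(2) by blast
    qed
    then show "AE x in M. v x = (\<Sum>i<m. B v (f i) * f i x)" by (simp add: r_def)
  qed
qed

lemma basis_square:
  assumes "orthonormal m f" "v \<in> D" "AE x in M. v x = (\<Sum>i<m. b i * f i x)"
  shows "A v v = (\<Sum>i<m. \<Sum>j<m. b i * b j * A (f i) (f j))" "B v v = (\<Sum>i<m. (b i)\<^sup>2)"
proof -
  have l: "lincomb m b f \<in> D"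
    using assms(1) by (intro lin_closed_lincomb lin) (auto simp: orthonormal_def)
  have f: "\<And>i. i < m \<Longrightarrow> f i \<in> D" using assms(1) by (auto simp: orthonormal_def)
  have "A v v = A (lincomb m b f) (lincomb m b f)"
    using cong_AE[OF assms(2) l assms(2)] cong_AE[OF assms(2) l l] assms(3) by simp
  then show "A v v = (\<Sum>i<m. \<Sum>j<m. b i * b j * A (f i) (f j))"
    by (simp add: lincomb_square[OF f])
  have "B v v = B (lincomb m b f) (lincomb m b f)"
    using assms(3) integrable_mult[OF assms(2,2)] integrable_mult[OF l l]
    by (intro integral_cong_AE) auto
  also have "\<dots> = (\<Sum>i<m. b i * B (lincomb m b f) (f i))"
    using f l by (intro B.lincomb_right)
  also have "\<dots> = (\<Sum>i<m. (b i)\<^sup>2)"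
    by (intro sum.cong) (auto simp: orthonormal_coeff[OF assms(1)] power2_eq_square)
  finally show "B v v = (\<Sum>i<m. (b i)\<^sup>2)" .
qed

text \<open>In coordinates of an orthonormal basis, \<open>A\<close> is a continuous quadratic form
  and attains its minimum on the compact unit sphere; homogeneity extends the inequality to all of
  \<open>Y\<close>.\<close>

lemma Rayleigh_minimiser_exists:
  assumes Y: "Y \<subseteq> D" "lin_closed Y" "finite_dim Y" and v0: "v0 \<in> Y" "\<not> (AE x in M. v0 x = 0)"
  obtains y where "y \<in> Y" "B y y = 1" "\<And>v. v \<in> Y \<Longrightarrow> A y y * B v v \<le> A v v"
proof -
  obtain m f where f: "orthonormal m f" "\<And>i. i < m \<Longrightarrow> f i \<in> Y"
    "\<And>v. v \<in> Y \<Longrightarrow> AE x in M. v x = (\<Sum>i<m. B v (f i) * f i x)"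
    by (rule orthonormal_basis_exists[OF Y]) blast
  have fD: "\<And>i. i < m \<Longrightarrow> f i \<in> D" using f(2) Y by auto
  define q where "q = (\<lambda>c::nat \<Rightarrow> real. \<Sum>i<m. \<Sum>j<m. c i * c j * A (f i) (f j))"
  \<comment> \<open>The unit sphere of R^m inside the functions on the naturals: coordinates from
    \<open>m\<close> on are pinned to 0 so that the ambient product is compact.\<close>
  define K where "K = Pi UNIV (\<lambda>i. if i < m then {-1..1} else {0::real}) \<inter> {c. (\<Sum>i<m. (c i)\<^sup>2) = 1}"
  have cont: "continuous_on S (\<lambda>c::nat \<Rightarrow> real. c i)" for S i
    by (rule continuous_on_subset[OF continuous_on_product_coordinates]) auto
  have contq: "continuous_on K q" unfolding q_def by (intro continuous_intros cont)
  have "closed {c::nat \<Rightarrow> real. (\<Sum>i<m. (c i)\<^sup>2) = 1}"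
    by (intro closed_Collect_eq continuous_intros cont)
  then have K: "compact K" unfolding K_def
    by (intro compact_Int_closed compact_PiE_UNIV) auto
  have unit: "(\<lambda>i. if i < m then b i / sqrt S else 0) \<in> K"
    if S: "S = (\<Sum>i<m. (b i)\<^sup>2)" "S > 0" for b :: "nat \<Rightarrow> real" and S
  proof -
    have "(\<Sum>i<m. (b i / sqrt S)\<^sup>2) = (\<Sum>i<m. (b i)\<^sup>2) / S"
      using S(2) by (simp add: power_divide sum_divide_distrib)
    then have 1: "(\<Sum>i<m. (b i / sqrt S)\<^sup>2) = 1" using S by simp
    have "\<bar>b i / sqrt S\<bar> \<le> 1" if "i < m" for i
    proof -
      have "(b i / sqrt S)\<^sup>2 \<le> (\<Sum>i<m. (b i / sqrt S)\<^sup>2)"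
        using that by (intro member_le_sum) auto
      then show ?thesis using 1 by (simp add: abs_square_le_1)
    qed
    then have "b i / sqrt S \<in> {-1..1}" if "i < m" for i using that abs_le_iff by (metis (no_types) atLeastAtMost_iff minus_le_iff)
    moreover have "(\<Sum>i<m. (if i < m then b i / sqrt S else 0)\<^sup>2) = 1" using 1 by (subst sum.cong) auto
    ultimately show ?thesis by (auto simp: K_def simp del: atLeastAtMost_iff)
  qed
  have v0D: "v0 \<in> D" using v0(1) Y(1) by auto
  have pos: "(\<Sum>i<m. (B v0 (f i))\<^sup>2) > 0"
    unfolding basis_square(2)[OF f(1) v0D f(3)[OF v0(1)], symmetric]
    using B_eq_0[OF v0D] v0(2) B.nonneg[OF v0D] by linarith
  have "K \<noteq> {}" using unit[OF refl pos] by blast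
  from continuous_attains_inf[OF K this contq] obtain c where c: "c \<in> K" "\<And>d. d \<in> K \<Longrightarrow> q c \<le> q d"
    by blast
  define y where "y = lincomb m c f"
  have yY: "y \<in> Y" unfolding y_def using f(2) Y by (intro lin_closed_lincomb) auto
  have AEy: "AE x in M. y x = (\<Sum>i<m. c i * f i x)" by (simp add: y_def)
  have Ay: "A y y = q c" "B y y = 1"
    using basis_square[OF f(1) _ AEy] yY Y c(1) by (auto simp: q_def K_def)
  show thesis
  proof (rule that[OF yY Ay(2)])
    fix v assume v: "v \<in> Y"
    define b where "b = (\<lambda>i. B v (f i))"
    define S where "S = (\<Sum>i<m. (b i)\<^sup>2)"
    have Av: "A v v = q b" and Bv: "B v v = S"
      using basis_square[OF f(1) _ f(3)[OF v]] v Y by (auto simp: q_def b_def S_def)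
    show "A y y * B v v \<le> A v v"
    proof (cases "S = 0")
      case True then show ?thesis using Bv nonneg[of v] v Y by auto
    next
      case False
      then have S: "S > 0" using sum_nonneg[of "{..<m}" "\<lambda>i. (b i)\<^sup>2"] by (simp add: S_def less_le)
      have "q (\<lambda>i. if i < m then b i / sqrt S else 0) = (\<Sum>i<m. \<Sum>j<m. b i * b j * A (f i) (f j) / S)"
        unfolding q_def using S by (intro sum.cong refl) auto
      also have "\<dots> = q b / S" by (simp add: q_def sum_divide_distrib)
      finally have "q c \<le> q b / S" using c(2)[OF unit[OF S_def S]] by simp
      then show ?thesis using S by (simp add: Ay Av Bv field_simps)
    qed
  qed
qed

text \<open>Vanishing of the first variation: along \<open>y + t * v\<close> the quadratic
  \<open>2 * t * h + t^2 * g\<close> is nonnegative for every t, which forces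
  \<open>h = 0\<close>.\<close>

lemma Rayleigh_minimiser_eigenvector:
  assumes "Y \<subseteq> D" "lin_closed Y" "y \<in> Y" "B y y = 1" "\<And>v. v \<in> Y \<Longrightarrow> A y y * B v v \<le> A v v" "v \<in> Y"
  shows "A y v = A y y * B y v"
proof -
  define h where "h = A y v - A y y * B y v"
  define g where "g = A v v - A y y * B v v"
  have g: "g \<ge> 0" using assms by (simp add: g_def)
  have yv: "y \<in> D" "v \<in> D" using assms by auto
  have *: "0 \<le> 2 * t * h + t\<^sup>2 * g" for t
  proof -
    have "A y y * B (\<lambda>x. 1 * y x + t * v x) (\<lambda>x. 1 * y x + t * v x)
        \<le> A (\<lambda>x. 1 * y x + t * v x) (\<lambda>x. 1 * y x + t * v x)"
      using assms by (intro assms(5) lin_closedD) auto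
    then show ?thesis unfolding quadratic[OF yv] B.quadratic[OF yv] h_def g_def
      by (simp add: assms(4) algebra_simps)
  qed
  \<comment> \<open>At \<open>t = - k\<close> the quadratic equals \<open>- k^2 * (g + 2)\<close>;
    the denominator \<open>g + 1\<close> also covers \<open>g = 0\<close>.\<close>
  define k where "k = h / (g + 1)"
  have h: "h = k * (g + 1)" using g by (simp add: k_def)
  have "k\<^sup>2 * (g + 2) \<le> 0" using *[of "- k"] by (simp add: h power2_eq_square algebra_simps)
  then have "h = 0" using g h by (simp add: mult_le_0_iff)
  then show ?thesis by (simp add: h_def)
qed

definition spectral_basis :: "('a \<Rightarrow> real) set \<Rightarrow> nat \<Rightarrow> (nat \<Rightarrow> 'a \<Rightarrow> real) \<Rightarrow> (nat \<Rightarrow> real) \<Rightarrow> bool" where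
  "spectral_basis X m e \<nu> \<longleftrightarrow> orthonormal m e \<and> (\<forall>i<m. e i \<in> X) \<and>
    (\<forall>i<m. \<forall>v\<in>X. A (e i) v = \<nu> i * B (e i) v) \<and>
    (\<forall>v\<in>X. AE x in M. v x = (\<Sum>i<m. B v (e i) * e i x))"

text \<open>Take a longest orthonormal family of eigenvectors. If it did not span, the Rayleigh
  minimiser on its orthogonal complement \<open>Y\<close> in \<open>X\<close> would be a further
  eigenvector.\<close>

lemma spectral_basis_exists:
  assumes X: "X \<subseteq> D" "lin_closed X" "finite_dim X"
  shows "\<exists>m e \<nu>. spectral_basis X m e \<nu>"
proof -
  from assms(3) obtain N where N: "\<And>m u. (\<forall>i<m. u i \<in> X) \<Longrightarrow> ae_independent M m u \<Longrightarrow> m \<le> N"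
    by (auto simp: finite_dim_def)
  define P where "P = (\<lambda>m. \<exists>e \<nu>. orthonormal m e \<and> (\<forall>i<m. e i \<in> X) \<and>
    (\<forall>i<m. \<forall>v\<in>X. A (e i) v = \<nu> i * B (e i) v))"
  obtain m where m: "P m" "\<not> P (Suc m)"
    by (rule maximal_natE[of P N])
       (auto simp: P_def orthonormal_def[of 0] intro: N orthonormal_ae_independent)
  then obtain e \<nu> where e: "orthonormal m e" "\<forall>i<m. e i \<in> X" "\<forall>i<m. \<forall>v\<in>X. A (e i) v = \<nu> i * B (e i) v"
    by (auto simp: P_def)
  have eD: "\<And>i. i < m \<Longrightarrow> e i \<in> D" using e X by auto
  define Y where "Y = {v \<in> X. \<forall>i<m. B v (e i) = 0}"
  have "Y \<subseteq> X" by (auto simp: Y_def)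
  then have Y: "Y \<subseteq> D" "finite_dim Y" using X N unfolding finite_dim_def by (auto, meson subsetD)
  have "lin_closed Y"
  proof -
    have "B (\<lambda>x. c * u x + d * v x) (e i) = 0"
      if "u \<in> X" "v \<in> X" "B u (e i) = 0" "B v (e i) = 0" "i < m" for u v c d i
      using that X eD by (subst B.left) auto
    then show ?thesis using X(2) by (auto simp: lin_closed_def Y_def)
  qed
  have "AE x in M. v x = (\<Sum>i<m. B v (e i) * e i x)" if v: "v \<in> X" for v
  proof (rule ccontr)
    assume n: "\<not> ?thesis"
    define r where "r = (\<lambda>x. v x - (\<Sum>i<m. B v (e i) * e i x))"
    have "\<not> (AE x in M. r x = 0)" using n by (simp add: r_def)
    have resY: "(\<lambda>x. v x - (\<Sum>i<m. B v (e i) * e i x)) \<in> Y" if v: "v \<in> X" for v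
      using residual[OF e(1), of v] v X e(2)
      by (auto simp: Y_def intro!: lin_closed_diff lin_closed_lincomb)
    then have "r \<in> Y" using v by (simp add: r_def)
    obtain y where y: "y \<in> Y" "B y y = 1" "\<And>v. v \<in> Y \<Longrightarrow> A y y * B v v \<le> A v v"
      by (rule Rayleigh_minimiser_exists[OF Y(1) \<open>lin_closed Y\<close> Y(2) \<open>r \<in> Y\<close> \<open>\<not> (AE x in M. r x = 0)\<close>]) blast
    have yX: "y \<in> X" "y \<in> D" "\<And>i. i < m \<Longrightarrow> B y (e i) = 0" using y(1) Y by (auto simp: Y_def)
    \<comment> \<open>The minimiser is an eigenvector relative to \<open>Y\<close> only. The part of
      \<open>v\<close> in the span of the \<open>e i\<close> contributes 0 to both sides, because
      \<open>A y (e i) = \<nu> i * B (e i) y = 0\<close>.\<close>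
    have eig: "A y v = A y y * B y v" if v: "v \<in> X" for v
    proof -
      let ?l = "lincomb m (\<lambda>i. B v (e i)) e"
      have l: "?l \<in> D" using eD by (intro lin_closed_lincomb lin) auto
      have vD: "v \<in> D" using v X by auto
      have "A y ?l = (\<Sum>i<m. B v (e i) * A y (e i))" using eD yX by (intro lincomb_right)
      also have "\<dots> = (\<Sum>i<m. 0)"
      proof (intro sum.cong refl)
        fix i assume i: "i \<in> {..<m}"
        have "A y (e i) = A (e i) y" using eD yX i by (intro sym) auto
        also have "\<dots> = \<nu> i * B (e i) y" using e(3) i yX by auto
        also have "\<dots> = \<nu> i * B y (e i)" by (simp add: mult.commute)
        finally show "B v (e i) * A y (e i) = 0" using yX i by simp
      qed
      finally have Al: "A y ?l = 0" by simp
      have "B y ?l = (\<Sum>i<m. B v (e i) * B y (e i))" using eD yX by (intro B.lincomb_right)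
      then have Bl: "B y ?l = 0" using yX by simp
      have "A y (\<lambda>x. v x - ?l x) = A y y * B y (\<lambda>x. v x - ?l x)"
        by (rule Rayleigh_minimiser_eigenvector[OF Y(1) \<open>lin_closed Y\<close> y resY[OF v]])
      then show ?thesis using Al Bl diff_right[OF vD l yX(2)] B.diff_right[OF vD l yX(2)] by simp
    qed
    have "P (Suc m)" unfolding P_def
    proof (intro exI conjI)
      show "orthonormal (Suc m) (e(m := y))" using e(1) yX y(2) by (intro orthonormal_Suc)
      show "\<forall>i<Suc m. (e(m := y)) i \<in> X" using e(2) yX by (auto simp: less_Suc_eq)
      show "\<forall>i<Suc m. \<forall>v\<in>X. A ((e(m := y)) i) v = (\<nu>(m := A y y)) i * B ((e(m := y)) i) v"
        using e(3) eig by (auto simp: less_Suc_eq)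
    qed
    then show False using m(2) by blast
  qed
  then show ?thesis using e by (auto simp: spectral_basis_def)
qed

lemma orthonormal_reindex:
  assumes "orthonormal m e" "inj_on h {..<n}" "h ` {..<n} \<subseteq> {..<m}"
  shows "orthonormal n (\<lambda>i. e (h i))"
proof -
  have h: "\<And>i. i < n \<Longrightarrow> h i < m" "\<And>i j. i < n \<Longrightarrow> j < n \<Longrightarrow> h i = h j \<longleftrightarrow> i = j"
    using assms(2,3) by (auto simp: inj_on_def)
  show ?thesis using assms(1) by (simp add: orthonormal_def h)
qed

lemma spectral_basis_square:
  assumes "spectral_basis X m e \<nu>" "X \<subseteq> D" "v \<in> X"
  shows "A v v = (\<Sum>i<m. \<nu> i * (B v (e i))\<^sup>2)" "B v v = (\<Sum>i<m. (B v (e i))\<^sup>2)"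
proof -
  have f: "orthonormal m e" "AE x in M. v x = (\<Sum>i<m. B v (e i) * e i x)" "v \<in> D"
    "\<And>i. i < m \<Longrightarrow> e i \<in> X" "\<And>i j. i < m \<Longrightarrow> j < m \<Longrightarrow> A (e i) (e j) = \<nu> i * B (e i) (e j)"
    using assms by (auto simp: spectral_basis_def)
  have "A v v = (\<Sum>i<m. \<Sum>j<m. B v (e i) * B v (e j) * A (e i) (e j))"
    by (rule basis_square(1)[OF f(1,3,2)])
  also have "\<dots> = (\<Sum>i<m. \<Sum>j<m. if j = i then \<nu> i * (B v (e i))\<^sup>2 else 0)"
    using f(1,5) by (intro sum.cong refl) (auto simp: orthonormal_def power2_eq_square)
  finally show "A v v = (\<Sum>i<m. \<nu> i * (B v (e i))\<^sup>2)" by simp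
  show "B v v = (\<Sum>i<m. (B v (e i))\<^sup>2)" by (rule basis_square(2)[OF f(1,3,2)])
qed

lemma spectral_basis_pos:
  assumes "spectral_basis X m e \<nu>" "X \<subseteq> D" "\<And>v. v \<in> X \<Longrightarrow> A v v = 0 \<Longrightarrow> AE x in M. v x = 0" "i < m"
  shows "\<nu> i > 0"
proof -
  have e: "e i \<in> X" "e i \<in> D" "B (e i) (e i) = 1" "A (e i) (e i) = \<nu> i * B (e i) (e i)"
    using assms by (auto simp: spectral_basis_def orthonormal_def)
  have "A (e i) (e i) \<noteq> 0" using assms(3)[OF e(1)] B_eq_0[OF e(2)] e(3) by auto
  then show ?thesis using nonneg[OF e(2)] e by simp
qed

text \<open>The indices are grouped by the value of \<open>\<nu>\<close>; each group is an
  independent family in one eigenspace. Definiteness enters because \<open>eigenvalues\<close> lists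
  positive values only.\<close>

lemma eigenvalue_count_ge:
  assumes sb: "spectral_basis X m e \<nu>" and X: "X \<subseteq> D"
    and pos: "\<And>v. v \<in> X \<Longrightarrow> A v v = 0 \<Longrightarrow> AE x in M. v x = 0"
  shows "enat (card {i. i < m \<and> \<nu> i \<le> s}) \<le> eigenvalue_count M X A s"
proof -
  define I where "I = {i. i < m \<and> \<nu> i \<le> s}"
  have fin: "finite I" by (simp add: I_def)
  have o: "orthonormal m e" and eX: "\<And>i. i < m \<Longrightarrow> e i \<in> X"
    and eig: "\<And>i v. i < m \<Longrightarrow> v \<in> X \<Longrightarrow> A (e i) v = \<nu> i * B (e i) v"
    using sb by (auto simp: spectral_basis_def)
  have dim: "enat (card {i \<in> I. \<nu> i = l}) \<le> ae_dim M (eigenspace M X A l)" for l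
  proof -
    define S where "S = {i \<in> I. \<nu> i = l}"
    obtain h where h: "bij_betw h {0..<card S} S"
      using ex_bij_betw_nat_finite[of S] fin by (auto simp: S_def)
    have S: "h i < m" "\<nu> (h i) = l" if "i < card S" for i
      using bij_betwE[OF h] that by (auto simp: S_def I_def)
    have "orthonormal (card S) (\<lambda>i. e (h i))"
      using S(1) bij_betw_imp_inj_on[OF h]
      by (intro orthonormal_reindex[OF o]) (auto simp: atLeast0LessThan)
    then have "ae_independent M (card S) (\<lambda>i. e (h i))" by (rule orthonormal_ae_independent)
    moreover have "e (h i) \<in> eigenspace M X A l" if "i < card S" for i
      using S[OF that] eX eig by (auto simp: eigenspace_def)
    ultimately show ?thesis unfolding S_def[symmetric] by (intro ae_dim_geI) auto
  qed
  have "\<nu> ` I \<subseteq> eigenvalues M X A \<inter> {..s}"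
  proof
    fix l assume "l \<in> \<nu> ` I"
    then obtain i where i: "i < m" "\<nu> i \<le> s" "l = \<nu> i" by (auto simp: I_def)
    have "\<not> (AE x in M. e i x = 0)"
      using B_eq_0[of "e i"] o i by (auto simp: orthonormal_def)
    moreover have "e i \<in> eigenspace M X A l" using i eX eig by (auto simp: eigenspace_def)
    moreover have "\<nu> i > 0" using spectral_basis_pos[OF sb X pos i(1)] .
    ultimately show "l \<in> eigenvalues M X A \<inter> {..s}" using i by (auto simp: eigenvalues_def)
  qed
  then have 1: "(\<Sum>l\<in>\<nu> ` I. ae_dim M (eigenspace M X A l)) \<le> eigenvalue_count M X A s"
    unfolding eigenvalue_count_def using fin by (intro SUP_upper) auto
  have 2: "(\<Sum>l\<in>\<nu> ` I. enat (card {i \<in> I. \<nu> i = l})) \<le> (\<Sum>l\<in>\<nu> ` I. ae_dim M (eigenspace M X A l))"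
    by (intro sum_mono dim)
  have "(\<Sum>l\<in>F. enat (g l)) = enat (\<Sum>l\<in>F. g l)" if "finite F" for F and g :: "real \<Rightarrow> nat"
    using that by induction (auto simp: zero_enat_def)
  moreover have "card I = (\<Sum>l\<in>\<nu> ` I. card {i \<in> I. \<nu> i = l})"
    using sum.image_gen[OF fin, of "\<lambda>_. 1::nat" \<nu>] by simp
  ultimately have "enat (card I) = (\<Sum>l\<in>\<nu> ` I. enat (card {i \<in> I. \<nu> i = l}))" using fin by simp
  also note 2
  also note 1
  finally show ?thesis by (simp add: I_def)
qed

text \<open>Upper half of the min-max principle. If fewer than \<open>k\<close> of the
  \<open>\<nu> i\<close> were at most \<open>s\<close>, some nontrivial combination of the
  \<open>w j\<close> would be orthogonal to all the corresponding \<open>e i\<close>, and its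
  Rayleigh quotient would exceed \<open>s\<close>.\<close>

lemma kth_eigenvalue_le:
  assumes X: "X \<subseteq> D" "lin_closed X" "finite_dim X"
    and pos: "\<And>v. v \<in> X \<Longrightarrow> A v v = 0 \<Longrightarrow> AE x in M. v x = 0"
    and w: "\<And>j. j < k \<Longrightarrow> w j \<in> X" "ae_independent M k w"
    and le: "\<And>c. A (lincomb k c w) (lincomb k c w) \<le> s * B (lincomb k c w) (lincomb k c w)"
  shows "kth_eigenvalue M X A k \<le> ereal s"
proof -
  obtain m e \<nu> where sb: "spectral_basis X m e \<nu>" using spectral_basis_exists[OF X] by blast
  have eX: "\<And>i. i < m \<Longrightarrow> e i \<in> X" using sb by (auto simp: spectral_basis_def)
  define I where "I = {i. i < m \<and> \<nu> i \<le> s}"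
  have "k \<le> card I"
  proof (rule ccontr)
    assume "\<not> k \<le> card I"
    then have "card I < card {..<k}" by simp
    from homogeneous_system_nontrivial[OF _ _ this, of "\<lambda>i j. B (w j) (e i)"]
    obtain c where c: "\<exists>j<k. c j \<noteq> 0" "\<forall>i\<in>I. (\<Sum>j<k. B (w j) (e i) * c j) = 0"
      by (auto simp: I_def)
    define u where "u = lincomb k c w"
    have u: "u \<in> X" unfolding u_def using w X by (intro lin_closed_lincomb) auto
    have "\<not> (AE x in M. u x = 0)" using c(1) w(2) unfolding ae_independent_def u_def by blast
    then have Bpos: "B u u \<noteq> 0" using B_eq_0 u X by auto
    have "B u (e i) = (\<Sum>j<k. c j * B (w j) (e i))" if "i < m" for i
      unfolding u_def using w X eX that by (intro B.lincomb_left) auto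
    then have z: "B u (e i) = 0" if "i \<in> I" for i
      using c(2) that by (auto simp: I_def mult.commute)
    have "(\<Sum>i<m. (\<nu> i - s) * (B u (e i))\<^sup>2) \<le> 0"
    proof -
      have "A u u \<le> s * B u u" unfolding u_def by (rule le)
      then show ?thesis unfolding spectral_basis_square[OF sb X(1) u]
        by (simp add: left_diff_distrib sum_subtractf sum_distrib_left)
    qed
    moreover have nn: "(\<nu> i - s) * (B u (e i))\<^sup>2 \<ge> 0" if "i < m" for i
      using z[of i] that by (cases "i \<in> I") (auto simp: I_def)
    ultimately have "(\<Sum>i<m. (\<nu> i - s) * (B u (e i))\<^sup>2) = 0" by (intro antisym sum_nonneg) auto
    then have "\<forall>i\<in>{..<m}. (\<nu> i - s) * (B u (e i))\<^sup>2 = 0"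
      using nn by (subst (asm) sum_nonneg_eq_0_iff) auto
    then have "B u (e i) = 0" if "i < m" for i
      using z[of i] that by (cases "i \<in> I") (auto simp: I_def)
    then show False using Bpos spectral_basis_square(2)[OF sb X(1) u] by simp
  qed
  also have "enat (card I) \<le> eigenvalue_count M X A s"
    unfolding I_def by (rule eigenvalue_count_ge[OF sb X(1) pos])
  finally show ?thesis unfolding kth_eigenvalue_def by (intro INF_lower) auto
qed

text \<open>Keeps the infimum in \<open>kth_eigenvalue\<close> positive, so that dividing by \<mu>
  makes sense. For \<open>k = 0\<close> every real would qualify and the infimum would be negative
  infinity.\<close>

lemma kth_eigenvalue_lower_bound:
  assumes X: "X \<subseteq> D" "lin_closed X" "finite_dim X"
    and pos: "\<And>v. v \<in> X \<Longrightarrow> A v v = 0 \<Longrightarrow> AE x in M. v x = 0"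
  obtains r where "r > 0" "\<And>k. k \<ge> 1 \<Longrightarrow> ereal r \<le> kth_eigenvalue M X A k"
proof -
  obtain m e \<nu> where sb: "spectral_basis X m e \<nu>" using spectral_basis_exists[OF X] by blast
  \<comment> \<open>The entry 1 keeps the set nonempty when \<open>m = 0\<close>.\<close>
  define r where "r = Min (insert 1 (\<nu> ` {..<m}))"
  have r: "r > 0" using spectral_basis_pos[OF sb X(1) pos] by (auto simp: r_def)
  have rle: "r \<le> \<nu> i" if "i < m" for i unfolding r_def using that by (intro Min_le) auto
  show thesis
  proof (rule that[OF r])
    fix k :: nat assume k: "k \<ge> 1"
    show "ereal r \<le> kth_eigenvalue M X A k"
      unfolding kth_eigenvalue_def
    proof (intro INF_greatest, clarify)
      fix t assume t: "enat k \<le> eigenvalue_count M X A t"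
      have "eigenvalues M X A \<inter> {..t} \<noteq> {}"
      proof
        assume "eigenvalues M X A \<inter> {..t} = {}"
        then have "eigenvalue_count M X A t = 0" by (simp add: eigenvalue_count_def)
        then show False using t k by (simp add: zero_enat_def)
      qed
      then obtain l u where l: "l \<le> t" "u \<in> X" "\<not> (AE x in M. u x = 0)" "A u u = l * B u u"
        by (auto simp: eigenvalues_def eigenspace_def)
      have Bu: "B u u > 0" using B_eq_0[of u] B.nonneg[of u] l X by (auto simp: less_le)
      have "r * B u u \<le> A u u"
        unfolding spectral_basis_square[OF sb X(1) l(2)] sum_distrib_left
        by (intro sum_mono mult_right_mono rle) auto
      then have "r \<le> l" using Bu l(4) by simp
      then show "ereal r \<le> ereal t" using l by simp
    qed
  qed
qed

lemma eigenvectors_orthogonal: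
  assumes "W \<subseteq> D" "u \<in> eigenspace M W A a" "v \<in> eigenspace M W A b" "a \<noteq> b"
  shows "B u v = 0"
proof -
  have "A u v = a * B u v" "A v u = b * B v u" using assms by (auto simp: eigenspace_def)
  moreover have "A u v = A v u" using assms by (intro sym) (auto simp: eigenspace_def)
  moreover have "B v u = B u v" by (simp add: mult.commute)
  ultimately show ?thesis using assms(4) by auto
qed

text \<open>Bases of different eigenspaces may be joined: the two partial sums of a vanishing
  combination are orthogonal by \<open>eigenvectors_orthogonal\<close>, hence both are null.\<close>

lemma eigenvector_family_exists:
  assumes W: "W \<subseteq> D" "lin_closed W"
    and "finite \<Lambda>" "enat k \<le> (\<Sum>l\<in>\<Lambda>. ae_dim M (eigenspace M W A l))"
  shows "\<exists>u \<nu>. (\<forall>i<k. \<nu> i \<in> \<Lambda> \<and> u i \<in> eigenspace M W A (\<nu> i)) \<and> ae_independent M k u"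
  using assms(3,4)
proof (induction \<Lambda> arbitrary: k rule: finite_induct)
  case empty
  then show ?case by (auto simp: zero_enat_def ae_independent_def)
next
  case (insert l \<Lambda>)
  let ?d = "ae_dim M (eigenspace M W A l)" and ?S = "\<Sum>l\<in>\<Lambda>. ae_dim M (eigenspace M W A l)"
  have le: "enat k \<le> ?d + ?S" using insert by simp
  \<comment> \<open>\<open>k2\<close> functions come from the new eigenvalue \<open>l\<close>, the
    others from \<open>\<Lambda>\<close>. Dimensions are \<open>enat\<close> and may be infinite,
    hence the case distinction.\<close>
  obtain k1 k2 where k: "k = k1 + k2" "enat k1 \<le> ?S" "enat k2 \<le> ?d"
  proof (cases "?S")
    case (enat p)
    show thesis
    proof (cases "k \<le> p")
      case True then show thesis using that[of k 0] enat by (simp add: zero_enat_def[symmetric])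
    next
      case False
      then show thesis using that[of p "k - p"] enat le
        by (cases ?d) auto
    qed
  next
    case infinity then show thesis using that[of k 0] by (simp add: zero_enat_def[symmetric])
  qed
  from insert.IH[OF k(2)] obtain u \<nu> where
    u: "\<forall>i<k1. \<nu> i \<in> \<Lambda> \<and> u i \<in> eigenspace M W A (\<nu> i)" "ae_independent M k1 u" by blast
  from ae_dim_geD[OF k(3)] obtain w where
    w: "\<And>i. i < k2 \<Longrightarrow> w i \<in> eigenspace M W A l" "ae_independent M k2 w" by blast
  define u' where "u' = (\<lambda>i. if i < k1 then u i else w (i - k1))"
  define \<nu>' where "\<nu>' = (\<lambda>i. if i < k1 then \<nu> i else l)"
  have uD: "\<And>i. i < k1 \<Longrightarrow> u i \<in> D" and wD: "\<And>i. i < k2 \<Longrightarrow> w i \<in> D"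
    using u w W by (auto simp: eigenspace_def)
  have "ae_independent M k u'" unfolding ae_independent_def
  proof (rule allI, rule impI)
    fix c assume c: "AE x in M. (\<Sum>i<k. c i * u' i x) = 0"
    let ?p = "lincomb k1 c u" and ?q = "lincomb k2 (\<lambda>i. c (k1 + i)) w"
    have p: "?p \<in> D" using uD by (intro lin_closed_lincomb lin) auto
    have q: "?q \<in> D" using wD by (intro lin_closed_lincomb lin) auto
    have "(\<Sum>i<k1 + n. c i * u' i x) = ?p x + (\<Sum>i<n. c (k1 + i) * w i x)" for x n
      by (induction n) (auto simp: u'_def)
    then have AE: "AE x in M. ?p x + ?q x = 0" using c k(1) by simp
    have "B ?p ?q = (\<Sum>i<k1. c i * B (u i) ?q)" using uD q by (intro B.lincomb_left)
    also have "\<dots> = (\<Sum>i<k1. c i * (\<Sum>j<k2. c (k1 + j) * B (u i) (w j)))"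
      using uD wD by (intro sum.cong refl) (simp add: B.lincomb_right)
    also have "\<dots> = 0"
    proof -
      have "B (u i) (w j) = 0" if "i < k1" "j < k2" for i j
        using u(1) w(1) that insert.hyps by (intro eigenvectors_orthogonal[OF W(1), of _ "\<nu> i" _ l]) auto
      then show ?thesis by simp
    qed
    finally have pq: "B ?p ?q = 0" .
    have "B (\<lambda>x. ?p x + ?q x) ?p = 0" "B (\<lambda>x. ?p x + ?q x) ?q = 0"
      using AE by (intro B_null; simp)+
    then have "B ?p ?p = 0" "B ?q ?q = 0"
      using pq B.add_left[OF p q p] B.add_left[OF p q q] B.sym[OF p q] by auto
    then have "AE x in M. ?p x = 0" "AE x in M. ?q x = 0" using B_eq_0 p q by auto
    from u(2)[unfolded ae_independent_def, THEN spec, of c, THEN mp, OF this(1)]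
      w(2)[unfolded ae_independent_def, THEN spec, of "\<lambda>i. c (k1 + i)", THEN mp, OF this(2)]
    have z: "\<forall>i<k1. c i = 0" "\<forall>i<k2. c (k1 + i) = 0" .
    show "\<forall>i<k. c i = 0"
    proof (intro allI impI)
      fix i assume "i < k"
      then show "c i = 0" using z(1) z(2)[rule_format, of "i - k1"] k(1) by (cases "i < k1") auto
    qed
  qed
  moreover have "\<forall>i<k. \<nu>' i \<in> insert l \<Lambda> \<and> u' i \<in> eigenspace M W A (\<nu>' i)"
    using u(1) w(1) k(1) by (auto simp: u'_def \<nu>'_def)
  ultimately show ?case by blast
qed

text \<open>What the exact problem contributes: a k-dimensional space with Rayleigh quotient at most
  \<open>t\<close>. The count is a supremum over finite sets of eigenvalues, so a finite lower bound
  is already reached by one of them.\<close>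

lemma eigenvalue_count_geD:
  assumes W: "W \<subseteq> D" "lin_closed W" and "k \<ge> 1" "enat k \<le> eigenvalue_count M W A t"
  obtains u where "\<And>i. i < k \<Longrightarrow> u i \<in> W" "ae_independent M k u" "t \<ge> 0"
    "\<And>c. A (lincomb k c u) (lincomb k c u) \<le> t * B (lincomb k c u) (lincomb k c u)"
proof -
  have "\<exists>\<Lambda>. finite \<Lambda> \<and> \<Lambda> \<subseteq> eigenvalues M W A \<inter> {..t} \<and> enat k \<le> (\<Sum>l\<in>\<Lambda>. ae_dim M (eigenspace M W A l))"
  proof (rule ccontr)
    assume n: "\<not> ?thesis"
    have "eigenvalue_count M W A t \<le> enat (k - 1)"
      unfolding eigenvalue_count_def
    proof (rule SUP_least)
      fix \<Lambda> assume "\<Lambda> \<in> {\<Lambda>. finite \<Lambda> \<and> \<Lambda> \<subseteq> eigenvalues M W A \<inter> {..t}}"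
      then have "(\<Sum>l\<in>\<Lambda>. ae_dim M (eigenspace M W A l)) < enat k" using n by (auto simp: not_le)
      then show "(\<Sum>l\<in>\<Lambda>. ae_dim M (eigenspace M W A l)) \<le> enat (k - 1)"
        using \<open>k \<ge> 1\<close> by (cases "\<Sum>l\<in>\<Lambda>. ae_dim M (eigenspace M W A l)") auto
    qed
    with assms(4) have "enat k \<le> enat (k - 1)" by (rule order_trans)
    then show False using assms(3) by simp
  qed
  then obtain \<Lambda> where L: "finite \<Lambda>" "\<Lambda> \<subseteq> eigenvalues M W A \<inter> {..t}"
    "enat k \<le> (\<Sum>l\<in>\<Lambda>. ae_dim M (eigenspace M W A l))" by blast
  from eigenvector_family_exists[OF W L(1,3)] obtain u \<nu> where
    u: "\<forall>i<k. \<nu> i \<in> \<Lambda> \<and> u i \<in> eigenspace M W A (\<nu> i)" "ae_independent M k u" by blast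
  have uW: "\<And>i. i < k \<Longrightarrow> u i \<in> W" and \<nu>t: "\<And>i. i < k \<Longrightarrow> \<nu> i \<le> t \<and> 0 < \<nu> i"
    using u(1) L(2) by (auto simp: eigenspace_def eigenvalues_def)
  have uD: "\<And>i. i < k \<Longrightarrow> u i \<in> D" using uW W by auto
  have "A (lincomb k c u) (lincomb k c u) \<le> t * B (lincomb k c u) (lincomb k c u)" for c
  proof -
    \<comment> \<open>The weights make \<open>t * B - A\<close> the square of \<open>z\<close>.
      Cross terms between different eigenvalues vanish by orthogonality, and within one eigenvalue
      the weights multiply to \<open>t - \<nu> i\<close>, so the eigenfunctions chosen there may be
      arbitrary.\<close>
    define z where "z = lincomb k (\<lambda>i. sqrt (t - \<nu> i) * c i) u"
    have "z \<in> D" unfolding z_def using uD by (intro lin_closed_lincomb lin) auto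
    have "B z z = (\<Sum>i<k. \<Sum>j<k. (sqrt (t - \<nu> i) * c i) * (sqrt (t - \<nu> j) * c j) * B (u i) (u j))"
      unfolding z_def using uD by (rule B.lincomb_square)
    also have "\<dots> = (\<Sum>i<k. \<Sum>j<k. t * (c i * c j * B (u i) (u j)) - c i * c j * A (u i) (u j))"
    proof (intro sum.cong refl)
      fix i j assume "i \<in> {..<k}" "j \<in> {..<k}"
      then have ij: "i < k" "j < k" by auto
      have A: "A (u i) (u j) = \<nu> i * B (u i) (u j)" using u(1) uW ij by (auto simp: eigenspace_def)
      show "(sqrt (t - \<nu> i) * c i) * (sqrt (t - \<nu> j) * c j) * B (u i) (u j) =
        t * (c i * c j * B (u i) (u j)) - c i * c j * A (u i) (u j)"
      proof (cases "\<nu> i = \<nu> j")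
        case True
        have "sqrt (t - \<nu> i) * sqrt (t - \<nu> i) = t - \<nu> i" using \<nu>t ij by simp
        then have q: "(sqrt (t - \<nu> i) * c i) * (sqrt (t - \<nu> i) * c j) = (t - \<nu> i) * (c i * c j)"
          by (metis mult.assoc mult.left_commute)
        have "(sqrt (t - \<nu> i) * c i) * (sqrt (t - \<nu> j) * c j) * B (u i) (u j)
          = (t - \<nu> i) * (c i * c j) * B (u i) (u j)" by (simp only: True[symmetric] q)
        then show ?thesis unfolding A by (simp add: algebra_simps)
      next
        case False
        then have "B (u i) (u j) = 0" using u(1) ij by (intro eigenvectors_orthogonal[OF W(1)]) auto
        then show ?thesis using A by simp
      qed
    qed
    also have "\<dots> = t * B (lincomb k c u) (lincomb k c u) - A (lincomb k c u) (lincomb k c u)"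
    proof -
      have 1: "B (lincomb k c u) (lincomb k c u) = (\<Sum>i<k. \<Sum>j<k. c i * c j * B (u i) (u j))"
        using uD by (rule B.lincomb_square)
      have 2: "A (lincomb k c u) (lincomb k c u) = (\<Sum>i<k. \<Sum>j<k. c i * c j * A (u i) (u j))"
        using uD by (rule lincomb_square)
      show ?thesis unfolding 1 2 by (simp only: sum_subtractf sum_distrib_left)
    qed
    finally show ?thesis using B.nonneg[OF \<open>z \<in> D\<close>] by simp
  qed
  moreover have "t \<ge> 0" using \<nu>t[of 0] assms(3) by auto
  ultimately show thesis using that uW u(2) by blast
qed

end

text \<open>Young's inequality for \<open>(\<alpha> + n)^2\<close> with weight
  \<open>\<theta> = C * t\<close>, chosen so that the terms in \<open>p\<close> cancel. In the
  application \<open>Q\<close> and \<open>p\<close> are the energies of the projection and of its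
  error, \<open>\<alpha>\<close> and \<open>n\<close> their L2 norms.\<close>

lemma GLB_scalar:
  fixes t C :: real
  assumes "Q + p \<le> t * (\<alpha> + n)\<^sup>2" "n\<^sup>2 \<le> C * p" "C * t < 1" "0 \<le> C" "0 \<le> t" "0 \<le> p"
  shows "(1 - C * t) * Q \<le> t * \<alpha>\<^sup>2"
proof -
  have "(1 - C * t) * (t * (\<alpha> + n)\<^sup>2) \<le> t * \<alpha>\<^sup>2 + (1 - C * t) * p"
  proof (cases "C = 0")
    case True
    then show ?thesis using assms by simp
  next
    case False
    then have C: "C > 0" using assms by simp
    define \<theta> where "\<theta> = C * t"
    have "C * ((1 - \<theta>) * (t * (\<alpha> + n)\<^sup>2)) = (1 - \<theta>) * \<theta> * (\<alpha> + n)\<^sup>2" by (simp add: \<theta>_def)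
    also have "\<dots> = \<theta> * \<alpha>\<^sup>2 + (1 - \<theta>) * n\<^sup>2 - (\<theta> * \<alpha> - (1 - \<theta>) * n)\<^sup>2"
      by (simp add: power2_eq_square algebra_simps)
    also have "\<dots> \<le> \<theta> * \<alpha>\<^sup>2 + (1 - \<theta>) * n\<^sup>2" by simp
    also have "\<dots> \<le> \<theta> * \<alpha>\<^sup>2 + (1 - \<theta>) * (C * p)"
      using assms by (intro add_left_mono mult_left_mono) (auto simp: \<theta>_def)
    also have "\<dots> = C * (t * \<alpha>\<^sup>2 + (1 - \<theta>) * p)" by (simp add: \<theta>_def algebra_simps)
    finally show ?thesis using C by (simp add: \<theta>_def)
  qed
  moreover have "(1 - C * t) * (Q + p) \<le> (1 - C * t) * (t * (\<alpha> + n)\<^sup>2)"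
    using assms by (intro mult_left_mono) auto
  ultimately show ?thesis by (simp add: algebra_simps)
qed

context sym_form
begin

lemma triangle:
  assumes "u \<in> D" "v \<in> D"
  shows "A (\<lambda>x. u x - v x) (\<lambda>x. u x - v x) \<le> (sqrt (A u u) + sqrt (A v v))\<^sup>2"
    and "A (\<lambda>x. u x + v x) (\<lambda>x. u x + v x) \<le> (sqrt (A u u) + sqrt (A v v))\<^sup>2"
proof -
  have "sqrt ((A u v)\<^sup>2) \<le> sqrt (A u u * A v v)"
    using Cauchy_Schwarz[OF assms] by (rule real_sqrt_le_mono)
  then have "\<bar>A u v\<bar> \<le> sqrt (A u u) * sqrt (A v v)" by (simp add: real_sqrt_mult)
  then show "A (\<lambda>x. u x - v x) (\<lambda>x. u x - v x) \<le> (sqrt (A u u) + sqrt (A v v))\<^sup>2"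
    "A (\<lambda>x. u x + v x) (\<lambda>x. u x + v x) \<le> (sqrt (A u u) + sqrt (A v v))\<^sup>2"
    using quadratic[OF assms, of 1 "-1"] quadratic[OF assms, of 1 1] nonneg assms
    by (auto simp: power2_sum abs_le_iff)
qed

end

text \<open>The bound for an arbitrary finite-dimensional \<open>X\<close> and a space
  \<open>W\<close> not containing it. Everything specific to the finite element method is packed
  into \<open>approx\<close>: an interpolant that is orthogonal for \<open>a\<close> and has
  controlled error.\<close>

lemma (in form_pair) GLB_le_kth_eigenvalue:
  fixes a b :: "('a \<Rightarrow> real) \<Rightarrow> ('a \<Rightarrow> real) \<Rightarrow> real"
  assumes a: "sym_form D a" and b: "sym_form D b" and Aab: "\<And>u v. A u v = a u v + b u v"
    and X: "X \<subseteq> D" "lin_closed X" "finite_dim X"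
    and pos: "\<And>v. v \<in> X \<Longrightarrow> A v v = 0 \<Longrightarrow> AE x in M. v x = 0"
    and W: "W \<subseteq> D" "lin_closed W"
    and \<epsilon>: "0 \<le> \<epsilon>" and \<delta>: "0 \<le> \<delta>"
    and approx: "\<And>u. u \<in> W \<Longrightarrow> \<exists>w\<in>X. (\<forall>z\<in>X. a (\<lambda>x. u x - w x) z = 0) \<and>
      B (\<lambda>x. u x - w x) (\<lambda>x. u x - w x) \<le> \<epsilon> * a (\<lambda>x. u x - w x) (\<lambda>x. u x - w x) \<and>
      b (\<lambda>x. u x - w x) (\<lambda>x. u x - w x) \<le> \<delta> * a (\<lambda>x. u x - w x) (\<lambda>x. u x - w x)"
    and k: "k \<ge> 1"
  shows "ereal (GLB \<epsilon> \<delta> (kth_eigenvalue M X A 1) (kth_eigenvalue M X A k)) \<le> kth_eigenvalue M W A k"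
proof -
  interpret a: sym_form D a by (rule a)
  interpret b: sym_form D b by (rule b)
  define \<mu> where "\<mu> = kth_eigenvalue M X A 1"
  define lam where "lam = kth_eigenvalue M X A k"
  obtain r0 where r0: "r0 > 0" "\<And>k. k \<ge> 1 \<Longrightarrow> ereal r0 \<le> kth_eigenvalue M X A k"
    by (rule kth_eigenvalue_lower_bound[OF X pos]) auto
  have \<mu>0: "ereal r0 \<le> \<mu>" and lam0: "ereal r0 \<le> lam"
    using r0(2)[of 1] r0(2)[OF k] by (simp_all add: \<mu>_def lam_def)
  define q where "q = (if \<mu> = \<infinity> then 0 else \<delta> / real_of_ereal \<mu>)"
  have q0: "q \<ge> 0" using \<delta> \<mu>0 r0(1) by (cases \<mu>) (auto simp: q_def)
  define C where "C = (sqrt \<epsilon> + sqrt q)\<^sup>2"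
  have C0: "C \<ge> 0" by (simp add: C_def)
  obtain m e \<nu> where sb: "spectral_basis X m e \<nu>" using spectral_basis_exists[OF X] by blast
  have eX: "\<And>i. i < m \<Longrightarrow> e i \<in> X" and eD: "\<And>i. i < m \<Longrightarrow> e i \<in> D"
    using sb X by (auto simp: spectral_basis_def)
  have \<nu>pos: "\<And>i. i < m \<Longrightarrow> \<nu> i > 0" by (rule spectral_basis_pos[OF sb X(1) pos])

  \<comment> \<open>The min-max principle with the single function \<open>z\<close>.\<close>
  have first: "\<mu> \<le> ereal s" if z: "z \<in> X" "\<not> (AE x in M. z x = 0)" "A z z \<le> s * B z z" for z s
    unfolding \<mu>_def
  proof (rule kth_eigenvalue_le[OF X pos, where w = "\<lambda>_. z"])
    show "ae_independent M 1 (\<lambda>_. z)"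
      unfolding ae_independent_def
    proof (intro allI impI)
      fix c :: "nat \<Rightarrow> real" and i :: nat assume c: "AE x in M. (\<Sum>i<1. c i * z x) = 0" and i: "i < 1"
      show "c i = 0"
      proof (rule ccontr)
        assume "c i \<noteq> 0"
        then have "AE x in M. z x = 0" using c i by simp
        then show False using z by simp
      qed
    qed
    show "A (lincomb 1 c (\<lambda>_. z)) (lincomb 1 c (\<lambda>_. z)) \<le> s * B (lincomb 1 c (\<lambda>_. z)) (lincomb 1 c (\<lambda>_. z))" for c
    proof -
      have zD: "z \<in> D" using z X by auto
      have "(\<lambda>x. c 0 * z x) \<in> D" using lin_closed_scale[OF lin zD] .
      then have "A (\<lambda>x. c 0 * z x) (\<lambda>x. c 0 * z x) = c 0 * (c 0 * A z z)"
        and "B (\<lambda>x. c 0 * z x) (\<lambda>x. c 0 * z x) = c 0 * (c 0 * B z z)"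
        using zD by (simp_all only: scale_left scale_right B.scale_left B.scale_right)
      moreover have "c 0 * (c 0 * A z z) \<le> s * (c 0 * (c 0 * B z z))"
        using mult_left_mono[OF z(3), of "c 0 * c 0"] by (simp add: mult_ac)
      ultimately show ?thesis by simp
    qed
  qed (use z in auto)
  \<comment> \<open>By convention \<open>q = 0\<close> if \<mu> is infinite; a non-null
    \<open>z\<close> rules this out, as its finite Rayleigh quotient bounds \<mu>. For null
    \<open>z\<close> the sign of \<open>g\<close> is visible only through
    \<open>\<delta> * g\<close>, hence the split on \<open>\<delta> = 0\<close>.\<close>
  have Poincare: "B z z \<le> q * g" if z: "z \<in> X" "A z z \<le> \<delta> * g" for z g
  proof (cases "AE x in M. z x = 0")
    case True
    have "B z z = 0" using True by (rule B_null)
    moreover have "0 \<le> q * g"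
    proof (cases "\<delta> = 0")
      case False
      have "0 \<le> \<delta> * g" using z nonneg[of z] X by auto
      then have "0 \<le> g" using False \<delta> by (simp add: zero_le_mult_iff)
      then show ?thesis using q0 by simp
    qed (simp add: q_def)
    ultimately show ?thesis by simp
  next
    case False
    have zD: "z \<in> D" using z X by auto
    have Bz: "B z z > 0" using B_eq_0[OF zD] B.nonneg[OF zD] False by linarith
    have le: "\<mu> \<le> ereal (A z z / B z z)" using Bz by (intro first[OF z(1) False]) simp
    then obtain r where r: "\<mu> = ereal r" "r > 0" using \<mu>0 r0(1) by (cases \<mu>) auto
    have "r * B z z \<le> A z z" using le Bz r(1) by (simp add: field_simps)
    also note z(2)
    finally show ?thesis using r by (simp add: q_def field_simps)
  qed

  \<comment> \<open>The energy projection in the spectral basis: the \<open>e i\<close> are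
    orthogonal for \<open>A\<close> with \<open>A (e i) (e i) = \<nu> i\<close>, so this is the
    coordinate of \<open>u\<close>.\<close>
  define G where "G = (\<lambda>u. lincomb m (\<lambda>i. A u (e i) / \<nu> i) e)"
  have GX: "G u \<in> X" for u unfolding G_def using eX X by (intro lin_closed_lincomb) auto
  have GD: "G u \<in> D" for u using GX X by auto
  have galerkin: "A (\<lambda>x. u x - G u x) z = 0" if u: "u \<in> D" and z: "z \<in> X" for u z
  proof -
    have r: "(\<lambda>x. u x - G u x) \<in> D" using u GD by (intro lin_closed_diff lin)
    have *: "A (\<lambda>x. u x - G u x) (e j) = 0" if j: "j < m" for j
    proof -
      have "A (G u) (e j) = (\<Sum>i<m. A u (e i) / \<nu> i * A (e i) (e j))"
        unfolding G_def using eD j by (intro lincomb_left) auto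
      also have "\<dots> = (\<Sum>i<m. if i = j then A u (e j) else 0)"
      proof (intro sum.cong refl)
        fix i assume i: "i \<in> {..<m}"
        have "A (e i) (e j) = \<nu> i * B (e i) (e j)" using sb eX i j by (auto simp: spectral_basis_def)
        also have "B (e i) (e j) = (if i = j then 1 else 0)"
          using sb i j by (auto simp: spectral_basis_def orthonormal_def)
        finally show "A u (e i) / \<nu> i * A (e i) (e j) = (if i = j then A u (e j) else 0)"
          using \<nu>pos[of i] i by auto
      qed
      finally show ?thesis using j u eD GD by (simp add: diff_left)
    qed
    have l: "lincomb m (\<lambda>i. B z (e i)) e \<in> D" using eD by (intro lin_closed_lincomb lin) auto
    have "A (\<lambda>x. u x - G u x) z = A (\<lambda>x. u x - G u x) (lincomb m (\<lambda>i. B z (e i)) e)"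
      using sb z X r l by (intro cong_AE) (auto simp: spectral_basis_def)
    also have "\<dots> = (\<Sum>i<m. B z (e i) * A (\<lambda>x. u x - G u x) (e i))"
      using eD r by (intro lincomb_right)
    finally show ?thesis using * by simp
  qed

  have err: "B (\<lambda>x. u x - G u x) (\<lambda>x. u x - G u x) \<le> C * A (\<lambda>x. u x - G u x) (\<lambda>x. u x - G u x)"
    if u: "u \<in> W" for u
  proof -
    have uD: "u \<in> D" using u W by auto
    obtain w where w: "w \<in> X" "\<forall>z\<in>X. a (\<lambda>x. u x - w x) z = 0"
      "B (\<lambda>x. u x - w x) (\<lambda>x. u x - w x) \<le> \<epsilon> * a (\<lambda>x. u x - w x) (\<lambda>x. u x - w x)"
      "b (\<lambda>x. u x - w x) (\<lambda>x. u x - w x) \<le> \<delta> * a (\<lambda>x. u x - w x) (\<lambda>x. u x - w x)"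
      using approx[OF u] by blast
    have wD: "w \<in> D" using w X by auto
    define e where "e = (\<lambda>x. u x - w x)"
    define d where "d = (\<lambda>x. G u x - w x)"
    define r where "r = (\<lambda>x. u x - G u x)"
    define g where "g = a e e"
    have eD: "e \<in> D" and rD: "r \<in> D" and dX: "d \<in> X" and dD: "d \<in> D"
      unfolding e_def r_def d_def using uD wD GD w(1) GX X by (auto intro!: lin_closed_diff lin)
    have red: "r = (\<lambda>x. e x - d x)" and erd: "e = (\<lambda>x. r x + d x)"
      by (auto simp: r_def e_def d_def)
    have g0: "g \<ge> 0" using a.nonneg[OF eD] by (simp add: g_def)
    have aed: "a e d = 0" using w(2) dX by (simp add: e_def)
    have "A r d = 0" using galerkin[OF uD dX] by (simp add: r_def)
    then have "A d d = A e d" using diff_left[OF eD dD dD] by (simp add: red)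
    also have "\<dots> = b e d" using aed by (simp add: Aab)
    finally have Add: "A d d = b e d" .
    have "(A d d)\<^sup>2 \<le> b e e * b d d" unfolding Add by (rule b.Cauchy_Schwarz[OF eD dD])
    also have "\<dots> \<le> (\<delta> * g) * A d d"
      using w(4) a.nonneg[OF dD] b.nonneg[OF dD] b.nonneg[OF eD] \<delta> g0
      by (intro mult_mono) (auto simp: Aab e_def g_def)
    finally have "A d d * A d d \<le> (\<delta> * g) * A d d" by (simp add: power2_eq_square)
    then have "A d d \<le> \<delta> * g" using nonneg[OF dD] \<delta> g0 by (cases "A d d = 0") auto
    then have Bd: "B d d \<le> q * g" by (rule Poincare[OF dX])
    \<comment> \<open>Orthogonality makes \<open>w\<close> the best approximation of
      \<open>u\<close> from \<open>X\<close> in the seminorm of \<open>a\<close>, so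
      \<open>e\<close> is no larger there than the error \<open>r\<close> of the projection.\<close>
    have "g = a r e + a d e" unfolding g_def using a.add_left[OF rD dD eD] by (simp add: erd[symmetric])
    also have "a d e = 0" using aed a.sym[OF eD dD] by simp
    finally have "g\<^sup>2 \<le> a r r * g" using a.Cauchy_Schwarz[OF rD eD] by (simp add: g_def)
    then have "g \<le> a r r" using g0 a.nonneg[OF rD] by (cases "g = 0") (auto simp: power2_eq_square)
    then have gA: "g \<le> A r r" using b.nonneg[OF rD] by (simp add: Aab)
    have "B r r \<le> (sqrt (B e e) + sqrt (B d d))\<^sup>2"
      unfolding red by (rule B.triangle(1)[OF eD dD])
    also have "\<dots> \<le> (sqrt (\<epsilon> * g) + sqrt (q * g))\<^sup>2"
      using w(3) Bd B.nonneg[OF eD] B.nonneg[OF dD]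
      by (intro power_mono add_mono real_sqrt_le_mono) (auto simp: e_def g_def)
    also have "\<dots> = C * g"
      using g0 by (simp add: C_def real_sqrt_mult distrib_right[symmetric] power_mult_distrib)
    also have "\<dots> \<le> C * A r r" using gA C0 by (intro mult_left_mono)
    finally show ?thesis by (simp add: r_def)
  qed

  have main: "GLB \<epsilon> \<delta> \<mu> lam \<le> t" if t: "enat k \<le> eigenvalue_count M W A t" for t
  proof -
    obtain u where u: "\<And>i. i < k \<Longrightarrow> u i \<in> W" "ae_independent M k u" "t \<ge> 0"
      "\<And>c. A (lincomb k c u) (lincomb k c u) \<le> t * B (lincomb k c u) (lincomb k c u)"
      by (rule eigenvalue_count_geD[OF W k t]) blast
    have GLB: "GLB \<epsilon> \<delta> \<mu> lam = (if lam = \<infinity> then 1 / C else real_of_ereal lam / (1 + C * real_of_ereal lam))"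
      by (simp add: GLB_def q_def[symmetric] C_def[symmetric])
    show ?thesis
    proof (cases "C * t < 1")
      case False
      \<comment> \<open>Both branches of \<open>GLB\<close> are at most \<open>1 / C\<close>, and
        here \<open>1 / C \<le> t\<close>.\<close>
      then have C: "C > 0" "C * t \<ge> 1" using C0 by (auto simp: less_le)
      show ?thesis
      proof (cases lam)
        case (real L)
        have L: "L > 0" using lam0 r0 real by auto
        have "1 * L \<le> (C * t) * L" using C L by (intro mult_right_mono) auto
        also have "\<dots> \<le> t + C * t * L" using u(3) by simp
        finally have "L \<le> t * (1 + C * L)" by (simp add: algebra_simps)
        moreover have "1 + C * L > 0" using C L by (intro add_pos_pos) auto
        ultimately show ?thesis unfolding GLB using real by (simp add: divide_le_eq)
      next
        case PInf
        then show ?thesis unfolding GLB using C by (simp add: field_simps)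
      next
        case MInf
        then show ?thesis using lam0 by simp
      qed
    next
      case True
      \<comment> \<open>The solution of \<open>s / (1 + C * s) = t\<close>, so that
        \<open>lam \<le> s\<close> is the claim.\<close>
      define s where "s = t / (1 - C * t)"
      have pos1: "1 - C * t > 0" using True by simp
      have split: "A v v = A (G v) (G v) + A (\<lambda>x. v x - G v x) (\<lambda>x. v x - G v x)" if v: "v \<in> W" for v
      proof -
        have vD: "v \<in> D" using v W by auto
        have r: "(\<lambda>x. v x - G v x) \<in> D" using vD GD by (intro lin_closed_diff lin)
        have "A (\<lambda>x. 1 * G v x + 1 * (v x - G v x)) (\<lambda>x. 1 * G v x + 1 * (v x - G v x))
          = A (G v) (G v) + A (\<lambda>x. v x - G v x) (\<lambda>x. v x - G v x)"
          using quadratic[OF GD[of v] r, of 1 1] galerkin[OF vD GX[of v]] sym[OF GD[of v] r] by simp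
        then show ?thesis by simp
      qed
      have comb: "lincomb k c (\<lambda>i. G (u i)) = G (lincomb k c u)" for c
      proof
        fix x
        have "A (lincomb k c u) (e i) = (\<Sum>j<k. c j * A (u j) (e i))" if "i < m" for i
          using u(1) W eD that by (intro lincomb_left) auto
        then show "lincomb k c (\<lambda>i. G (u i)) x = G (lincomb k c u) x"
          unfolding G_def
          by (subst sum.cong[OF refl, of "{..<m}" _ "\<lambda>i. (\<Sum>j<k. c j * A (u j) (e i)) / \<nu> i * e i x"])
             (auto simp: sum_distrib_left sum_distrib_right sum_divide_distrib sum.swap[of _ "{..<m}"] mult_ac intro!: sum.cong)
      qed
      have uW: "lincomb k c u \<in> W" for c using u(1) W by (intro lin_closed_lincomb) auto
      have Bt: "B v v \<le> (sqrt (B (G v) (G v)) + sqrt (B (\<lambda>x. v x - G v x) (\<lambda>x. v x - G v x)))\<^sup>2"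
        if v: "v \<in> W" for v
      proof -
        have "(\<lambda>x. v x - G v x) \<in> D" using v W GD by (intro lin_closed_diff lin) auto
        from B.triangle(2)[OF GD[of v] this] show ?thesis by simp
      qed
      have "lam \<le> ereal s" unfolding lam_def
      proof (rule kth_eigenvalue_le[OF X pos, where w = "\<lambda>i. G (u i)"])
        show "G (u j) \<in> X" for j by (rule GX)
        show "A (lincomb k c (\<lambda>i. G (u i))) (lincomb k c (\<lambda>i. G (u i)))
          \<le> s * B (lincomb k c (\<lambda>i. G (u i))) (lincomb k c (\<lambda>i. G (u i)))" for c
        proof -
          define v where "v = lincomb k c u"
          have v: "v \<in> W" unfolding v_def by (rule uW)
          have r: "(\<lambda>x. v x - G v x) \<in> D" using v W GD by (intro lin_closed_diff lin) auto
          have "A v v \<le> t * B v v" unfolding v_def by (rule u(4))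
          also have "\<dots> \<le> t * (sqrt (B (G v) (G v)) + sqrt (B (\<lambda>x. v x - G v x) (\<lambda>x. v x - G v x)))\<^sup>2"
            using u(3) Bt[OF v] by (intro mult_left_mono)
          finally have le: "A (G v) (G v) + A (\<lambda>x. v x - G v x) (\<lambda>x. v x - G v x)
            \<le> t * (sqrt (B (G v) (G v)) + sqrt (B (\<lambda>x. v x - G v x) (\<lambda>x. v x - G v x)))\<^sup>2"
            unfolding split[OF v] .
          have "(sqrt (B (\<lambda>x. v x - G v x) (\<lambda>x. v x - G v x)))\<^sup>2
            \<le> C * A (\<lambda>x. v x - G v x) (\<lambda>x. v x - G v x)"
            using err[OF v] B.nonneg[OF r] by simp
          from GLB_scalar[OF le this True C0 u(3) nonneg[OF r]]
          have "(1 - C * t) * A (G v) (G v) \<le> t * B (G v) (G v)" using B.nonneg[OF GD] by simp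
          then have "A (G v) (G v) \<le> s * B (G v) (G v)"
            using pos1 by (simp add: s_def field_simps)
          moreover define w where "w = lincomb k c (\<lambda>i. G (u i))"
          moreover have "w = G v" unfolding w_def v_def by (rule comb)
          ultimately have "A w w \<le> s * B w w" by simp
          then show ?thesis unfolding w_def .
        qed
        \<comment> \<open>The projection does not lower the dimension: if \<open>G v\<close> is
          null, then \<open>B v v \<le> C * A v v \<le> C * t * B v v\<close> with
          \<open>C * t < 1\<close>.\<close>
        show "ae_independent M k (\<lambda>i. G (u i))"
          unfolding ae_independent_def
        proof (rule allI, rule impI)
          fix c assume c: "AE x in M. lincomb k c (\<lambda>i. G (u i)) x = 0"
          define v where "v = lincomb k c u"
          have v: "v \<in> W" unfolding v_def by (rule uW)
          have vD: "v \<in> D" using v W by auto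
          have z: "AE x in M. G v x = 0" using c unfolding fun_cong[OF comb] v_def .
          have r: "(\<lambda>x. v x - G v x) \<in> D" using v W GD by (intro lin_closed_diff lin) auto
          have Bz: "B (G v) (G v) = 0" by (rule B_null[OF z])
          have "B v v \<le> B (\<lambda>x. v x - G v x) (\<lambda>x. v x - G v x)"
            using Bt[OF v] unfolding Bz using B.nonneg[OF r] by simp
          also have "\<dots> \<le> C * A v v"
            using err[OF v] mult_left_mono[OF _ C0, of "A (\<lambda>x. v x - G v x) (\<lambda>x. v x - G v x)" "A v v"]
              split[OF v] nonneg[OF GD[of v]] by linarith
          also have "\<dots> \<le> C * (t * B v v)" using u(4)[of c] C0 unfolding v_def by (intro mult_left_mono)
          finally have "(1 - C * t) * B v v \<le> 0" by (simp add: algebra_simps)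
          then have "B v v = 0" using pos1 B.nonneg[OF vD] by (simp add: mult_le_0_iff)
          then have "AE x in M. lincomb k c u x = 0" using B_eq_0[OF vD] by (simp add: v_def)
          then show "\<forall>i<k. c i = 0" using u(2)[unfolded ae_independent_def, THEN spec, of c] by simp
        qed
      qed
      then obtain L where L: "lam = ereal L" "L > 0" "L \<le> s" using lam0 r0 by (cases lam) auto
      have "L \<le> t * (1 + C * L)" using L(3) pos1 by (simp add: s_def field_simps)
      moreover have "1 + C * L > 0" using C0 L by (intro add_pos_nonneg) auto
      ultimately show ?thesis unfolding GLB using L by (simp add: divide_le_eq)
    qed
  qed
  show ?thesis unfolding \<mu>_def[symmetric] lam_def[symmetric]
    unfolding kth_eigenvalue_def[of M W] using main by (intro INF_greatest) auto
qed

section \<open>Test functions\<close>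

text \<open>Smoothness by an invariant: iterated derivatives never leave \<open>S\<close>, so they
  are differentiable without being computed.\<close>

lemma smooth_coinduct:
  assumes "f \<in> S" "\<And>g x. g \<in> S \<Longrightarrow> g differentiable (at x)"
    "\<And>g b. g \<in> S \<Longrightarrow> b \<in> Basis \<Longrightarrow> partial_deriv b g \<in> S"
  shows "smooth f"
proof -
  have "fold partial_deriv bs g \<in> S" if "g \<in> S" "set bs \<subseteq> Basis" for bs g
    using that by (induction bs arbitrary: g) (auto intro: assms(3))
  then show ?thesis unfolding smooth_def using assms(1,2) by blast
qed

lemma smooth_differentiable: "smooth f \<Longrightarrow> f differentiable (at x)"
  unfolding smooth_def by (drule spec[of _ "[]"]) simp

lemma smooth_partial_deriv:
  fixes f :: "'a::euclidean_space \<Rightarrow> real"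
  shows "smooth f \<Longrightarrow> b \<in> Basis \<Longrightarrow> smooth (partial_deriv b f)"
  unfolding smooth_def
proof (intro allI impI)
  fix bs :: "'a list" and x assume *: "\<forall>bs. set bs \<subseteq> Basis \<longrightarrow> (\<forall>x. fold partial_deriv bs f differentiable at x)"
    and b: "b \<in> Basis" "set bs \<subseteq> Basis"
  show "fold partial_deriv bs (partial_deriv b f) differentiable at x"
    using *[rule_format, of "b # bs" x] b by simp
qed

lemma partial_deriv_eqI: "(f has_derivative f') (at x) \<Longrightarrow> partial_deriv b f x = f' b"
  unfolding partial_deriv_def using frechet_derivative_at by metis

definition grad :: "('a::euclidean_space \<Rightarrow> real) \<Rightarrow> 'a \<Rightarrow> 'a" where
  "grad f x = (\<Sum>b\<in>Basis. partial_deriv b f x *\<^sub>R b)"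

lemma grad_inner_Basis: "b \<in> Basis \<Longrightarrow> grad f x \<bullet> b = partial_deriv b f x"
  by (simp add: grad_def inner_sum_left inner_Basis if_distrib cong: if_cong)

lemma has_derivative_grad:
  assumes "f differentiable (at x)"
  shows "(f has_derivative (\<lambda>h. grad f x \<bullet> h)) (at x)"
proof -
  from assms obtain f' where f': "(f has_derivative f') (at x)" by (auto simp: differentiable_def)
  have "f' = (\<lambda>h. grad f x \<bullet> h)"
  proof
    fix h
    have lin: "linear f'" using f' by (rule has_derivative_linear)
    have "f' (\<Sum>b\<in>Basis. (h \<bullet> b) *\<^sub>R b) = (\<Sum>b\<in>Basis. (h \<bullet> b) * f' b)"
      using lin by (simp add: linear_sum linear_scale)
    also have "\<dots> = grad f x \<bullet> h"
      by (simp add: grad_def inner_sum_left partial_deriv_eqI[OF f'] inner_commute[of h] mult.commute)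
    finally show "f' h = grad f x \<bullet> h" by (simp add: euclidean_representation)
  qed
  then show ?thesis using f' by simp
qed

lemma grad_eqI:
  assumes "(f has_derivative (\<lambda>h. a \<bullet> h)) (at x)"
  shows "grad f x = a"
  by (rule euclidean_eqI) (simp add: grad_inner_Basis partial_deriv_eqI[OF assms])

lemma smooth_has_derivative: "smooth f \<Longrightarrow> (f has_derivative (\<lambda>h. grad f x \<bullet> h)) (at x)"
  by (intro has_derivative_grad smooth_differentiable)

lemma smooth_continuous: "smooth f \<Longrightarrow> continuous_on S f"
  using smooth_differentiable differentiable_imp_continuous_within continuous_at_imp_continuous_on by blast

lemma smooth_grad_continuous: "smooth f \<Longrightarrow> continuous_on S (grad f)"
  unfolding grad_def[abs_def] by (intro continuous_intros smooth_continuous smooth_partial_deriv)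

lemma smooth_lincomb:
  fixes f g :: "'a::euclidean_space \<Rightarrow> real"
  assumes "smooth f" "smooth g"
  shows "smooth (\<lambda>x. c * f x + d * g x)"
proof (rule smooth_coinduct[where S = "{(\<lambda>x. c * f x + d * g x) | f g. smooth f \<and> smooth g}"])
  show "(\<lambda>x. c * f x + d * g x) \<in> {(\<lambda>x. c * f x + d * g x) | f g. smooth f \<and> smooth g}"
    using assms by blast
next
  fix h x assume "h \<in> {(\<lambda>x. c * f x + d * g x) | f g. smooth f \<and> smooth g}"
  then obtain f g where fg: "smooth f" "smooth g" "h = (\<lambda>x. c * f x + d * g x)" by blast
  have "(h has_derivative (\<lambda>v. c * (grad f x \<bullet> v) + d * (grad g x \<bullet> v))) (at x)"
    unfolding fg(3) by (intro derivative_intros smooth_has_derivative fg)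
  then show "h differentiable at x" by (auto simp: differentiable_def)
next
  fix h :: "'a \<Rightarrow> real" and b :: 'a assume h: "h \<in> {(\<lambda>x. c * f x + d * g x) | f g. smooth f \<and> smooth g}" and b: "b \<in> Basis"
  then obtain f g where fg: "smooth f" "smooth g" "h = (\<lambda>x. c * f x + d * g x)" by blast
  have "partial_deriv b h x = c * partial_deriv b f x + d * partial_deriv b g x" for x
  proof -
    have "(h has_derivative (\<lambda>v. c * (grad f x \<bullet> v) + d * (grad g x \<bullet> v))) (at x)"
      unfolding fg(3) by (intro derivative_intros smooth_has_derivative fg)
    from partial_deriv_eqI[OF this] show ?thesis by (simp add: grad_inner_Basis b)
  qed
  then have "partial_deriv b h = (\<lambda>x. c * partial_deriv b f x + d * partial_deriv b g x)" by blast
  then show "partial_deriv b h \<in> {(\<lambda>x. c * f x + d * g x) | f g. smooth f \<and> smooth g}"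
    using fg b smooth_partial_deriv by blast
qed

lemma test_functionsD:
  assumes "\<phi> \<in> test_functions U"
  shows "smooth \<phi>" "compact (closure {x. \<phi> x \<noteq> 0})" "closure {x. \<phi> x \<noteq> 0} \<subseteq> U"
    "x \<notin> closure {x. \<phi> x \<noteq> 0} \<Longrightarrow> \<phi> x = 0" "x \<notin> U \<Longrightarrow> \<phi> x = 0"
  using assms closure_subset[of "{x. \<phi> x \<noteq> 0}"] by (auto simp: test_functions_def)

lemma test_functions_mono: "\<phi> \<in> test_functions U \<Longrightarrow> U \<subseteq> U' \<Longrightarrow> \<phi> \<in> test_functions U'"
  by (auto simp: test_functions_def)

lemma lin_closed_test_functions: "lin_closed (test_functions U)"
  unfolding lin_closed_def
proof (intro conjI ballI allI)
  show "(\<lambda>x. 0) \<in> test_functions U"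
  proof -
    have "smooth (\<lambda>x::'a. 0::real)"
      by (rule smooth_coinduct[where S = "{\<lambda>x. 0}"])
         (auto simp: partial_deriv_eqI[OF has_derivative_const])
    then show ?thesis by (simp add: test_functions_def)
  qed
next
  fix u v and c d :: real assume u: "u \<in> test_functions U" and v: "v \<in> test_functions U"
  let ?w = "\<lambda>x. c * u x + d * v x"
  have "{x. ?w x \<noteq> 0} \<subseteq> {x. u x \<noteq> 0} \<union> {x. v x \<noteq> 0}" by auto
  from closure_mono[OF this]
  have sub: "closure {x. ?w x \<noteq> 0} \<subseteq> closure {x. u x \<noteq> 0} \<union> closure {x. v x \<noteq> 0}"
    by (simp only: closure_Un)
  have "compact (closure {x. ?w x \<noteq> 0})"
  proof -
    have "compact (closure {x. u x \<noteq> 0} \<union> closure {x. v x \<noteq> 0})"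
      using u v by (intro compact_Un test_functionsD)
    then have "bounded (closure {x. ?w x \<noteq> 0})" using compact_imp_bounded sub bounded_subset by blast
    then show ?thesis by (simp only: compact_eq_bounded_closed closed_closure)
  qed
  moreover have "smooth ?w" using u v by (intro smooth_lincomb test_functionsD)
  ultimately show "?w \<in> test_functions U"
    using sub test_functionsD(3)[OF u] test_functionsD(3)[OF v] by (auto simp: test_functions_def)
qed

section \<open>Smooth bump functions on boxes\<close>

definition flat :: "nat \<Rightarrow> real \<Rightarrow> real" where
  "flat m t = (if t > 0 then exp (- 1 / t) / t ^ m else 0)"

lemma flat_tendsto_0: "(flat m \<longlongrightarrow> 0) (at 0)"
proof -
  have "((\<lambda>s::real. s ^ m / exp s) \<longlongrightarrow> 0) at_top" by (rule tendsto_power_div_exp_0)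
  then have "((\<lambda>t::real. (inverse t) ^ m / exp (inverse t)) \<longlongrightarrow> 0) (at_right 0)"
    by (rule filterlim_compose[OF _ filterlim_inverse_at_top_right])
  moreover have "\<forall>\<^sub>F t in at_right (0::real). (inverse t) ^ m / exp (inverse t) = flat m t"
    using eventually_at_right_less[of 0]
    by eventually_elim (simp add: flat_def exp_minus divide_simps)
  ultimately have R: "(flat m \<longlongrightarrow> 0) (at_right 0)" by (simp cong: tendsto_cong)
  have "\<forall>\<^sub>F t in at_left (0::real). 0 = flat m t"
    unfolding eventually_at_filter by (intro always_eventually) (simp add: flat_def)
  then have L: "(flat m \<longlongrightarrow> 0) (at_left 0)" by (rule tendsto_eventually[OF eventually_mono]) simp
  show ?thesis using filterlim_split_at[OF L R] by simp
qed

text \<open>The powers of t in the denominator make the family closed under differentiation up to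
  linear combinations. At 0 the difference quotient of \<open>flat m\<close> is
  \<open>flat (m + 1)\<close>, which tends to 0.\<close>

lemma flat_has_derivative: "(flat m has_real_derivative (flat (m + 2) t - real m * flat (m + 1) t)) (at t)"
proof -
  consider "t > 0" | "t < 0" | "t = 0" by linarith
  then show ?thesis
  proof cases
    case 1
    have "((\<lambda>t. exp (- 1 / t) / t ^ m) has_real_derivative
      (exp (- 1 / t) * (1 / t\<^sup>2) * t ^ m - exp (- 1 / t) * (real m * t ^ (m - 1))) / (t ^ m * t ^ m)) (at t)"
      using 1 by (auto intro!: derivative_eq_intros simp: power2_eq_square)
    also have "(exp (- 1 / t) * (1 / t\<^sup>2) * t ^ m - exp (- 1 / t) * (real m * t ^ (m - 1))) / (t ^ m * t ^ m)
      = flat (m + 2) t - real m * flat (m + 1) t"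
      using 1 by (cases m) (simp_all add: flat_def power2_eq_square divide_simps, simp_all add: algebra_simps)
    finally show ?thesis
    proof (rule has_field_derivative_transform_within_open[where S = "{0<..}"])
      show "exp (- 1 / s) / s ^ m = flat m s" if "s \<in> {0<..}" for s using that by (simp add: flat_def)
    qed (use 1 in auto)
  next
    case 2
    have "((\<lambda>t. 0) has_real_derivative (flat (m + 2) t - real m * flat (m + 1) t)) (at t)"
      using 2 by (simp add: flat_def)
    then show ?thesis
    proof (rule has_field_derivative_transform_within_open[where S = "{..<0}"])
      show "0 = flat m s" if "s \<in> {..<0}" for s using that by (simp add: flat_def)
    qed (use 2 in auto)
  next
    case 3
    have "(\<lambda>h. (flat m (0 + h) - flat m 0) / h) = flat (m + 1)"
      by (auto simp: flat_def fun_eq_iff)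
    then have "(flat m has_real_derivative 0) (at 0)"
      unfolding has_field_derivative_iff using flat_tendsto_0[of "m + 1"] by (simp add: flat_def DERIV_def)
    then show ?thesis using 3 by (simp add: flat_def)
  qed
qed

text \<open>Closed under directional derivatives, which makes it an invariant for
  \<open>smooth_coinduct\<close>. Affine arguments suffice to build products over the
  coordinates.\<close>

inductive_set flat_algebra :: "('a::euclidean_space \<Rightarrow> real) set" where
  const: "(\<lambda>x. c) \<in> flat_algebra"
| flat: "(\<lambda>x. flat m (x \<bullet> a + b)) \<in> flat_algebra"
| add: "f \<in> flat_algebra \<Longrightarrow> g \<in> flat_algebra \<Longrightarrow> (\<lambda>x. f x + g x) \<in> flat_algebra"
| mult: "f \<in> flat_algebra \<Longrightarrow> g \<in> flat_algebra \<Longrightarrow> (\<lambda>x. f x * g x) \<in> flat_algebra"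

lemma flat_algebra_deriv:
  assumes "f \<in> flat_algebra"
  shows "\<exists>f'. (\<forall>x. (f has_derivative f' x) (at x)) \<and> (\<forall>b. (\<lambda>x. f' x b) \<in> flat_algebra)"
  using assms
proof induction
  case (const c)
  show ?case by (rule exI[of _ "\<lambda>x h. 0"]) (auto intro: flat_algebra.const)
next
  case (flat m a b)
  have "((\<lambda>x. flat m (x \<bullet> a + b)) has_derivative
    (\<lambda>h. (h \<bullet> a) * (flat (m + 2) (x \<bullet> a + b) + (- real m) * flat (m + 1) (x \<bullet> a + b)))) (at x)" for x
  proof -
    have "((\<lambda>x. flat m (x \<bullet> a + b)) has_derivative
      (\<lambda>h. (flat (m + 2) (x \<bullet> a + b) - real m * flat (m + 1) (x \<bullet> a + b)) * (h \<bullet> a))) (at x)"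
      by (rule has_derivative_compose[OF _ flat_has_derivative[unfolded has_field_derivative_def]])
         (auto intro!: derivative_eq_intros)
    then show ?thesis by (simp add: algebra_simps)
  qed
  then show ?case
    by (intro exI[of _ "\<lambda>x h. (h \<bullet> a) * (flat (m + 2) (x \<bullet> a + b) + (- real m) * flat (m + 1) (x \<bullet> a + b))"])
       (intro conjI allI flat_algebra.intros)
next
  case (add f g)
  then obtain f' g' where "\<forall>x. (f has_derivative f' x) (at x)" "\<forall>b. (\<lambda>x. f' x b) \<in> flat_algebra"
    "\<forall>x. (g has_derivative g' x) (at x)" "\<forall>b. (\<lambda>x. g' x b) \<in> flat_algebra" by blast
  then show ?case
    by (intro exI[of _ "\<lambda>x h. f' x h + g' x h"]) (auto intro!: has_derivative_add flat_algebra.add)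
next
  case (mult f g)
  then obtain f' g' where "\<forall>x. (f has_derivative f' x) (at x)" "\<forall>b. (\<lambda>x. f' x b) \<in> flat_algebra"
    "\<forall>x. (g has_derivative g' x) (at x)" "\<forall>b. (\<lambda>x. g' x b) \<in> flat_algebra" by blast
  then show ?case using mult.hyps
    by (intro exI[of _ "\<lambda>x h. f x * g' x h + f' x h * g x"])
       (auto intro!: has_derivative_mult flat_algebra.add flat_algebra.mult)
qed

lemma flat_algebra_smooth: "f \<in> flat_algebra \<Longrightarrow> smooth f"
proof (rule smooth_coinduct[where S = flat_algebra])
  fix g :: "'a \<Rightarrow> real" and x b assume "g \<in> flat_algebra"
  then obtain g' where g': "\<forall>x. (g has_derivative g' x) (at x)" "\<forall>b. (\<lambda>x. g' x b) \<in> flat_algebra"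
    using flat_algebra_deriv by blast
  then show "g differentiable at x" by (auto simp: differentiable_def)
  have "partial_deriv b g = (\<lambda>x. g' x b)" using g'(1) partial_deriv_eqI by blast
  then show "partial_deriv b g \<in> flat_algebra" using g'(2) by simp
qed

text \<open>The parameter \<open>n\<close> steepens the bump: each factor
  \<open>exp (- 1 / ((n + 1) * s))\<close> with \<open>s > 0\<close> tends to 1, so the limit is the
  indicator of the open box.\<close>

definition box_bump :: "'a::euclidean_space \<Rightarrow> 'a \<Rightarrow> nat \<Rightarrow> 'a \<Rightarrow> real" where
  "box_bump l u n x = (\<Prod>b\<in>Basis. flat 0 (real (Suc n) * (x \<bullet> b - l \<bullet> b)) * flat 0 (real (Suc n) * (u \<bullet> b - x \<bullet> b)))"

lemma flat_0_bounds: "0 \<le> flat 0 t" "flat 0 t \<le> 1"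
  by (auto simp: flat_def)

lemma box_bump_bounds: "0 \<le> box_bump l u n x" "box_bump l u n x \<le> 1"
  unfolding box_bump_def using flat_0_bounds
  by (auto intro!: prod_nonneg prod_le_1 mult_nonneg_nonneg mult_le_one)

lemma box_bump_eq_0: "x \<notin> box l u \<Longrightarrow> box_bump l u n x = 0"
proof -
  assume "x \<notin> box l u"
  then obtain b where b: "b \<in> Basis" "x \<bullet> b - l \<bullet> b \<le> 0 \<or> u \<bullet> b - x \<bullet> b \<le> 0"
    by (auto simp: box_def not_less)
  have "flat 0 (real (Suc n) * s) = 0" if "s \<le> 0" for s
    using that by (simp add: flat_def zero_less_mult_iff)
  then have "flat 0 (real (Suc n) * (x \<bullet> b - l \<bullet> b)) * flat 0 (real (Suc n) * (u \<bullet> b - x \<bullet> b)) = 0"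
    using b(2) by auto
  then show ?thesis unfolding box_bump_def using b(1) by (intro prod_zero) auto
qed

lemma box_bump_smooth: "smooth (box_bump l u n)"
proof -
  have "(\<lambda>x. \<Prod>b\<in>S. flat 0 (real (Suc n) * (x \<bullet> b - l \<bullet> b)) * flat 0 (real (Suc n) * (u \<bullet> b - x \<bullet> b))) \<in> flat_algebra"
    if "finite S" for S
    using that
  proof induction
    case empty
    then show ?case using flat_algebra.const[of 1] by simp
  next
    case (insert b S)
    have "real (Suc n) * (x \<bullet> b - l \<bullet> b) = x \<bullet> (real (Suc n) *\<^sub>R b) + - (real (Suc n) * (l \<bullet> b))"
      "real (Suc n) * (u \<bullet> b - x \<bullet> b) = x \<bullet> ((- real (Suc n)) *\<^sub>R b) + (real (Suc n) * (u \<bullet> b))" for x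
      by (simp_all add: algebra_simps)
    then have "(\<lambda>x. flat 0 (real (Suc n) * (x \<bullet> b - l \<bullet> b)) * flat 0 (real (Suc n) * (u \<bullet> b - x \<bullet> b))) \<in> flat_algebra"
      by (simp only: flat_algebra.flat flat_algebra.mult)
    from flat_algebra.mult[OF this insert(3)] show ?case by (simp only: prod.insert[OF insert(1,2)])
  qed
  from flat_algebra_smooth[OF this[OF finite_Basis]] show ?thesis by (simp add: box_bump_def[abs_def])
qed

lemma box_bump_test_function:
  assumes "cbox l u \<subseteq> U"
  shows "box_bump l u n \<in> test_functions U"
proof -
  have "{x. box_bump l u n x \<noteq> 0} \<subseteq> cbox l u" using box_bump_eq_0 box_subset_cbox by blast
  then have "closure {x. box_bump l u n x \<noteq> 0} \<subseteq> cbox l u" by (intro closure_minimal closed_cbox)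
  then have "compact (closure {x. box_bump l u n x \<noteq> 0})" "closure {x. box_bump l u n x \<noteq> 0} \<subseteq> U"
    using assms bounded_subset[OF bounded_cbox] by (auto simp: compact_eq_bounded_closed)
  then show ?thesis using box_bump_smooth by (auto simp: test_functions_def)
qed

lemma box_bump_tendsto: "(\<lambda>n. box_bump l u n x) \<longlonglongrightarrow> indicator (box l u) x"
proof (cases "x \<in> box l u")
  case True
  have lim: "(\<lambda>n. flat 0 (real (Suc n) * s)) \<longlonglongrightarrow> 1" if "s > 0" for s
  proof -
    have "(\<lambda>n. exp (- (inverse (real (Suc n)) * (1 / s)))) \<longlonglongrightarrow> exp (- (0 * (1 / s)))"
      by (intro tendsto_intros LIMSEQ_inverse_real_of_nat)
    moreover have "exp (- (inverse (real (Suc n)) * (1 / s))) = flat 0 (real (Suc n) * s)" for n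
      using that by (simp add: flat_def divide_simps)
    ultimately show ?thesis by simp
  qed
  have "(\<lambda>n. box_bump l u n x) \<longlonglongrightarrow> (\<Prod>b\<in>(Basis::'a set). 1 * 1)"
    unfolding box_bump_def using True by (intro tendsto_prod tendsto_mult lim) (auto simp: box_def)
  then show ?thesis using True by simp
qed (simp add: box_bump_eq_0)

section \<open>The fundamental lemma of the calculus of variations\<close>

text \<open>\<open>ennreal\<close> truncates at 0, so the two densities are the positive and the
  negative part of \<open>g\<close>. They agree on boxes, an intersection-stable generator, hence
  almost everywhere; as at most one part is nonzero at a point, both vanish.\<close>

lemma AE_zero_if_box_integrals_zero:
  fixes g :: "'a::euclidean_space \<Rightarrow> real"
  assumes g: "integrable lborel g" and z: "\<And>l u. (\<integral>x. indicator (box l u) x * g x \<partial>lborel) = 0"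
  shows "AE x in lborel. g x = 0"
proof -
  have [measurable]: "g \<in> borel_measurable borel" using g by auto
  have eq: "density lborel (\<lambda>x. ennreal (g x)) = density lborel (\<lambda>x. ennreal (- g x))"
  proof (rule measure_eqI_generator_eq)
    let ?E = "range (\<lambda>(a, b). box a b::'a set)"
    let ?A = "\<lambda>n::nat. box (- (real n *\<^sub>R One)) (real n *\<^sub>R One) :: 'a set"
    show "Int_stable ?E" by (auto simp: Int_stable_def box_Int_box)
    show "?E \<subseteq> Pow UNIV" "sets (density lborel (\<lambda>x. ennreal (g x))) = sigma_sets UNIV ?E"
      "sets (density lborel (\<lambda>x. ennreal (- g x))) = sigma_sets UNIV ?E"
      by (simp_all add: borel_eq_box)
    show "range ?A \<subseteq> ?E" "(\<Union>i. ?A i) = UNIV" unfolding UN_box_eq_UNIV by auto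
    have int: "integrable lborel (\<lambda>x. indicator X x * g x)" if "X \<in> sets borel" for X
      using integrable_mult_indicator[OF _ g, of X] that by simp
    have pos: "emeasure (density lborel (\<lambda>x. ennreal (h x))) X = ennreal (\<integral>x. indicator X x * max 0 (h x) \<partial>lborel)"
      if "X \<in> sets borel" "h = g \<or> h = (\<lambda>x. - g x)" for X h
    proof -
      have [measurable]: "h \<in> borel_measurable borel" "X \<in> sets borel" using that by auto
      have "integrable lborel (\<lambda>x. indicator X x * max 0 (h x))"
        using g that by (intro Bochner_Integration.integrable_bound[OF g]) (auto simp: indicator_def)
      then have "ennreal (\<integral>x. indicator X x * max 0 (h x) \<partial>lborel) = (\<integral>\<^sup>+x. ennreal (indicator X x * max 0 (h x)) \<partial>lborel)"
        by (subst nn_integral_eq_integral) auto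
      also have "\<dots> = (\<integral>\<^sup>+x. ennreal (h x) * indicator X x \<partial>lborel)"
        by (intro nn_integral_cong) (auto simp: indicator_def max_def ennreal_neg)
      finally show ?thesis by (simp add: emeasure_density)
    qed
    show "emeasure (density lborel (\<lambda>x. ennreal (g x))) (?A i) \<noteq> \<infinity>" for i
      by (subst pos) auto
    show "emeasure (density lborel (\<lambda>x. ennreal (g x))) X = emeasure (density lborel (\<lambda>x. ennreal (- g x))) X"
      if "X \<in> ?E" for X
    proof -
      from that have X: "X \<in> sets borel" "(\<integral>x. indicator X x * g x \<partial>lborel) = 0" using z by auto
      have "(\<integral>x. indicator X x * max 0 (g x) \<partial>lborel) - (\<integral>x. indicator X x * max 0 (- g x) \<partial>lborel)
        = (\<integral>x. indicator X x * max 0 (g x) - indicator X x * max 0 (- g x) \<partial>lborel)"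
        using X(1) by (intro Bochner_Integration.integral_diff[symmetric] Bochner_Integration.integrable_bound[OF g])
          (auto simp: indicator_def)
      also have "\<dots> = (\<integral>x. indicator X x * g x \<partial>lborel)"
        by (intro Bochner_Integration.integral_cong) (auto simp: max_def)
      finally show ?thesis using X by (simp add: pos)
    qed
  qed
  have "AE x in lborel. ennreal (g x) = ennreal (- g x)"
    using eq by (subst (asm) sigma_finite_measure.density_unique_iff[OF sigma_finite_lborel]) auto
  then show ?thesis
  proof eventually_elim
    case (elim x)
    then show ?case by (cases "g x \<le> 0") (auto simp: ennreal_neg ennreal_eq_0_iff eq_commute[of 0])
  qed
qed

lemma L2_space_bounded_set_integrable:
  fixes f :: "'a::euclidean_space \<Rightarrow> real"
  assumes "f \<in> L2_space (lebesgue_on U)" "U \<in> sets lebesgue" "K \<subseteq> U" "K \<in> lmeasurable"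
  shows "integrable lebesgue (\<lambda>x. indicator K x * f x)"
proof -
  have m: "(\<lambda>x. indicator U x * f x) \<in> borel_measurable lebesgue" and
    i: "integrable lebesgue (\<lambda>x. indicator U x * (f x)\<^sup>2)"
    using assms(1,2) by (auto simp: L2_space_def borel_measurable_restrict_space_iff integrable_restrict_space)
  have K: "K \<in> sets lebesgue" using assms(4) by auto
  show ?thesis
  proof (rule Bochner_Integration.integrable_bound)
    show "integrable lebesgue (\<lambda>x. indicator U x * (f x)\<^sup>2 + indicator K x)"
      using i assms(4) by (intro Bochner_Integration.integrable_add) (auto simp: integrable_indicator_iff fmeasurable_def)
    have "(\<lambda>x. indicator K x * (indicator U x * f x)) \<in> borel_measurable lebesgue"
      by (rule borel_measurable_times[OF borel_measurable_indicator[OF K] m])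
    moreover have "(\<lambda>x. indicator K x * (indicator U x * f x)) = (\<lambda>x. indicator K x * f x)"
      using assms(3) by (auto simp: indicator_def fun_eq_iff)
    ultimately show "(\<lambda>x. indicator K x * f x) \<in> borel_measurable lebesgue" by simp
    have "\<bar>t\<bar> \<le> t\<^sup>2 + 1" for t :: real
    proof -
      have "0 \<le> (\<bar>t\<bar> - 1)\<^sup>2 + \<bar>t\<bar>" by simp
      then show ?thesis by (simp add: power2_diff)
    qed
    then show "AE x in lebesgue. norm (indicator K x * f x) \<le> norm (indicator U x * (f x)\<^sup>2 + indicator K x)"
      using assms(3) by (intro AE_I2) (auto simp: indicator_def)
  qed
qed

text \<open>Bumps converge to indicators of boxes, so \<open>g\<close> has zero integral over every
  box in \<open>U\<close>, and countably many boxes exhaust \<open>U\<close>. This is what makes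
  weak gradients unique almost everywhere.\<close>

lemma fundamental_lemma:
  fixes g :: "'a::euclidean_space \<Rightarrow> real"
  assumes U: "open U" and g: "g \<in> L2_space (lebesgue_on U)"
    and z: "\<And>\<phi>. \<phi> \<in> test_functions U \<Longrightarrow> (LINT x|lebesgue_on U. g x * \<phi> x) = 0"
  shows "AE x in lebesgue_on U. g x = 0"
proof -
  have Um: "U \<in> sets lebesgue" using U by auto
  have box0: "(\<integral>x. indicator (box l u) x * g x \<partial>lebesgue) = 0" if K: "cbox l u \<subseteq> U" for l u
  proof -
    have gi: "integrable lebesgue (\<lambda>x. indicator (cbox l u) x * g x)"
      using g Um K by (rule L2_space_bounded_set_integrable) simp
    have "(\<integral>x. indicator U x * (g x * box_bump l u n x) \<partial>lebesgue) = 0" for n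
      using z[OF box_bump_test_function[OF K, of n]] Um by (simp add: integral_restrict_space)
    moreover have "indicator U x * (g x * box_bump l u n x) = (indicator (cbox l u) x * g x) * box_bump l u n x" for x n
      using K box_bump_eq_0[of x l u n] box_subset_cbox[of l u] by (cases "x \<in> cbox l u") (auto simp: indicator_def)
    ultimately have *: "(\<integral>x. (indicator (cbox l u) x * g x) * box_bump l u n x \<partial>lebesgue) = 0" for n
      by simp
    have bm: "box_bump l u n \<in> borel_measurable lebesgue" for n
      using borel_measurable_continuous_onI[OF smooth_continuous[OF box_bump_smooth, of UNIV l u n]]
      by (simp add: measurable_completion)
    have "(\<lambda>n. \<integral>x. (indicator (cbox l u) x * g x) * box_bump l u n x \<partial>lebesgue)
      \<longlonglongrightarrow> (\<integral>x. (indicator (cbox l u) x * g x) * indicator (box l u) x \<partial>lebesgue)"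
    proof (rule integral_dominated_convergence)
      show "integrable lebesgue (\<lambda>x. norm (indicator (cbox l u) x * g x))"
        using gi by (rule integrable_norm)
      show "AE x in lebesgue. norm (indicator (cbox l u) x * g x * box_bump l u n x) \<le> norm (indicator (cbox l u) x * g x)" for n
        using box_bump_bounds[of l u n] by (intro AE_I2) (auto simp: abs_mult intro!: mult_left_le)
      show "AE x in lebesgue. (\<lambda>n. indicator (cbox l u) x * g x * box_bump l u n x) \<longlonglongrightarrow> indicator (cbox l u) x * g x * indicator (box l u) x"
        by (intro AE_I2 tendsto_mult tendsto_const box_bump_tendsto)
      show "(\<lambda>x. indicator (cbox l u) x * g x * box_bump l u n x) \<in> borel_measurable lebesgue" for n
        using borel_measurable_integrable[OF gi] bm by (rule borel_measurable_times)
      show "(\<lambda>x. indicator (cbox l u) x * g x * indicator (box l u) x) \<in> borel_measurable lebesgue"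
        using borel_measurable_integrable[OF gi]
        by (rule borel_measurable_times[OF _ borel_measurable_indicator[OF fmeasurableD[OF lmeasurable_box]]])
    qed
    then have "(\<integral>x. (indicator (cbox l u) x * g x) * indicator (box l u) x \<partial>lebesgue) = 0"
      by (simp add: * LIMSEQ_const_iff)
    moreover have "(indicator (cbox l u) x * g x) * indicator (box l u) x = indicator (box l u) x * g x" for x
      using box_subset_cbox[of l u] by (auto simp: indicator_def)
    ultimately show ?thesis by simp
  qed
  have ae: "AE x in lebesgue. x \<in> cbox a b \<longrightarrow> g x = 0" if K: "cbox a b \<subseteq> U" for a b
  proof -
    let ?g = "\<lambda>x. indicator (box a b) x * g x"
    have "box a b \<subseteq> U" using K box_subset_cbox by blast
    then have gi: "integrable lebesgue ?g"
      using g Um by (intro L2_space_bounded_set_integrable[of g U]) auto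
    \<comment> \<open>The criterion with boxes is stated for \<open>lborel\<close>, so a Borel
      representative replaces the Lebesgue measurable function.\<close>
    then obtain h where h: "h \<in> borel_measurable lborel" "AE x in lborel. ?g x = h x"
      using completion_ex_borel_measurable_real[OF borel_measurable_integrable[OF gi]] by blast
    have h2: "AE x in lebesgue. ?g x = h x" using h(2) by (rule AE_completion)
    have hm: "h \<in> borel_measurable lebesgue" using h(1) by (rule measurable_completion)
    have "integrable lebesgue h"
      using gi h2 hm borel_measurable_integrable[OF gi] by (subst integrable_cong_AE[of _ _ ?g]) (auto elim: eventually_mono)
    then have hi: "integrable lborel h" using h(1) by (simp add: integrable_completion)
    have "AE x in lborel. h x = 0"
    proof (rule AE_zero_if_box_integrals_zero[OF hi])
      fix l u :: 'a
      obtain l' u' where lu: "box l u \<inter> box a b = box l' u'" using box_Int_box[of l u a b] by blast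
      have ii: "(\<lambda>x. indicator (box l u) x * h x) \<in> borel_measurable lborel" using h(1) by auto
      have im: "(indicator (box l u) :: 'a \<Rightarrow> real) \<in> borel_measurable lebesgue"
        by (rule borel_measurable_indicator[OF fmeasurableD[OF lmeasurable_box]])
      have "(\<integral>x. indicator (box l u) x * h x \<partial>lborel) = (\<integral>x. indicator (box l u) x * h x \<partial>lebesgue)"
        using ii by (simp add: integral_completion)
      also have "\<dots> = (\<integral>x. indicator (box l u) x * ?g x \<partial>lebesgue)"
        using h2 borel_measurable_times[OF im hm] borel_measurable_times[OF im borel_measurable_integrable[OF gi]]
        by (intro integral_cong_AE) (auto elim: eventually_mono)
      also have "\<dots> = (\<integral>x. indicator (box l' u') x * g x \<partial>lebesgue)"
        unfolding lu[symmetric] by (intro Bochner_Integration.integral_cong) (auto simp: indicator_def)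
      also have "\<dots> = 0"
      proof (cases "box l' u' = {}")
        case False
        have "box l' u' \<subseteq> box a b" using lu by blast
        then have "cbox l' u' \<subseteq> cbox a b" using False by (simp add: subset_box box_ne_empty) (meson less_imp_le order_trans)?
        then show ?thesis using K by (intro box0) auto
      qed simp
      finally show "(\<integral>x. indicator (box l u) x * h x \<partial>lborel) = 0" .
    qed
    then have "AE x in lebesgue. h x = 0" by (rule AE_completion)
    moreover have "AE x in lebesgue. x \<notin> cbox a b - box a b"
      using AE_not_in[of "cbox a b - box a b" lebesgue] negligible_frontier_interval[of a b]
      by (simp add: negligible_iff_null_sets)
    ultimately show ?thesis using h2 by eventually_elim (auto simp: indicator_def)
  qed
  obtain \<D> where D: "countable \<D>" "\<D> \<subseteq> Pow U" "\<And>X. X \<in> \<D> \<Longrightarrow> \<exists>a b. X = cbox a b" "\<Union>\<D> = U"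
    using open_countable_Union_open_cbox[OF U] by metis
  have "AE x in lebesgue. \<forall>X\<in>\<D>. x \<in> X \<longrightarrow> g x = 0"
    unfolding AE_ball_countable[OF D(1)] using D(2,3) ae by (metis PowD in_mono)
  then have "AE x in lebesgue. x \<in> U \<longrightarrow> g x = 0"
    by eventually_elim (use D(4) in blast)
  then show ?thesis using Um by (simp add: AE_restrict_space_iff)
qed

section \<open>Integration along lines\<close>

lemma integrable_lborel_bounded_support:
  fixes F :: "'b::euclidean_space \<Rightarrow> real"
  assumes "F \<in> borel_measurable borel" "\<And>x. \<bar>F x\<bar> \<le> C" "bounded S" "\<And>x. x \<notin> S \<Longrightarrow> F x = 0"
  shows "integrable lborel F"
proof -
  obtain r where r: "S \<subseteq> cball 0 r" using assms(3) by (auto simp: bounded_iff subset_iff)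
  show ?thesis
  proof (rule Bochner_Integration.integrable_bound)
    show "integrable lborel (\<lambda>x. C * indicator (cball (0::'b) r) x)"
      using emeasure_bounded_finite[of "cball (0::'b) r"] by (intro integrable_mult_right integrable_real_indicator) auto
    show "F \<in> borel_measurable lborel" using assms(1) by simp
    show "AE x in lborel. norm (F x) \<le> norm (C * indicator (cball 0 r) x)"
    proof (intro AE_I2)
      fix x
      have "0 \<le> C" using assms(2)[of x] by linarith
      then show "norm (F x) \<le> norm (C * indicator (cball 0 r) x)"
        using assms(2)[of x] assms(4)[of x] r by (cases "x \<in> S") auto
    qed
  qed
qed

lemma nn_integral_lborel_translation:
  fixes f :: "'a::euclidean_space \<Rightarrow> ennreal"
  assumes [measurable]: "f \<in> borel_measurable borel"
  shows "(\<integral>\<^sup>+x. f (x + c) \<partial>lborel) = (\<integral>\<^sup>+x. f x \<partial>lborel)"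
  by (subst (2) lborel_distr_plus[of c, symmetric], subst nn_integral_distr) (auto simp: add.commute)

lemma integral_lborel_translation:
  fixes f :: "'a::euclidean_space \<Rightarrow> real"
  assumes [measurable]: "f \<in> borel_measurable borel"
  shows "(\<integral>x. f (x + c) \<partial>lborel) = (\<integral>x. f x \<partial>lborel)"
  by (subst (2) lborel_distr_plus[of c, symmetric], subst integral_distr) (auto simp: add.commute)

lemma integrable_lborel_translation:
  fixes f :: "'a::euclidean_space \<Rightarrow> real"
  assumes "integrable lborel f"
  shows "integrable lborel (\<lambda>x. f (x + c))"
proof -
  have "integrable (distr lborel borel ((+) c)) f" unfolding lborel_distr_plus by (rule assms)
  then show ?thesis
    using assms by (subst (asm) integrable_distr_eq) (auto simp: add.commute)
qed

text \<open>The shear along \<open>d\<close> preserves volume: for fixed t it is a translation in y.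
  All integrations along lines below go through this identity.\<close>

lemma nn_integral_shift:
  fixes f :: "'a::euclidean_space \<Rightarrow> real \<Rightarrow> ennreal"
  assumes f[measurable]: "(\<lambda>(y, t). f y t) \<in> borel_measurable (borel \<Otimes>\<^sub>M borel)"
  shows "(\<integral>\<^sup>+y. \<integral>\<^sup>+t. f (y + t *\<^sub>R d) t \<partial>lborel \<partial>lborel) = (\<integral>\<^sup>+y. \<integral>\<^sup>+t. f y t \<partial>lborel \<partial>lborel)"
proof -
  have [measurable]: "(\<lambda>(y, t). f (y + t *\<^sub>R d) t) \<in> borel_measurable (borel \<Otimes>\<^sub>M borel)"
    by measurable
  have "(\<integral>\<^sup>+y. \<integral>\<^sup>+t. f (y + t *\<^sub>R d) t \<partial>lborel \<partial>lborel) = (\<integral>\<^sup>+t. \<integral>\<^sup>+y. f (y + t *\<^sub>R d) t \<partial>lborel \<partial>lborel)"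
    by (intro lborel_pair.Fubini'[symmetric]) measurable
  also have "\<dots> = (\<integral>\<^sup>+t. \<integral>\<^sup>+y. f y t \<partial>lborel \<partial>lborel)"
    by (intro nn_integral_cong nn_integral_lborel_translation) measurable
  also have "\<dots> = (\<integral>\<^sup>+y. \<integral>\<^sup>+t. f y t \<partial>lborel \<partial>lborel)"
    by (intro lborel_pair.Fubini') measurable
  finally show ?thesis .
qed

lemma integral_shift:
  fixes f :: "'a::euclidean_space \<Rightarrow> real \<Rightarrow> real"
  assumes f: "integrable (lborel \<Otimes>\<^sub>M lborel) (\<lambda>(y, t). f y t)"
  shows "(\<integral>y. \<integral>t. f (y + t *\<^sub>R d) t \<partial>lborel \<partial>lborel) = (\<integral>y. \<integral>t. f y t \<partial>lborel \<partial>lborel)"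
    and "integrable (lborel \<Otimes>\<^sub>M lborel) (\<lambda>(y, t). f (y + t *\<^sub>R d) t)"
proof -
  have fm[measurable]: "(\<lambda>(y, t). f y t) \<in> borel_measurable (borel \<Otimes>\<^sub>M borel)"
    using borel_measurable_integrable[OF f] by (simp cong: measurable_cong_sets add: borel_prod)
  have [measurable]: "(\<lambda>(y, t). f (y + t *\<^sub>R d) t) \<in> borel_measurable (borel \<Otimes>\<^sub>M borel)"
    by measurable
  have fst: "(\<integral>\<^sup>+y. \<integral>\<^sup>+t. g y t \<partial>lborel \<partial>lborel) = (\<integral>\<^sup>+z. (\<lambda>(y, t). g y t) z \<partial>(lborel \<Otimes>\<^sub>M lborel))"
    if "(\<lambda>(y, t). g y t) \<in> borel_measurable (borel \<Otimes>\<^sub>M borel)" for g :: "'a \<Rightarrow> real \<Rightarrow> ennreal"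
    using that by (subst lborel.nn_integral_fst[symmetric]) (auto cong: measurable_cong_sets)
  have "(\<integral>\<^sup>+z. ennreal (norm ((\<lambda>(y, t). f (y + t *\<^sub>R d) t) z)) \<partial>(lborel \<Otimes>\<^sub>M lborel))
    = (\<integral>\<^sup>+y. \<integral>\<^sup>+t. ennreal (norm (f (y + t *\<^sub>R d) t)) \<partial>lborel \<partial>lborel)"
    by (subst fst) (auto simp: case_prod_beta' intro!: nn_integral_cong)
  also have "\<dots> = (\<integral>\<^sup>+y. \<integral>\<^sup>+t. ennreal (norm (f y t)) \<partial>lborel \<partial>lborel)"
    by (rule nn_integral_shift) measurable
  also have "\<dots> = (\<integral>\<^sup>+z. ennreal (norm ((\<lambda>(y, t). f y t) z)) \<partial>(lborel \<Otimes>\<^sub>M lborel))"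
    by (subst fst) (auto simp: case_prod_beta' intro!: nn_integral_cong)
  also have "\<dots> < \<infinity>" using f by (simp add: integrable_iff_bounded)
  finally show i: "integrable (lborel \<Otimes>\<^sub>M lborel) (\<lambda>(y, t). f (y + t *\<^sub>R d) t)"
    by (intro integrableI_bounded) (auto cong: measurable_cong_sets)
  have "(\<integral>y. \<integral>t. f (y + t *\<^sub>R d) t \<partial>lborel \<partial>lborel) = (\<integral>t. \<integral>y. f (y + t *\<^sub>R d) t \<partial>lborel \<partial>lborel)"
    by (rule lborel_pair.Fubini_integral[symmetric, OF i])
  also have "\<dots> = (\<integral>t. \<integral>y. f y t \<partial>lborel \<partial>lborel)"
    by (intro Bochner_Integration.integral_cong refl integral_lborel_translation) measurable
  also have "\<dots> = (\<integral>y. \<integral>t. f y t \<partial>lborel \<partial>lborel)"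
    by (rule lborel_pair.Fubini_integral[OF f])
  finally show "(\<integral>y. \<integral>t. f (y + t *\<^sub>R d) t \<partial>lborel \<partial>lborel) = (\<integral>y. \<integral>t. f y t \<partial>lborel \<partial>lborel)" .
qed

lemma line_has_derivative:
  fixes \<psi> :: "'a::euclidean_space \<Rightarrow> real"
  assumes "\<And>x. (\<psi> has_derivative (\<lambda>h. p x \<bullet> h)) (at x)"
  shows "((\<lambda>t. \<psi> (x + t *\<^sub>R d)) has_real_derivative p (x + t *\<^sub>R d) \<bullet> d) (at t within S)"
proof -
  have "((\<lambda>t. \<psi> (x + t *\<^sub>R d)) has_derivative (\<lambda>h. p (x + t *\<^sub>R d) \<bullet> (h *\<^sub>R d))) (at t within S)"
    by (rule has_derivative_compose[OF _ assms]) (auto intro!: derivative_eq_intros)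
  then show ?thesis by (simp add: has_field_derivative_def mult.commute[of _ "p (x + t *\<^sub>R d) \<bullet> d"])
qed

lemma line_integral:
  fixes \<psi> :: "'a::euclidean_space \<Rightarrow> real"
  assumes "\<And>x. (\<psi> has_derivative (\<lambda>h. p x \<bullet> h)) (at x)" "continuous_on UNIV p" "a \<le> b"
  shows "(\<integral>t. indicator {a..b} t * (p (x + t *\<^sub>R d) \<bullet> d) \<partial>lborel) = \<psi> (x + b *\<^sub>R d) - \<psi> (x + a *\<^sub>R d)"
    "integrable lborel (\<lambda>t. indicator {a..b} t * (p (x + t *\<^sub>R d) \<bullet> d))"
proof -
  have c: "continuous_on {a..b} (\<lambda>t. p (x + t *\<^sub>R d) \<bullet> d)"
    by (intro continuous_intros continuous_on_compose2[OF assms(2)]) auto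
  show "(\<integral>t. indicator {a..b} t * (p (x + t *\<^sub>R d) \<bullet> d) \<partial>lborel) = \<psi> (x + b *\<^sub>R d) - \<psi> (x + a *\<^sub>R d)"
    using integral_FTC_Icc[OF assms(3) _ c, of "\<lambda>t. \<psi> (x + t *\<^sub>R d)"] line_has_derivative[OF assms(1)]
    by (simp add: has_real_derivative_iff_has_vector_derivative)
  show "integrable lborel (\<lambda>t. indicator {a..b} t * (p (x + t *\<^sub>R d) \<bullet> d))"
    using borel_integrable_compact[OF compact_Icc c] by simp
qed

lemma continuous_bounded_support:
  fixes p :: "'a::euclidean_space \<Rightarrow> 'b::real_normed_vector"
  assumes "continuous_on UNIV p" "bounded S" "\<And>x. x \<notin> S \<Longrightarrow> p x = 0"
  shows "\<exists>C. \<forall>x. norm (p x) \<le> C"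
proof -
  have "compact (p ` closure S)"
    using assms by (intro compact_continuous_image continuous_on_subset[OF assms(1)]) auto
  then obtain C where C: "\<And>x. x \<in> closure S \<Longrightarrow> norm (p x) \<le> C" using compact_imp_bounded bounded_iff by (metis imageI)
  have "norm (p x) \<le> max C 0" for x
    using C[of x] assms(3)[of x] closure_subset[of S] by (cases "x \<in> S") auto
  then show ?thesis by blast
qed

lemma integrable_continuous_bounded_support:
  fixes p :: "'a::euclidean_space \<Rightarrow> real"
  assumes "continuous_on UNIV p" "bounded S" "\<And>x. x \<notin> S \<Longrightarrow> p x = 0"
  shows "integrable lborel p"
proof -
  obtain C where "\<forall>x. norm (p x) \<le> C" using continuous_bounded_support[OF assms] by blast
  then show ?thesis
    using assms borel_measurable_continuous_onI by (intro integrable_lborel_bounded_support[of p C S]) auto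
qed

text \<open>A dummy variable in [0,1] is inserted and sheared along \<open>v\<close>; the inner
  integral becomes \<open>\<psi> (x + v) - \<psi> x\<close>, whose integral vanishes by translation
  invariance. This treats all directions at once.\<close>

lemma integral_derivative_eq_0:
  fixes \<psi> :: "'a::euclidean_space \<Rightarrow> real"
  assumes d: "\<And>x. (\<psi> has_derivative (\<lambda>h. p x \<bullet> h)) (at x)" and p: "continuous_on UNIV p"
    and S: "bounded S" "\<And>x. x \<notin> S \<Longrightarrow> \<psi> x = 0" "\<And>x. x \<notin> S \<Longrightarrow> p x = 0"
  shows "(\<integral>x. p x \<bullet> v \<partial>lborel) = 0"
proof -
  have c\<psi>: "continuous_on UNIV \<psi>"
    by (intro continuous_at_imp_continuous_on ballI has_derivative_continuous[OF d])
  have [measurable]: "p \<in> borel_measurable borel" "\<psi> \<in> borel_measurable borel"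
    using p c\<psi> by (auto intro: borel_measurable_continuous_onI)
  obtain C where C: "norm (p x) \<le> C" for x using continuous_bounded_support[OF p S(1,3)] by blast
  let ?f = "\<lambda>x t. indicator {0..1::real} t * (p x \<bullet> v)"
  have int: "integrable (lborel \<Otimes>\<^sub>M lborel) (\<lambda>(x, t). ?f x t)"
    unfolding lborel_prod
  proof (rule integrable_lborel_bounded_support[where C = "C * norm v" and S = "S \<times> {0..1}"])
    show "(\<lambda>(x, t). ?f x t) \<in> borel_measurable borel" unfolding borel_prod[symmetric] by measurable
    have "\<bar>p x \<bullet> v\<bar> \<le> C * norm v" for x
      using Cauchy_Schwarz_ineq2[of "p x" v] mult_right_mono[OF C norm_ge_zero, of x v] by linarith
    moreover from this[of 0] have "0 \<le> C * norm v" by linarith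
    ultimately show "\<bar>(\<lambda>(x, t). ?f x t) z\<bar> \<le> C * norm v" for z
      by (cases z) (auto simp: indicator_def)
    show "bounded (S \<times> {0..1::real})" using S(1) by (intro bounded_Times) auto
    show "(\<lambda>(x, t). ?f x t) z = 0" if "z \<notin> S \<times> {0..1}" for z
      using that S(3) by (cases z) (auto simp: indicator_def)
  qed
  have "(\<integral>x. p x \<bullet> v \<partial>lborel) = (\<integral>x. \<integral>t. ?f x t \<partial>lborel \<partial>lborel)"
    by (simp add: mult.commute[of _ "p _ \<bullet> v"])
  also have "\<dots> = (\<integral>x. \<integral>t. ?f (x + t *\<^sub>R v) t \<partial>lborel \<partial>lborel)"
    by (rule integral_shift(1)[symmetric, OF int])
  also have "\<dots> = (\<integral>x. \<psi> (x + v) - \<psi> x \<partial>lborel)"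
    using line_integral(1)[OF d p, of 0 1] by simp
  also have "\<dots> = 0"
    using integrable_continuous_bounded_support[OF c\<psi> S(1,2)]
    by (subst Bochner_Integration.integral_diff) (auto simp: integral_lborel_translation intro!: integrable_lborel_translation)
  finally show ?thesis .
qed

lemma test_function_grad_zero:
  assumes "\<phi> \<in> test_functions U" "x \<notin> closure {x. \<phi> x \<noteq> 0}"
  shows "grad \<phi> x = 0"
proof (rule grad_eqI)
  have "((\<lambda>x. 0) has_derivative (\<lambda>h. 0 \<bullet> h)) (at x)" by simp
  then show "(\<phi> has_derivative (\<lambda>h. 0 \<bullet> h)) (at x)"
  proof (rule has_derivative_transform_within_open[where s = "- closure {x. \<phi> x \<noteq> 0}"])
    show "0 = \<phi> y" if "y \<in> - closure {x. \<phi> x \<noteq> 0}" for y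
    proof -
      have "y \<notin> closure {x. \<phi> x \<noteq> 0}" using that by (simp only: Compl_iff simp_thms)
      from test_functionsD(4)[OF assms(1) this] show ?thesis by (rule sym)
    qed
    show "open (- closure {x. \<phi> x \<noteq> 0})" by (rule open_Compl[OF closed_closure])
    show "x \<in> - closure {x. \<phi> x \<noteq> 0}" using assms(2) by (simp only: Compl_iff simp_thms)
  qed
qed

lemma integral_lebesgue_on_supported:
  fixes f :: "'a::euclidean_space \<Rightarrow> real"
  assumes "U \<in> sets lebesgue" "f \<in> borel_measurable borel" "\<And>x. x \<notin> U \<Longrightarrow> f x = 0"
  shows "(LINT x|lebesgue_on U. f x) = (\<integral>x. f x \<partial>lborel)"
proof -
  have "(LINT x|lebesgue_on U. f x) = (\<integral>x. indicator U x * f x \<partial>lebesgue)"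
    using assms(1) by (simp add: integral_restrict_space)
  also have "\<dots> = (\<integral>x. f x \<partial>lebesgue)"
    using assms(3) by (intro Bochner_Integration.integral_cong) (auto simp: indicator_def)
  also have "\<dots> = (\<integral>x. f x \<partial>lborel)" using assms(2) by (simp add: integral_completion)
  finally show ?thesis .
qed

text \<open>By Leibniz's rule the identity says that a derivative of \<open>u * \<phi>\<close> has
  integral zero; the product has bounded support even when \<open>u\<close> has not.\<close>

lemma has_weak_gradientI_classical:
  fixes u :: "'a::euclidean_space \<Rightarrow> real"
  assumes u: "\<And>x. (u has_derivative (\<lambda>h. q x \<bullet> h)) (at x)" and q: "continuous_on UNIV q"
    and U: "open U" and L2: "u \<in> L2_space (lebesgue_on U)" "q \<in> L2_space (lebesgue_on U)"
  shows "has_weak_gradient U u q"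
  unfolding has_weak_gradient_def
proof (intro conjI ballI, rule L2(1), rule L2(2))
  fix \<phi> b assume \<phi>: "\<phi> \<in> test_functions U" and b: "(b::'a) \<in> Basis"
  note sm = test_functionsD(1)[OF \<phi>]
  define K where "K = closure {x. \<phi> x \<noteq> 0}"
  let ?p = "\<lambda>x. u x *\<^sub>R grad \<phi> x + \<phi> x *\<^sub>R q x"
  have cu: "continuous_on UNIV u"
    by (intro continuous_at_imp_continuous_on ballI has_derivative_continuous[OF u])
  have Um: "U \<in> sets lebesgue" using U by auto
  have S: "bounded K" "K \<subseteq> U"
    unfolding K_def using test_functionsD(2,3)[OF \<phi>] by (simp_all only: compact_imp_bounded)
  have cont: "continuous_on UNIV (\<lambda>x. u x * partial_deriv b \<phi> x)" "continuous_on UNIV (\<lambda>x. (q x \<bullet> b) * \<phi> x)"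
    by (intro continuous_intros cu q smooth_continuous sm smooth_partial_deriv b)+
  have zero: "\<phi> x = 0" "partial_deriv b \<phi> x = 0" "grad \<phi> x = 0" if "x \<notin> K" for x
    using test_functionsD(4)[OF \<phi> that[unfolded K_def]] test_function_grad_zero[OF \<phi> that[unfolded K_def]]
      grad_inner_Basis[OF b, of \<phi> x] by auto
  have int: "integrable lborel (\<lambda>x. u x * partial_deriv b \<phi> x)" "integrable lborel (\<lambda>x. (q x \<bullet> b) * \<phi> x)"
    using zero cont by (auto intro!: integrable_continuous_bounded_support[OF _ S(1)])
  have "(\<integral>x. ?p x \<bullet> b \<partial>lborel) = 0"
  proof (rule integral_derivative_eq_0[where \<psi> = "\<lambda>x. u x * \<phi> x", OF _ _ S(1)])
    show "((\<lambda>x. u x * \<phi> x) has_derivative (\<lambda>h. ?p x \<bullet> h)) (at x)" for x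
      using has_derivative_mult[OF u smooth_has_derivative[OF sm], of x]
      by (simp add: inner_add_left mult.commute)
    show "continuous_on UNIV ?p"
      by (intro continuous_intros cu q smooth_continuous smooth_grad_continuous sm)
  qed (use zero in auto)
  then have "(\<integral>x. u x * partial_deriv b \<phi> x + (q x \<bullet> b) * \<phi> x \<partial>lborel) = 0"
    by (simp add: inner_add_left grad_inner_Basis[OF b] mult.commute)
  then have "(\<integral>x. u x * partial_deriv b \<phi> x \<partial>lborel) + (\<integral>x. (q x \<bullet> b) * \<phi> x \<partial>lborel) = 0"
    using int by simp
  moreover have "(LINT x|lebesgue_on U. u x * partial_deriv b \<phi> x) = (\<integral>x. u x * partial_deriv b \<phi> x \<partial>lborel)"
    using Um borel_measurable_continuous_onI[OF cont(1)] zero S(2)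
    by (intro integral_lebesgue_on_supported) auto
  moreover have "(LINT x|lebesgue_on U. (q x \<bullet> b) * \<phi> x) = (\<integral>x. (q x \<bullet> b) * \<phi> x \<partial>lborel)"
    using Um borel_measurable_continuous_onI[OF cont(2)] zero S(2)
    by (intro integral_lebesgue_on_supported) auto
  ultimately show "(LINT x|lebesgue_on U. u x * partial_deriv b \<phi> x) = - (LINT x|lebesgue_on U. (q x \<bullet> b) * \<phi> x)"
    by linarith
qed

section \<open>Weak gradients\<close>

lemma L2_space_measurable: "f \<in> L2_space M \<Longrightarrow> f \<in> borel_measurable M"
  and L2_space_integrable: "f \<in> L2_space M \<Longrightarrow> integrable M (\<lambda>x. (norm (f x))\<^sup>2)"
  by (auto simp: L2_space_def)

lemma L2_space_lincomb:
  assumes "f \<in> L2_space M" "g \<in> L2_space M"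
  shows "(\<lambda>x. c *\<^sub>R f x + d *\<^sub>R g x) \<in> L2_space M"
proof -
  have m: "f \<in> borel_measurable M" "g \<in> borel_measurable M" using assms by (auto dest: L2_space_measurable)
  have "integrable M (\<lambda>x. (norm (c *\<^sub>R f x + d *\<^sub>R g x))\<^sup>2)"
  proof (rule Bochner_Integration.integrable_bound)
    show "integrable M (\<lambda>x. 2 * c\<^sup>2 * (norm (f x))\<^sup>2 + 2 * d\<^sup>2 * (norm (g x))\<^sup>2)"
      using assms by (intro Bochner_Integration.integrable_add integrable_mult_right L2_space_integrable)
    show "(\<lambda>x. (norm (c *\<^sub>R f x + d *\<^sub>R g x))\<^sup>2) \<in> borel_measurable M" using m by measurable
    have "(norm (c *\<^sub>R a + d *\<^sub>R b))\<^sup>2 \<le> 2 * c\<^sup>2 * (norm a)\<^sup>2 + 2 * d\<^sup>2 * (norm b)\<^sup>2" for a b :: 'b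
    proof -
      have "(norm (c *\<^sub>R a + d *\<^sub>R b))\<^sup>2 \<le> (norm (c *\<^sub>R a) + norm (d *\<^sub>R b))\<^sup>2"
        by (intro power_mono norm_triangle_ineq) auto
      also have "\<dots> \<le> 2 * (norm (c *\<^sub>R a))\<^sup>2 + 2 * (norm (d *\<^sub>R b))\<^sup>2"
        using sum_squares_bound[of "norm (c *\<^sub>R a)" "norm (d *\<^sub>R b)"] by (simp add: power2_sum)
      finally show ?thesis by (simp add: power_mult_distrib)
    qed
    then show "AE x in M. norm ((norm (c *\<^sub>R f x + d *\<^sub>R g x))\<^sup>2) \<le> norm (2 * c\<^sup>2 * (norm (f x))\<^sup>2 + 2 * d\<^sup>2 * (norm (g x))\<^sup>2)"
      by (intro AE_I2) simp
  qed
  then show ?thesis using m by (simp add: L2_space_def)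
qed

lemma lin_closed_L2_space: "lin_closed (L2_space M :: ('a \<Rightarrow> real) set)"
  unfolding lin_closed_def
proof (intro conjI ballI allI)
  show "(\<lambda>x. 0) \<in> (L2_space M :: ('a \<Rightarrow> real) set)" by (simp add: L2_space_def)
  show "(\<lambda>x. c * u x + d * v x) \<in> L2_space M" if "u \<in> L2_space M" "v \<in> L2_space M"
    for u v :: "'a \<Rightarrow> real" and c d
    using L2_space_lincomb[OF that, of c d] by simp
qed

lemma L2_space_bound:
  assumes "f \<in> borel_measurable M" "g \<in> L2_space M" "\<And>x. x \<in> space M \<Longrightarrow> norm (f x) \<le> C * norm (g x)"
  shows "f \<in> L2_space M"
proof -
  have "integrable M (\<lambda>x. (norm (f x))\<^sup>2)"
  proof (rule Bochner_Integration.integrable_bound)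
    show "integrable M (\<lambda>x. C\<^sup>2 * (norm (g x))\<^sup>2)" using assms(2) by (intro integrable_mult_right L2_space_integrable)
    show "(\<lambda>x. (norm (f x))\<^sup>2) \<in> borel_measurable M" using assms(1) by measurable
    show "AE x in M. norm ((norm (f x))\<^sup>2) \<le> norm (C\<^sup>2 * (norm (g x))\<^sup>2)"
    proof (rule AE_I2)
      fix x assume "x \<in> space M"
      from power_mono[OF assms(3)[OF this], of 2] show "norm ((norm (f x))\<^sup>2) \<le> norm (C\<^sup>2 * (norm (g x))\<^sup>2)"
        by (simp add: power_mult_distrib)
    qed
  qed
  then show ?thesis using assms(1) by (simp add: L2_space_def)
qed

lemma L2_space_component: "f \<in> L2_space M \<Longrightarrow> (\<lambda>x. f x \<bullet> d) \<in> L2_space M"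
proof (rule L2_space_bound[where g = f and C = "norm d"])
  assume f: "f \<in> L2_space M"
  from L2_space_measurable[OF f] show "(\<lambda>x. f x \<bullet> d) \<in> borel_measurable M" by measurable
  show "norm (f x \<bullet> d) \<le> norm d * norm (f x)" for x
    using Cauchy_Schwarz_ineq2[of "f x" d] by (simp only: real_norm_def mult.commute)
qed

lemma L2_space_inner_integrable:
  assumes "f \<in> L2_space M" "g \<in> L2_space M"
  shows "integrable M (\<lambda>x. f x \<bullet> g x)"
proof -
  have "integrable M (\<lambda>x. \<Sum>b\<in>Basis. (f x \<bullet> b) * (g x \<bullet> b))"
    using assms by (intro Bochner_Integration.integrable_sum L2_space_mult_integrable L2_space_component)
  then show ?thesis by (simp add: euclidean_inner[symmetric])
qed

lemma sym_form_L2_inner: "sym_form (L2_space M) (L2_inner M)"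
proof
  fix u v w :: "'a \<Rightarrow> real" and c d assume "u \<in> L2_space M" "v \<in> L2_space M" "w \<in> L2_space M"
  then show "L2_inner M (\<lambda>x. c * u x + d * v x) w = c * L2_inner M u w + d * L2_inner M v w"
    by (simp add: distrib_right mult.assoc L2_space_mult_integrable)
qed (auto simp: lin_closed_L2_space mult.commute)

lemma sym_form_mono: "sym_form D A \<Longrightarrow> lin_closed D' \<Longrightarrow> D' \<subseteq> D \<Longrightarrow> sym_form D' A"
  by (auto simp: sym_form_def subset_iff)

lemma sym_form_add: "sym_form D A \<Longrightarrow> sym_form D A' \<Longrightarrow> sym_form D (\<lambda>u v. A u v + A' u v)"
  by (auto simp: sym_form_def algebra_simps)

lemma L2_space_restrict:
  assumes "f \<in> L2_space (lebesgue_on U)" "U \<in> sets lebesgue" "U' \<in> sets lebesgue" "U' \<subseteq> U"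
  shows "f \<in> L2_space (lebesgue_on U')"
proof -
  have m: "f \<in> borel_measurable (lebesgue_on U')"
    using L2_space_measurable[OF assms(1)] assms(4) by (rule measurable_restrict_mono)
  have "integrable lebesgue (\<lambda>x. indicator U x *\<^sub>R (norm (f x))\<^sup>2)"
    using assms(2) L2_space_integrable[OF assms(1)] by (simp add: integrable_restrict_space)
  then have "integrable lebesgue (\<lambda>x. indicator U' x *\<^sub>R (indicator U x *\<^sub>R (norm (f x))\<^sup>2))"
    by (rule integrable_mult_indicator[OF assms(3)])
  moreover have "(\<lambda>x. indicator U' x *\<^sub>R (indicator U x *\<^sub>R (norm (f x))\<^sup>2)) = (\<lambda>x. indicator U' x *\<^sub>R (norm (f x))\<^sup>2)"
    using assms(4) by (auto simp: indicator_def fun_eq_iff)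
  ultimately have "integrable lebesgue (\<lambda>x. indicator U' x *\<^sub>R (norm (f x))\<^sup>2)" by (simp only:)
  then have "integrable (lebesgue_on U') (\<lambda>x. (norm (f x))\<^sup>2)"
    using assms(3) by (simp add: integrable_restrict_space)
  then show ?thesis using m by (simp add: L2_space_def)
qed

lemma L2_space_cong: "(\<And>x. x \<in> U \<Longrightarrow> f x = g x) \<Longrightarrow> f \<in> L2_space (lebesgue_on U) \<longleftrightarrow> g \<in> L2_space (lebesgue_on U)"
proof -
  assume *: "\<And>x. x \<in> U \<Longrightarrow> f x = g x"
  have "f \<in> borel_measurable (lebesgue_on U) \<longleftrightarrow> g \<in> borel_measurable (lebesgue_on U)"
    using * by (intro measurable_cong) simp
  moreover have "integrable (lebesgue_on U) (\<lambda>x. (norm (f x))\<^sup>2) \<longleftrightarrow> integrable (lebesgue_on U) (\<lambda>x. (norm (g x))\<^sup>2)"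
    using * by (intro Bochner_Integration.integrable_cong) simp_all
  ultimately show ?thesis by (simp add: L2_space_def)
qed

lemma continuous_L2_space:
  fixes f :: "'a::euclidean_space \<Rightarrow> 'b::euclidean_space"
  assumes "continuous_on UNIV f" "bounded U" "U \<in> sets lebesgue"
  shows "f \<in> L2_space (lebesgue_on U)"
proof -
  have m: "f \<in> borel_measurable lebesgue"
    using borel_measurable_continuous_onI[OF assms(1)] by (simp add: measurable_completion)
  have "compact (f ` closure U)"
    using assms by (intro compact_continuous_image continuous_on_subset[OF assms(1)]) auto
  then obtain C where C: "\<And>x. x \<in> closure U \<Longrightarrow> norm (f x) \<le> C"
    by (meson bounded_iff compact_imp_bounded imageI)
  have U: "U \<in> lmeasurable" using assms(2,3) by (rule bounded_set_imp_lmeasurable)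
  have one: "(\<lambda>_. C) \<in> L2_space (lebesgue_on U)"
    using U by (auto simp: L2_space_def integrable_restrict_space fmeasurable_def)
  show ?thesis
  proof (rule L2_space_bound[OF _ one, of _ 1])
    show "f \<in> borel_measurable (lebesgue_on U)" using m by (rule measurable_restrict_space1)
    fix x assume "x \<in> space (lebesgue_on U)"
    then have "x \<in> closure U" using closure_subset by auto
    from C[OF this] show "norm (f x) \<le> 1 * norm C" by simp
  qed
qed

lemma integral_lebesgue_on_mono:
  fixes f :: "'a::euclidean_space \<Rightarrow> real"
  assumes "U \<in> sets lebesgue" "U' \<in> sets lebesgue" "U' \<subseteq> U" "\<And>x. x \<notin> U' \<Longrightarrow> f x = 0"
  shows "(LINT x|lebesgue_on U'. f x) = (LINT x|lebesgue_on U. f x)"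
  using assms by (auto simp: integral_restrict_space indicator_def intro!: Bochner_Integration.integral_cong)

lemma has_weak_gradient_L2:
  "has_weak_gradient U u g \<Longrightarrow> u \<in> L2_space (lebesgue_on U)"
  "has_weak_gradient U u g \<Longrightarrow> g \<in> L2_space (lebesgue_on U)"
  by (auto simp: has_weak_gradient_def)

lemma test_function_partial_deriv_zero:
  assumes "\<phi> \<in> test_functions U" "x \<notin> U" "b \<in> Basis"
  shows "partial_deriv b \<phi> x = 0"
proof -
  have "x \<notin> closure {x. \<phi> x \<noteq> 0}" using test_functionsD(3)[OF assms(1)] assms(2) by (rule contra_subsetD)
  from test_function_grad_zero[OF assms(1) this] show ?thesis by (simp add: grad_inner_Basis[OF assms(3), symmetric])
qed

lemma test_function_L2_space:
  fixes U :: "'a::euclidean_space set"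
  assumes "open U" "\<phi> \<in> test_functions U" "b \<in> Basis"
  shows "\<phi> \<in> L2_space (lebesgue_on U)" "partial_deriv b \<phi> \<in> L2_space (lebesgue_on U)"
proof -
  have Um: "U \<in> sets lebesgue" using assms(1) by auto
  have *: "f \<in> L2_space (lebesgue_on U)" if f: "continuous_on UNIV f" "\<And>x. x \<notin> closure {x. \<phi> x \<noteq> 0} \<Longrightarrow> f x = 0" for f :: "'a \<Rightarrow> real"
  proof -
    have m: "f \<in> borel_measurable lebesgue"
      using borel_measurable_continuous_onI[OF f(1)] by (simp add: measurable_completion)
    have "bounded (closure {x. \<phi> x \<noteq> 0})" by (rule compact_imp_bounded[OF test_functionsD(2)[OF assms(2)]])
    then have "integrable lborel (\<lambda>x. (f x)\<^sup>2)"
      using f by (intro integrable_continuous_bounded_support[of _ "closure {x. \<phi> x \<noteq> 0}"] continuous_intros) auto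
    then have "integrable lebesgue (\<lambda>x. (f x)\<^sup>2)" by (simp add: integrable_completion)
    from integrable_mult_indicator[OF Um this]
    have "integrable (lebesgue_on U) (\<lambda>x. (f x)\<^sup>2)" using Um by (simp add: integrable_restrict_space)
    moreover have "f \<in> borel_measurable (lebesgue_on U)" using m by (rule measurable_restrict_space1)
    ultimately show ?thesis by (simp add: L2_space_def)
  qed
  have sm: "smooth \<phi>" by (rule test_functionsD(1)[OF assms(2)])
  show "\<phi> \<in> L2_space (lebesgue_on U)"
    by (rule *[OF smooth_continuous[OF sm] test_functionsD(4)[OF assms(2)]])
  show "partial_deriv b \<phi> \<in> L2_space (lebesgue_on U)"
  proof (rule *[OF smooth_continuous[OF smooth_partial_deriv[OF sm assms(3)]]])
    fix x assume "x \<notin> closure {x. \<phi> x \<noteq> 0}"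
    from test_function_grad_zero[OF assms(2) this] show "partial_deriv b \<phi> x = 0"
      by (simp add: grad_inner_Basis[OF assms(3), symmetric])
  qed
qed

lemma has_weak_gradient_unique:
  assumes U: "open U" and g: "has_weak_gradient U u g" and h: "has_weak_gradient U u h"
  shows "AE x in lebesgue_on U. g x = h x"
proof -
  have "AE x in lebesgue_on U. g x \<bullet> b - h x \<bullet> b = 0" if b: "b \<in> Basis" for b
  proof (rule fundamental_lemma[OF U])
    have L2: "(\<lambda>x. g x \<bullet> b) \<in> L2_space (lebesgue_on U)" "(\<lambda>x. h x \<bullet> b) \<in> L2_space (lebesgue_on U)"
      using has_weak_gradient_L2(2)[OF g] has_weak_gradient_L2(2)[OF h] by (auto intro: L2_space_component)
    then show "(\<lambda>x. g x \<bullet> b - h x \<bullet> b) \<in> L2_space (lebesgue_on U)"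
      by (rule lin_closed_diff[OF lin_closed_L2_space])
    fix \<phi> assume \<phi>: "\<phi> \<in> test_functions U"
    have \<phi>L2: "\<phi> \<in> L2_space (lebesgue_on U)" by (rule test_function_L2_space(1)[OF U \<phi> b])
    have "(LINT x|lebesgue_on U. (g x \<bullet> b - h x \<bullet> b) * \<phi> x)
      = (LINT x|lebesgue_on U. (g x \<bullet> b) * \<phi> x) - (LINT x|lebesgue_on U. (h x \<bullet> b) * \<phi> x)"
      by (subst Bochner_Integration.integral_diff[symmetric])
         (auto intro: L2_space_mult_integrable L2 \<phi>L2 simp: left_diff_distrib)
    also have "\<dots> = 0" using g h \<phi> b by (simp add: has_weak_gradient_def)
    finally show "(LINT x|lebesgue_on U. (g x \<bullet> b - h x \<bullet> b) * \<phi> x) = 0" .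
  qed
  then have "AE x in lebesgue_on U. \<forall>b\<in>Basis. g x \<bullet> b - h x \<bullet> b = 0"
    by (subst AE_ball_countable[OF countable_finite[OF finite_Basis]]) blast
  then show ?thesis by eventually_elim (auto intro: euclidean_eqI)
qed

lemma H1_weak_gradient: "u \<in> H1 U \<Longrightarrow> has_weak_gradient U u (weak_gradient U u)"
  unfolding H1_def weak_gradient_def by (simp add: someI_ex)

lemma has_weak_gradient_H1: "has_weak_gradient U u g \<Longrightarrow> u \<in> H1 U"
  by (auto simp: H1_def)

lemma weak_gradient_AE:
  "open U \<Longrightarrow> has_weak_gradient U u g \<Longrightarrow> AE x in lebesgue_on U. weak_gradient U u x = g x"
  by (rule has_weak_gradient_unique[OF _ H1_weak_gradient[OF has_weak_gradient_H1]])

lemma has_weak_gradient_lincomb: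
  assumes U: "open U" and u: "has_weak_gradient U u g" and v: "has_weak_gradient U v h"
  shows "has_weak_gradient U (\<lambda>x. c * u x + d * v x) (\<lambda>x. c *\<^sub>R g x + d *\<^sub>R h x)"
  unfolding has_weak_gradient_def
proof (intro conjI ballI)
  note L2 = has_weak_gradient_L2[OF u] has_weak_gradient_L2[OF v]
  show "(\<lambda>x. c * u x + d * v x) \<in> L2_space (lebesgue_on U)"
    by (rule lin_closedD[OF lin_closed_L2_space L2(1,3)])
  show "(\<lambda>x. c *\<^sub>R g x + d *\<^sub>R h x) \<in> L2_space (lebesgue_on U)"
    by (rule L2_space_lincomb[OF L2(2,4)])
  fix \<phi> and b :: 'a assume \<phi>: "\<phi> \<in> test_functions U" and b: "b \<in> Basis"
  note \<phi>L2 = test_function_L2_space[OF U \<phi> b]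
  have i: "integrable (lebesgue_on U) (\<lambda>x. u x * partial_deriv b \<phi> x)"
    "integrable (lebesgue_on U) (\<lambda>x. v x * partial_deriv b \<phi> x)"
    "integrable (lebesgue_on U) (\<lambda>x. (g x \<bullet> b) * \<phi> x)" "integrable (lebesgue_on U) (\<lambda>x. (h x \<bullet> b) * \<phi> x)"
    using L2 \<phi>L2 by (auto intro!: L2_space_mult_integrable L2_space_component)
  have "(LINT x|lebesgue_on U. (c * u x + d * v x) * partial_deriv b \<phi> x)
    = c * (LINT x|lebesgue_on U. u x * partial_deriv b \<phi> x) + d * (LINT x|lebesgue_on U. v x * partial_deriv b \<phi> x)"
    using i by (simp add: distrib_right mult.assoc)
  also have "\<dots> = c * - (LINT x|lebesgue_on U. (g x \<bullet> b) * \<phi> x) + d * - (LINT x|lebesgue_on U. (h x \<bullet> b) * \<phi> x)"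
    using u v \<phi> b by (simp add: has_weak_gradient_def)
  also have "\<dots> = - (LINT x|lebesgue_on U. ((c *\<^sub>R g x + d *\<^sub>R h x) \<bullet> b) * \<phi> x)"
    using i by (simp add: distrib_right mult.assoc inner_add_left)
  finally show "(LINT x|lebesgue_on U. (c * u x + d * v x) * partial_deriv b \<phi> x)
    = - (LINT x|lebesgue_on U. ((c *\<^sub>R g x + d *\<^sub>R h x) \<bullet> b) * \<phi> x)" .
qed

lemma has_weak_gradient_diff:
  "open U \<Longrightarrow> has_weak_gradient U u g \<Longrightarrow> has_weak_gradient U v h \<Longrightarrow>
    has_weak_gradient U (\<lambda>x. u x - v x) (\<lambda>x. g x - h x)"
  using has_weak_gradient_lincomb[of U u g v h 1 "-1"] by simp

lemma has_weak_gradient_restrict: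
  assumes "open U" "open U'" "U' \<subseteq> U" "has_weak_gradient U u g"
  shows "has_weak_gradient U' u g"
  unfolding has_weak_gradient_def
proof (intro conjI ballI)
  have m: "U \<in> sets lebesgue" "U' \<in> sets lebesgue" using assms by auto
  show "u \<in> L2_space (lebesgue_on U')" "g \<in> L2_space (lebesgue_on U')"
    using has_weak_gradient_L2[OF assms(4)] m assms(3) by (auto intro: L2_space_restrict)
  fix \<phi> and b :: 'a assume \<phi>: "\<phi> \<in> test_functions U'" and b: "b \<in> Basis"
  have "(LINT x|lebesgue_on U'. u x * partial_deriv b \<phi> x) = (LINT x|lebesgue_on U. u x * partial_deriv b \<phi> x)"
    using m assms(3) test_function_partial_deriv_zero[OF \<phi> _ b] by (intro integral_lebesgue_on_mono) auto
  moreover have "(LINT x|lebesgue_on U'. (g x \<bullet> b) * \<phi> x) = (LINT x|lebesgue_on U. (g x \<bullet> b) * \<phi> x)"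
    using m assms(3) test_functionsD(5)[OF \<phi>] by (intro integral_lebesgue_on_mono) auto
  ultimately show "(LINT x|lebesgue_on U'. u x * partial_deriv b \<phi> x) = - (LINT x|lebesgue_on U'. (g x \<bullet> b) * \<phi> x)"
    using assms(4) test_functions_mono[OF \<phi> assms(3)] b by (simp add: has_weak_gradient_def)
qed

lemma has_weak_gradient_cong:
  assumes "\<And>x. x \<in> U \<Longrightarrow> u x = v x" "has_weak_gradient U u g"
  shows "has_weak_gradient U v g"
proof -
  have "u \<in> L2_space (lebesgue_on U) \<longleftrightarrow> v \<in> L2_space (lebesgue_on U)"
    using assms(1) by (rule L2_space_cong)
  with has_weak_gradient_L2(1)[OF assms(2)] have "v \<in> L2_space (lebesgue_on U)" by simp
  moreover have "(LINT x|lebesgue_on U. v x * w x) = (LINT x|lebesgue_on U. u x * w x)" for w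
    using assms(1) by (intro Bochner_Integration.integral_cong) auto
  ultimately show ?thesis using assms(2) by (simp add: has_weak_gradient_def)
qed

text \<open>\<open>weak_gradient\<close> is a mere choice; uniqueness almost everywhere allows any
  gradient at hand in its place.\<close>

lemma grad_inner_eq:
  assumes "open U" "has_weak_gradient U u g" "has_weak_gradient U v h"
  shows "grad_inner U u v = (LINT x|lebesgue_on U. g x \<bullet> h x)"
  unfolding grad_inner_def
proof (rule integral_cong_AE)
  note L2 = has_weak_gradient_L2(2)[OF assms(2)] has_weak_gradient_L2(2)[OF assms(3)]
    has_weak_gradient_L2(2)[OF H1_weak_gradient[OF has_weak_gradient_H1[OF assms(2)]]]
    has_weak_gradient_L2(2)[OF H1_weak_gradient[OF has_weak_gradient_H1[OF assms(3)]]]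
  show "(\<lambda>x. weak_gradient U u x \<bullet> weak_gradient U v x) \<in> borel_measurable (lebesgue_on U)"
    by (rule borel_measurable_integrable[OF L2_space_inner_integrable[OF L2(3,4)]])
  show "(\<lambda>x. g x \<bullet> h x) \<in> borel_measurable (lebesgue_on U)"
    by (rule borel_measurable_integrable[OF L2_space_inner_integrable[OF L2(1,2)]])
  show "AE x in lebesgue_on U. weak_gradient U u x \<bullet> weak_gradient U v x = g x \<bullet> h x"
    using weak_gradient_AE[OF assms(1,2)] weak_gradient_AE[OF assms(1,3)] by eventually_elim simp
qed

lemma lin_closed_H1:
  assumes "open U"
  shows "lin_closed (H1 U)"
proof -
  have "has_weak_gradient U (\<lambda>x. 0) (\<lambda>x. 0)"
    by (auto simp: has_weak_gradient_def L2_space_def)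
  then show ?thesis
    unfolding lin_closed_def
    by (intro conjI ballI allI has_weak_gradient_H1[OF has_weak_gradient_lincomb[OF assms H1_weak_gradient H1_weak_gradient]])
       (rule has_weak_gradient_H1)
qed

lemma sym_form_grad_inner:
  assumes U: "open U"
  shows "sym_form (H1 U) (grad_inner U)"
proof
  show "lin_closed (H1 U)" by (rule lin_closed_H1[OF U])
  show "grad_inner U u v = grad_inner U v u" for u v by (simp add: grad_inner_def inner_commute)
  show "0 \<le> grad_inner U u u" for u unfolding grad_inner_def by (intro integral_nonneg_AE) auto
  fix u v w c d assume "u \<in> H1 U" "v \<in> H1 U" "w \<in> H1 U"
  then have g: "has_weak_gradient U u (weak_gradient U u)" "has_weak_gradient U v (weak_gradient U v)"
    "has_weak_gradient U w (weak_gradient U w)" by (auto intro: H1_weak_gradient)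
  have i: "integrable (lebesgue_on U) (\<lambda>x. weak_gradient U u x \<bullet> weak_gradient U w x)"
    "integrable (lebesgue_on U) (\<lambda>x. weak_gradient U v x \<bullet> weak_gradient U w x)"
    using has_weak_gradient_L2(2) g by (auto intro!: L2_space_inner_integrable)
  show "grad_inner U (\<lambda>x. c * u x + d * v x) w = c * grad_inner U u w + d * grad_inner U v w"
    unfolding grad_inner_eq[OF U has_weak_gradient_lincomb[OF U g(1,2)] g(3)]
    using i by (simp add: inner_add_left grad_inner_def)
qed

text \<open>The zero field satisfies the weak identity for \<open>u\<close>. This is behind the
  condition \<open>null\<close> of \<open>form_pair\<close>.\<close>

lemma weak_gradient_AE_zero:
  assumes U: "open U" and u: "u \<in> H1 U" and z: "AE x in lebesgue_on U. u x = 0"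
  shows "AE x in lebesgue_on U. weak_gradient U u x = 0"
proof (rule weak_gradient_AE[OF U])
  have "(LINT x|lebesgue_on U. u x * w x) = 0" for w
    using z by (intro integral_eq_zero_AE) (auto elim: eventually_mono)
  then show "has_weak_gradient U u (\<lambda>x. 0)"
    using has_weak_gradient_L2(1)[OF H1_weak_gradient[OF u]] by (auto simp: has_weak_gradient_def L2_space_def)
qed

lemma grad_inner_null:
  assumes "open U" "u \<in> H1 U" "AE x in lebesgue_on U. u x = 0"
  shows "grad_inner U u v = 0"
  unfolding grad_inner_def
  using weak_gradient_AE_zero[OF assms] by (intro integral_eq_zero_AE) (auto elim: eventually_mono)

lemma test_function_weak_gradient:
  assumes "open U" "bounded U" "\<phi> \<in> test_functions U"
  shows "has_weak_gradient U \<phi> (grad \<phi>)"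
proof -
  note sm = test_functionsD(1)[OF assms(3)]
  have Um: "U \<in> sets lebesgue" using assms(1) by auto
  show ?thesis
    by (rule has_weak_gradientI_classical[OF smooth_has_derivative[OF sm] smooth_grad_continuous[OF sm] assms(1)
        continuous_L2_space[OF smooth_continuous[OF sm] assms(2) Um]
        continuous_L2_space[OF smooth_grad_continuous[OF sm] assms(2) Um]])
qed

section \<open>The H1 inner product and approximation by test functions\<close>

definition H1_inner :: "'a::euclidean_space set \<Rightarrow> ('a \<Rightarrow> real) \<Rightarrow> ('a \<Rightarrow> real) \<Rightarrow> real" where
  "H1_inner U u v = L2_inner (lebesgue_on U) u v + grad_inner U u v"

lemma sym_form_H1_inner: "open U \<Longrightarrow> sym_form (H1 U) (H1_inner U)"
  unfolding H1_inner_def[abs_def]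
  by (intro sym_form_add sym_form_grad_inner sym_form_mono[OF sym_form_L2_inner lin_closed_H1])
     (auto dest: H1_weak_gradient has_weak_gradient_L2)

lemma H1_norm_eq: "H1_norm U u = sqrt (H1_inner U u u)"
  unfolding H1_norm_def L2_norm_def H1_inner_def grad_inner_def
  by (simp add: power2_norm_eq_inner flip: power2_eq_square)

lemma lin_closed_H10:
  assumes U: "open U" "bounded U"
  shows "lin_closed (H10 U)"
proof -
  interpret S: sym_form "H1 U" "H1_inner U" by (rule sym_form_H1_inner[OF U(1)])
  note lH = lin_closed_H1[OF U(1)]
  have tH: "\<phi> \<in> H1 U" if "\<phi> \<in> test_functions U" for \<phi>
    using test_function_weak_gradient[OF U that] by (rule has_weak_gradient_H1)
  have zero: "(\<lambda>x. 0) \<in> H10 U"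
  proof -
    have "H1_inner U (\<lambda>x. 0) (\<lambda>x. 0) = 0"
      using S.scale_left[of "\<lambda>x. 0" "\<lambda>x. 0" 0] lH by (simp add: lin_closed_def)
    then have "H1_approx U (\<lambda>j x. 0) (\<lambda>x. 0)"
      using lin_closed_test_functions[of U] by (simp add: H1_approx_def H1_norm_eq lin_closed_def)
    then show ?thesis using lH by (auto simp: H10_def lin_closed_def)
  qed
  have "(\<lambda>x. c * u x + d * v x) \<in> H10 U" if uv: "u \<in> H10 U" "v \<in> H10 U" for u v c d
  proof -
    from uv obtain \<phi> \<psi> where a: "H1_approx U \<phi> u" "H1_approx U \<psi> v" and H: "u \<in> H1 U" "v \<in> H1 U"
      by (auto simp: H10_def)
    then have t: "\<And>j. \<phi> j \<in> test_functions U" "\<And>j. \<psi> j \<in> test_functions U"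
      and l: "(\<lambda>j. H1_norm U (\<lambda>x. u x - \<phi> j x)) \<longlonglongrightarrow> 0" "(\<lambda>j. H1_norm U (\<lambda>x. v x - \<psi> j x)) \<longlonglongrightarrow> 0"
      by (auto simp: H1_approx_def)
    have le: "H1_norm U (\<lambda>x. (c * u x + d * v x) - (c * \<phi> j x + d * \<psi> j x))
      \<le> \<bar>c\<bar> * H1_norm U (\<lambda>x. u x - \<phi> j x) + \<bar>d\<bar> * H1_norm U (\<lambda>x. v x - \<psi> j x)" for j
    proof -
      let ?e = "\<lambda>x. u x - \<phi> j x" and ?f = "\<lambda>x. v x - \<psi> j x"
      have ef: "?e \<in> H1 U" "?f \<in> H1 U" using H tH t by (auto intro!: lin_closed_diff lH)
      have ef': "(\<lambda>x. c * ?e x) \<in> H1 U" "(\<lambda>x. d * ?f x) \<in> H1 U" by (rule lin_closed_scale[OF lH ef(1)], rule lin_closed_scale[OF lH ef(2)])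
      have "H1_inner U (\<lambda>x. c * ?e x + d * ?f x) (\<lambda>x. c * ?e x + d * ?f x)
        \<le> (sqrt (H1_inner U (\<lambda>x. c * ?e x) (\<lambda>x. c * ?e x)) + sqrt (H1_inner U (\<lambda>x. d * ?f x) (\<lambda>x. d * ?f x)))\<^sup>2"
        by (rule S.triangle(2)[OF ef'])
      also have "H1_inner U (\<lambda>x. c * ?e x) (\<lambda>x. c * ?e x) = c\<^sup>2 * H1_inner U ?e ?e"
        using S.scale_left[OF ef(1) ef'(1)] S.scale_right[OF ef(1,1)] by (simp add: power2_eq_square)
      also have "H1_inner U (\<lambda>x. d * ?f x) (\<lambda>x. d * ?f x) = d\<^sup>2 * H1_inner U ?f ?f"
        using S.scale_left[OF ef(2) ef'(2)] S.scale_right[OF ef(2,2)] by (simp add: power2_eq_square)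
      finally have "sqrt (H1_inner U (\<lambda>x. c * ?e x + d * ?f x) (\<lambda>x. c * ?e x + d * ?f x))
        \<le> \<bar>sqrt (c\<^sup>2 * H1_inner U ?e ?e) + sqrt (d\<^sup>2 * H1_inner U ?f ?f)\<bar>"
        using real_sqrt_le_mono by fastforce
      also have "\<dots> = \<bar>c\<bar> * sqrt (H1_inner U ?e ?e) + \<bar>d\<bar> * sqrt (H1_inner U ?f ?f)"
        using S.nonneg[OF ef(1)] S.nonneg[OF ef(2)] by (simp add: real_sqrt_mult)
      also have "(\<lambda>x. c * ?e x + d * ?f x) = (\<lambda>x. (c * u x + d * v x) - (c * \<phi> j x + d * \<psi> j x))"
        by (auto simp: algebra_simps)
      finally show ?thesis by (simp add: H1_norm_eq)
    qed
    have "H1_approx U (\<lambda>j x. c * \<phi> j x + d * \<psi> j x) (\<lambda>x. c * u x + d * v x)"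
      unfolding H1_approx_def
    proof (intro conjI allI)
      show "(\<lambda>x. c * \<phi> j x + d * \<psi> j x) \<in> test_functions U" for j
        by (rule lin_closedD[OF lin_closed_test_functions t])
      have "(\<lambda>j. \<bar>c\<bar> * H1_norm U (\<lambda>x. u x - \<phi> j x) + \<bar>d\<bar> * H1_norm U (\<lambda>x. v x - \<psi> j x)) \<longlonglongrightarrow> \<bar>c\<bar> * 0 + \<bar>d\<bar> * 0"
        by (intro tendsto_intros l)
      then have lim: "(\<lambda>j. \<bar>c\<bar> * H1_norm U (\<lambda>x. u x - \<phi> j x) + \<bar>d\<bar> * H1_norm U (\<lambda>x. v x - \<psi> j x)) \<longlonglongrightarrow> 0" by simp
      show "(\<lambda>j. H1_norm U (\<lambda>x. (c * u x + d * v x) - (c * \<phi> j x + d * \<psi> j x))) \<longlonglongrightarrow> 0"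
        by (rule tendsto_sandwich[OF _ _ tendsto_const lim])
           (use le in \<open>auto simp: H1_norm_def intro!: always_eventually\<close>)
    qed
    then show ?thesis using lin_closedD[OF lH H] by (auto simp: H10_def)
  qed
  then show ?thesis using zero by (simp add: lin_closed_def)
qed

lemma H1_norm_sq:
  assumes "open U" "has_weak_gradient U u g"
  shows "(H1_norm U u)\<^sup>2 = (LINT x|lebesgue_on U. (u x)\<^sup>2) + (LINT x|lebesgue_on U. (norm (g x))\<^sup>2)"
proof -
  have "0 \<le> H1_inner U u u"
    using sym_form.nonneg[OF sym_form_H1_inner[OF assms(1)] has_weak_gradient_H1[OF assms(2)]] .
  then show ?thesis
    by (simp add: H1_norm_eq H1_inner_def grad_inner_eq[OF assms assms(2)] power2_norm_eq_inner flip: power2_eq_square)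
qed

text \<open>Integrating the gradient over \<open>T\<close> is continuous in the H1 norm, by
  Cauchy-Schwarz against the indicator of \<open>T\<close>.\<close>

lemma H1_approx_integral_grad:
  assumes U: "open U" "bounded U" and g: "has_weak_gradient U u g" and a: "H1_approx U \<phi> u"
    and T: "T \<in> sets lebesgue" "T \<subseteq> U"
  shows "(\<lambda>j. LINT x|lebesgue_on T. grad (\<phi> j) x \<bullet> d) \<longlonglongrightarrow> (LINT x|lebesgue_on T. g x \<bullet> d)"
proof -
  have Um: "U \<in> sets lebesgue" using U by auto
  have t: "\<And>j. \<phi> j \<in> test_functions U" and l: "(\<lambda>j. H1_norm U (\<lambda>x. u x - \<phi> j x)) \<longlonglongrightarrow> 0"
    using a by (auto simp: H1_approx_def)
  have wg: "has_weak_gradient U (\<lambda>x. u x - \<phi> j x) (\<lambda>x. g x - grad (\<phi> j) x)" for j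
    by (rule has_weak_gradient_diff[OF U(1) g test_function_weak_gradient[OF U t]])
  define K where "K = (norm d)\<^sup>2 * (LINT x|lebesgue_on U. (indicator T x)\<^sup>2)"
  have bound: "((LINT x|lebesgue_on T. grad (\<phi> j) x \<bullet> d) - (LINT x|lebesgue_on T. g x \<bullet> d))\<^sup>2
    \<le> K * (H1_norm U (\<lambda>x. u x - \<phi> j x))\<^sup>2" for j
  proof -
    let ?r = "\<lambda>x. g x - grad (\<phi> j) x"
    have rL2: "?r \<in> L2_space (lebesgue_on U)" by (rule has_weak_gradient_L2(2)[OF wg])
    have rd: "(\<lambda>x. ?r x \<bullet> d) \<in> L2_space (lebesgue_on U)" by (rule L2_space_component[OF rL2])
    have ind: "(indicator T :: 'a \<Rightarrow> real) \<in> L2_space (lebesgue_on U)"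
    proof (rule L2_space_bound[of _ _ "\<lambda>_. 1" 1])
      show "(\<lambda>_. 1::real) \<in> L2_space (lebesgue_on U)"
        by (rule continuous_L2_space) (use U Um in auto)
      show "indicator T \<in> borel_measurable (lebesgue_on U)"
        by (rule measurable_restrict_space1[OF borel_measurable_indicator[OF T(1)]])
    qed (auto simp: indicator_def)
    have iT: "integrable (lebesgue_on T) (\<lambda>x. h x \<bullet> d)" if "h \<in> L2_space (lebesgue_on U)" for h :: "'a \<Rightarrow> 'a"
    proof -
      have "(\<lambda>_. d) \<in> L2_space (lebesgue_on T)"
        by (rule continuous_L2_space) (use U T bounded_subset in auto)
      then show ?thesis
        using L2_space_restrict[OF that Um T] by (intro L2_space_inner_integrable)
    qed
    have gr: "grad (\<phi> j) \<in> L2_space (lebesgue_on U)"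
      by (rule has_weak_gradient_L2(2)[OF test_function_weak_gradient[OF U t]])
    have "(LINT x|lebesgue_on T. g x \<bullet> d) - (LINT x|lebesgue_on T. grad (\<phi> j) x \<bullet> d)
      = (LINT x|lebesgue_on T. ?r x \<bullet> d)"
      using iT[OF has_weak_gradient_L2(2)[OF g]] iT[OF gr] by (simp add: inner_diff_left)
    also have "\<dots> = L2_inner (lebesgue_on U) (\<lambda>x. ?r x \<bullet> d) (indicator T)"
      using Um T by (auto simp: integral_restrict_space indicator_def intro!: Bochner_Integration.integral_cong)
    finally have eq: "(LINT x|lebesgue_on T. g x \<bullet> d) - (LINT x|lebesgue_on T. grad (\<phi> j) x \<bullet> d)
      = L2_inner (lebesgue_on U) (\<lambda>x. ?r x \<bullet> d) (indicator T)" .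
    have "((LINT x|lebesgue_on T. grad (\<phi> j) x \<bullet> d) - (LINT x|lebesgue_on T. g x \<bullet> d))\<^sup>2
      = (L2_inner (lebesgue_on U) (\<lambda>x. ?r x \<bullet> d) (indicator T))\<^sup>2"
      unfolding eq[symmetric] by (rule power2_commute)
    also have "\<dots> \<le> L2_inner (lebesgue_on U) (\<lambda>x. ?r x \<bullet> d) (\<lambda>x. ?r x \<bullet> d) * L2_inner (lebesgue_on U) (indicator T) (indicator T)"
      by (rule sym_form.Cauchy_Schwarz[OF sym_form_L2_inner rd ind])
    also have "\<dots> \<le> ((norm d)\<^sup>2 * (LINT x|lebesgue_on U. (norm (?r x))\<^sup>2)) * (LINT x|lebesgue_on U. (indicator T x)\<^sup>2)"
    proof (rule mult_mono)
      have "(?r x \<bullet> d) * (?r x \<bullet> d) \<le> (norm d)\<^sup>2 * (norm (?r x))\<^sup>2" for x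
        using Cauchy_Schwarz_ineq[of "?r x" d] by (simp add: power2_eq_square[symmetric] power2_norm_eq_inner mult.commute)
      then have "L2_inner (lebesgue_on U) (\<lambda>x. ?r x \<bullet> d) (\<lambda>x. ?r x \<bullet> d) \<le> (LINT x|lebesgue_on U. (norm d)\<^sup>2 * (norm (?r x))\<^sup>2)"
        using L2_space_mult_integrable[OF rd rd] L2_space_integrable[OF rL2] by (intro integral_mono) auto
      then show "L2_inner (lebesgue_on U) (\<lambda>x. ?r x \<bullet> d) (\<lambda>x. ?r x \<bullet> d) \<le> (norm d)\<^sup>2 * (LINT x|lebesgue_on U. (norm (?r x))\<^sup>2)"
        by simp
    qed (auto simp: power2_eq_square intro!: mult_nonneg_nonneg integral_nonneg_AE)
    also have "\<dots> \<le> K * (H1_norm U (\<lambda>x. u x - \<phi> j x))\<^sup>2"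
    proof -
      have "(LINT x|lebesgue_on U. (norm (?r x))\<^sup>2) \<le> (H1_norm U (\<lambda>x. u x - \<phi> j x))\<^sup>2"
        unfolding H1_norm_sq[OF U(1) wg] by (simp add: integral_nonneg_AE)
      moreover have "K \<ge> 0" unfolding K_def by (intro mult_nonneg_nonneg integral_nonneg_AE) auto
      ultimately show ?thesis unfolding K_def by (simp add: mult_ac mult_left_mono integral_nonneg_AE)
    qed
    finally show ?thesis .
  qed
  have "(\<lambda>j. K * (H1_norm U (\<lambda>x. u x - \<phi> j x))\<^sup>2) \<longlonglongrightarrow> K * 0\<^sup>2" by (intro tendsto_intros l)
  then have lim: "(\<lambda>j. K * (H1_norm U (\<lambda>x. u x - \<phi> j x))\<^sup>2) \<longlonglongrightarrow> 0" by simp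
  have "(\<lambda>j. ((LINT x|lebesgue_on T. grad (\<phi> j) x \<bullet> d) - (LINT x|lebesgue_on T. g x \<bullet> d))\<^sup>2) \<longlonglongrightarrow> 0"
  proof (rule tendsto_sandwich[OF _ _ tendsto_const lim])
    show "\<forall>\<^sub>F j in sequentially. 0 \<le> ((LINT x|lebesgue_on T. grad (\<phi> j) x \<bullet> d) - (LINT x|lebesgue_on T. g x \<bullet> d))\<^sup>2"
      by simp
    show "\<forall>\<^sub>F j in sequentially. ((LINT x|lebesgue_on T. grad (\<phi> j) x \<bullet> d) - (LINT x|lebesgue_on T. g x \<bullet> d))\<^sup>2
      \<le> K * (H1_norm U (\<lambda>x. u x - \<phi> j x))\<^sup>2"
      by (rule always_eventually, rule allI, rule bound)
  qed
  then have "(\<lambda>j. (LINT x|lebesgue_on T. grad (\<phi> j) x \<bullet> d) - (LINT x|lebesgue_on T. g x \<bullet> d)) \<longlonglongrightarrow> 0"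
    by (simp add: power_tendsto_0_iff)
  then show ?thesis by (simp add: LIM_zero_iff)
qed

section \<open>Linear changes of variables\<close>

text \<open>Lebesgue measure is determined up to a constant by translation invariance: both sides of
  \<open>eq\<close> below are the value of the same double integral.\<close>

lemma nn_integral_lborel_linear:
  fixes L :: "'a::euclidean_space \<Rightarrow> 'a"
  assumes L: "linear L" and L': "linear L'" and inv: "\<And>x. L (L' x) = x" "\<And>x. L' (L x) = x"
  shows "\<exists>c>0. \<forall>h\<in>borel_measurable borel. (\<integral>\<^sup>+x. h (L x) \<partial>lborel) = ennreal c * (\<integral>\<^sup>+x. h x \<partial>lborel)"
proof -
  have cL: "continuous_on UNIV L" "continuous_on UNIV L'"
    using L L' by (simp_all add: linear_continuous_on linear_conv_bounded_linear)
  have [measurable]: "L \<in> borel_measurable borel" "L' \<in> borel_measurable borel"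
    using cL by (auto intro: borel_measurable_continuous_onI)
  have eq: "(\<integral>\<^sup>+x. g (L x) \<partial>lborel) * (\<integral>\<^sup>+x. h x \<partial>lborel) = (\<integral>\<^sup>+x. h (L x) \<partial>lborel) * (\<integral>\<^sup>+x. g x \<partial>lborel)"
    if [measurable]: "g \<in> borel_measurable borel" "h \<in> borel_measurable borel" for g h :: "'a \<Rightarrow> ennreal"
  proof -
    have "(\<integral>\<^sup>+x. g (L x) \<partial>lborel) * (\<integral>\<^sup>+x. h x \<partial>lborel) = (\<integral>\<^sup>+x. \<integral>\<^sup>+y. g (L x) * h y \<partial>lborel \<partial>lborel)"
      by (simp add: nn_integral_cmult nn_integral_multc)
    also have "\<dots> = (\<integral>\<^sup>+x. \<integral>\<^sup>+y. g (L x) * h (y + L x) \<partial>lborel \<partial>lborel)"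
      by (intro nn_integral_cong nn_integral_lborel_translation[symmetric]) measurable
    also have "\<dots> = (\<integral>\<^sup>+y. \<integral>\<^sup>+x. g (L x) * h (y + L x) \<partial>lborel \<partial>lborel)"
      by (rule lborel_pair.Fubini'[symmetric]) measurable
    \<comment> \<open>Translating x by \<open>- L' y\<close> turns \<open>h (y + L x)\<close> into
      \<open>h (L x)\<close> and moves y into the argument of \<open>g\<close>, where a reflection
      removes it.\<close>
    also have "\<dots> = (\<integral>\<^sup>+y. \<integral>\<^sup>+x. g (L (x + - L' y)) * h (y + L (x + - L' y)) \<partial>lborel \<partial>lborel)"
      by (intro nn_integral_cong nn_integral_lborel_translation[symmetric]) measurable
    also have "\<dots> = (\<integral>\<^sup>+y. \<integral>\<^sup>+x. g (L x - y) * h (L x) \<partial>lborel \<partial>lborel)"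
      using L by (simp add: linear_diff inv)
    also have "\<dots> = (\<integral>\<^sup>+x. \<integral>\<^sup>+y. g (L x - y) * h (L x) \<partial>lborel \<partial>lborel)"
      by (rule lborel_pair.Fubini') measurable
    also have "\<dots> = (\<integral>\<^sup>+x. (\<integral>\<^sup>+y. g y \<partial>lborel) * h (L x) \<partial>lborel)"
    proof (intro nn_integral_cong)
      fix x
      have "(\<integral>\<^sup>+y. g (L x - y) \<partial>lborel) = (\<integral>\<^sup>+y. g y \<partial>lborel)"
        by (subst (2) lborel_affine[of "- 1" "L x"]) (simp_all add: nn_integral_density nn_integral_distr)
      then show "(\<integral>\<^sup>+y. g (L x - y) * h (L x) \<partial>lborel) = (\<integral>\<^sup>+y. g y \<partial>lborel) * h (L x)"
        by (simp add: nn_integral_multc)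
    qed
    also have "\<dots> = (\<integral>\<^sup>+x. h (L x) \<partial>lborel) * (\<integral>\<^sup>+x. g x \<partial>lborel)"
      by (simp add: nn_integral_cmult mult.commute)
    finally show ?thesis .
  qed
  \<comment> \<open>The box has volume 1, so \<open>eq\<close> identifies the constant as the volume
    of its preimage: finite because the preimage is bounded, nonzero because it is open and
    nonempty.\<close>
  let ?B = "box 0 One :: 'a set"
  have B1: "(\<integral>\<^sup>+x. indicator ?B x \<partial>lborel) = 1"
    by (simp add: emeasure_lborel_box_eq)
  have "(\<integral>\<^sup>+x. indicator ?B (L x) \<partial>lborel) = emeasure lborel (L -` ?B)"
  proof -
    have "(\<integral>\<^sup>+x. indicator ?B (L x) \<partial>lborel) = (\<integral>\<^sup>+x. indicator (L -` ?B) x \<partial>lborel)"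
      by (intro nn_integral_cong) (auto simp: indicator_def)
    also have "\<dots> = emeasure lborel (L -` ?B)"
      using open_vimage[OF open_box cL(1)] by (subst nn_integral_indicator) auto
    finally show ?thesis .
  qed
  moreover have im: "L -` ?B = L' ` ?B" using inv by (auto simp: image_iff) (metis inv(2))
  moreover have "bounded (L' ` ?B)" using L' by (intro bounded_linear_image bounded_box) (simp add: linear_conv_bounded_linear)
  moreover have "open (L -` ?B)" by (rule open_vimage[OF open_box cL(1)])
  moreover have "L' ` ?B \<noteq> {}" by (auto simp: box_ne_empty)
  ultimately have "(\<integral>\<^sup>+x. indicator ?B (L x) \<partial>lborel) < \<infinity>" "(\<integral>\<^sup>+x. indicator ?B (L x) \<partial>lborel) \<noteq> 0"
    using emeasure_bounded_finite[of "L -` ?B"] open_not_negligible[of "L -` ?B"]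
    by (auto simp: negligible_iff_null_sets null_sets_def)
  then obtain c where c: "(\<integral>\<^sup>+x. indicator ?B (L x) \<partial>lborel) = ennreal c" "c > 0"
    by (cases "\<integral>\<^sup>+x. indicator ?B (L x) \<partial>lborel") (auto simp: less_le)
  show ?thesis
  proof (intro exI[of _ c] conjI ballI c(2))
    fix h :: "'a \<Rightarrow> ennreal" assume "h \<in> borel_measurable borel"
    from eq[OF this, of "indicator ?B"] show "(\<integral>\<^sup>+x. h (L x) \<partial>lborel) = ennreal c * (\<integral>\<^sup>+x. h x \<partial>lborel)"
      unfolding B1 c(1) by simp
  qed
qed

lemma integral_lborel_affine:
  fixes L :: "'a::euclidean_space \<Rightarrow> 'a"
  assumes L: "linear L" and L': "linear L'" and inv: "\<And>x. L (L' x) = x" "\<And>x. L' (L x) = x"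
  shows "\<exists>c>0. \<forall>h::'a \<Rightarrow> real. h \<in> borel_measurable borel \<longrightarrow>
    (\<integral>x. h (L x + v) \<partial>lborel) = c * (\<integral>x. h x \<partial>lborel)"
proof -
  from nn_integral_lborel_linear[OF assms] obtain c where c: "c > 0"
    "\<And>h. h \<in> borel_measurable borel \<Longrightarrow> (\<integral>\<^sup>+x. h (L x) \<partial>lborel) = ennreal c * (\<integral>\<^sup>+x. h x \<partial>lborel)" by auto
  have [measurable]: "L \<in> borel_measurable borel"
    using L by (intro borel_measurable_continuous_onI) (simp add: linear_continuous_on linear_conv_bounded_linear)
  have d: "distr lborel borel (\<lambda>x. L x + v) = density lborel (\<lambda>_. ennreal c)"
  proof (rule measure_eqI)
    fix A assume "A \<in> sets (distr lborel borel (\<lambda>x. L x + v))"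
    then have [measurable]: "A \<in> sets borel" by simp
    have "emeasure (distr lborel borel (\<lambda>x. L x + v)) A = (\<integral>\<^sup>+x. indicator A x \<partial>distr lborel borel (\<lambda>x. L x + v))"
      by simp
    also have "\<dots> = (\<integral>\<^sup>+x. indicator A (L x + v) \<partial>lborel)"
      by (rule nn_integral_distr) measurable
    also have "\<dots> = ennreal c * (\<integral>\<^sup>+x. indicator A (x + v) \<partial>lborel)"
      by (rule c(2)[where h = "\<lambda>x. indicator A (x + v)"]) measurable
    also have "(\<integral>\<^sup>+x. indicator A (x + v) \<partial>lborel) = (\<integral>\<^sup>+x. indicator A x \<partial>lborel)"
      by (rule nn_integral_lborel_translation) measurable
    also have "ennreal c * (\<integral>\<^sup>+x. indicator A x \<partial>lborel) = emeasure (density lborel (\<lambda>_. ennreal c)) A"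
      by (simp add: emeasure_density nn_integral_cmult)
    finally show "emeasure (distr lborel borel (\<lambda>x. L x + v)) A = emeasure (density lborel (\<lambda>_. ennreal c)) A" .
  qed simp
  show ?thesis
  proof (intro exI[of _ c] conjI allI impI c(1))
    fix h :: "'a \<Rightarrow> real" assume [measurable]: "h \<in> borel_measurable borel"
    have "(\<integral>x. h (L x + v) \<partial>lborel) = (\<integral>x. h x \<partial>distr lborel borel (\<lambda>x. L x + v))"
      by (simp add: integral_distr)
    also have "\<dots> = c * (\<integral>x. h x \<partial>lborel)"
      unfolding d using c(1) by (simp add: integral_density)
    finally show "(\<integral>x. h (L x + v) \<partial>lborel) = c * (\<integral>x. h x \<partial>lborel)" .
  qed
qed

section \<open>Barycentric coordinates\<close>

lemma linear_functional_inner: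
  fixes g :: "'a::euclidean_space \<Rightarrow> real"
  assumes "linear g"
  shows "\<exists>a. \<forall>x. g x = a \<bullet> x"
proof (intro exI allI)
  fix x
  have "g (\<Sum>b\<in>Basis. (x \<bullet> b) *\<^sub>R b) = (\<Sum>b\<in>Basis. (x \<bullet> b) * g b)"
    using assms by (simp add: linear_sum linear_scale)
  then have "g x = (\<Sum>b\<in>Basis. (x \<bullet> b) * g b)" by (simp only: euclidean_representation)
  also have "\<dots> = (\<Sum>b\<in>Basis. g b *\<^sub>R b) \<bullet> x"
    by (simp add: inner_sum_left inner_commute[of x] mult.commute)
  finally show "g x = (\<Sum>b\<in>Basis. g b *\<^sub>R b) \<bullet> x" .
qed

locale full_simplex =
  fixes C :: "'a::euclidean_space set"
  assumes indep: "\<not> affine_dependent C" and card_C: "card C = DIM('a) + 1"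
begin

lemma finite_C: "finite C"
  using indep by (rule aff_independent_finite)

lemma affine_hull_C: "affine hull C = UNIV"
proof -
  have "aff_dim C = int DIM('a)" using indep card_C by (simp add: affine_independent_iff_card)
  then show ?thesis by (simp add: aff_dim_eq_full)
qed

lemma affine_zero:
  assumes "\<And>q. q \<in> C \<Longrightarrow> a \<bullet> q + b = 0"
  shows "a \<bullet> x + b = 0"
proof -
  have "affine hull C \<subseteq> {x. a \<bullet> x = - b}"
    using assms by (intro hull_minimal affine_hyperplane) (auto simp: eq_neg_iff_add_eq_0)
  then have "a \<bullet> x = - b" unfolding affine_hull_C by blast
  then show ?thesis by simp
qed

lemma other_vertex: "\<exists>q\<in>C. q \<noteq> p"
proof (rule ccontr)
  assume "\<not> ?thesis"
  then have "C \<subseteq> {p}" by auto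
  then have "card C \<le> 1" using card_mono[of "{p}" C] by simp
  then show False using card_C DIM_positive[where 'a = 'a] by simp
qed

text \<open>Relative to a base vertex \<open>q0\<close> different from \<open>p\<close>, the edge
  vectors are independent, so a linear functional can be 1 on \<open>p - q0\<close> and 0 on the
  others.\<close>

lemma bary_exists:
  assumes p: "p \<in> C"
  shows "\<exists>z::'a \<times> real. \<forall>q\<in>C. fst z \<bullet> q + snd z = (if q = p then 1 else 0)"
proof -
  obtain q0 where q0: "q0 \<in> C" "q0 \<noteq> p" using other_vertex by blast
  have "independent ((\<lambda>x. - q0 + x) ` (C - {q0}))"
    using indep affine_dependent_iff_dependent2[OF q0(1)] by simp
  from linear_independent_extend[OF this, of "\<lambda>x. if x = p - q0 then 1 else 0::real"]
  obtain g where g: "linear g" "\<And>x. x \<in> (\<lambda>x. - q0 + x) ` (C - {q0}) \<Longrightarrow> g x = (if x = p - q0 then 1 else 0::real)"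
    by blast
  obtain a where a: "\<forall>x. g x = a \<bullet> x" using linear_functional_inner[OF g(1)] by blast
  have "a \<bullet> q + - (a \<bullet> q0) = (if q = p then 1 else 0)" if q: "q \<in> C" for q
  proof (cases "q = q0")
    case False
    then have "- q0 + q \<in> (\<lambda>x. - q0 + x) ` (C - {q0})" using q by blast
    from g(2)[OF this] a have "a \<bullet> (- q0 + q) = (if - q0 + q = p - q0 then 1 else 0)" by simp
    then show ?thesis by (simp add: inner_diff_right split: if_splits)
  qed (use q0 in simp)
  then show ?thesis by (intro exI[of _ "(a, - (a \<bullet> q0))"]) simp
qed

definition bary_coeff :: "'a \<Rightarrow> 'a \<times> real" where
  "bary_coeff p = (SOME z. \<forall>q\<in>C. fst z \<bullet> q + snd z = (if q = p then 1 else 0))"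

definition bgrad :: "'a \<Rightarrow> 'a" where "bgrad p = fst (bary_coeff p)"

definition bary :: "'a \<Rightarrow> 'a \<Rightarrow> real" where "bary p x = bgrad p \<bullet> x + snd (bary_coeff p)"

lemma bary_vertex: "p \<in> C \<Longrightarrow> q \<in> C \<Longrightarrow> bary p q = (if q = p then 1 else 0)"
  using someI_ex[OF bary_exists] unfolding bary_def bgrad_def bary_coeff_def by blast

lemma bary_add: "bary p (x + y) = bary p x + bgrad p \<bullet> y"
  by (simp add: bary_def inner_add_right)

lemma bary_diff: "bgrad p \<bullet> (x - y) = bary p x - bary p y"
  by (simp add: bary_def inner_diff_right)

lemma continuous_bary: "continuous_on S (bary p)"
  unfolding bary_def[abs_def] by (intro continuous_intros)

lemma bary_measurable[measurable]: "bary p \<in> borel_measurable borel"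
  by (intro borel_measurable_continuous_onI continuous_bary)

text \<open>The difference of the two sides is affine and vanishes at the vertices, hence
  everywhere. Constants give the partition of unity, coordinate functions the reproduction of
  points.\<close>

lemma affine_eq: "a \<bullet> x + b = (\<Sum>p\<in>C. bary p x * (a \<bullet> p + b))"
proof -
  let ?a = "a - (\<Sum>p\<in>C. (a \<bullet> p + b) *\<^sub>R bgrad p)"
  let ?b = "b - (\<Sum>p\<in>C. (a \<bullet> p + b) * snd (bary_coeff p))"
  have e: "?a \<bullet> y + ?b = a \<bullet> y + b - (\<Sum>p\<in>C. bary p y * (a \<bullet> p + b))" for y
    by (simp add: inner_diff_left inner_sum_left bary_def sum.distrib[symmetric] algebra_simps)
  have "?a \<bullet> q + ?b = 0" if q: "q \<in> C" for q
  proof -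
    have "(\<Sum>p\<in>C. bary p q * (a \<bullet> p + b)) = (\<Sum>p\<in>C. if p = q then a \<bullet> q + b else 0)"
      using q by (intro sum.cong) (auto simp: bary_vertex)
    then show ?thesis unfolding e using q finite_C by simp
  qed
  from affine_zero[OF this, of x] show ?thesis unfolding e by simp
qed

lemma sum_bary: "(\<Sum>p\<in>C. bary p x) = 1"
  using affine_eq[of 0 x 1] by simp

lemma bary_combination: "(\<Sum>p\<in>C. bary p x *\<^sub>R p) = x"
proof (rule euclidean_eqI)
  fix b :: 'a assume "b \<in> Basis"
  show "(\<Sum>p\<in>C. bary p x *\<^sub>R p) \<bullet> b = x \<bullet> b"
    using affine_eq[of b x 0] by (simp add: inner_commute[of _ b] inner_sum_right)
qed

lemma bary_of_combination:
  assumes "sum u C = 1" "p \<in> C"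
  shows "bary p (\<Sum>q\<in>C. u q *\<^sub>R q) = u p"
proof -
  have "bary p (\<Sum>q\<in>C. u q *\<^sub>R q) = (\<Sum>q\<in>C. u q * (bgrad p \<bullet> q)) + (\<Sum>q\<in>C. u q) * snd (bary_coeff p)"
    using assms(1) by (simp add: bary_def inner_sum_right)
  also have "\<dots> = (\<Sum>q\<in>C. u q * bary p q)"
    by (simp add: bary_def sum_distrib_right distrib_left sum.distrib)
  also have "\<dots> = (\<Sum>q\<in>C. if q = p then u p else 0)"
    using assms(2) by (intro sum.cong) (auto simp: bary_vertex)
  finally show ?thesis using assms(2) finite_C by simp
qed

lemma mem_simplex: "x \<in> convex hull C \<longleftrightarrow> (\<forall>p\<in>C. 0 \<le> bary p x)"
proof
  assume "x \<in> convex hull C"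
  then obtain u where "\<forall>x\<in>C. 0 \<le> u x" "sum u C = 1" "(\<Sum>x\<in>C. u x *\<^sub>R x) = x"
    unfolding convex_hull_finite[OF finite_C] by blast
  then show "\<forall>p\<in>C. 0 \<le> bary p x" using bary_of_combination[of u] by auto
next
  assume "\<forall>p\<in>C. 0 \<le> bary p x"
  then show "x \<in> convex hull C"
    unfolding convex_hull_finite[OF finite_C] using sum_bary[of x] bary_combination[of x]
    by (intro CollectI exI[of _ "\<lambda>p. bary p x"]) auto
qed

lemma mem_interior_simplex: "x \<in> interior (convex hull C) \<longleftrightarrow> (\<forall>p\<in>C. 0 < bary p x)"
proof -
  have "interior (convex hull C) = {y. \<exists>u. (\<forall>x\<in>C. 0 < u x) \<and> sum u C = 1 \<and> (\<Sum>x\<in>C. u x *\<^sub>R x) = y}"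
    using interior_convex_hull_explicit_minimal[OF indep] card_C by simp
  moreover have "(\<exists>u. (\<forall>x\<in>C. 0 < u x) \<and> sum u C = 1 \<and> (\<Sum>x\<in>C. u x *\<^sub>R x) = x) \<longleftrightarrow> (\<forall>p\<in>C. 0 < bary p x)"
  proof
    assume "\<exists>u. (\<forall>x\<in>C. 0 < u x) \<and> sum u C = 1 \<and> (\<Sum>x\<in>C. u x *\<^sub>R x) = x"
    then show "\<forall>p\<in>C. 0 < bary p x" using bary_of_combination by auto
  next
    assume "\<forall>p\<in>C. 0 < bary p x"
    then show "\<exists>u. (\<forall>x\<in>C. 0 < u x) \<and> sum u C = 1 \<and> (\<Sum>x\<in>C. u x *\<^sub>R x) = x"
      using sum_bary[of x] bary_combination[of x] by (intro exI[of _ "\<lambda>p. bary p x"]) auto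
  qed
  ultimately show ?thesis by blast
qed

text \<open>Facets are labelled by the opposite vertex, so that \<open>face p\<close> lies in the
  zero set of \<open>bary p\<close>.\<close>

definition face :: "'a \<Rightarrow> 'a set" where "face p = convex hull (C - {p})"

lemma facet_iff: "F facet_of convex hull C \<longleftrightarrow> (\<exists>p\<in>C. F = face p)"
  using facet_of_convex_hull_affine_independent_alt[OF indep, of F] card_C DIM_positive[where 'a = 'a]
  by (auto simp: face_def Suc_le_eq)

lemma mem_face:
  assumes p: "p \<in> C"
  shows "x \<in> face p \<longleftrightarrow> (\<forall>q\<in>C. 0 \<le> bary q x) \<and> bary p x = 0"
proof
  assume "x \<in> face p"
  then have "x \<in> convex hull C" using hull_mono[of "C - {p}" C] by (auto simp: face_def)
  moreover obtain u where u: "sum u (C - {p}) = 1" "(\<Sum>x\<in>C - {p}. u x *\<^sub>R x) = x"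
    using \<open>x \<in> face p\<close> finite_C unfolding face_def by (subst (asm) convex_hull_finite) auto
  have "sum (u(p := 0)) C = 1" "(\<Sum>x\<in>C. (u(p := 0)) x *\<^sub>R x) = x"
    using u p finite_C by (simp_all add: sum.remove[OF _ p])
  from bary_of_combination[OF this(1) p] this(2) have "bary p x = 0" by simp
  ultimately show "(\<forall>q\<in>C. 0 \<le> bary q x) \<and> bary p x = 0" by (simp add: mem_simplex)
next
  assume a: "(\<forall>q\<in>C. 0 \<le> bary q x) \<and> bary p x = 0"
  have "sum (\<lambda>q. bary q x) (C - {p}) = 1" "(\<Sum>q\<in>C - {p}. bary q x *\<^sub>R q) = x"
    using sum_bary[of x] bary_combination[of x] a p finite_C by (simp_all add: sum.remove[OF _ p])
  then show "x \<in> face p"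
    unfolding face_def convex_hull_finite[OF finite_Diff[OF finite_C]] using a
    by (intro CollectI exI[of _ "\<lambda>q. bary q x"]) auto
qed

lemma face_inj: "p \<in> C \<Longrightarrow> q \<in> C \<Longrightarrow> face p = face q \<Longrightarrow> p = q"
proof (rule ccontr)
  assume pq: "p \<in> C" "q \<in> C" "face p = face q" "p \<noteq> q"
  then have "p \<in> face q" unfolding face_def by (intro hull_inc) auto
  then have "p \<in> face p" using pq by simp
  then show False using pq(1) by (simp add: mem_face[OF pq(1)] bary_vertex)
qed

lemma affine_hull_face:
  assumes p: "p \<in> C"
  shows "affine hull (face p) = {x. bary p x = 0}"
proof
  have "affine {x. bgrad p \<bullet> x = - snd (bary_coeff p)}" by (rule affine_hyperplane)
  then have "affine {x. bary p x = 0}" by (simp add: bary_def eq_neg_iff_add_eq_0)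
  then show "affine hull (face p) \<subseteq> {x. bary p x = 0}"
    by (intro hull_minimal) (auto simp: mem_face[OF p])
  show "{x. bary p x = 0} \<subseteq> affine hull (face p)"
  proof
    fix x assume "x \<in> {x. bary p x = 0}"
    then have a: "bary p x = 0" by simp
    have "sum (\<lambda>q. bary q x) (C - {p}) = 1" "(\<Sum>q\<in>C - {p}. bary q x *\<^sub>R q) = x"
      using sum_bary[of x] bary_combination[of x] a p finite_C by (simp_all add: sum.remove[OF _ p])
    then have "x \<in> affine hull (C - {p})"
      unfolding affine_hull_finite[OF finite_Diff[OF finite_C]] by (intro CollectI exI[of _ "\<lambda>q. bary q x"]) auto
    then show "x \<in> affine hull (face p)" by (simp add: face_def affine_hull_convex_hull)
  qed
qed

lemma mid_face:
  assumes p: "p \<in> C"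
  shows "mid (face p) = (\<Sum>q\<in>C - {p}. q) /\<^sub>R real DIM('a)"
proof -
  have "\<not> affine_dependent (C - {p})" using indep affine_independent_subset by blast
  then have "{x. x extreme_point_of face p} = C - {p}"
    unfolding face_def by (auto simp: extreme_point_of_convex_hull_affine_independent)
  moreover have "card (C - {p}) = DIM('a)" using p card_C finite_C by simp
  ultimately show ?thesis by (simp add: mid_def)
qed

lemma bary_mid_face:
  assumes p: "p \<in> C" and q: "q \<in> C"
  shows "bary q (mid (face p)) = (if q = p then 0 else 1 / real DIM('a))"
proof -
  let ?u = "\<lambda>r. if r = p then 0 else 1 / real DIM('a)"
  have c: "card (C - {p}) = DIM('a)" using p card_C finite_C by simp
  have "sum ?u C = (\<Sum>r\<in>C - {p}. 1 / real DIM('a))"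
    using p finite_C by (simp add: sum.remove[OF _ p])
  then have 1: "sum ?u C = 1" using c by simp
  have "(\<Sum>r\<in>C. ?u r *\<^sub>R r) = (\<Sum>r\<in>C - {p}. (1 / real DIM('a)) *\<^sub>R r)"
    using p finite_C by (simp add: sum.remove[OF _ p])
  then have "(\<Sum>r\<in>C. ?u r *\<^sub>R r) = mid (face p)"
    by (simp add: mid_face[OF p] scaleR_sum_right inverse_eq_divide)
  with bary_of_combination[OF 1 q] show ?thesis by simp
qed

lemma bgrad_nonzero: "p \<in> C \<Longrightarrow> bgrad p \<noteq> 0"
proof
  assume p: "p \<in> C" "bgrad p = 0"
  obtain q where "q \<in> C" "q \<noteq> p" using other_vertex by blast
  then show False using bary_diff[of p p q] p by (simp add: bary_vertex)
qed

section \<open>Surface integrals over the faces of a simplex\<close>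

text \<open>Projection onto the hyperplane of the face opposite to \<open>p\<close> along \<open>d\<close>, where
  \<open>bgrad p \<bullet> d = - 1\<close>, and the part of thickness \<open>2 r\<close> of the cylinder over the face in direction \<open>d\<close>.\<close>

definition proj :: "'a \<Rightarrow> 'a \<Rightarrow> 'a \<Rightarrow> 'a" where "proj p d x = x + bary p x *\<^sub>R d"

definition cyl :: "'a \<Rightarrow> 'a \<Rightarrow> real \<Rightarrow> 'a set" where
  "cyl p d r = {x. proj p d x \<in> face p \<and> \<bar>bary p x\<bar> \<le> r}"

definition cyl_integral :: "'a \<Rightarrow> 'a \<Rightarrow> ('a \<Rightarrow> real) \<Rightarrow> real" where
  "cyl_integral p d g = (\<integral>x. indicator (cyl p d (1/2)) x * g (proj p d x) \<partial>lborel)"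

text \<open>Not a unit vector: its length is the height of the simplex over \<open>face p\<close>,
  so that moving along it by 1 raises \<open>bary p\<close> by 1.\<close>

definition normal :: "'a \<Rightarrow> 'a" where "normal p = (1 / (bgrad p \<bullet> bgrad p)) *\<^sub>R bgrad p"

lemma compact_face: "compact (face p)"
  unfolding face_def using finite_C by (simp add: finite_imp_compact_convex_hull)

lemma continuous_proj: "continuous_on S (proj p d)"
  unfolding proj_def[abs_def] by (intro continuous_intros continuous_bary)

lemma proj_measurable[measurable]: "proj p d \<in> borel_measurable borel"
  by (intro borel_measurable_continuous_onI continuous_proj)

lemma compact_cyl: "compact (cyl p d r)"
proof -
  have "closed (proj p d -` face p)"
    by (rule closed_vimage[OF compact_imp_closed[OF compact_face] continuous_proj])
  moreover have "closed {x. \<bar>bary p x\<bar> \<le> r}"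
    by (intro closed_Collect_le continuous_intros continuous_bary)
  moreover have "cyl p d r = proj p d -` face p \<inter> {x. \<bar>bary p x\<bar> \<le> r}" by (auto simp: cyl_def)
  ultimately have c: "closed (cyl p d r)" by (simp add: closed_Int)
  obtain R where R: "\<And>x. x \<in> face p \<Longrightarrow> norm x \<le> R"
    using compact_imp_bounded[OF compact_face[of p]] by (auto simp: bounded_iff)
  have "norm x \<le> R + r * norm d" if "x \<in> cyl p d r" for x
  proof -
    have "x = proj p d x - bary p x *\<^sub>R d" by (simp add: proj_def)
    then have "norm x \<le> norm (proj p d x) + norm (bary p x *\<^sub>R d)" by (metis norm_triangle_ineq4)
    also have "\<dots> \<le> R + r * norm d"
      using that R by (intro add_mono) (auto simp: cyl_def intro: mult_right_mono)
    finally show ?thesis .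
  qed
  then have "bounded (cyl p d r)" by (auto simp: bounded_iff)
  then show ?thesis using c by (simp add: compact_eq_bounded_closed)
qed

lemma cyl_borel[measurable]: "cyl p d r \<in> sets borel"
  using compact_imp_closed[OF compact_cyl] by (rule borel_closed)

lemma bary_proj: "bgrad p \<bullet> d = - 1 \<Longrightarrow> bary p (proj p d x) = 0"
  by (simp add: proj_def bary_add)

lemma bgrad_normal: "p \<in> C \<Longrightarrow> bgrad p \<bullet> (- normal p) = - 1"
  using bgrad_nonzero by (simp add: normal_def)

lemma closest_point_face:
  assumes p: "p \<in> C"
  shows "closest_point (affine hull (face p)) x = proj p (- normal p) x"
    and "infdist x (affine hull (face p)) = \<bar>bary p x\<bar> / norm (bgrad p)"
proof -
  let ?H = "affine hull (face p)" and ?y = "proj p (- normal p) x"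
  have nz: "bgrad p \<noteq> 0" by (rule bgrad_nonzero[OF p])
  have "norm (normal p) = 1 / norm (bgrad p)"
    using nz by (simp add: normal_def power2_norm_eq_inner[symmetric] power2_eq_square)
  then have d: "dist x ?y = \<bar>bary p x\<bar> / norm (bgrad p)"
    by (simp add: proj_def dist_norm)
  have y: "?y \<in> ?H" using bary_proj[OF bgrad_normal[OF p]] by (simp add: affine_hull_face[OF p])
  have le: "dist x ?y \<le> dist x z" if "z \<in> ?H" for z
  proof -
    have "bary p x = bgrad p \<bullet> (x - z)" using that by (simp add: bary_diff affine_hull_face[OF p])
    then have "\<bar>bary p x\<bar> \<le> norm (bgrad p) * norm (x - z)" using Cauchy_Schwarz_ineq2 by simp
    then show ?thesis unfolding d using nz by (simp add: dist_norm divide_le_eq mult.commute)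
  qed
  have "?y = closest_point ?H x"
    by (rule closest_point_unique) (use y le in \<open>auto simp: affine_imp_convex\<close>)
  then show cp: "closest_point ?H x = ?y" by simp
  have "infdist x ?H = dist x ?y"
  proof (rule antisym)
    show "infdist x ?H \<le> dist x ?y" by (rule infdist_le[OF y])
    have "?H \<noteq> {}" using y by auto
    then show "dist x ?y \<le> infdist x ?H" using le by (simp add: infdist_def cINF_greatest)
  qed
  then show "infdist x ?H = \<bar>bary p x\<bar> / norm (bgrad p)" by (simp add: d)
qed

text \<open>The distance to the hyperplane is \<open>\<bar>bary p x\<bar> / norm (bgrad p)\<close>,
  so half-height 1/2 of the prism corresponds to \<open>norm (bgrad p) / 2\<close> in terms of
  \<open>bary p\<close>.\<close>

lemma surface_integral_orthogonal:
  fixes g :: "'a \<Rightarrow> real"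
  assumes p: "p \<in> C" and g[measurable]: "g \<in> borel_measurable borel"
  shows "(LINT x|surface_measure (face p). g x) =
    (\<integral>x. indicator (cyl p (- normal p) (norm (bgrad p) / 2)) x * g (proj p (- normal p) x) \<partial>lborel)"
proof -
  let ?A = "cyl p (- normal p) (norm (bgrad p) / 2)"
  have cp: "closest_point (affine hull (face p)) = proj p (- normal p)"
    using closest_point_face(1)[OF p] by blast
  have "\<bar>bary p x\<bar> / norm (bgrad p) \<le> 1 / 2 \<longleftrightarrow> \<bar>bary p x\<bar> \<le> norm (bgrad p) / 2" for x
    using bgrad_nonzero[OF p] by (simp add: divide_le_eq)
  then have A: "{x. closest_point (affine hull (face p)) x \<in> face p \<and> infdist x (affine hull (face p)) \<le> 1/2} = ?A"
    by (simp add: closest_point_face[OF p] cyl_def)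
  have [measurable]: "proj p (- normal p) \<in> measurable (restrict_space lborel ?A) borel"
    by (rule measurable_restrict_space1) measurable
  show ?thesis unfolding surface_measure_def A unfolding cp
    by (simp add: integral_distr integral_restrict_space)
qed

text \<open>An affine map carries the normal prism to the cylinder along \<open>d\<close> and
  intertwines the two projections. Its Jacobian \<open>K\<close> does not depend on
  \<open>g\<close>.\<close>

lemma surface_integral:
  assumes p: "p \<in> C" and d: "bgrad p \<bullet> d = - 1"
  shows "\<exists>K>0. \<forall>g. g \<in> borel_measurable borel \<longrightarrow>
    (LINT x|surface_measure (face p). g x) = K * cyl_integral p d g"
proof -
  \<comment> \<open>\<open>w\<close> is chosen such that \<open>x - bary p x *\<^sub>R w\<close> has
    barycentric coordinate \<open>bary p x / N\<close> and projects along \<open>d\<close> to the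
    normal projection of \<open>x\<close>. With \<open>w' = N *\<^sub>R w\<close> the inverse has
    the same shape.\<close>
  define G N w w' where "G = bgrad p" and "N = norm G" and "w = normal p + (1 / N) *\<^sub>R d"
    and "w' = d + N *\<^sub>R normal p"
  have N: "N > 0" using bgrad_nonzero[OF p] by (simp add: N_def G_def)
  have Gn: "G \<bullet> normal p = 1" using bgrad_normal[OF p] by (simp add: G_def)
  have Gd: "G \<bullet> d = - 1" using d by (simp add: G_def)
  have Gw: "G \<bullet> w = 1 - 1 / N" "G \<bullet> w' = N - 1" by (simp_all add: w_def w'_def inner_add_right Gn Gd)
  have ww': "w' = N *\<^sub>R w" using N by (simp add: w_def w'_def scaleR_add_right)
  let ?L = "\<lambda>x. x - (G \<bullet> x) *\<^sub>R w" and ?L' = "\<lambda>x. x + (G \<bullet> x) *\<^sub>R w'"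
  have lin: "linear ?L" "linear ?L'"
    by (auto intro!: linearI simp: inner_add_right algebra_simps)
  have inv: "?L (?L' x) = x" "?L' (?L x) = x" for x
  proof -
    have "G \<bullet> ?L' x = N * (G \<bullet> x)" by (simp add: inner_add_right Gw algebra_simps)
    then have "?L (?L' x) = x + (G \<bullet> x) *\<^sub>R w' - (N * (G \<bullet> x)) *\<^sub>R w" by (simp only:)
    then show "?L (?L' x) = x" by (simp add: ww' mult.commute)
    have "G \<bullet> ?L x = (G \<bullet> x) / N" by (simp add: inner_diff_right Gw algebra_simps)
    then have "?L' (?L x) = x - (G \<bullet> x) *\<^sub>R w + ((G \<bullet> x) / N) *\<^sub>R w'" by (simp only:)
    then show "?L' (?L x) = x" using N by (simp add: ww')
  qed
  define v where "v = - (snd (bary_coeff p) *\<^sub>R w)"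
  have Lv: "?L x + v = x - bary p x *\<^sub>R w" for x
    by (simp add: v_def bary_def G_def algebra_simps)
  have bL: "bary p (?L x + v) = bary p x / N" for x
  proof -
    have "bary p (x + - (bary p x *\<^sub>R w)) = bary p x - bary p x * (G \<bullet> w)"
      unfolding bary_add by (simp add: G_def)
    then show ?thesis unfolding Lv by (simp add: Gw algebra_simps)
  qed
  have pL: "proj p d (?L x + v) = proj p (- normal p) x" for x
  proof -
    have "proj p d (?L x + v) = (x - bary p x *\<^sub>R w) + (bary p x / N) *\<^sub>R d"
      unfolding proj_def bL by (simp only: Lv)
    then show ?thesis by (simp add: w_def proj_def algebra_simps)
  qed
  have "\<bar>bary p x / N\<bar> \<le> 1 / 2 \<longleftrightarrow> \<bar>bary p x\<bar> \<le> norm (bgrad p) / 2" for x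
    using N by (simp add: divide_le_eq N_def[symmetric] G_def[symmetric])
  then have ind: "indicator (cyl p d (1/2)) (?L x + v) = (indicator (cyl p (- normal p) (norm (bgrad p) / 2)) x :: real)" for x
    unfolding cyl_def indicator_def by (simp only: mem_Collect_eq pL bL)
  from integral_lborel_affine[OF lin inv, of v] obtain c where c: "c > 0"
    "\<And>h::'a \<Rightarrow> real. h \<in> borel_measurable borel \<Longrightarrow> (\<integral>x. h (?L x + v) \<partial>lborel) = c * (\<integral>x. h x \<partial>lborel)" by blast
  show ?thesis
  proof (intro exI[of _ c] conjI allI impI c(1))
    fix g :: "'a \<Rightarrow> real" assume g[measurable]: "g \<in> borel_measurable borel"
    have "(LINT x|surface_measure (face p). g x) =
      (\<integral>x. indicator (cyl p d (1/2)) (?L x + v) * g (proj p d (?L x + v)) \<partial>lborel)"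
      unfolding surface_integral_orthogonal[OF p g] ind pL ..
    also have "\<dots> = c * cyl_integral p d g"
      unfolding cyl_integral_def by (rule c(2)) measurable
    finally show "(LINT x|surface_measure (face p). g x) = c * cyl_integral p d g" .
  qed
qed

definition face_average :: "'a \<Rightarrow> ('a \<Rightarrow> real) \<Rightarrow> real" where
  "face_average p g = (LINT x|surface_measure (face p). g x) / measure (surface_measure (face p)) (face p)"

lemma cyl_integral_cong:
  "(\<And>x. x \<in> face p \<Longrightarrow> g x = h x) \<Longrightarrow> cyl_integral p d g = cyl_integral p d h"
  unfolding cyl_integral_def
  by (intro Bochner_Integration.integral_cong) (auto simp: indicator_def cyl_def)

lemma sets_surface_measure[measurable_cong]: "sets (surface_measure F) = sets borel"
  by (simp add: surface_measure_def)

text \<open>The factor from \<open>surface_integral\<close> cancels, so averages over a face may be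
  computed on a cylinder in any transversal direction.\<close>

lemma face_average_eq:
  assumes p: "p \<in> C" and d: "bgrad p \<bullet> d = - 1" and g: "g \<in> borel_measurable borel"
  shows "face_average p g = cyl_integral p d g / cyl_integral p d (\<lambda>_. 1)"
proof -
  from surface_integral[OF p d] obtain K where K: "K > 0"
    "\<And>g. g \<in> borel_measurable borel \<Longrightarrow> (LINT x|surface_measure (face p). g x) = K * cyl_integral p d g" by blast
  have F: "face p \<in> sets borel" using compact_imp_closed[OF compact_face] by (rule borel_closed)
  have "measure (surface_measure (face p)) (face p) = (LINT x|surface_measure (face p). indicator (face p) x)"
    using F by (simp add: sets_surface_measure)
  also have "\<dots> = K * cyl_integral p d (indicator (face p))" using F by (intro K(2)) simp
  also have "cyl_integral p d (indicator (face p)) = cyl_integral p d (\<lambda>_. 1)"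
    by (rule cyl_integral_cong) simp
  finally show ?thesis unfolding face_average_def using K g by simp
qed

lemma cyl_integrable:
  fixes g :: "'a \<Rightarrow> real"
  shows "continuous_on UNIV g \<Longrightarrow> integrable lborel (\<lambda>x. indicator (cyl p d (1/2)) x * g (proj p d x))"
  using borel_integrable_compact[OF compact_cyl[of p d "1/2"], of "\<lambda>x. g (proj p d x)"]
    continuous_on_compose2[of UNIV g "cyl p d (1/2)" "proj p d"] continuous_proj by simp

lemma cyl_integral_lincomb:
  assumes "finite S" "\<And>i. i \<in> S \<Longrightarrow> continuous_on UNIV (g i)"
  shows "cyl_integral p d (\<lambda>x. \<Sum>i\<in>S. c i * g i x) = (\<Sum>i\<in>S. c i * cyl_integral p d (g i))"
proof -
  have "cyl_integral p d (\<lambda>x. \<Sum>i\<in>S. c i * g i x) = (\<integral>x. (\<Sum>i\<in>S. c i * (indicator (cyl p d (1/2)) x * g i (proj p d x))) \<partial>lborel)"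
    unfolding cyl_integral_def by (simp add: sum_distrib_left mult_ac)
  also have "\<dots> = (\<Sum>i\<in>S. c i * cyl_integral p d (g i))"
    unfolding cyl_integral_def using cyl_integrable[OF assms(2)] by (subst Bochner_Integration.integral_sum) auto
  finally show ?thesis .
qed

end

section \<open>The divergence theorem along an edge\<close>

locale two_vertices = full_simplex +
  fixes P Q :: 'a
  assumes PQ: "P \<in> C" "Q \<in> C" "P \<noteq> Q"
begin

abbreviation "d \<equiv> Q - P"

lemma bgrad_d: "bgrad P \<bullet> d = - 1" "bgrad Q \<bullet> d = 1" "R \<in> C \<Longrightarrow> R \<noteq> P \<Longrightarrow> R \<noteq> Q \<Longrightarrow> bgrad R \<bullet> d = 0"
  using PQ by (auto simp: bary_diff bary_vertex)

lemma bary_line: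
  "bary P (y + t *\<^sub>R d) = bary P y - t" "bary Q (y + t *\<^sub>R d) = bary Q y + t"
  "R \<in> C \<Longrightarrow> R \<noteq> P \<Longrightarrow> R \<noteq> Q \<Longrightarrow> bary R (y + t *\<^sub>R d) = bary R y"
  using bgrad_d by (auto simp: bary_add)

text \<open>The union of the lines parallel to the edge that meet the simplex. Inside it, the
  simplex and both cylinders are described by the coordinates of \<open>P\<close> and
  \<open>Q\<close> alone.\<close>

definition Z :: "'a set" where
  "Z = {y. (\<forall>R\<in>C - {P, Q}. 0 \<le> bary R y) \<and> 0 \<le> bary P y + bary Q y}"

lemma Z_line: "y + t *\<^sub>R d \<in> Z \<longleftrightarrow> y \<in> Z"
  by (simp add: Z_def bary_line)

lemma Z_iff:
  assumes "bary Q z = bary P y + bary Q y" "\<And>R. R \<in> C \<Longrightarrow> R \<noteq> P \<Longrightarrow> R \<noteq> Q \<Longrightarrow> bary R z = bary R y" "bary P z = 0"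
  shows "(\<forall>q\<in>C. 0 \<le> bary q z) \<and> bary P z = 0 \<longleftrightarrow> y \<in> Z"
proof
  assume "(\<forall>q\<in>C. 0 \<le> bary q z) \<and> bary P z = 0"
  then have nn: "\<And>q. q \<in> C \<Longrightarrow> 0 \<le> bary q z" by blast
  show "y \<in> Z" unfolding Z_def
  proof (intro CollectI conjI ballI)
    fix R assume "R \<in> C - {P, Q}"
    then show "0 \<le> bary R y" using nn[of R] assms(2)[of R] by simp
  next
    show "0 \<le> bary P y + bary Q y" using nn[OF PQ(2)] assms(1) by simp
  qed
next
  assume y: "y \<in> Z"
  have "0 \<le> bary q z" if "q \<in> C" for q
  proof (cases "q = P \<or> q = Q")
    case True then show ?thesis using assms(1,3) y by (auto simp: Z_def)
  next
    case False then show ?thesis using assms(2)[of q] y that by (simp add: Z_def)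
  qed
  then show "(\<forall>q\<in>C. 0 \<le> bary q z) \<and> bary P z = 0" using assms(3) by blast
qed

lemma Z_iff':
  assumes "bary P z = bary P y + bary Q y" "\<And>R. R \<in> C \<Longrightarrow> R \<noteq> P \<Longrightarrow> R \<noteq> Q \<Longrightarrow> bary R z = bary R y" "bary Q z = 0"
  shows "(\<forall>q\<in>C. 0 \<le> bary q z) \<and> bary Q z = 0 \<longleftrightarrow> y \<in> Z"
proof -
  interpret sw: two_vertices C Q P by unfold_locales (use PQ in auto)
  have "y \<in> sw.Z \<longleftrightarrow> y \<in> Z" by (simp add: sw.Z_def Z_def insert_commute add.commute)
  moreover have "(\<forall>q\<in>C. 0 \<le> bary q z) \<and> bary Q z = 0 \<longleftrightarrow> y \<in> sw.Z"
    by (rule sw.Z_iff) (use assms in auto)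
  ultimately show ?thesis by simp
qed

lemma cyl_P: "y \<in> cyl P d (1/2) \<longleftrightarrow> y \<in> Z \<and> \<bar>bary P y\<bar> \<le> 1/2"
proof -
  define z where "z = proj P d y"
  have b: "bary P z = 0" "bary Q z = bary P y + bary Q y" "\<And>R. R \<in> C \<Longrightarrow> R \<noteq> P \<Longrightarrow> R \<noteq> Q \<Longrightarrow> bary R z = bary R y"
    by (simp_all add: z_def proj_def bary_line)
  have "z \<in> face P \<longleftrightarrow> y \<in> Z" unfolding mem_face[OF PQ(1)] by (rule Z_iff[OF b(2,3)]) (simp_all add: b(1))
  then show ?thesis by (auto simp: cyl_def z_def)
qed

lemma cyl_Q: "y \<in> cyl Q (P - Q) (1/2) \<longleftrightarrow> y \<in> Z \<and> \<bar>bary Q y\<bar> \<le> 1/2"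
proof -
  have eq: "proj Q (P - Q) y = y + (- bary Q y) *\<^sub>R d" by (simp add: proj_def scaleR_diff_right)
  have b: "bary P (proj Q (P - Q) y) = bary P y + bary Q y" "bary Q (proj Q (P - Q) y) = 0"
    "\<And>R. R \<in> C \<Longrightarrow> R \<noteq> P \<Longrightarrow> R \<noteq> Q \<Longrightarrow> bary R (proj Q (P - Q) y) = bary R y"
    unfolding eq by (subst bary_line(1), simp, subst bary_line(2), simp, rule bary_line(3))
  define z where "z = proj Q (P - Q) y"
  note b = b[folded z_def]
  have "z \<in> face Q \<longleftrightarrow> y \<in> Z" unfolding mem_face[OF PQ(2)] by (rule Z_iff'[OF b(1,3)]) (simp_all add: b(2))
  then show ?thesis by (auto simp: cyl_def z_def)
qed

lemma mem_T_iff: "x \<in> convex hull C \<longleftrightarrow> x \<in> Z \<and> 0 \<le> bary P x \<and> 0 \<le> bary Q x"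
  using PQ by (auto simp: mem_simplex Z_def)

lemma Z_bound:
  assumes "y \<in> Z"
  shows "bary P y + bary Q y \<le> 1"
proof -
  have "(\<Sum>R\<in>C. bary R y) = bary P y + (bary Q y + (\<Sum>R\<in>C - {P} - {Q}. bary R y))"
    using PQ finite_C by (simp add: sum.remove[of C P] sum.remove[of "C - {P}" Q])
  moreover have "0 \<le> (\<Sum>R\<in>C - {P} - {Q}. bary R y)"
    using assms by (intro sum_nonneg) (auto simp: Z_def)
  ultimately show ?thesis using sum_bary[of y] by linarith
qed

text \<open>Its integral is 1 after any shift, so a factor \<open>win (bary P y + t)\<close> adds a
  variable t for free. After the shear along the edge the factor is constant in t and expresses
  membership in the cylinder at \<open>P\<close>.\<close>

definition win :: "real \<Rightarrow> real" where "win t = (if \<bar>t\<bar> \<le> 1/2 then 1 else 0)"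

lemma win_measurable[measurable]: "win \<in> borel_measurable borel"
  unfolding win_def[abs_def] by measurable

lemma unit_window: "(\<integral>t. win (s + t) \<partial>lborel) = 1"
proof -
  have "(\<lambda>t. win (s + t)) = indicator {- s - 1/2 .. - s + 1/2}"
  proof
    fix t
    have "\<bar>s + t\<bar> \<le> 1/2 \<longleftrightarrow> t \<in> {- s - 1/2 .. - s + 1/2}" unfolding atLeastAtMost_iff by arith
    then show "win (s + t) = indicator {- s - 1/2 .. - s + 1/2} t"
      unfolding win_def by (cases "\<bar>s + t\<bar> \<le> 1/2") (simp_all only: indicator_simps if_True if_False simp_thms)
  qed
  then show ?thesis by simp
qed

text \<open>The two cylinders cut the same lines in different segments of equal parameter length. A
  window at \<open>P\<close> is inserted, the shear moves t into the condition at \<open>Q\<close>,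
  and that condition integrates to 1.\<close>

lemma window_swap:
  assumes "continuous_on UNIV \<phi>"
  shows "cyl_integral Q (P - Q) \<phi> = (\<integral>y. indicator (cyl P d (1/2)) y * \<phi> (proj Q (P - Q) y) \<partial>lborel)"
proof -
  let ?h = "\<lambda>y. indicator (cyl Q (P - Q) (1/2)) y * \<phi> (proj Q (P - Q) y)"
  let ?f = "\<lambda>y t. ?h y * win (bary P y + t)"
  have [measurable]: "\<phi> \<in> borel_measurable borel" using assms by (rule borel_measurable_continuous_onI)
  have hm[measurable]: "?h \<in> borel_measurable borel" by measurable
  have "compact ((\<lambda>y. \<phi> (proj Q (P - Q) y)) ` cyl Q (P - Q) (1/2))"
    by (intro compact_continuous_image compact_cyl continuous_on_compose2[OF assms continuous_proj]) auto
  then obtain B where B: "\<And>y. y \<in> cyl Q (P - Q) (1/2) \<Longrightarrow> \<bar>\<phi> (proj Q (P - Q) y)\<bar> \<le> B"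
    using compact_imp_bounded by (fastforce simp: bounded_iff)
  have int: "integrable (lborel \<Otimes>\<^sub>M lborel) (\<lambda>(y, t). ?f y t)"
    unfolding lborel_prod
  proof (rule integrable_lborel_bounded_support[where C = "max B 0" and S = "cyl Q (P - Q) (1/2) \<times> {-2..2}"])
    show "(\<lambda>(y, t). ?f y t) \<in> borel_measurable borel" unfolding borel_prod[symmetric] by measurable
    show "\<bar>(\<lambda>(y, t). ?f y t) z\<bar> \<le> max B 0" for z
      using B[of "fst z"] by (cases z) (auto simp: indicator_def win_def)
    show "bounded (cyl Q (P - Q) (1/2) \<times> {-2..2::real})"
      using compact_imp_bounded[OF compact_cyl] by (intro bounded_Times) auto
    show "(\<lambda>(y, t). ?f y t) z = 0" if "z \<notin> cyl Q (P - Q) (1/2) \<times> {-2..2}" for z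
    proof (cases z)
      case (Pair y t)
      show ?thesis
      proof (cases "y \<in> cyl Q (P - Q) (1/2) \<and> \<bar>bary P y + t\<bar> \<le> 1/2")
        case True
        then have "y \<in> Z" "\<bar>bary Q y\<bar> \<le> 1/2" by (auto simp: cyl_Q)
        moreover from this have "0 \<le> bary P y + bary Q y" by (simp add: Z_def)
        ultimately have "\<bar>t\<bar> \<le> 2" using Z_bound[of y] conjunct2[OF True] by arith
        then show ?thesis using that True Pair by (auto simp: abs_le_iff)
      qed (auto simp: Pair win_def)
    qed
  qed
  have sh: "?f (y + t *\<^sub>R d) t = indicator (cyl P d (1/2)) y * \<phi> (proj Q (P - Q) y) * win (bary Q y + t)" for y t
  proof -
    have "proj Q (P - Q) (y + t *\<^sub>R d) = proj Q (P - Q) y"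
      unfolding proj_def bary_line by (simp add: algebra_simps)
    then show ?thesis by (auto simp: indicator_def win_def cyl_P cyl_Q Z_line bary_line)
  qed
  have "cyl_integral Q (P - Q) \<phi> = (\<integral>y. \<integral>t. ?f y t \<partial>lborel \<partial>lborel)"
    by (simp add: cyl_integral_def unit_window)
  also have "\<dots> = (\<integral>y. \<integral>t. ?f (y + t *\<^sub>R d) t \<partial>lborel \<partial>lborel)"
    by (rule integral_shift(1)[symmetric, OF int])
  also have "\<dots> = (\<integral>y. indicator (cyl P d (1/2)) y * \<phi> (proj Q (P - Q) y) \<partial>lborel)"
    unfolding sh by (simp add: unit_window)
  finally show ?thesis .
qed

text \<open>Every line in the direction of the edge from \<open>P\<close> to \<open>Q\<close> enters through the face opposite to \<open>Q\<close> and leaves through the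
  face opposite to \<open>P\<close>.\<close>

lemma edge_divergence:
  assumes \<phi>: "\<And>x. (\<phi> has_derivative (\<lambda>h. p x \<bullet> h)) (at x)" and p: "continuous_on UNIV p"
  shows "(\<integral>x. indicator (convex hull C) x * (p x \<bullet> d) \<partial>lborel) = cyl_integral P d \<phi> - cyl_integral Q (P - Q) \<phi>"
proof -
  have c\<phi>: "continuous_on UNIV \<phi>"
    by (intro continuous_at_imp_continuous_on ballI has_derivative_continuous[OF \<phi>])
  have [measurable]: "p \<in> borel_measurable borel" using p by (rule borel_measurable_continuous_onI)
  let ?T = "convex hull C"
  have T: "compact ?T" using finite_C by (rule finite_imp_compact_convex_hull)
  have [measurable]: "?T \<in> sets borel" using compact_imp_closed[OF T] by (rule borel_closed)
  let ?f = "\<lambda>y t. indicator ?T y * (p y \<bullet> d) * win (bary P y + t)"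
  have "compact ((\<lambda>y. p y \<bullet> d) ` ?T)"
    by (intro compact_continuous_image T continuous_intros continuous_on_subset[OF p]) auto
  then obtain B where B: "\<And>y. y \<in> ?T \<Longrightarrow> \<bar>p y \<bullet> d\<bar> \<le> B"
    using compact_imp_bounded by (fastforce simp: bounded_iff)
  have int: "integrable (lborel \<Otimes>\<^sub>M lborel) (\<lambda>(y, t). ?f y t)"
    unfolding lborel_prod
  proof (rule integrable_lborel_bounded_support[where C = "max B 0" and S = "?T \<times> {-2..2}"])
    show "(\<lambda>(y, t). ?f y t) \<in> borel_measurable borel" unfolding borel_prod[symmetric] by measurable
    show "\<bar>(\<lambda>(y, t). ?f y t) z\<bar> \<le> max B 0" for z
      using B[of "fst z"] by (cases z) (auto simp: indicator_def win_def)
    show "bounded (?T \<times> {-2..2::real})"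
      using compact_imp_bounded[OF T] by (intro bounded_Times) auto
    show "(\<lambda>(y, t). ?f y t) z = 0" if "z \<notin> ?T \<times> {-2..2}" for z
    proof (cases z)
      case (Pair y t)
      show ?thesis
      proof (cases "y \<in> ?T \<and> \<bar>bary P y + t\<bar> \<le> 1/2")
        case True
        then have "y \<in> Z" "0 \<le> bary P y" "0 \<le> bary Q y" by (auto simp: mem_T_iff)
        then have "\<bar>t\<bar> \<le> 2" using Z_bound[of y] conjunct2[OF True] by arith
        then show ?thesis using that True Pair by (auto simp: abs_le_iff)
      qed (auto simp: Pair win_def)
    qed
  qed
  have line: "(\<integral>t. ?f (y + t *\<^sub>R d) t \<partial>lborel)
    = indicator (cyl P d (1/2)) y * (\<phi> (proj P d y) - \<phi> (proj Q (P - Q) y))" for y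
  proof (cases "y \<in> cyl P d (1/2)")
    case True
    then have y: "y \<in> Z" "\<bar>bary P y\<bar> \<le> 1/2" "- bary Q y \<le> bary P y" by (auto simp: cyl_P Z_def)
    \<comment> \<open>What remains is the parameter interval on which the line stays in the simplex:
      \<open>bary P y - t\<close> and \<open>bary Q y + t\<close> must both be nonnegative.\<close>
    have "(\<lambda>t. ?f (y + t *\<^sub>R d) t) = (\<lambda>t. indicator {- bary Q y..bary P y} t * (p (y + t *\<^sub>R d) \<bullet> d))"
      using y by (intro ext) (auto simp: indicator_def win_def mem_T_iff Z_line bary_line)
    then have "(\<integral>t. ?f (y + t *\<^sub>R d) t \<partial>lborel) = (\<integral>t. indicator {- bary Q y..bary P y} t * (p (y + t *\<^sub>R d) \<bullet> d) \<partial>lborel)"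
      by (rule arg_cong)
    also have "\<dots> = \<phi> (y + bary P y *\<^sub>R d) - \<phi> (y + (- bary Q y) *\<^sub>R d)"
      by (rule line_integral(1)[OF \<phi> p y(3)])
    also have "y + (- bary Q y) *\<^sub>R d = proj Q (P - Q) y" by (simp add: proj_def algebra_simps)
    also have "y + bary P y *\<^sub>R d = proj P d y" by (simp add: proj_def)
    finally show ?thesis using True by simp
  next
    case False
    then have "(\<lambda>t. ?f (y + t *\<^sub>R d) t) = (\<lambda>_. 0)"
      by (intro ext) (auto simp: indicator_def win_def mem_T_iff Z_line bary_line cyl_P)
    then have "(\<integral>t. ?f (y + t *\<^sub>R d) t \<partial>lborel) = (\<integral>t. 0 \<partial>(lborel :: real measure))" by (rule arg_cong)
    then show ?thesis using False by simp
  qed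
  have i: "integrable lborel (\<lambda>y. indicator (cyl P d (1/2)) y * \<phi> (proj P d y))"
    "integrable lborel (\<lambda>y. indicator (cyl P d (1/2)) y * \<phi> (proj Q (P - Q) y))"
  proof -
    have "continuous_on (cyl P d (1/2)) (\<lambda>x. \<phi> (proj Q (P - Q) x))"
      by (rule continuous_on_compose2[OF c\<phi> continuous_proj]) simp
    from borel_integrable_compact[OF compact_cyl this]
    show "integrable lborel (\<lambda>y. indicator (cyl P d (1/2)) y * \<phi> (proj Q (P - Q) y))" by simp
  qed (rule cyl_integrable[OF c\<phi>])
  have "(\<integral>x. indicator ?T x * (p x \<bullet> d) \<partial>lborel) = (\<integral>y. \<integral>t. ?f y t \<partial>lborel \<partial>lborel)"
    by (simp add: unit_window)
  also have "\<dots> = (\<integral>y. \<integral>t. ?f (y + t *\<^sub>R d) t \<partial>lborel \<partial>lborel)"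
    by (rule integral_shift(1)[symmetric, OF int])
  also have "\<dots> = cyl_integral P d \<phi> - cyl_integral Q (P - Q) \<phi>"
    unfolding line window_swap[OF c\<phi>] unfolding cyl_integral_def using i by (simp add: right_diff_distrib)
  finally show ?thesis .
qed

end

section \<open>Averages of barycentric coordinates over faces\<close>

context full_simplex
begin

definition vol :: real where "vol = measure lborel (convex hull C)"

lemma vol_integral: "(\<integral>x. indicator (convex hull C) x * c \<partial>lborel) = vol * c"
proof -
  have "compact (convex hull C)" using finite_C by (rule finite_imp_compact_convex_hull)
  then have "convex hull C \<in> sets borel" using compact_imp_closed borel_closed by blast
  then show ?thesis by (simp add: vol_def)
qed

lemma interior_nonempty: "interior (convex hull C) \<noteq> {}"
proof -
  let ?u = "\<lambda>p::'a. 1 / real (card C)"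
  have s: "sum ?u C = 1" using card_C by simp
  have "(\<Sum>q\<in>C. ?u q *\<^sub>R q) \<in> interior (convex hull C)"
    unfolding mem_interior_simplex using bary_of_combination[OF s] card_C by simp
  then show ?thesis by blast
qed

lemma vol_pos: "vol > 0"
proof -
  have c: "compact (convex hull C)" using finite_C by (rule finite_imp_compact_convex_hull)
  have "\<not> negligible (interior (convex hull C))"
    by (rule open_not_negligible) (use interior_nonempty in auto)
  then have "\<not> negligible (convex hull C)" using negligible_subset interior_subset by blast
  moreover have "convex hull C \<in> lmeasurable" by (rule lmeasurable_compact[OF c])
  ultimately have "measure lebesgue (convex hull C) \<noteq> 0" by (simp add: negligible_iff_measure0)
  moreover have "measure lebesgue (convex hull C) = vol"
    unfolding vol_def using borel_closed[OF compact_imp_closed[OF c]] by simp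
  ultimately have "vol \<noteq> 0" by simp
  moreover have "vol \<ge> 0" unfolding vol_def by (rule measure_nonneg)
  ultimately show ?thesis by linarith
qed

lemma bary_has_derivative: "(bary r has_derivative (\<lambda>h. bgrad r \<bullet> h)) (at x)"
  unfolding bary_def[abs_def] by (auto intro!: derivative_eq_intros)

text \<open>All are instances of \<open>edge_divergence\<close>: the constant 1 shows that both
  cylinders have the same volume, \<open>bary Q\<close> relates this volume to \<open>vol\<close>,
  and any third coordinate is constant along the edge, so its two averages agree.\<close>

lemma
  assumes PQ: "P \<in> C" "Q \<in> C" "P \<noteq> Q"
  shows edge_formula_aux: "\<And>\<phi> p. (\<And>x. (\<phi> has_derivative (\<lambda>h. p x \<bullet> h)) (at x)) \<Longrightarrow> continuous_on UNIV p \<Longrightarrow>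
      (\<integral>x. indicator (convex hull C) x * (p x \<bullet> (Q - P)) \<partial>lborel)
      = cyl_integral P (Q - P) (\<lambda>_. 1) * (face_average P \<phi> - face_average Q \<phi>)"
    and cyl_vol_sym: "cyl_integral P (Q - P) (\<lambda>_. 1) = cyl_integral Q (P - Q) (\<lambda>_. 1)"
    and cyl_vol_average: "cyl_integral P (Q - P) (\<lambda>_. 1) * face_average P (bary Q) = vol"
    and average_eq: "\<And>R. R \<in> C \<Longrightarrow> R \<noteq> P \<Longrightarrow> R \<noteq> Q \<Longrightarrow> face_average P (bary R) = face_average Q (bary R)"
    and cyl_vol_pos: "cyl_integral P (Q - P) (\<lambda>_. 1) > 0"
proof -
  interpret two_vertices C P Q by unfold_locales (use PQ in auto)
  let ?V = "cyl_integral P (Q - P) (\<lambda>_. 1)"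
  have bm: "bary R \<in> borel_measurable borel" for R by (rule bary_measurable)
  have Q0: "cyl_integral Q (P - Q) (bary Q) = 0"
    using cyl_integral_cong[of Q "bary Q" "\<lambda>_. 0"] mem_face[OF PQ(2)] by (simp add: cyl_integral_def)
  have "cyl_integral P (Q - P) (bary Q) = vol"
    using edge_divergence[of "bary Q" "\<lambda>_. bgrad Q", OF bary_has_derivative continuous_on_const]
    unfolding Q0 bgrad_d(2) vol_integral by simp
  \<comment> \<open>\<open>bary Q\<close> is at most 1 on the face, so the volume of the cylinder is
    at least \<open>vol\<close> and therefore positive.\<close>
  moreover have "cyl_integral P (Q - P) (bary Q) \<le> ?V"
    unfolding cyl_integral_def
  proof (rule integral_mono)
    show "integrable lborel (\<lambda>x. indicator (cyl P (Q - P) (1/2)) x * bary Q (proj P (Q - P) x))"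
      by (rule cyl_integrable[OF continuous_bary])
    show "integrable lborel (\<lambda>x. indicator (cyl P (Q - P) (1/2)) x * (1::real))"
      by (rule cyl_integrable[of "\<lambda>_. 1"]) auto
    fix x
    show "indicator (cyl P (Q - P) (1/2)) x * bary Q (proj P (Q - P) x) \<le> indicator (cyl P (Q - P) (1/2)) x * 1"
    proof (cases "x \<in> cyl P (Q - P) (1/2)")
      case True
      then have "proj P (Q - P) x \<in> face P" by (simp add: cyl_def)
      then have nn: "\<And>r. r \<in> C \<Longrightarrow> 0 \<le> bary r (proj P (Q - P) x)" by (simp add: mem_face[OF PQ(1)])
      have "bary Q (proj P (Q - P) x) \<le> (\<Sum>r\<in>C. bary r (proj P (Q - P) x))"
        using nn PQ(2) finite_C by (intro member_le_sum) auto
      then show ?thesis using True by (simp add: sum_bary)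
    qed simp
  qed
  ultimately show V: "?V > 0" using vol_pos by simp
  have neg: "bgrad Q \<bullet> (P - Q) = - 1" using bgrad_d(2) by (simp add: inner_diff_right)
  have zero: "cyl_integral P (Q - P) (\<lambda>_. 1) - cyl_integral Q (P - Q) (\<lambda>_. 1) = 0"
    using edge_divergence[of "\<lambda>_. 1" "\<lambda>_. 0"] by simp
  then show "?V = cyl_integral Q (P - Q) (\<lambda>_. 1)" by simp
  have av: "cyl_integral P (Q - P) \<phi> = ?V * face_average P \<phi>" "cyl_integral Q (P - Q) \<phi> = ?V * face_average Q \<phi>"
    if "\<phi> \<in> borel_measurable borel" for \<phi>
    using face_average_eq[OF PQ(1) bgrad_d(1) that] face_average_eq[OF PQ(2) neg that] V zero by auto
  show F: "(\<integral>x. indicator (convex hull C) x * (p x \<bullet> (Q - P)) \<partial>lborel) = ?V * (face_average P \<phi> - face_average Q \<phi>)"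
    if "\<And>x. (\<phi> has_derivative (\<lambda>h. p x \<bullet> h)) (at x)" "continuous_on UNIV p" for \<phi> p
  proof -
    have "\<phi> \<in> borel_measurable borel"
      by (intro borel_measurable_continuous_onI continuous_at_imp_continuous_on ballI has_derivative_continuous[OF that(1)])
    from edge_divergence[OF that] av[OF this] show ?thesis by (simp add: right_diff_distrib)
  qed
  show "?V * face_average P (bary Q) = vol"
    using av(1)[OF bm, of Q] \<open>cyl_integral P (Q - P) (bary Q) = vol\<close> by simp
  show "face_average P (bary R) = face_average Q (bary R)" if R: "R \<in> C" "R \<noteq> P" "R \<noteq> Q" for R
    using F[of "bary R" "\<lambda>_. bgrad R", OF bary_has_derivative continuous_on_const] bgrad_d(3)[OF R] V by simp
qed

text \<open>No integral is evaluated. Over \<open>face P\<close> the coordinates other than that of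
  \<open>P\<close> have equal averages by symmetry, \<open>bary P\<close> has average 0, and all
  averages add up to 1.\<close>

lemma face_average_bary:
  assumes P: "P \<in> C" and R: "R \<in> C"
  shows "face_average P (bary R) = bary R (mid (face P))"
proof -
  obtain Q0 where Q0: "Q0 \<in> C" "Q0 \<noteq> P" using other_vertex by blast
  have d: "bgrad P \<bullet> (Q0 - P) = - 1" using Q0 P by (simp add: bary_diff bary_vertex)
  have V: "cyl_integral P (Q0 - P) (\<lambda>_. 1) > 0" using cyl_vol_pos[of P Q0] P Q0 by simp
  have av: "face_average P g = cyl_integral P (Q0 - P) g / cyl_integral P (Q0 - P) (\<lambda>_. 1)"
    if "g \<in> borel_measurable borel" for g by (rule face_average_eq[OF P d that])
  have PP: "face_average P (bary P) = 0"
    unfolding av[OF bary_measurable]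
    using cyl_integral_cong[of P "bary P" "\<lambda>_. 0" "Q0 - P"] mem_face[OF P] by (simp add: cyl_integral_def)
  have symm: "face_average A (bary B) = face_average B (bary A)" if "A \<in> C" "B \<in> C" "A \<noteq> B" for A B
    using cyl_vol_average[of A B] cyl_vol_average[of B A] cyl_vol_sym[of A B] cyl_vol_pos[of A B] that
    by (metis mult_left_cancel less_irrefl)
  have eq: "face_average P (bary r) = face_average P (bary Q0)" if r: "r \<in> C" "r \<noteq> P" for r
  proof (cases "r = Q0")
    case False
    have "face_average P (bary r) = face_average Q0 (bary r)" using average_eq[of P Q0 r] P Q0 r False by simp
    also have "\<dots> = face_average r (bary Q0)" using symm[of Q0 r] Q0 r False by simp
    also have "\<dots> = face_average P (bary Q0)" using average_eq[of r P Q0] P Q0 r False by simp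
    finally show ?thesis .
  qed simp
  have "1 = face_average P (\<lambda>x. \<Sum>r\<in>C. 1 * bary r x)"
    unfolding sum_bary mult_1 using V by (subst av) auto
  also have "\<dots> = (\<Sum>r\<in>C. 1 * cyl_integral P (Q0 - P) (bary r)) / cyl_integral P (Q0 - P) (\<lambda>_. 1)"
    by (subst av) (simp_all only: cyl_integral_lincomb[OF finite_C continuous_bary], measurable)
  also have "\<dots> = (\<Sum>r\<in>C. face_average P (bary r))"
    by (simp add: av[OF bary_measurable] sum_divide_distrib)
  also have "\<dots> = (\<Sum>r\<in>C - {P}. face_average P (bary Q0))"
    using PP eq P finite_C by (simp add: sum.remove[OF _ P])
  also have "\<dots> = real DIM('a) * face_average P (bary Q0)"
    using P card_C finite_C by simp
  finally have "face_average P (bary Q0) = 1 / real DIM('a)" by (simp add: field_simps)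
  then show ?thesis using PP eq[of R] R by (simp add: bary_mid_face[OF P R])
qed

text \<open>The factor is the volume of the cylinder: \<open>vol\<close> divided by the average
  \<open>1 / DIM('a)\<close> of \<open>bary Q\<close> over \<open>face P\<close>.\<close>

theorem edge_formula:
  assumes "P \<in> C" "Q \<in> C" "P \<noteq> Q"
    and "\<And>x. (\<phi> has_derivative (\<lambda>h. p x \<bullet> h)) (at x)" "continuous_on UNIV p"
  shows "(\<integral>x. indicator (convex hull C) x * (p x \<bullet> (Q - P)) \<partial>lborel)
      = real DIM('a) * vol * (face_average P \<phi> - face_average Q \<phi>)"
proof -
  have "face_average P (bary Q) = 1 / real DIM('a)"
    using assms by (simp add: face_average_bary bary_mid_face)
  from cyl_vol_average[OF assms(1-3), unfolded this]
  have "cyl_integral P (Q - P) (\<lambda>_. 1) = real DIM('a) * vol"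
    by (simp add: field_simps)
  then show ?thesis using edge_formula_aux[OF assms] by simp
qed

end

section \<open>Completeness of square integrable functions\<close>

text \<open>On a finite measure space an L2 Cauchy sequence is L1 Cauchy, so a subsequence converges
  almost everywhere; Fatou's lemma then gives convergence in L2 to that pointwise limit.\<close>

lemma L2_Cauchy_subsequence_limit:
  fixes f :: "nat \<Rightarrow> 'a \<Rightarrow> real"
  assumes M: "finite_measure M" and f: "\<And>j. f j \<in> L2_space M"
    and Cau: "\<And>e. e > 0 \<Longrightarrow> \<exists>N. \<forall>i\<ge>N. \<forall>j\<ge>N. (LINT x|M. (f i x - f j x)\<^sup>2) < e"
  shows "\<exists>r g. strict_mono r \<and> g \<in> L2_space M \<and> (\<lambda>j. L2_norm M (\<lambda>x. f (r j) x - g x)) \<longlonglongrightarrow> 0"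
proof -
  interpret finite_measure M by (rule M)
  note S = sym_form_L2_inner[of M]
  have fm[measurable]: "f j \<in> borel_measurable M" for j using f by (rule L2_space_measurable)
  have one: "(\<lambda>_. 1::real) \<in> L2_space M" by (simp add: L2_space_def)
  have diff: "(\<lambda>x. f i x - f j x) \<in> L2_space M" for i j by (rule lin_closed_diff[OF lin_closed_L2_space f f])
  have abs: "(\<lambda>x. \<bar>f i x - f j x\<bar>) \<in> L2_space M" for i j using diff[of i j] by (simp add: L2_space_def)
  have int: "integrable M (f j)" for j using L2_space_mult_integrable[OF f one] by simp
  define c where "c = measure M (space M)"
  have L1: "(LINT x|M. norm (f i x - f j x))\<^sup>2 \<le> (LINT x|M. (f i x - f j x)\<^sup>2) * c" for i j
    using sym_form.Cauchy_Schwarz[OF S abs[of i j] one] by (simp add: c_def power2_eq_square)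
  obtain r where r: "strict_mono r" "AE x in M. Cauchy (\<lambda>i. f (r i) x)"
  proof (rule cauchy_L1_AE_cauchy_subseq[of M f])
    show "integrable M (f n)" for n by (rule int)
    fix e :: real assume e: "e > 0"
    \<comment> \<open>Cauchy-Schwarz bounds the squared L1 distance by \<open>c\<close> times the
      squared L2 distance; adding 1 covers \<open>c = 0\<close>.\<close>
    define e' where "e' = e\<^sup>2 / (c + 1)"
    have c0: "c \<ge> 0" by (simp add: c_def)
    then have "e' > 0" using e by (simp add: e'_def)
    from Cau[OF this] obtain N where N: "\<forall>i\<ge>N. \<forall>j\<ge>N. (LINT x|M. (f i x - f j x)\<^sup>2) < e'" by blast
    have "(LINT x|M. norm (f i x - f j x)) < e" if "i \<ge> N" "j \<ge> N" for i j
    proof (rule power_less_imp_less_base[of _ 2])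
      have "(LINT x|M. (f i x - f j x)\<^sup>2) * c \<le> e' * c" using N[rule_format, OF that] c0 by (intro mult_right_mono) auto
      also have "\<dots> < e\<^sup>2" using c0 e by (simp add: e'_def divide_less_eq mult.commute)
      finally show "(LINT x|M. norm (f i x - f j x))\<^sup>2 < e\<^sup>2" using L1[of i j] by linarith
    qed (use e in simp)
    then show "\<exists>N. \<forall>i\<ge>N. \<forall>j\<ge>N. (LINT x|M. norm (f i x - f j x)) < e" by blast
  qed blast
  define g where "g = (\<lambda>x. lim (\<lambda>i. f (r i) x))"
  have gm[measurable]: "g \<in> borel_measurable M" unfolding g_def by (rule borel_measurable_lim_metric) measurable
  have lim: "AE x in M. (\<lambda>i. f (r i) x) \<longlonglongrightarrow> g x"
    using r(2) by eventually_elim (simp add: g_def convergent_LIMSEQ_iff[symmetric] real_Cauchy_convergent)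
  have tail: "\<exists>N. \<forall>i\<ge>N. (\<integral>\<^sup>+x. ennreal ((f (r i) x - g x)\<^sup>2) \<partial>M) \<le> ennreal e" if e: "e > 0" for e
  proof -
    from Cau[OF e] obtain N where N: "\<forall>i\<ge>N. \<forall>j\<ge>N. (LINT x|M. (f i x - f j x)\<^sup>2) < e" by blast
    have "(\<integral>\<^sup>+x. ennreal ((f (r i) x - g x)\<^sup>2) \<partial>M) \<le> ennreal e" if i: "i \<ge> N" for i
    proof -
      have "(\<integral>\<^sup>+x. ennreal ((f (r i) x - g x)\<^sup>2) \<partial>M) = (\<integral>\<^sup>+x. liminf (\<lambda>j. ennreal ((f (r i) x - f (r j) x)\<^sup>2)) \<partial>M)"
      proof (rule nn_integral_cong_AE)
        show "AE x in M. ennreal ((f (r i) x - g x)\<^sup>2) = liminf (\<lambda>j. ennreal ((f (r i) x - f (r j) x)\<^sup>2))"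
          using lim
        proof eventually_elim
          case (elim x)
          then have "(\<lambda>j. ennreal ((f (r i) x - f (r j) x)\<^sup>2)) \<longlonglongrightarrow> ennreal ((f (r i) x - g x)\<^sup>2)"
            by (intro tendsto_intros) auto
          from lim_imp_Liminf[OF sequentially_bot this] show ?case by (rule sym)
        qed
      qed
      also have "\<dots> \<le> liminf (\<lambda>j. \<integral>\<^sup>+x. ennreal ((f (r i) x - f (r j) x)\<^sup>2) \<partial>M)"
        by (rule nn_integral_liminf) measurable
      also have "\<dots> \<le> ennreal e"
      proof -
        have "(\<integral>\<^sup>+x. ennreal ((f (r i) x - f (r j) x)\<^sup>2) \<partial>M) \<le> ennreal e" if "j \<ge> N" for j
        proof -
          have "integrable M (\<lambda>x. (f (r i) x - f (r j) x)\<^sup>2)"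
            using L2_space_integrable[OF diff] by simp
          then have "(\<integral>\<^sup>+x. ennreal ((f (r i) x - f (r j) x)\<^sup>2) \<partial>M) = ennreal (LINT x|M. (f (r i) x - f (r j) x)\<^sup>2)"
            by (subst nn_integral_eq_integral) auto
          moreover have "r i \<ge> N" "r j \<ge> N" using seq_suble[OF r(1)] i that order_trans by blast+
          ultimately show ?thesis using N by (simp add: ennreal_leI less_imp_le)
        qed
        then have "\<forall>\<^sub>F j in sequentially. (\<integral>\<^sup>+x. ennreal ((f (r i) x - f (r j) x)\<^sup>2) \<partial>M) \<le> ennreal e"
          by (auto simp: eventually_sequentially)
        then show ?thesis
          by (intro Liminf_le) auto
      qed
      finally show ?thesis .
    qed
    then show ?thesis by blast
  qed
  have gL2: "g \<in> L2_space M"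
  proof -
    obtain N where N: "\<forall>i\<ge>N. (\<integral>\<^sup>+x. ennreal ((f (r i) x - g x)\<^sup>2) \<partial>M) \<le> ennreal 1" using tail[of 1] by auto
    have "integrable M (\<lambda>x. (f (r N) x - g x)\<^sup>2)"
      using N[rule_format, of N] by (intro integrableI_bounded) (auto intro: le_less_trans)
    then have "(\<lambda>x. f (r N) x - g x) \<in> L2_space M" by (simp add: L2_space_def)
    from lin_closed_diff[OF lin_closed_L2_space f[of "r N"] this] show ?thesis by simp
  qed
  have "(\<lambda>j. L2_norm M (\<lambda>x. f (r j) x - g x)) \<longlonglongrightarrow> 0"
  proof (rule LIMSEQ_I)
    fix e :: real assume e: "e > 0"
    then have "(e/2)\<^sup>2 > 0" by simp
    from tail[OF this] obtain N where N: "\<forall>i\<ge>N. (\<integral>\<^sup>+x. ennreal ((f (r i) x - g x)\<^sup>2) \<partial>M) \<le> ennreal ((e/2)\<^sup>2)" by blast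
    have "L2_norm M (\<lambda>x. f (r i) x - g x) < e" if "i \<ge> N" for i
    proof -
      have d: "(\<lambda>x. f (r i) x - g x) \<in> L2_space M" by (rule lin_closed_diff[OF lin_closed_L2_space f gL2])
      have "ennreal (LINT x|M. (f (r i) x - g x)\<^sup>2) = (\<integral>\<^sup>+x. ennreal ((f (r i) x - g x)\<^sup>2) \<partial>M)"
        using L2_space_integrable[OF d] by (subst nn_integral_eq_integral) auto
      then have "ennreal (LINT x|M. (f (r i) x - g x)\<^sup>2) \<le> ennreal ((e/2)\<^sup>2)" using N that by simp
      then have "(LINT x|M. (f (r i) x - g x)\<^sup>2) \<le> (e/2)\<^sup>2" by (simp add: ennreal_le_iff)
      then have "L2_norm M (\<lambda>x. f (r i) x - g x) \<le> sqrt ((e/2)\<^sup>2)"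
        unfolding L2_norm_def by (intro real_sqrt_le_mono) simp
      then show ?thesis using e by simp
    qed
    then show "\<exists>N. \<forall>n\<ge>N. norm (L2_norm M (\<lambda>x. f (r n) x - g x) - 0) < e"
      by (auto simp: L2_norm_def integral_nonneg_AE)
  qed
  then show ?thesis using r(1) gL2 by blast
qed

section \<open>Traces\<close>

text \<open>Along the line, the squares at s and t differ by the integral of a derivative that is at
  most \<open>H\<close>, by 2ab \<le> a^2 + b^2. Averaging over t in a window of length 1 adds the
  square once more, hence the factor 2.\<close>

lemma pointwise_trace_bound:
  fixes \<phi> :: "'a::euclidean_space \<Rightarrow> real"
  assumes \<phi>: "smooth \<phi>" and s: "\<bar>s\<bar> \<le> 1/2"
  shows "(\<phi> (x + s *\<^sub>R d))\<^sup>2 \<le> (\<integral>t. indicator {-1/2..1/2} t *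
    (2 * (\<phi> (x + t *\<^sub>R d))\<^sup>2 + (grad \<phi> (x + t *\<^sub>R d) \<bullet> d)\<^sup>2) \<partial>lborel)"
proof -
  define H where "H = (\<lambda>t. (\<phi> (x + t *\<^sub>R d))\<^sup>2 + (grad \<phi> (x + t *\<^sub>R d) \<bullet> d)\<^sup>2)"
  let ?p = "\<lambda>x. (2 * \<phi> x) *\<^sub>R grad \<phi> x"
  have cl: "continuous_on S (\<lambda>t. x + t *\<^sub>R d)" for S :: "real set" by (intro continuous_intros)
  have c\<phi>: "continuous_on S (\<lambda>t. \<phi> (x + t *\<^sub>R d))" for S
    by (rule continuous_on_compose2[OF smooth_continuous[OF \<phi>, of UNIV] cl]) simp
  have cg: "continuous_on S (\<lambda>t. grad \<phi> (x + t *\<^sub>R d))" for S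
    by (rule continuous_on_compose2[OF smooth_grad_continuous[OF \<phi>, of UNIV] cl]) simp
  have cH: "continuous_on S H" for S unfolding H_def by (intro continuous_intros c\<phi> cg)
  have der: "((\<lambda>x. (\<phi> x)\<^sup>2) has_derivative (\<lambda>h. ?p x \<bullet> h)) (at x)" for x
    using has_derivative_mult[OF smooth_has_derivative[OF \<phi>, of x] smooth_has_derivative[OF \<phi>, of x]]
    by (simp add: power2_eq_square algebra_simps)
  have cp: "continuous_on UNIV ?p"
    by (intro continuous_intros smooth_continuous[OF \<phi>] smooth_grad_continuous[OF \<phi>])
  have iH: "integrable lborel (\<lambda>t. indicator {a..b} t * H t)" for a b :: real
    using borel_integrable_compact[OF compact_Icc cH, of a b] by simp
  have H0: "H t \<ge> 0" for t by (simp add: H_def)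
  have pH: "\<bar>?p (x + t *\<^sub>R d) \<bullet> d\<bar> \<le> H t" for t
  proof -
    have "2 * \<bar>a * b\<bar> \<le> a\<^sup>2 + b\<^sup>2" for a b :: real
      using sum_squares_bound[of "\<bar>a\<bar>" "\<bar>b\<bar>"] by (simp add: abs_mult)
    then show ?thesis unfolding H_def by (simp add: abs_mult mult.assoc)
  qed
  have seg: "\<bar>(\<phi> (x + b *\<^sub>R d))\<^sup>2 - (\<phi> (x + a *\<^sub>R d))\<^sup>2\<bar> \<le> (\<integral>t. indicator {-1/2..1/2} t * H t \<partial>lborel)"
    if ab: "a \<le> b" "-1/2 \<le> a" "b \<le> 1/2" for a b
  proof -
    have "\<bar>\<integral>t. indicator {a..b} t * (?p (x + t *\<^sub>R d) \<bullet> d) \<partial>lborel\<bar> \<le> (\<integral>t. indicator {-1/2..1/2} t * H t \<partial>lborel)"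
    proof (rule integral_abs_bound_integral)
      show "integrable lborel (\<lambda>t. indicator {a..b} t * (?p (x + t *\<^sub>R d) \<bullet> d))"
        by (rule line_integral(2)[OF der cp ab(1)])
      show "integrable lborel (\<lambda>t. indicator {-1/2..1/2} t * H t)" by (rule iH)
      show "\<bar>indicator {a..b} t * (?p (x + t *\<^sub>R d) \<bullet> d)\<bar> \<le> indicator {-1/2..1/2} t * H t" for t
      proof (cases "t \<in> {a..b}")
        case True
        then have "t \<in> {-1/2..1/2}" using ab by auto
        then show ?thesis using True pH[of t] by (simp only: indicator_simps mult_1)
      next
        case False
        then have "indicator {a..b} t = (0::real)" by (rule indicator_simps(2))
        moreover have "0 \<le> indicator {-1/2..1/2} t * H t" by (intro mult_nonneg_nonneg H0) simp
        ultimately show ?thesis by (simp only: mult_zero_left abs_zero)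
      qed
    qed
    then show ?thesis unfolding line_integral(1)[OF der cp ab(1)] .
  qed
  have both: "(\<phi> (x + s *\<^sub>R d))\<^sup>2 \<le> (\<phi> (x + t *\<^sub>R d))\<^sup>2 + (\<integral>t. indicator {-1/2..1/2} t * H t \<partial>lborel)"
    if "t \<in> {-1/2..1/2}" for t
  proof (cases "t \<le> s")
    case True
    have "-1/2 \<le> t" "s \<le> 1/2" using that s by (simp_all only: atLeastAtMost_iff abs_le_iff)
    from seg[OF True this] show ?thesis by arith
  next
    case False
    then have "s \<le> t" by simp
    moreover have "-1/2 \<le> s" using s by arith
    moreover have "t \<le> 1/2" using that by (simp only: atLeastAtMost_iff)
    ultimately have "\<bar>(\<phi> (x + t *\<^sub>R d))\<^sup>2 - (\<phi> (x + s *\<^sub>R d))\<^sup>2\<bar> \<le> (\<integral>t. indicator {-1/2..1/2} t * H t \<partial>lborel)"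
      by (rule seg)
    then show ?thesis by arith
  qed
  let ?I = "\<integral>t. indicator {-1/2..1/2} t * H t \<partial>lborel"
  have i1: "integrable lborel (\<lambda>t. indicator {-1/2..1/2::real} t * c)" for c :: real by (intro integrable_mult_left) simp
  have i\<phi>: "integrable lborel (\<lambda>t. indicator {-1/2..1/2} t * (\<phi> (x + t *\<^sub>R d))\<^sup>2)"
    using borel_integrable_compact[OF compact_Icc, of "-1/2" "1/2" "\<lambda>t. (\<phi> (x + t *\<^sub>R d))\<^sup>2"]
    by (simp add: continuous_on_power c\<phi>)
  have "(\<phi> (x + s *\<^sub>R d))\<^sup>2 = (\<integral>t. indicator {-1/2..1/2::real} t * (\<phi> (x + s *\<^sub>R d))\<^sup>2 \<partial>lborel)" by simp
  also have "\<dots> \<le> (\<integral>t. indicator {-1/2..1/2} t * (\<phi> (x + t *\<^sub>R d))\<^sup>2 + indicator {-1/2..1/2} t * ?I \<partial>lborel)"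
  proof (rule integral_mono[OF i1 Bochner_Integration.integrable_add[OF i\<phi> i1]])
    fix t
    show "indicator {-1/2..1/2} t * (\<phi> (x + s *\<^sub>R d))\<^sup>2
      \<le> indicator {-1/2..1/2} t * (\<phi> (x + t *\<^sub>R d))\<^sup>2 + indicator {-1/2..1/2} t * ?I"
    proof (cases "t \<in> {-1/2..1/2}")
      case True
      with both[OF this] show ?thesis by (simp only: indicator_simps mult_1)
    next
      case False
      then have "indicator {-1/2..1/2} t = (0::real)" by (rule indicator_simps(2))
      then show ?thesis by (simp only: mult_zero_left add_0_right order_refl)
    qed
  qed
  also have "\<dots> = (\<integral>t. indicator {-1/2..1/2} t * (\<phi> (x + t *\<^sub>R d))\<^sup>2 \<partial>lborel) + ?I"
    using i\<phi> i1[of ?I] by simp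
  also have "\<dots> = (\<integral>t. indicator {-1/2..1/2} t * (\<phi> (x + t *\<^sub>R d))\<^sup>2 + indicator {-1/2..1/2} t * H t \<partial>lborel)"
    by (rule Bochner_Integration.integral_add[symmetric, OF i\<phi> iH])
  also have "\<dots> = (\<integral>t. indicator {-1/2..1/2} t * (2 * (\<phi> (x + t *\<^sub>R d))\<^sup>2 + (grad \<phi> (x + t *\<^sub>R d) \<bullet> d)\<^sup>2) \<partial>lborel)"
    by (intro Bochner_Integration.integral_cong refl) (simp add: H_def algebra_simps)
  finally show ?thesis .
qed

context full_simplex
begin

lemma finite_surface_measure:
  assumes p: "p \<in> C"
  shows "finite_measure (surface_measure (face p))"
    and "\<And>g::'a \<Rightarrow> real. continuous_on UNIV g \<Longrightarrow> integrable (surface_measure (face p)) g"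
proof -
  let ?A = "cyl p (- normal p) (norm (bgrad p) / 2)"
  have cp: "closest_point (affine hull (face p)) = proj p (- normal p)"
    using closest_point_face(1)[OF p] by blast
  have "\<bar>bary p x\<bar> / norm (bgrad p) \<le> 1 / 2 \<longleftrightarrow> \<bar>bary p x\<bar> \<le> norm (bgrad p) / 2" for x
    using bgrad_nonzero[OF p] by (simp add: divide_le_eq)
  then have A: "{x. closest_point (affine hull (face p)) x \<in> face p \<and> infdist x (affine hull (face p)) \<le> 1/2} = ?A"
    by (simp add: closest_point_face[OF p] cyl_def)
  have m[measurable]: "proj p (- normal p) \<in> measurable (restrict_space lborel ?A) borel"
    by (rule measurable_restrict_space1) measurable
  have sm: "surface_measure (face p) = distr (restrict_space lborel ?A) borel (proj p (- normal p))"
    unfolding surface_measure_def A unfolding cp ..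
  show "finite_measure (surface_measure (face p))"
  proof
    have "emeasure (surface_measure (face p)) (space (surface_measure (face p))) = emeasure lborel ?A"
      unfolding sm by (simp add: emeasure_distr emeasure_restrict_space space_restrict_space)
    then show "emeasure (surface_measure (face p)) (space (surface_measure (face p))) \<noteq> \<infinity>"
      using emeasure_bounded_finite[OF compact_imp_bounded[OF compact_cyl[of p "- normal p" "norm (bgrad p) / 2"]]]
      by simp
  qed
  fix g :: "'a \<Rightarrow> real" assume g: "continuous_on UNIV g"
  have [measurable]: "g \<in> borel_measurable borel" using g by (rule borel_measurable_continuous_onI)
  have "continuous_on ?A (\<lambda>x. g (proj p (- normal p) x))"
    by (rule continuous_on_compose2[OF g continuous_proj]) simp
  from borel_integrable_compact[OF compact_cyl this]
  show "integrable (surface_measure (face p)) g"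
    unfolding sm by (subst integrable_distr_eq) (auto simp: integrable_restrict_space)
qed

text \<open>The pointwise bound is integrated over the cylinder, and the shear turns the double
  integral into one over the whole space. Test functions vanish outside \<open>U\<close>, so the
  norm on \<open>U\<close> appears, with a constant depending only on the face.\<close>

lemma trace_inequality:
  assumes p: "p \<in> C"
  shows "\<exists>K\<ge>0. \<forall>U \<phi>. open U \<longrightarrow> bounded U \<longrightarrow> \<phi> \<in> test_functions U \<longrightarrow>
    (LINT x|surface_measure (face p). (\<phi> x)\<^sup>2) \<le> K * (H1_norm U \<phi>)\<^sup>2"
proof -
  define d where "d = - normal p"
  have d: "bgrad p \<bullet> d = - 1" unfolding d_def by (rule bgrad_normal[OF p])
  from surface_integral[OF p d] obtain k where k: "k > 0"
    "\<And>g. g \<in> borel_measurable borel \<Longrightarrow> (LINT x|surface_measure (face p). g x) = k * cyl_integral p d g" by blast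
  define K where "K = k * max 2 ((norm d)\<^sup>2)"
  have "(LINT x|surface_measure (face p). (\<phi> x)\<^sup>2) \<le> K * (H1_norm U \<phi>)\<^sup>2"
    if U: "open U" "bounded U" and \<phi>: "\<phi> \<in> test_functions U" for U \<phi>
  proof -
    note sm = test_functionsD(1)[OF \<phi>]
    have c\<phi>: "continuous_on UNIV \<phi>" by (rule smooth_continuous[OF sm])
    have cg: "continuous_on UNIV (grad \<phi>)" by (rule smooth_grad_continuous[OF sm])
    have m[measurable]: "\<phi> \<in> borel_measurable borel" "grad \<phi> \<in> borel_measurable borel"
      using c\<phi> cg by (auto intro: borel_measurable_continuous_onI)
    have z: "\<phi> x = 0" "grad \<phi> x = 0" if "x \<notin> U" for x
    proof -
      have "x \<notin> closure {x. \<phi> x \<noteq> 0}" using test_functionsD(3)[OF \<phi>] that by (rule contra_subsetD)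
      then show "grad \<phi> x = 0" by (rule test_function_grad_zero[OF \<phi>])
      show "\<phi> x = 0" by (rule test_functionsD(5)[OF \<phi> that])
    qed
    let ?G = "\<lambda>x. 2 * (\<phi> x)\<^sup>2 + (grad \<phi> x \<bullet> d)\<^sup>2"
    have cG: "continuous_on UNIV ?G" by (intro continuous_intros c\<phi> cg)
    have G0: "?G x = 0" if "x \<notin> U" for x using z[OF that] by simp
    have iG: "integrable lborel ?G" by (rule integrable_continuous_bounded_support[OF cG U(2) G0])
    obtain B where B: "\<forall>x. norm (?G x) \<le> B" using continuous_bounded_support[OF cG U(2) G0] by blast
    have int: "integrable (lborel \<Otimes>\<^sub>M lborel) (\<lambda>(x, t). indicator {-1/2..1/2::real} t * ?G x)"
      unfolding lborel_prod
    proof (rule integrable_lborel_bounded_support[where C = B and S = "U \<times> {-1/2..1/2}"])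
      show "(\<lambda>(x, t). indicator {-1/2..1/2::real} t * ?G x) \<in> borel_measurable borel"
        unfolding borel_prod[symmetric] by measurable
      have "0 \<le> B" using B[rule_format, of 0] norm_ge_zero order_trans by blast
      then show "\<bar>(\<lambda>(x, t). indicator {-1/2..1/2::real} t * ?G x) w\<bar> \<le> B" for w
        using B[rule_format, of "fst w"] by (cases w) (simp add: indicator_def)
      show "bounded (U \<times> {-1/2..1/2::real})" using U by (intro bounded_Times) auto
      show "(\<lambda>(x, t). indicator {-1/2..1/2::real} t * ?G x) w = 0" if w: "w \<notin> U \<times> {-1/2..1/2}" for w
      proof (cases w)
        case (Pair x t)
        then show ?thesis using w G0[of x] by (cases "x \<in> U") (simp_all only: mem_Times_iff fst_conv snd_conv indicator_simps case_prod_conv simp_thms mult_zero_left mult_zero_right)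
      qed
    qed
    have "cyl_integral p d (\<lambda>x. (\<phi> x)\<^sup>2) \<le> (\<integral>x. \<integral>t. indicator {-1/2..1/2::real} t * ?G (x + t *\<^sub>R d) \<partial>lborel \<partial>lborel)"
      unfolding cyl_integral_def
    proof (rule integral_mono)
      show "integrable lborel (\<lambda>x. indicator (cyl p d (1/2)) x * (\<phi> (proj p d x))\<^sup>2)"
        by (rule cyl_integrable) (intro continuous_intros c\<phi>)
      show "integrable lborel (\<lambda>x. \<integral>t. indicator {-1/2..1/2::real} t * ?G (x + t *\<^sub>R d) \<partial>lborel)"
        using lborel_pair.integrable_fst[OF integral_shift(2)[OF int, of d]] by simp
      fix x
      show "indicator (cyl p d (1/2)) x * (\<phi> (proj p d x))\<^sup>2 \<le> (\<integral>t. indicator {-1/2..1/2::real} t * ?G (x + t *\<^sub>R d) \<partial>lborel)"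
      proof (cases "x \<in> cyl p d (1/2)")
        case True
        then have "\<bar>bary p x\<bar> \<le> 1/2" by (simp add: cyl_def)
        from pointwise_trace_bound[OF sm this, of x d] show ?thesis using True by (simp only: proj_def indicator_simps mult_1)
      next
        case False
        have "0 \<le> (\<integral>t. indicator {-1/2..1/2::real} t * ?G (x + t *\<^sub>R d) \<partial>lborel)"
          by (intro integral_nonneg_AE AE_I2) simp
        then show ?thesis using False by simp
      qed
    qed
    also have "\<dots> = (\<integral>x. \<integral>t. indicator {-1/2..1/2::real} t * ?G x \<partial>lborel \<partial>lborel)"
      by (rule integral_shift(1)[OF int])
    also have "\<dots> = (\<integral>x. ?G x \<partial>lborel)" by simp
    also have "\<dots> \<le> (\<integral>x. max 2 ((norm d)\<^sup>2) * ((\<phi> x)\<^sup>2 + (norm (grad \<phi> x))\<^sup>2) \<partial>lborel)"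
    proof (rule integral_mono[OF iG])
      show "integrable lborel (\<lambda>x. max 2 ((norm d)\<^sup>2) * ((\<phi> x)\<^sup>2 + (norm (grad \<phi> x))\<^sup>2))"
        by (rule integrable_continuous_bounded_support[OF _ U(2)]) (use z in \<open>auto intro!: continuous_intros c\<phi> cg\<close>)
      fix x
      have "(grad \<phi> x \<bullet> d)\<^sup>2 \<le> (norm d)\<^sup>2 * (norm (grad \<phi> x))\<^sup>2"
        using Cauchy_Schwarz_ineq[of "grad \<phi> x" d] by (simp add: power2_norm_eq_inner mult.commute)
      moreover have "(norm d)\<^sup>2 * (norm (grad \<phi> x))\<^sup>2 \<le> max 2 ((norm d)\<^sup>2) * (norm (grad \<phi> x))\<^sup>2"
        "2 * (\<phi> x)\<^sup>2 \<le> max 2 ((norm d)\<^sup>2) * (\<phi> x)\<^sup>2"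
        by (intro mult_right_mono max.cobounded2 max.cobounded1 zero_le_power2)+
      ultimately show "?G x \<le> max 2 ((norm d)\<^sup>2) * ((\<phi> x)\<^sup>2 + (norm (grad \<phi> x))\<^sup>2)"
        by (simp only: distrib_left)
    qed
    also have "\<dots> = max 2 ((norm d)\<^sup>2) * (H1_norm U \<phi>)\<^sup>2"
    proof -
      have i: "integrable lborel (\<lambda>x. (\<phi> x)\<^sup>2)" "integrable lborel (\<lambda>x. (norm (grad \<phi> x))\<^sup>2)"
        by (rule integrable_continuous_bounded_support[OF _ U(2)], intro continuous_intros c\<phi>, simp add: z,
            rule integrable_continuous_bounded_support[OF _ U(2)], intro continuous_intros cg, simp add: z)
      have "(LINT x|lebesgue_on U. (\<phi> x)\<^sup>2) = (\<integral>x. (\<phi> x)\<^sup>2 \<partial>lborel)"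
        by (rule integral_lebesgue_on_supported) (use U z in auto)
      moreover have "(LINT x|lebesgue_on U. (norm (grad \<phi> x))\<^sup>2) = (\<integral>x. (norm (grad \<phi> x))\<^sup>2 \<partial>lborel)"
        by (rule integral_lebesgue_on_supported) (use U z in auto)
      ultimately show ?thesis
        unfolding H1_norm_sq[OF U(1) test_function_weak_gradient[OF U \<phi>]] using i by simp
    qed
    finally have "cyl_integral p d (\<lambda>x. (\<phi> x)\<^sup>2) \<le> max 2 ((norm d)\<^sup>2) * (H1_norm U \<phi>)\<^sup>2" .
    then have "k * cyl_integral p d (\<lambda>x. (\<phi> x)\<^sup>2) \<le> k * (max 2 ((norm d)\<^sup>2) * (H1_norm U \<phi>)\<^sup>2)"
      using k(1) by (intro mult_left_mono) auto
    moreover have "(LINT x|surface_measure (face p). (\<phi> x)\<^sup>2) = k * cyl_integral p d (\<lambda>x. (\<phi> x)\<^sup>2)"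
      by (rule k(2)) measurable
    ultimately show ?thesis by (simp add: K_def mult.assoc)
  qed
  moreover have "K \<ge> 0" unfolding K_def using k(1) by (intro mult_nonneg_nonneg) auto
  ultimately show ?thesis by blast
qed

end

lemma H1_approx_distance:
  assumes U: "open U" "bounded U" and v: "v \<in> H1 U" and a: "\<And>j. \<phi> j \<in> test_functions U" "\<And>j. \<psi> j \<in> test_functions U"
  shows "H1_norm U (\<lambda>x. \<phi> i x - \<psi> j x) \<le> H1_norm U (\<lambda>x. v x - \<phi> i x) + H1_norm U (\<lambda>x. v x - \<psi> j x)"
proof -
  interpret S: sym_form "H1 U" "H1_inner U" by (rule sym_form_H1_inner[OF U(1)])
  have t: "f \<in> H1 U" if "f \<in> test_functions U" for f
    by (rule has_weak_gradient_H1[OF test_function_weak_gradient[OF U that]])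
  let ?a = "\<lambda>x. v x - \<phi> i x" and ?b = "\<lambda>x. v x - \<psi> j x"
  have ab: "?a \<in> H1 U" "?b \<in> H1 U"
    using v t[OF a(1)] t[OF a(2)] by (auto intro!: lin_closed_diff[OF lin_closed_H1[OF U(1)]])
  have "(\<lambda>x. \<phi> i x - \<psi> j x) = (\<lambda>x. ?b x - ?a x)" by auto
  then have "H1_inner U (\<lambda>x. \<phi> i x - \<psi> j x) (\<lambda>x. \<phi> i x - \<psi> j x)
    \<le> (sqrt (H1_inner U ?b ?b) + sqrt (H1_inner U ?a ?a))\<^sup>2"
    using S.triangle(1)[OF ab(2,1)] by simp
  then have "sqrt (H1_inner U (\<lambda>x. \<phi> i x - \<psi> j x) (\<lambda>x. \<phi> i x - \<psi> j x))
    \<le> sqrt ((sqrt (H1_inner U ?b ?b) + sqrt (H1_inner U ?a ?a))\<^sup>2)" by (rule real_sqrt_le_mono)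
  also have "\<dots> = sqrt (H1_inner U ?b ?b) + sqrt (H1_inner U ?a ?a)"
    using S.nonneg[OF ab(1)] S.nonneg[OF ab(2)] by simp
  finally show ?thesis by (simp only: H1_norm_eq add.commute)
qed

lemma H1_norm_nonneg: "0 \<le> H1_norm U u"
  by (simp add: H1_norm_def)

context full_simplex
begin

lemma measure_surface_face_pos:
  assumes p: "p \<in> C"
  shows "measure (surface_measure (face p)) (face p) > 0"
proof -
  obtain q where q: "q \<in> C" "q \<noteq> p" using other_vertex by blast
  then have d: "bgrad p \<bullet> (q - p) = - 1" using p by (simp add: bary_diff bary_vertex)
  from surface_integral[OF p d] obtain K where K: "K > 0"
    "\<And>g. g \<in> borel_measurable borel \<Longrightarrow> (LINT x|surface_measure (face p). g x) = K * cyl_integral p (q - p) g" by blast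
  have F: "face p \<in> sets borel" using compact_imp_closed[OF compact_face] by (rule borel_closed)
  have "measure (surface_measure (face p)) (face p) = (LINT x|surface_measure (face p). indicator (face p) x)"
    using F by (simp add: sets_surface_measure)
  also have "\<dots> = K * cyl_integral p (q - p) (indicator (face p))" using F by (intro K(2)) simp
  also have "cyl_integral p (q - p) (indicator (face p)) = cyl_integral p (q - p) (\<lambda>_. 1)"
    by (rule cyl_integral_cong) simp
  finally show ?thesis using K(1) cyl_vol_pos[of p q] p q by simp
qed

text \<open>The trace is a choice made along some unknown approximating sequence. The trace
  inequality shows that a suitable limit exists, and that every approximating sequence leads to the
  same mean.\<close>

lemma face_mean_limit:
  assumes p: "p \<in> C" and U: "open U" "bounded U" and v: "v \<in> H10 U" and a: "H1_approx U \<phi> v"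
  shows "(\<lambda>j. face_average p (\<phi> j)) \<longlonglongrightarrow> face_mean U (face p) v"
proof -
  let ?M = "surface_measure (face p)"
  interpret M: finite_measure ?M by (rule finite_surface_measure(1)[OF p])
  obtain K where K: "K \<ge> 0" "\<And>\<phi>. \<phi> \<in> test_functions U \<Longrightarrow> (LINT x|?M. (\<phi> x)\<^sup>2) \<le> K * (H1_norm U \<phi>)\<^sup>2"
    using trace_inequality[OF p] U by blast
  have vH: "v \<in> H1 U" using v by (simp add: H10_def)
  have L2: "f \<in> L2_space ?M" if "f \<in> test_functions U" for f
  proof -
    have c: "continuous_on UNIV f" by (rule smooth_continuous[OF test_functionsD(1)[OF that]])
    have "continuous_on UNIV (\<lambda>x. (f x)\<^sup>2)" by (intro continuous_intros c)
    from finite_surface_measure(2)[OF p this] finite_surface_measure(2)[OF p c]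
    show ?thesis by (simp add: L2_space_def)
  qed
  have dist: "(LINT x|?M. (\<phi> i x - \<psi> j x)\<^sup>2) \<le> K * (H1_norm U (\<lambda>x. v x - \<phi> i x) + H1_norm U (\<lambda>x. v x - \<psi> j x))\<^sup>2"
    if "\<And>j. \<phi> j \<in> test_functions U" "\<And>j. \<psi> j \<in> test_functions U" for \<phi> \<psi> :: "nat \<Rightarrow> 'a \<Rightarrow> real" and i j
  proof -
    have "(LINT x|?M. (\<phi> i x - \<psi> j x)\<^sup>2) \<le> K * (H1_norm U (\<lambda>x. \<phi> i x - \<psi> j x))\<^sup>2"
      by (rule K(2)[OF lin_closed_diff[OF lin_closed_test_functions that(1) that(2)]])
    also have "\<dots> \<le> K * (H1_norm U (\<lambda>x. v x - \<phi> i x) + H1_norm U (\<lambda>x. v x - \<psi> j x))\<^sup>2"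
      using H1_approx_distance[OF U vH that] H1_norm_nonneg K(1) by (intro mult_left_mono power_mono) auto
    finally show ?thesis .
  qed
  have \<phi>t: "\<And>j. \<phi> j \<in> test_functions U" and \<phi>l: "(\<lambda>j. H1_norm U (\<lambda>x. v x - \<phi> j x)) \<longlonglongrightarrow> 0"
    using a by (auto simp: H1_approx_def)
  have "\<exists>r g. strict_mono r \<and> g \<in> L2_space ?M \<and> (\<lambda>j. L2_norm ?M (\<lambda>x. \<phi> (r j) x - g x)) \<longlonglongrightarrow> 0"
  proof (rule L2_Cauchy_subsequence_limit[OF M.finite_measure_axioms L2[OF \<phi>t]])
    fix e :: real assume e: "e > 0"
    \<comment> \<open>Chosen so that \<open>K * (2 * \<eta>)^2 = K * e / (K + 1)\<close>, which is
      below \<open>e\<close>.\<close>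
    define \<eta> where "\<eta> = sqrt (e / (K + 1)) / 2"
    have \<eta>: "\<eta> > 0" using e K(1) by (simp add: \<eta>_def)
    from LIMSEQ_D[OF \<phi>l this] obtain N where N: "\<And>j. j \<ge> N \<Longrightarrow> H1_norm U (\<lambda>x. v x - \<phi> j x) < \<eta>"
      using H1_norm_nonneg by fastforce
    have "(LINT x|?M. (\<phi> i x - \<phi> j x)\<^sup>2) < e" if "i \<ge> N" "j \<ge> N" for i j
    proof -
      have "(LINT x|?M. (\<phi> i x - \<phi> j x)\<^sup>2) \<le> K * (H1_norm U (\<lambda>x. v x - \<phi> i x) + H1_norm U (\<lambda>x. v x - \<phi> j x))\<^sup>2"
        by (rule dist[OF \<phi>t \<phi>t])
      also have "\<dots> \<le> K * (\<eta> + \<eta>)\<^sup>2"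
        using N[OF that(1)] N[OF that(2)] H1_norm_nonneg K(1)
        by (intro mult_left_mono power_mono add_mono add_nonneg_nonneg) auto
      also have "\<dots> = K * (e / (K + 1))" using e K(1) by (simp add: \<eta>_def)
      also have "\<dots> < e" using e K(1) by (simp add: field_simps)
      finally show ?thesis .
    qed
    then show "\<exists>N. \<forall>i\<ge>N. \<forall>j\<ge>N. (LINT x|?M. (\<phi> i x - \<phi> j x)\<^sup>2) < e" by blast
  qed
  then obtain r g where rg: "strict_mono r" "g \<in> L2_space ?M" "(\<lambda>j. L2_norm ?M (\<lambda>x. \<phi> (r j) x - g x)) \<longlonglongrightarrow> 0" by blast
  have "H1_approx U (\<lambda>j. \<phi> (r j)) v"
    using \<phi>t LIMSEQ_subseq_LIMSEQ[OF \<phi>l rg(1)] by (simp add: H1_approx_def o_def)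
  with rg have "\<exists>g. g \<in> L2_space ?M \<and> (\<exists>\<phi>. H1_approx U \<phi> v \<and> (\<lambda>j. L2_norm ?M (\<lambda>x. \<phi> j x - g x)) \<longlonglongrightarrow> 0)" by blast
  \<comment> \<open>The sequence behind the chosen trace is unrelated to \<open>\<phi>\<close>; the
    two are compared through \<open>dist\<close>.\<close>
  from someI_ex[OF this] obtain \<psi> where
    h: "H10_trace U (face p) v \<in> L2_space ?M" and \<psi>: "H1_approx U \<psi> v"
    "(\<lambda>j. L2_norm ?M (\<lambda>x. \<psi> j x - H10_trace U (face p) v x)) \<longlonglongrightarrow> 0"
    unfolding H10_trace_def[symmetric] by blast
  let ?h = "H10_trace U (face p) v"
  have \<psi>t: "\<And>j. \<psi> j \<in> test_functions U" and \<psi>l: "(\<lambda>j. H1_norm U (\<lambda>x. v x - \<psi> j x)) \<longlonglongrightarrow> 0"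
    using \<psi> by (auto simp: H1_approx_def)
  define c where "c = measure ?M (space ?M)"
  have one: "(\<lambda>_. 1::real) \<in> L2_space ?M" by (simp add: L2_space_def)
  have bound: "\<bar>LINT x|?M. f x\<bar> \<le> L2_norm ?M f * sqrt c" if f: "f \<in> L2_space ?M" for f :: "'a \<Rightarrow> real"
  proof -
    have "(LINT x|?M. f x)\<^sup>2 \<le> (LINT x|?M. (f x)\<^sup>2) * c"
      using sym_form.Cauchy_Schwarz[OF sym_form_L2_inner f one] by (simp add: c_def power2_eq_square)
    from real_sqrt_le_mono[OF this] show ?thesis by (simp add: L2_norm_def real_sqrt_mult)
  qed
  have int: "integrable ?M f" if "f \<in> L2_space ?M" for f :: "'a \<Rightarrow> real"
    using L2_space_mult_integrable[OF that one] by simp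
  have "(\<lambda>j. LINT x|?M. \<phi> j x) \<longlonglongrightarrow> (LINT x|?M. ?h x)"
  proof -
    let ?b = "\<lambda>j. sqrt K * (H1_norm U (\<lambda>x. v x - \<phi> j x) + H1_norm U (\<lambda>x. v x - \<psi> j x)) * sqrt c
      + L2_norm ?M (\<lambda>x. \<psi> j x - ?h x) * sqrt c"
    have lim: "?b \<longlonglongrightarrow> sqrt K * (0 + 0) * sqrt c + 0 * sqrt c" by (intro tendsto_intros \<phi>l \<psi>l \<psi>(2))
    have le: "\<bar>(LINT x|?M. \<phi> j x) - (LINT x|?M. ?h x)\<bar> \<le> ?b j" for j
    proof -
      have d1: "(\<lambda>x. \<phi> j x - \<psi> j x) \<in> L2_space ?M" and d2: "(\<lambda>x. \<psi> j x - ?h x) \<in> L2_space ?M"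
        by (rule lin_closed_diff[OF lin_closed_L2_space L2[OF \<phi>t] L2[OF \<psi>t]],
            rule lin_closed_diff[OF lin_closed_L2_space L2[OF \<psi>t] h])
      have "L2_norm ?M (\<lambda>x. \<phi> j x - \<psi> j x) \<le> sqrt (K * (H1_norm U (\<lambda>x. v x - \<phi> j x) + H1_norm U (\<lambda>x. v x - \<psi> j x))\<^sup>2)"
        unfolding L2_norm_def using dist[OF \<phi>t \<psi>t, where i = j and j = j] by (intro real_sqrt_le_mono) simp
      also have "\<dots> = sqrt K * (H1_norm U (\<lambda>x. v x - \<phi> j x) + H1_norm U (\<lambda>x. v x - \<psi> j x))"
      proof -
        have "0 \<le> H1_norm U (\<lambda>x. v x - \<phi> j x) + H1_norm U (\<lambda>x. v x - \<psi> j x)"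
          by (intro add_nonneg_nonneg H1_norm_nonneg)
        then show ?thesis by (simp add: real_sqrt_mult)
      qed
      finally have "L2_norm ?M (\<lambda>x. \<phi> j x - \<psi> j x) * sqrt c
        \<le> sqrt K * (H1_norm U (\<lambda>x. v x - \<phi> j x) + H1_norm U (\<lambda>x. v x - \<psi> j x)) * sqrt c"
        by (rule mult_right_mono) (simp add: c_def)
      moreover have "(LINT x|?M. \<phi> j x) - (LINT x|?M. ?h x) = (LINT x|?M. \<phi> j x - \<psi> j x) + (LINT x|?M. \<psi> j x - ?h x)"
        using int[OF L2[OF \<phi>t]] int[OF L2[OF \<psi>t]] int[OF h] by simp
      ultimately show ?thesis using bound[OF d1] bound[OF d2] by linarith
    qed
    have "(\<lambda>j. (LINT x|?M. \<phi> j x) - (LINT x|?M. ?h x)) \<longlonglongrightarrow> 0"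
    proof (rule Lim_null_comparison)
      show "\<forall>\<^sub>F j in sequentially. norm ((LINT x|?M. \<phi> j x) - (LINT x|?M. ?h x)) \<le> ?b j"
        using le by (intro always_eventually) simp
      show "?b \<longlonglongrightarrow> 0" using lim by simp
    qed
    then show ?thesis by (simp add: LIM_zero_iff)
  qed
  then have "(\<lambda>j. (LINT x|?M. \<phi> j x) / measure ?M (face p)) \<longlonglongrightarrow> (LINT x|?M. ?h x) / measure ?M (face p)"
    using measure_surface_face_pos[OF p] by (intro tendsto_divide tendsto_const) auto
  then show ?thesis by (simp add: face_average_def face_mean_def)
qed

section \<open>Weak gradients and affine traces on a single simplex\<close>

lemma
  shows compact_simplex: "compact (convex hull C)" and convex_simplex: "convex (convex hull C)"
    and interior_measurable: "interior (convex hull C) \<in> sets lebesgue"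
    and bounded_interior: "bounded (interior (convex hull C))"
proof -
  show c: "compact (convex hull C)" using finite_C by (rule finite_imp_compact_convex_hull)
  show "bounded (interior (convex hull C))"
    using compact_imp_bounded[OF c] bounded_subset interior_subset by blast
qed auto

lemma AE_boundary: "AE x in lebesgue. x \<in> convex hull C \<longleftrightarrow> x \<in> interior (convex hull C)"
proof -
  have "frontier (convex hull C) \<in> null_sets lebesgue"
    using negligible_convex_frontier[OF convex_simplex] by (simp add: negligible_iff_null_sets)
  from AE_not_in[OF this] show ?thesis
  proof eventually_elim
    case (elim x)
    have "closure (convex hull C) = convex hull C" using compact_imp_closed[OF compact_simplex] by simp
    then show ?case using elim interior_subset by (auto simp: frontier_def)
  qed
qed

lemma integral_interior:
  fixes f :: "'a \<Rightarrow> real"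
  assumes f[measurable]: "f \<in> borel_measurable borel"
  shows "(LINT x|lebesgue_on (interior (convex hull C)). f x) = (\<integral>x. indicator (convex hull C) x * f x \<partial>lborel)"
proof -
  have [measurable]: "convex hull C \<in> sets borel" using compact_imp_closed[OF compact_simplex] by (rule borel_closed)
  have m: "(\<lambda>x. indicator (convex hull C) x * f x) \<in> borel_measurable lborel"
    "(\<lambda>x. indicator (interior (convex hull C)) x * f x) \<in> borel_measurable lborel" by measurable
  have "(LINT x|lebesgue_on (interior (convex hull C)). f x) = (\<integral>x. indicator (interior (convex hull C)) x * f x \<partial>lebesgue)"
    by (simp add: integral_restrict_space)
  also have "\<dots> = (\<integral>x. indicator (convex hull C) x * f x \<partial>lebesgue)"
  proof (rule integral_cong_AE)
    show "AE x in lebesgue. indicator (interior (convex hull C)) x * f x = indicator (convex hull C) x * f x"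
      using AE_boundary by eventually_elim (simp add: indicator_def)
  qed (use m in \<open>auto intro: measurable_completion\<close>)
  also have "\<dots> = (\<integral>x. indicator (convex hull C) x * f x \<partial>lborel)"
    by (rule integral_completion[OF m(1)])
  finally show ?thesis .
qed

text \<open>Both sides are limits along test functions, for which \<open>edge_formula\<close>
  holds.\<close>

lemma weak_gradient_edge:
  assumes U: "open U" "bounded U" and sub: "interior (convex hull C) \<subseteq> U"
    and v: "v \<in> H10 U" "has_weak_gradient U v g" and PQ: "P \<in> C" "Q \<in> C" "P \<noteq> Q"
  shows "(LINT x|lebesgue_on (interior (convex hull C)). g x \<bullet> (Q - P))
    = real DIM('a) * vol * (face_mean U (face P) v - face_mean U (face Q) v)"
proof -
  obtain \<phi> where a: "H1_approx U \<phi> v" using v(1) by (auto simp: H10_def)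
  have "(\<lambda>j. LINT x|lebesgue_on (interior (convex hull C)). grad (\<phi> j) x \<bullet> (Q - P))
    \<longlonglongrightarrow> (LINT x|lebesgue_on (interior (convex hull C)). g x \<bullet> (Q - P))"
    by (rule H1_approx_integral_grad[OF U v(2) a interior_measurable sub])
  moreover have "(LINT x|lebesgue_on (interior (convex hull C)). grad (\<phi> j) x \<bullet> (Q - P))
    = real DIM('a) * vol * (face_average P (\<phi> j) - face_average Q (\<phi> j))" for j
  proof -
    have "\<phi> j \<in> test_functions U" using a by (simp add: H1_approx_def)
    then have s: "smooth (\<phi> j)" by (rule test_functionsD(1))
    have "(\<lambda>x. grad (\<phi> j) x \<bullet> (Q - P)) \<in> borel_measurable borel"
      by (intro borel_measurable_continuous_onI continuous_intros smooth_grad_continuous[OF s])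
    from integral_interior[OF this] show ?thesis
      using edge_formula[OF PQ smooth_has_derivative[OF s] smooth_grad_continuous[OF s]] by simp
  qed
  moreover have "(\<lambda>j. real DIM('a) * vol * (face_average P (\<phi> j) - face_average Q (\<phi> j)))
    \<longlonglongrightarrow> real DIM('a) * vol * (face_mean U (face P) v - face_mean U (face Q) v)"
    by (intro tendsto_intros face_mean_limit[OF _ U v(1) a] PQ)
  ultimately show ?thesis using LIMSEQ_unique by simp
qed

lemma mid_face_diff:
  assumes "P \<in> C" "Q \<in> C"
  shows "real DIM('a) *\<^sub>R (mid (face P) - mid (face Q)) = Q - P"
proof -
  have "(\<Sum>q\<in>C - {r}. q) = (\<Sum>q\<in>C. q) - r" if "r \<in> C" for r
    using that finite_C by (simp add: sum_diff1)
  then show ?thesis using assms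
    by (simp add: mid_face scaleR_diff_right[symmetric]) 
qed

lemma measure_interior: "measure (lebesgue_on (interior (convex hull C))) (space (lebesgue_on (interior (convex hull C)))) = vol"
proof -
  have "(LINT x|lebesgue_on (interior (convex hull C)). 1) = (\<integral>x. indicator (convex hull C) x * (1::real) \<partial>lborel)"
    by (rule integral_interior) simp
  then show ?thesis using vol_integral[of 1] by simp
qed

text \<open>The elementwise gradient of the Crouzeix--Raviart interpolant is the mean of the gradient:
  both are determined by the means over the faces.\<close>

lemma interpolation_gradient_orthogonal:
  assumes U: "open U" "bounded U" and sub: "interior (convex hull C) \<subseteq> U"
    and v: "v \<in> H10 U" "has_weak_gradient U v g"
    and w: "\<And>P. P \<in> C \<Longrightarrow> a \<bullet> mid (face P) + b = face_mean U (face P) v"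
  shows "(LINT x|lebesgue_on (interior (convex hull C)). (g x - a) \<bullet> d) = 0"
proof -
  let ?M = "lebesgue_on (interior (convex hull C))"
  have U': "open (interior (convex hull C))" by simp
  have gL2: "g \<in> L2_space ?M"
    by (rule has_weak_gradient_L2(2)[OF has_weak_gradient_restrict[OF U(1) U' sub v(2)]])
  have cL2: "(\<lambda>_. c) \<in> L2_space ?M" for c :: 'a
    by (rule continuous_L2_space[OF continuous_on_const bounded_interior interior_measurable])
  have dL2: "(\<lambda>x. g x - a) \<in> L2_space ?M" using L2_space_lincomb[OF gL2 cL2, of 1 "-1" a] by simp
  have int: "integrable ?M (\<lambda>x. (g x - a) \<bullet> d)" for d by (rule L2_space_inner_integrable[OF dL2 cL2])
  have "linear (\<lambda>d. LINT x|?M. (g x - a) \<bullet> d)"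
    using int by (intro linearI) (simp_all add: inner_add_right)
  \<comment> \<open>The functional is represented by a vector \<open>e\<close>. It will be
    orthogonal to every edge, so the inner product with \<open>e\<close> is constant on the
    vertices, hence everywhere, and \<open>e\<close> is 0.\<close>
  from linear_functional_inner[OF this] obtain e where e: "\<forall>d. (LINT x|?M. (g x - a) \<bullet> d) = e \<bullet> d" by blast
  have edge: "e \<bullet> (Q - P) = 0" if PQ: "P \<in> C" "Q \<in> C" "P \<noteq> Q" for P Q
  proof -
    have i: "integrable ?M (\<lambda>x. g x \<bullet> (Q - P))" by (rule L2_space_inner_integrable[OF gL2 cL2])
    have ic: "integrable ?M (\<lambda>x. a \<bullet> (Q - P))" by (rule L2_space_inner_integrable[OF cL2 cL2])
    have "(LINT x|?M. (g x - a) \<bullet> (Q - P)) = (LINT x|?M. g x \<bullet> (Q - P)) - (LINT x|?M. a \<bullet> (Q - P))"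
      unfolding inner_diff_left by (rule Bochner_Integration.integral_diff[OF i ic])
    also have "(LINT x|?M. a \<bullet> (Q - P)) = vol * (a \<bullet> (Q - P))" using measure_interior by simp
    also have "a \<bullet> (Q - P) = real DIM('a) * (a \<bullet> mid (face P) - a \<bullet> mid (face Q))"
      unfolding mid_face_diff[OF PQ(1,2), symmetric] by (simp add: inner_diff_right)
    also have "a \<bullet> mid (face P) - a \<bullet> mid (face Q) = face_mean U (face P) v - face_mean U (face Q) v"
      using w[OF PQ(1)] w[OF PQ(2)] by simp
    also have "(LINT x|?M. g x \<bullet> (Q - P)) = real DIM('a) * vol * (face_mean U (face P) v - face_mean U (face Q) v)"
      by (rule weak_gradient_edge[OF U sub v PQ])
    finally show ?thesis using e by simp
  qed
  obtain P where P: "P \<in> C" using other_vertex by blast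
  have "e \<bullet> q + - (e \<bullet> P) = 0" if "q \<in> C" for q
    using edge[OF P that] by (cases "q = P") (auto simp: inner_diff_right)
  then have z: "e \<bullet> x + - (e \<bullet> P) = 0" for x by (rule affine_zero)
  from z[of 0] z[of e] have "e = 0" by simp
  then show ?thesis using e by simp
qed

lemma trace_affine:
  assumes v: "\<And>y. y \<in> interior (convex hull C) \<Longrightarrow> v y = a \<bullet> y + b" and x: "x \<in> convex hull C"
  shows "trace_from (convex hull C) v x = a \<bullet> x + b"
proof -
  have "x \<in> closure (interior (convex hull C))"
    using x convex_closure_interior[OF convex_simplex interior_nonempty] closure_subset by blast
  then have "x islimpt interior (convex hull C)"
    using interior_limit_point[of x "interior (convex hull C)"] by (auto simp: closure_def)
  then have nt: "at x within interior (convex hull C) \<noteq> bot" by (simp add: trivial_limit_within)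
  have "((\<lambda>y. a \<bullet> y + b) \<longlongrightarrow> a \<bullet> x + b) (at x within interior (convex hull C))" by (intro tendsto_intros)
  then have "(v \<longlongrightarrow> a \<bullet> x + b) (at x within interior (convex hull C))"
    by (rule Lim_transform_eventually) (auto simp: eventually_at_filter v)
  then show ?thesis unfolding trace_from_def by (rule tendsto_Lim[OF nt])
qed

lemma rel_interior_face:
  assumes P: "P \<in> C"
  shows "x \<in> rel_interior (face P) \<longleftrightarrow> bary P x = 0 \<and> (\<forall>q\<in>C - {P}. 0 < bary q x)"
proof -
  have ind: "\<not> affine_dependent (C - {P})" using indep affine_independent_subset by blast
  have "x \<in> rel_interior (face P) \<longleftrightarrow> (\<exists>u. (\<forall>q\<in>C - {P}. 0 < u q) \<and> sum u (C - {P}) = 1 \<and> (\<Sum>q\<in>C - {P}. u q *\<^sub>R q) = x)"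
    unfolding face_def rel_interior_convex_hull_explicit[OF ind] by simp
  also have "\<dots> \<longleftrightarrow> bary P x = 0 \<and> (\<forall>q\<in>C - {P}. 0 < bary q x)"
  proof
    assume "\<exists>u. (\<forall>q\<in>C - {P}. 0 < u q) \<and> sum u (C - {P}) = 1 \<and> (\<Sum>q\<in>C - {P}. u q *\<^sub>R q) = x"
    then obtain u where u: "\<forall>q\<in>C - {P}. 0 < u q" "sum u (C - {P}) = 1" "(\<Sum>q\<in>C - {P}. u q *\<^sub>R q) = x" by blast
    have s: "sum (u(P := 0)) C = 1" "(\<Sum>q\<in>C. (u(P := 0)) q *\<^sub>R q) = x"
      using u P finite_C by (simp_all add: sum.remove[OF _ P])
    have "bary q x = (u(P := 0)) q" if "q \<in> C" for q
      using bary_of_combination[OF s(1) that] unfolding s(2) .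
    then show "bary P x = 0 \<and> (\<forall>q\<in>C - {P}. 0 < bary q x)" using u(1) P by simp
  next
    assume a: "bary P x = 0 \<and> (\<forall>q\<in>C - {P}. 0 < bary q x)"
    have "sum (\<lambda>q. bary q x) (C - {P}) = 1" "(\<Sum>q\<in>C - {P}. bary q x *\<^sub>R q) = x"
      using sum_bary[of x] bary_combination[of x] a P finite_C by (simp_all add: sum.remove[OF _ P])
    then show "\<exists>u. (\<forall>q\<in>C - {P}. 0 < u q) \<and> sum u (C - {P}) = 1 \<and> (\<Sum>q\<in>C - {P}. u q *\<^sub>R q) = x"
      using a by (intro exI[of _ "\<lambda>q. bary q x"]) auto
  qed
  finally show ?thesis .
qed

text \<open>At such a point only the constraint of \<open>P\<close> is active, so the simplex is
  locally a half-space.\<close>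

lemma rel_interior_face_neighbourhood:
  assumes P: "P \<in> C" and x: "x \<in> rel_interior (face P)"
  shows "\<exists>e>0. \<forall>y. dist y x < e \<longrightarrow> (0 \<le> bary P y \<longrightarrow> y \<in> convex hull C) \<and> (0 < bary P y \<longrightarrow> y \<in> interior (convex hull C))"
proof -
  have "open (\<Inter>q\<in>C - {P}. {y. 0 < bary q y})"
    using finite_C by (intro open_INT ballI open_Collect_less continuous_intros continuous_bary) auto
  moreover have "x \<in> (\<Inter>q\<in>C - {P}. {y. 0 < bary q y})" using x by (simp add: rel_interior_face[OF P])
  ultimately obtain e where e: "e > 0" "ball x e \<subseteq> (\<Inter>q\<in>C - {P}. {y. 0 < bary q y})"
    using openE by blast
  have q: "0 < bary q y" if "dist y x < e" "q \<in> C" "q \<noteq> P" for q y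
  proof -
    have "y \<in> ball x e" using that by (simp add: dist_commute)
    then show ?thesis using e(2) that by auto
  qed
  show ?thesis
  proof (intro exI[of _ e] conjI allI impI e(1))
    fix y assume y: "dist y x < e"
    show "y \<in> convex hull C" if "0 \<le> bary P y"
      unfolding mem_simplex
    proof
      fix r assume "r \<in> C"
      then show "0 \<le> bary r y" using q[OF y, of r] that by (cases "r = P") (simp_all add: less_imp_le)
    qed
    show "y \<in> interior (convex hull C)" if "0 < bary P y"
      unfolding mem_interior_simplex
    proof
      fix r assume "r \<in> C"
      then show "0 < bary r y" using q[OF y, of r] that by (cases "r = P") simp_all
    qed
  qed
qed

lemma mid_rel_interior: "P \<in> C \<Longrightarrow> mid (face P) \<in> rel_interior (face P)"
  by (simp add: rel_interior_face bary_mid_face)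

lemma aff_dim_C: "aff_dim (convex hull C) = int DIM('a)"
  using indep card_C by (simp add: aff_dim_convex_hull affine_independent_iff_card)

end

text \<open>Below the graph, points outside the closure come arbitrarily close to a boundary point.
  This excludes slits, so simplices covering the closure have their interiors in the domain.\<close>

lemma interior_closure_lipschitz_domain:
  assumes "bounded_lipschitz_domain \<Omega>"
  shows "interior (closure \<Omega>) \<subseteq> \<Omega>"
proof
  fix x assume x: "x \<in> interior (closure \<Omega>)"
  show "x \<in> \<Omega>"
  proof (rule ccontr)
    assume nx: "x \<notin> \<Omega>"
    have op: "open \<Omega>" using assms by (simp add: bounded_lipschitz_domain_def)
    have "x \<in> frontier \<Omega>" using x nx interior_subset interior_open[OF op] by (auto simp: frontier_def)
    then obtain U e L \<gamma> where U: "open U" "x \<in> U" "norm e = 1" "L-lipschitz_on UNIV (\<gamma> :: 'a \<Rightarrow> real)"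
      "\<Omega> \<inter> U = {y \<in> U. \<gamma> (y - (y \<bullet> e) *\<^sub>R e) < y \<bullet> e}"
      using assms unfolding bounded_lipschitz_domain_def by blast
    have c\<gamma>: "continuous_on UNIV \<gamma>" using U(4) by (rule lipschitz_on_continuous_on)
    let ?f = "\<lambda>y. \<gamma> (y - (y \<bullet> e) *\<^sub>R e)"
    have cf: "continuous_on UNIV ?f"
      by (rule continuous_on_compose2[OF c\<gamma>]) (auto intro!: continuous_intros)
    \<comment> \<open>The points strictly below the graph: open and disjoint from the domain, hence
      from its closure.\<close>
    define W where "W = U \<inter> {y. y \<bullet> e < ?f y}"
    have "open W" unfolding W_def by (intro open_Int U(1) open_Collect_less continuous_intros cf)
    have "W \<inter> \<Omega> = {}"
    proof -
      have "\<gamma> (y - (y \<bullet> e) *\<^sub>R e) < y \<bullet> e" if "y \<in> \<Omega>" "y \<in> U" for y using U(5) that by blast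
      then show ?thesis by (fastforce simp: W_def)
    qed
    then have Wc: "W \<inter> closure \<Omega> = {}" using open_Int_closure_eq_empty[OF \<open>open W\<close>] by blast
    have "open (U \<inter> interior (closure \<Omega>))" "x \<in> U \<inter> interior (closure \<Omega>)" using U x by auto
    then obtain r where r: "r > 0" "ball x r \<subseteq> U \<inter> interior (closure \<Omega>)" using openE by blast
    \<comment> \<open>\<open>x\<close> is on or below the graph; a step along \<open>- e\<close>
      leaves the argument of \<open>\<gamma>\<close> unchanged and leads strictly below it.\<close>
    define y where "y = x - (r/2) *\<^sub>R e"
    have "y \<in> ball x r" using r(1) U(3) by (simp add: y_def dist_norm)
    then have y: "y \<in> U" "y \<in> closure \<Omega>" using r(2) interior_subset[of "closure \<Omega>"] by auto
    have ee: "e \<bullet> e = 1" using U(3) by (simp add: norm_eq_1)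
    have "\<not> ?f x < x \<bullet> e"
    proof
      assume "?f x < x \<bullet> e"
      then have "x \<in> {y \<in> U. \<gamma> (y - (y \<bullet> e) *\<^sub>R e) < y \<bullet> e}" using U(2) by blast
      then have "x \<in> \<Omega> \<inter> U" unfolding U(5) .
      then show False using nx by blast
    qed
    then have "?f x \<ge> x \<bullet> e" by simp
    moreover have "y \<bullet> e = x \<bullet> e - r/2" by (simp add: y_def inner_diff_left ee)
    moreover have "y - (y \<bullet> e) *\<^sub>R e = x - (x \<bullet> e) *\<^sub>R e"
      unfolding \<open>y \<bullet> e = x \<bullet> e - r/2\<close> by (simp add: y_def algebra_simps)
    ultimately have "y \<in> W" using y(1) r(1) by (simp add: W_def)
    then show False using Wc y(2) by blast
  qed
qed

section \<open>Regular triangulations\<close>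

locale cr_mesh =
  fixes \<Omega> :: "'a::euclidean_space set" and \<T> :: "'a set set"
  assumes dom: "bounded_lipschitz_domain \<Omega>" and tri: "regular_triangulation \<Omega> \<T>"
begin

lemma open_\<Omega>: "open \<Omega>" and bounded_\<Omega>: "bounded \<Omega>"
  using dom by (simp_all add: bounded_lipschitz_domain_def)

lemma finite_mesh: "finite \<T>" and Union_mesh: "\<Union>\<T> = closure \<Omega>"
  and Int_face: "T \<in> \<T> \<Longrightarrow> T' \<in> \<T> \<Longrightarrow> (T \<inter> T') face_of T"
  using tri by (auto simp: regular_triangulation_def triangulation_def)

definition verts :: "'a set \<Rightarrow> 'a set" where
  "verts T = (SOME C. full_simplex C \<and> T = convex hull C)"

lemma verts:
  assumes "T \<in> \<T>"
  shows "full_simplex (verts T)" "T = convex hull (verts T)"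
proof -
  have "int DIM('a) simplex T" using assms tri by (simp add: regular_triangulation_def)
  then obtain C where "\<not> affine_dependent C" "int (card C) = int DIM('a) + 1" "T = convex hull C"
    by (auto simp: simplex_def)
  then have "\<exists>C. full_simplex C \<and> T = convex hull C" by (auto simp: full_simplex_def)
  from someI_ex[OF this] show "full_simplex (verts T)" "T = convex hull (verts T)"
    by (simp_all add: verts_def)
qed

abbreviation "bc T \<equiv> full_simplex.bary (verts T)"
abbreviation "fc T \<equiv> full_simplex.face (verts T)"

lemma Tfacet:
  assumes "T \<in> \<T>"
  shows "F facet_of T \<longleftrightarrow> (\<exists>p\<in>verts T. F = fc T p)"
  using full_simplex.facet_iff[OF verts(1)[OF assms], of F] by (simp add: verts(2)[OF assms, symmetric])

lemma mesh_simplex: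
  assumes "T \<in> \<T>"
  shows "compact T" "convex T" "interior T \<noteq> {}" "aff_dim T = int DIM('a)" "closed T"
proof -
  note v = verts[OF assms]
  show "compact T" "convex T" "interior T \<noteq> {}" "aff_dim T = int DIM('a)"
    using full_simplex.compact_simplex[OF v(1)] full_simplex.convex_simplex[OF v(1)]
      full_simplex.interior_nonempty[OF v(1)] full_simplex.aff_dim_C[OF v(1)] by (simp_all add: v(2)[symmetric])
  then show "closed T" by (simp add: compact_imp_closed)
qed

lemma interior_subset_\<Omega>:
  assumes "T \<in> \<T>"
  shows "interior T \<subseteq> \<Omega>"
proof -
  have "T \<subseteq> closure \<Omega>" using assms Union_mesh by blast
  then have "interior T \<subseteq> interior (closure \<Omega>)" by (rule interior_mono)
  then show ?thesis using interior_closure_lipschitz_domain[OF dom] by blast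
qed

lemma mesh_subset_closure: "T \<in> \<T> \<Longrightarrow> T \<subseteq> closure \<Omega>"
  using Union_mesh by blast

lemma interiors_disjoint:
  assumes T: "T \<in> \<T>" "T' \<in> \<T>" and x: "x \<in> interior T" "x \<in> interior T'"
  shows "T = T'"
proof -
  have *: "S \<subseteq> S'" if S: "S \<in> \<T>" "S' \<in> \<T>" "x \<in> interior S" "x \<in> S'" for S S'
  proof (rule ccontr)
    assume "\<not> S \<subseteq> S'"
    then have "S \<inter> S' \<noteq> S" by blast
    from face_of_disjoint_interior[OF Int_face[OF S(1,2)] this]
    show False using S interior_subset by blast
  qed
  show ?thesis using *[OF T x(1)] *[OF T(2,1) x(2)] x interior_subset by blast
qed

text \<open>\<open>T \<inter> T'\<close> is a face of \<open>T\<close> containing a relative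
  interior point of the facet, so it contains the facet. It is not all of \<open>T\<close> because
  interiors are disjoint, and comparing dimensions leaves only equality.\<close>

lemma shared_facet:
  assumes T: "T \<in> \<T>" "T' \<in> \<T>" "T \<noteq> T'" and p: "p \<in> verts T"
    and x: "x \<in> rel_interior (fc T p)" "x \<in> T'"
  shows "fc T p facet_of T'"
proof -
  let ?F = "fc T p" and ?G = "T \<inter> T'"
  have F: "?F facet_of T" using Tfacet[OF T(1)] p by blast
  have FT: "?F \<subseteq> T" using F by (rule facet_of_imp_subset)
  have G: "?G face_of T" by (rule Int_face[OF T(1,2)])
  have "x \<in> ?F" using x(1) rel_interior_subset by blast
  then have "?G \<inter> rel_interior ?F \<noteq> {}" using x FT by blast
  then have sub: "?F \<subseteq> ?G" by (rule subset_of_face_of[OF G FT])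
  have "?G \<noteq> T"
  proof
    assume "?G = T"
    then have "T \<subseteq> T'" by blast
    then have "interior T \<subseteq> interior T'" by (rule interior_mono)
    moreover obtain z where "z \<in> interior T" using mesh_simplex(3)[OF T(1)] by blast
    ultimately show False using interiors_disjoint[OF T(1,2)] T(3) by blast
  qed
  then have lt: "aff_dim ?G < aff_dim T" by (rule face_of_aff_dim_lt[OF mesh_simplex(2)[OF T(1)] G])
  have aF: "aff_dim ?F = aff_dim T - 1" using F by (simp add: facet_of_def)
  have FG: "?F face_of ?G"
    by (rule face_of_subset[OF facet_of_imp_face_of[OF F] sub Int_lower1])
  have "?F = ?G"
  proof (rule ccontr)
    assume "?F \<noteq> ?G"
    from face_of_aff_dim_lt[OF face_of_imp_convex[OF G] FG this] show False using lt aF by linarith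
  qed
  moreover have "?G face_of T'" using Int_face[OF T(2,1)] by (simp add: Int_commute)
  ultimately have "?F face_of T'" by simp
  moreover have "?F \<noteq> {}" using F by (simp add: facet_of_def)
  ultimately show ?thesis
    using aF mesh_simplex(4)[OF T(1)] mesh_simplex(4)[OF T(2)] by (simp add: facet_of_def)
qed

text \<open>Near a relative interior point of the facet that lies in the domain, points across the
  facet must be covered by other simplices. These are finitely many closed sets, so one of them
  contains the point.\<close>

lemma second_simplex:
  assumes T: "T \<in> \<T>" and p: "p \<in> verts T" and nf: "\<not> fc T p \<subseteq> frontier \<Omega>"
  obtains T' where "T' \<in> \<T>" "T' \<noteq> T" "fc T p facet_of T'"
proof -
  interpret full_simplex "verts T" by (rule verts(1)[OF T])
  obtain x0 where x0: "x0 \<in> face p" "x0 \<notin> frontier \<Omega>" using nf by blast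
  have "fc T p facet_of T" using Tfacet[OF T] p by blast
  then have "face p \<subseteq> T" by (rule facet_of_imp_subset)
  then have "x0 \<in> closure \<Omega>" using x0(1) mesh_subset_closure[OF T] by blast
  then have "x0 \<in> \<Omega>" using x0(2) interior_open[OF open_\<Omega>] by (simp add: frontier_def)
  then obtain r where r: "r > 0" "ball x0 r \<subseteq> \<Omega>" using open_\<Omega> openE by blast
  define m where "m = mid (face p)"
  \<comment> \<open>\<open>x0\<close> may lie on the rim of the facet. Moving it towards the
    barycentre makes all other coordinates positive, and \<open>s\<close> is small enough to stay in
    the ball inside the domain.\<close>
  define s where "s = min 1 (r / (2 * (norm (m - x0) + 1)))"
  have np: "0 < norm (m - x0) + 1" by (simp add: add_nonneg_pos)
  have s: "0 < s" "s \<le> 1" using r(1) np by (simp_all add: s_def)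
  define x where "x = x0 + s *\<^sub>R (m - x0)"
  have bx: "bary q x = (1 - s) * bary q x0 + s * bary q m" for q
  proof -
    have "bary q x = bary q x0 + bgrad q \<bullet> (s *\<^sub>R (m - x0))" unfolding x_def by (rule bary_add)
    also have "\<dots> = bary q x0 + s * (bary q m - bary q x0)" by (simp only: inner_scaleR_right bary_diff)
    finally show ?thesis by (simp add: algebra_simps)
  qed
  have "x \<in> rel_interior (face p)"
    unfolding rel_interior_face[OF p] bx m_def using x0(1) s p
    by (auto simp: bary_mid_face mem_face[OF p] intro!: add_nonneg_pos mult_nonneg_nonneg)
  have "norm (s *\<^sub>R (m - x0)) < r"
  proof -
    have "s * norm (m - x0) \<le> (r / (2 * (norm (m - x0) + 1))) * (norm (m - x0) + 1)"
      using s np r(1) by (intro mult_mono) (auto simp: s_def)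
    also have "\<dots> = r / 2" using np by (simp add: field_simps)
    finally show ?thesis using r(1) s by simp
  qed
  then have "x \<in> \<Omega>" using r(2) by (auto simp: x_def dist_norm)
  \<comment> \<open>Points on the far side of the facet, where \<open>bary p\<close> is negative,
    tending to \<open>x\<close>.\<close>
  define y where "y = (\<lambda>k::nat. x + (- inverse (real (Suc k))) *\<^sub>R bgrad p)"
  have ylim: "y \<longlonglongrightarrow> x"
  proof -
    have "y \<longlonglongrightarrow> x + (- 0) *\<^sub>R bgrad p"
      unfolding y_def by (intro tendsto_intros LIMSEQ_inverse_real_of_nat)
    then show ?thesis by simp
  qed
  have yT: "y k \<notin> T" for k
  proof -
    have "bary p x = 0" using \<open>x \<in> rel_interior (face p)\<close> by (simp add: rel_interior_face[OF p])
    then have "bary p (y k) = - (inverse (real (Suc k)) * (bgrad p \<bullet> bgrad p))"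
      unfolding y_def bary_add by simp
    also have "\<dots> < 0" using bgrad_nonzero[OF p] by simp
    finally show ?thesis using p mem_simplex[of "y k"] verts(2)[OF T] by force
  qed
  have "closed (\<Union>(\<T> - {T}))" using finite_mesh mesh_simplex(5) by (intro closed_Union) auto
  moreover have "\<forall>\<^sub>F k in sequentially. y k \<in> \<Union>(\<T> - {T})"
  proof -
    have "\<forall>\<^sub>F k in sequentially. y k \<in> \<Omega>" using ylim open_\<Omega> \<open>x \<in> \<Omega>\<close> by (rule topological_tendstoD)
    then show ?thesis
    proof eventually_elim
      case (elim k)
      then have "y k \<in> \<Union>\<T>" using Union_mesh closure_subset by blast
      then show ?case using yT[of k] by blast
    qed
  qed
  ultimately have "x \<in> \<Union>(\<T> - {T})" using ylim by (intro Lim_in_closed_set[of _ y sequentially]) auto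
  then obtain T' where T': "T' \<in> \<T>" "T' \<noteq> T" "x \<in> T'" by blast
  from shared_facet[OF T T'(1) T'(2)[symmetric] p \<open>x \<in> rel_interior (face p)\<close> T'(3)]
  show thesis using that T' by blast
qed

text \<open>Both coordinates vanish on the hyperplane of the common facet, so they are proportional.
  A positive factor would put points near the barycentre into both interiors.\<close>

lemma opposite_sides:
  assumes T: "T \<in> \<T>" "T' \<in> \<T>" "T \<noteq> T'" and p: "p \<in> verts T" "p' \<in> verts T'" and F: "fc T p = fc T' p'"
  shows "\<exists>c<0. \<forall>y. bc T' p' y = c * bc T p y"
proof -
  interpret S: full_simplex "verts T" by (rule verts(1)[OF T(1)])
  interpret S': full_simplex "verts T'" by (rule verts(1)[OF T(2)])
  define m where "m = mid (S.face p)"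
  have m: "m \<in> rel_interior (S.face p)" "m \<in> rel_interior (S'.face p')"
    using S.mid_rel_interior[OF p(1)] by (simp_all add: m_def F[symmetric])
  have bm: "S.bary p m = 0" "S'.bary p' m = 0"
    using m S.rel_interior_face[OF p(1)] S'.rel_interior_face[OF p(2)] by auto
  define c where "c = S'.bary p' p"
  have eq: "S'.bary p' y = c * S.bary p y" for y
  proof -
    \<comment> \<open>The projection of \<open>y\<close> to the hyperplane along
      \<open>p - m\<close>, a direction in which \<open>S.bary p\<close> grows with slope 1.\<close>
    let ?z = "y - S.bary p y *\<^sub>R (p - m)"
    have "S.bary p ?z = S.bary p y - S.bary p y * (S.bgrad p \<bullet> (p - m))"
      using S.bary_add[of p y "- (S.bary p y *\<^sub>R (p - m))"] by simp
    also have "S.bgrad p \<bullet> (p - m) = 1" unfolding S.bary_diff bm using S.bary_vertex[OF p(1,1)] by simp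
    finally have "?z \<in> affine hull (S.face p)" by (simp add: S.affine_hull_face[OF p(1)])
    then have "S'.bary p' ?z = 0" unfolding F by (simp add: S'.affine_hull_face[OF p(2)])
    moreover have "S'.bary p' ?z = S'.bary p' y - S.bary p y * (S'.bgrad p' \<bullet> (p - m))"
      using S'.bary_add[of p' y "- (S.bary p y *\<^sub>R (p - m))"] by simp
    moreover have "S'.bgrad p' \<bullet> (p - m) = c" unfolding S'.bary_diff bm by (simp add: c_def)
    ultimately show ?thesis by (simp add: mult.commute)
  qed
  have "c \<noteq> 0" using eq[of p'] S'.bary_vertex[OF p(2,2)] by auto
  moreover have "\<not> c > 0"
  proof
    assume c: "c > 0"
    obtain e where e: "e > 0" "\<And>y. dist y m < e \<Longrightarrow> 0 < S.bary p y \<Longrightarrow> y \<in> interior (convex hull (verts T))"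
      using S.rel_interior_face_neighbourhood[OF p(1) m(1)] by blast
    obtain e' where e': "e' > 0" "\<And>y. dist y m < e' \<Longrightarrow> 0 < S'.bary p' y \<Longrightarrow> y \<in> interior (convex hull (verts T'))"
      using S'.rel_interior_face_neighbourhood[OF p(2) m(2)] by blast
    \<comment> \<open>A short step from the barycentre along this gradient raises both coordinates
      and stays within both neighbourhoods, so it ends in both interiors.\<close>
    let ?G = "S.bgrad p"
    have G: "norm ?G > 0" using S.bgrad_nonzero[OF p(1)] by simp
    define s where "s = min e e' / (2 * norm ?G)"
    have s: "s > 0" using e(1) e'(1) G by (simp add: s_def)
    define y where "y = m + s *\<^sub>R ?G"
    have "dist y m = s * norm ?G" using s by (simp add: y_def dist_norm)
    also have "\<dots> = min e e' / 2" using G by (simp add: s_def)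
    finally have "dist y m = min e e' / 2" .
    then have d: "dist y m < e" "dist y m < e'" using e(1) e'(1) by linarith+
    have b: "0 < S.bary p y" using S.bgrad_nonzero[OF p(1)] s by (simp add: y_def S.bary_add bm)
    then have b': "0 < S'.bary p' y" using eq c by simp
    from interiors_disjoint[OF T(1,2), of y] e(2)[OF d(1) b] e'(2)[OF d(2) b'] T(3)
    show False by (simp add: verts(2)[OF T(1), symmetric] verts(2)[OF T(2), symmetric])
  qed
  ultimately have "c < 0" by simp
  then show ?thesis using eq by blast
qed

text \<open>Near \<open>x\<close> each simplex fills the half of a ball where its own coordinate is
  nonnegative; by \<open>opposite_sides\<close> the two halves cover the ball.\<close>

lemma interior_of_pair:
  assumes T: "T \<in> \<T>" "T' \<in> \<T>" "T \<noteq> T'" and F: "F facet_of T" "F facet_of T'" and x: "x \<in> rel_interior F"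
  shows "x \<in> interior (T \<union> T')"
proof -
  interpret S: full_simplex "verts T" by (rule verts(1)[OF T(1)])
  interpret S': full_simplex "verts T'" by (rule verts(1)[OF T(2)])
  from F(1) obtain p where p: "p \<in> verts T" "F = S.face p" unfolding Tfacet[OF T(1)] by (elim bexE)
  from F(2) obtain p' where p': "p' \<in> verts T'" "F = S'.face p'" unfolding Tfacet[OF T(2)] by (elim bexE)
  note p = p p'
  obtain c where c: "c < 0" "\<forall>y. S'.bary p' y = c * S.bary p y"
    using opposite_sides[OF T p(1,3) trans[OF p(2)[symmetric] p(4)]] by blast
  obtain e where e: "e > 0" "\<And>y. dist y x < e \<Longrightarrow> 0 \<le> S.bary p y \<Longrightarrow> y \<in> convex hull (verts T)"
    using S.rel_interior_face_neighbourhood[OF p(1) x[unfolded p(2)]] by blast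
  obtain e' where e': "e' > 0" "\<And>y. dist y x < e' \<Longrightarrow> 0 \<le> S'.bary p' y \<Longrightarrow> y \<in> convex hull (verts T')"
    using S'.rel_interior_face_neighbourhood[OF p(3) x[unfolded p(4)]] by blast
  have "ball x (min e e') \<subseteq> T \<union> T'"
  proof
    fix y assume "y \<in> ball x (min e e')"
    then have d: "dist y x < e" "dist y x < e'" by (simp_all add: dist_commute)
    show "y \<in> T \<union> T'"
    proof (cases "0 \<le> S.bary p y")
      case True
      from e(2)[OF d(1) this] show ?thesis by (simp add: verts(2)[OF T(1), symmetric])
    next
      case False
      then have "0 \<le> S'.bary p' y" using c by (simp add: mult_nonpos_nonpos)
      from e'(2)[OF d(2) this] show ?thesis by (simp add: verts(2)[OF T(2), symmetric])
    qed
  qed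
  moreover have "min e e' > 0" using e(1) e'(1) by simp
  ultimately show ?thesis unfolding mem_interior by blast
qed

text \<open>Three simplices would be pairwise on opposite sides, but the product of two negative
  factors of proportionality is positive.\<close>

lemma at_most_two:
  assumes T: "T1 \<in> \<T>" "T2 \<in> \<T>" "T3 \<in> \<T>" and F: "F facet_of T1" "F facet_of T2" "F facet_of T3"
    and ne: "T1 \<noteq> T2" "T1 \<noteq> T3"
  shows "T2 = T3"
proof (rule ccontr)
  assume n: "T2 \<noteq> T3"
  from F(1) obtain p1 where p1: "p1 \<in> verts T1" "F = fc T1 p1" unfolding Tfacet[OF T(1)] by (elim bexE)
  from F(2) obtain p2 where p2: "p2 \<in> verts T2" "F = fc T2 p2" unfolding Tfacet[OF T(2)] by (elim bexE)
  from F(3) obtain p3 where p3: "p3 \<in> verts T3" "F = fc T3 p3" unfolding Tfacet[OF T(3)] by (elim bexE)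
  note p = p1 p2 p3
  obtain c12 where c12: "c12 < 0" "\<forall>y. bc T2 p2 y = c12 * bc T1 p1 y"
    using opposite_sides[OF T(1,2) ne(1) p(1,3) trans[OF p(2)[symmetric] p(4)]] by blast
  obtain c13 where c13: "c13 < 0" "\<forall>y. bc T3 p3 y = c13 * bc T1 p1 y"
    using opposite_sides[OF T(1,3) ne(2) p(1,5) trans[OF p(2)[symmetric] p(6)]] by blast
  obtain c23 where c23: "c23 < 0" "\<forall>y. bc T3 p3 y = c23 * bc T2 p2 y"
    using opposite_sides[OF T(2,3) n p(3,5) trans[OF p(4)[symmetric] p(6)]] by blast
  have "bc T1 p1 p1 = 1" using full_simplex.bary_vertex[OF verts(1)[OF T(1)] p(1,1)] by simp
  then have "c13 = c23 * c12" using c12(2)[rule_format, of p1] c13(2)[rule_format, of p1] c23(2)[rule_format, of p1] by simp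
  moreover have "c23 * c12 > 0" using c23(1) c12(1) by (rule mult_neg_neg)
  ultimately show False using c13(1) by simp
qed

end

section \<open>Integration over the mesh and piecewise affine functions\<close>

lemma lin_closed_sum:
  assumes "lin_closed X" "finite S" "\<And>i. i \<in> S \<Longrightarrow> g i \<in> X"
  shows "(\<lambda>x. \<Sum>i\<in>S. c i * g i x) \<in> X"
  using assms(2,3)
proof (induction S rule: finite_induct)
  case empty
  then show ?case using assms(1) by (simp add: lin_closed_def)
next
  case (insert i S)
  then show ?case using lin_closedD[OF assms(1), of "g i" "\<lambda>x. \<Sum>i\<in>S. c i * g i x" "c i" 1] by simp
qed

text \<open>Piecewise affine functions are unconstrained on the skeleton, so their measurability
  rests on completeness of Lebesgue measure.\<close>

lemma borel_measurable_null_support: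
  fixes f :: "'a::euclidean_space \<Rightarrow> real"
  assumes N: "N \<in> null_sets lebesgue" and f: "\<And>x. x \<notin> N \<Longrightarrow> f x = 0"
  shows "f \<in> borel_measurable lebesgue"
proof (rule measurableI)
  fix A :: "real set" assume "A \<in> sets borel"
  have null: "S \<in> sets lebesgue" if "S \<subseteq> N" for S
  proof -
    have "negligible N" using N by (simp add: negligible_iff_null_sets)
    then have "negligible S" using that by (rule negligible_subset)
    then show ?thesis by (simp add: negligible_iff_null_sets null_setsD2)
  qed
  show "f -` A \<inter> space lebesgue \<in> sets lebesgue"
  proof (cases "0 \<in> A")
    case False
    have "f -` A \<subseteq> N"
    proof
      fix x assume "x \<in> f -` A"
      then show "x \<in> N" using False f[of x] by (cases "x \<in> N") auto
    qed
    from null[OF this] show ?thesis by simp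
  next
    case True
    have "- (f -` A) \<subseteq> N"
    proof
      fix x assume "x \<in> - (f -` A)"
      then show "x \<in> N" using True f[of x] by (cases "x \<in> N") auto
    qed
    from sets.compl_sets[OF null[OF this]] show ?thesis by (simp add: Compl_eq_Diff_UNIV double_diff)
  qed
qed simp

context cr_mesh
begin

lemma \<Omega>_measurable: "\<Omega> \<in> sets lebesgue"
  using open_\<Omega> by auto

lemma interior_mesh_measurable: "T \<in> \<T> \<Longrightarrow> interior T \<in> sets lebesgue"
  by auto

lemma skeleton_null: "\<Omega> - (\<Union>T\<in>\<T>. interior T) \<in> null_sets lebesgue"
proof -
  have "negligible (\<Union>T\<in>\<T>. frontier T)"
    using finite_mesh mesh_simplex(2) by (intro negligible_Union) (auto intro: negligible_convex_frontier)
  moreover have "\<Omega> - (\<Union>T\<in>\<T>. interior T) \<subseteq> (\<Union>T\<in>\<T>. frontier T)"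
  proof
    fix x assume x: "x \<in> \<Omega> - (\<Union>T\<in>\<T>. interior T)"
    then have "x \<in> \<Union>\<T>" using Union_mesh closure_subset by blast
    then obtain T where "T \<in> \<T>" "x \<in> T" by blast
    then show "x \<in> (\<Union>T\<in>\<T>. frontier T)" using x closure_subset[of T] by (auto simp: frontier_def)
  qed
  ultimately show ?thesis using negligible_subset by (simp add: negligible_iff_null_sets) 
qed

lemma AE_mesh_iff:
  "(AE x in lebesgue_on \<Omega>. P x) \<longleftrightarrow> (\<forall>T\<in>\<T>. AE x in lebesgue_on (interior T). P x)"
proof
  assume P: "AE x in lebesgue_on \<Omega>. P x"
  show "\<forall>T\<in>\<T>. AE x in lebesgue_on (interior T). P x"
  proof
    fix T assume T: "T \<in> \<T>"
    have "AE x in lebesgue. x \<in> \<Omega> \<longrightarrow> P x" using P \<Omega>_measurable by (simp add: AE_restrict_space_iff)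
    then have "AE x in lebesgue. x \<in> interior T \<longrightarrow> P x"
      by eventually_elim (use interior_subset_\<Omega>[OF T] in blast)
    then show "AE x in lebesgue_on (interior T). P x" by (simp add: AE_restrict_space_iff)
  qed
next
  assume P: "\<forall>T\<in>\<T>. AE x in lebesgue_on (interior T). P x"
  have "AE x in lebesgue. \<forall>T\<in>\<T>. x \<in> interior T \<longrightarrow> P x"
    using P by (subst AE_ball_countable[OF countable_finite[OF finite_mesh]]) (simp add: AE_restrict_space_iff)
  then have "AE x in lebesgue. x \<in> \<Omega> \<longrightarrow> P x"
    using AE_not_in[OF skeleton_null] by eventually_elim blast
  then show "AE x in lebesgue_on \<Omega>. P x" using \<Omega>_measurable by (simp add: AE_restrict_space_iff)
qed

lemma indicator_mesh:
  assumes "x \<notin> \<Omega> - (\<Union>T\<in>\<T>. interior T)"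
  shows "indicator \<Omega> x = (\<Sum>T\<in>\<T>. indicator (interior T) x :: real)"
proof (cases "x \<in> \<Omega>")
  case True
  then obtain T where T: "T \<in> \<T>" "x \<in> interior T" using assms by blast
  have "(\<Sum>S\<in>\<T>. indicator (interior S) x :: real) = (\<Sum>S\<in>\<T>. if S = T then 1 else 0)"
  proof (intro sum.cong refl)
    fix S assume S: "S \<in> \<T>"
    show "indicator (interior S) x = (if S = T then 1 else 0 :: real)"
    proof (cases "S = T")
      case False
      then have "x \<notin> interior S" using interiors_disjoint[OF S T(1) _ T(2)] by blast
      then show ?thesis using False by simp
    qed (use T in simp)
  qed
  then show ?thesis using True T finite_mesh by simp
next
  case False
  then have "indicator (interior T) x = (0::real)" if "T \<in> \<T>" for T
    using interior_subset_\<Omega>[OF that] by (auto simp: indicator_def)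
  then show ?thesis using False by simp
qed

lemma integral_mesh:
  fixes f :: "'a \<Rightarrow> real"
  assumes f: "integrable (lebesgue_on \<Omega>) f"
  shows "(LINT x|lebesgue_on \<Omega>. f x) = (\<Sum>T\<in>\<T>. LINT x|lebesgue_on (interior T). f x)"
    and "\<And>T. T \<in> \<T> \<Longrightarrow> integrable (lebesgue_on (interior T)) f"
proof -
  have i: "integrable lebesgue (\<lambda>x. indicator \<Omega> x * f x)" using f \<Omega>_measurable by (simp add: integrable_restrict_space)
  have eq: "(\<lambda>x. indicator (interior T) x *\<^sub>R (indicator \<Omega> x * f x)) = (\<lambda>x. indicator (interior T) x * f x)" if "T \<in> \<T>" for T
    using interior_subset_\<Omega>[OF that] by (auto simp: indicator_def fun_eq_iff)
  have iT: "integrable lebesgue (\<lambda>x. indicator (interior T) x * f x)" if "T \<in> \<T>" for T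
    using integrable_mult_indicator[OF interior_mesh_measurable[OF that] i] unfolding eq[OF that] .
  then show "integrable (lebesgue_on (interior T)) f" if "T \<in> \<T>" for T
    using that by (simp add: integrable_restrict_space)
  have "(LINT x|lebesgue_on \<Omega>. f x) = (\<integral>x. indicator \<Omega> x * f x \<partial>lebesgue)"
    using \<Omega>_measurable by (simp add: integral_restrict_space)
  also have "\<dots> = (\<integral>x. (\<Sum>T\<in>\<T>. indicator (interior T) x * f x) \<partial>lebesgue)"
  proof (rule integral_cong_AE)
    show "(\<lambda>x. indicator \<Omega> x * f x) \<in> borel_measurable lebesgue" by (rule borel_measurable_integrable[OF i])
    show "(\<lambda>x. \<Sum>T\<in>\<T>. indicator (interior T) x * f x) \<in> borel_measurable lebesgue"
      by (rule borel_measurable_sum) (rule borel_measurable_integrable[OF iT])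
    show "AE x in lebesgue. indicator \<Omega> x * f x = (\<Sum>T\<in>\<T>. indicator (interior T) x * f x)"
      using AE_not_in[OF skeleton_null]
    proof eventually_elim
      case (elim x)
      show ?case unfolding indicator_mesh[OF elim] by (rule sum_distrib_right)
    qed
  qed
  also have "\<dots> = (\<Sum>T\<in>\<T>. \<integral>x. indicator (interior T) x * f x \<partial>lebesgue)"
    by (rule Bochner_Integration.integral_sum[OF iT])
  also have "\<dots> = (\<Sum>T\<in>\<T>. LINT x|lebesgue_on (interior T). f x)"
    by (intro sum.cong refl) (simp add: integral_restrict_space)
  finally show "(LINT x|lebesgue_on \<Omega>. f x) = (\<Sum>T\<in>\<T>. LINT x|lebesgue_on (interior T). f x)" .
qed

lemma integrable_meshI:
  fixes f :: "'a \<Rightarrow> real"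
  assumes f: "\<And>T. T \<in> \<T> \<Longrightarrow> integrable (lebesgue_on (interior T)) f"
  shows "integrable (lebesgue_on \<Omega>) f"
proof -
  have iT: "integrable lebesgue (\<lambda>x. indicator (interior T) x * f x)" if "T \<in> \<T>" for T
    using f[OF that] by (simp add: integrable_restrict_space)
  let ?N = "\<Omega> - (\<Union>T\<in>\<T>. interior T)"
  have s: "integrable lebesgue (\<lambda>x. \<Sum>T\<in>\<T>. indicator (interior T) x * f x)"
    by (rule Bochner_Integration.integrable_sum[OF iT])
  \<comment> \<open>Off the skeleton the interiors partition the domain. On it \<open>f\<close> is
    arbitrary, so this part is kept as a separate term with null support.\<close>
  have e: "indicator \<Omega> x * f x = (\<Sum>T\<in>\<T>. indicator (interior T) x * f x) + indicator ?N x * f x" for x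
  proof (cases "x \<in> ?N")
    case True
    then show ?thesis by (auto simp: indicator_def intro!: sum.neutral)
  next
    case False
    then show ?thesis by (simp add: indicator_mesh[OF False] sum_distrib_right del: Diff_iff)
  qed
  have n: "(\<lambda>x. indicator ?N x * f x) \<in> borel_measurable lebesgue"
    by (rule borel_measurable_null_support[OF skeleton_null]) simp
  have "AE x in lebesgue. (\<Sum>T\<in>\<T>. indicator (interior T) x * f x) = indicator \<Omega> x * f x"
    using AE_not_in[OF skeleton_null] by eventually_elim (simp add: e)
  moreover have "(\<lambda>x. indicator \<Omega> x * f x) \<in> borel_measurable lebesgue"
    unfolding e by (intro borel_measurable_add borel_measurable_integrable[OF s] n)
  ultimately have "integrable lebesgue (\<lambda>x. indicator \<Omega> x * f x)"
    by (intro integrable_cong_AE_imp[OF s])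
  then show ?thesis using \<Omega>_measurable by (simp add: integrable_restrict_space)
qed

lemma bounded_interior_mesh: "T \<in> \<T> \<Longrightarrow> bounded (interior T)"
  by (rule bounded_subset[OF compact_imp_bounded[OF mesh_simplex(1)] interior_subset])

lemma L2_space_meshI:
  fixes f :: "'a \<Rightarrow> real"
  assumes f: "\<And>T. T \<in> \<T> \<Longrightarrow> f \<in> L2_space (lebesgue_on (interior T))"
  shows "f \<in> L2_space (lebesgue_on \<Omega>)"
proof -
  have one: "(\<lambda>_. 1::real) \<in> L2_space (lebesgue_on (interior T))" if "T \<in> \<T>" for T
    by (rule continuous_L2_space[OF continuous_on_const bounded_interior_mesh[OF that] interior_mesh_measurable[OF that]])
  have "integrable (lebesgue_on \<Omega>) f"
  proof (rule integrable_meshI)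
    fix T assume T: "T \<in> \<T>"
    from L2_space_mult_integrable[OF f[OF T] one[OF T]] show "integrable (lebesgue_on (interior T)) f" by simp
  qed
  moreover have "integrable (lebesgue_on \<Omega>) (\<lambda>x. (f x)\<^sup>2)"
  proof (rule integrable_meshI)
    fix T assume T: "T \<in> \<T>"
    from L2_space_integrable[OF f[OF T]] show "integrable (lebesgue_on (interior T)) (\<lambda>x. (f x)\<^sup>2)" by simp
  qed
  ultimately show ?thesis by (simp add: L2_space_def)
qed

definition coeffs :: "('a \<Rightarrow> real) \<Rightarrow> 'a set \<Rightarrow> 'a \<times> real" where
  "coeffs v T = (SOME z. \<forall>x\<in>interior T. v x = fst z \<bullet> x + snd z)"

abbreviation "slope v T \<equiv> fst (coeffs v T)"
abbreviation "offset v T \<equiv> snd (coeffs v T)"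

lemma P1_coeffs:
  assumes "v \<in> P1 \<T>" "T \<in> \<T>" "x \<in> interior T"
  shows "v x = slope v T \<bullet> x + offset v T"
proof -
  obtain a b where "\<forall>x\<in>interior T. v x = a \<bullet> x + b" using assms(1,2) unfolding P1_def by blast
  then have "\<exists>z. \<forall>x\<in>interior T. v x = fst z \<bullet> x + snd z" by (intro exI[of _ "(a, b)"]) simp
  then have "\<forall>x\<in>interior T. v x = slope v T \<bullet> x + offset v T" unfolding coeffs_def by (rule someI_ex)
  then show ?thesis using assms(3) by blast
qed

lemma trace_eqI:
  assumes T: "T \<in> \<T>" and v: "\<And>x. x \<in> interior T \<Longrightarrow> v x = a \<bullet> x + b" and x: "x \<in> T"
  shows "trace_from T v x = a \<bullet> x + b"
  using full_simplex.trace_affine[OF verts(1)[OF T], of v a b x] v x by (simp add: verts(2)[OF T, symmetric])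

lemma trace_P1: "v \<in> P1 \<T> \<Longrightarrow> T \<in> \<T> \<Longrightarrow> x \<in> T \<Longrightarrow> trace_from T v x = slope v T \<bullet> x + offset v T"
  by (rule trace_eqI) (auto intro: P1_coeffs)

lemma trace_lincomb:
  assumes "u \<in> P1 \<T>" "v \<in> P1 \<T>" "T \<in> \<T>" "x \<in> T"
  shows "trace_from T (\<lambda>x. c * u x + d * v x) x = c * trace_from T u x + d * trace_from T v x"
proof -
  have "trace_from T (\<lambda>x. c * u x + d * v x) x
    = (c *\<^sub>R slope u T + d *\<^sub>R slope v T) \<bullet> x + (c * offset u T + d * offset v T)"
    using assms by (intro trace_eqI) (auto simp: P1_coeffs inner_add_left algebra_simps)
  then show ?thesis using assms by (simp add: trace_P1 inner_add_left algebra_simps)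
qed

lemma trace_sum:
  assumes "finite S" "\<And>i. i \<in> S \<Longrightarrow> g i \<in> P1 \<T>" "T \<in> \<T>" "x \<in> T"
  shows "trace_from T (\<lambda>x. \<Sum>i\<in>S. c i * g i x) x = (\<Sum>i\<in>S. c i * trace_from T (g i) x)"
proof -
  have "trace_from T (\<lambda>x. \<Sum>i\<in>S. c i * g i x) x
    = (\<Sum>i\<in>S. c i *\<^sub>R slope (g i) T) \<bullet> x + (\<Sum>i\<in>S. c i * offset (g i) T)"
    using assms by (intro trace_eqI) (auto simp: P1_coeffs inner_sum_left sum.distrib distrib_left intro!: sum.cong)
  then show ?thesis using assms by (simp add: trace_P1 inner_sum_left sum.distrib distrib_left)
qed

lemma facet_mid:
  assumes "T \<in> \<T>" "F facet_of T"
  shows "mid F \<in> T" "mid F \<in> rel_interior F"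
proof -
  interpret full_simplex "verts T" by (rule verts(1)[OF assms(1)])
  from assms(2) obtain p where p: "p \<in> verts T" "F = face p" unfolding Tfacet[OF assms(1)] by (elim bexE)
  show m: "mid F \<in> rel_interior F" unfolding p(2) by (rule mid_rel_interior[OF p(1)])
  then show "mid F \<in> T" using rel_interior_subset facet_of_imp_subset[OF assms(2)] by blast
qed

lemma T_plus:
  assumes "F \<in> mesh_faces \<T>"
  shows "T_plus \<T> F \<in> \<T>" "F facet_of T_plus \<T> F"
proof -
  have "\<exists>T. T \<in> \<T> \<and> F facet_of T" using assms by (auto simp: mesh_faces_def)
  from someI_ex[OF this] show "T_plus \<T> F \<in> \<T>" "F facet_of T_plus \<T> F" by (simp_all add: T_plus_def)
qed

text \<open>By \<open>second_simplex\<close>, a face that is not in the frontier has a neighbour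
  across it, so the choice is meaningful.\<close>

lemma T_minus:
  assumes "F \<in> interior_faces \<Omega> \<T>"
  shows "T_minus \<T> F \<in> \<T>" "F facet_of T_minus \<T> F" "T_minus \<T> F \<noteq> T_plus \<T> F"
proof -
  have F: "F \<in> mesh_faces \<T>" "\<not> F \<subseteq> frontier \<Omega>" using assms by (auto simp: interior_faces_def)
  note T = T_plus[OF F(1)]
  from T(2) obtain p where p: "p \<in> verts (T_plus \<T> F)" "F = fc (T_plus \<T> F) p" unfolding Tfacet[OF T(1)] by (elim bexE)
  obtain T' where "T' \<in> \<T>" "T' \<noteq> T_plus \<T> F" "fc (T_plus \<T> F) p facet_of T'"
    using second_simplex[OF T(1) p(1)] F(2) p(2) by metis
  then have "\<exists>T'. T' \<in> \<T> \<and> F facet_of T' \<and> T' \<noteq> T_plus \<T> F" using p(2)[symmetric] by auto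
  from someI_ex[OF this] show "T_minus \<T> F \<in> \<T>" "F facet_of T_minus \<T> F" "T_minus \<T> F \<noteq> T_plus \<T> F"
    by (simp_all add: T_minus_def)
qed

lemma interior_face_mesh_face: "F \<in> interior_faces \<Omega> \<T> \<Longrightarrow> F \<in> mesh_faces \<T>"
  by (simp add: interior_faces_def)

lemma jump_lincomb:
  assumes "u \<in> P1 \<T>" "v \<in> P1 \<T>" "F \<in> mesh_faces \<T>"
  shows "jump \<Omega> \<T> (\<lambda>x. c * u x + d * v x) F (mid F) = c * jump \<Omega> \<T> u F (mid F) + d * jump \<Omega> \<T> v F (mid F)"
proof -
  note p = T_plus[OF assms(3)]
  have 1: "trace_from (T_plus \<T> F) (\<lambda>x. c * u x + d * v x) (mid F)
    = c * trace_from (T_plus \<T> F) u (mid F) + d * trace_from (T_plus \<T> F) v (mid F)"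
    by (rule trace_lincomb[OF assms(1,2) p(1) facet_mid(1)[OF p]])
  show ?thesis
  proof (cases "F \<in> interior_faces \<Omega> \<T>")
    case True
    note m = T_minus[OF True]
    have "trace_from (T_minus \<T> F) (\<lambda>x. c * u x + d * v x) (mid F)
      = c * trace_from (T_minus \<T> F) u (mid F) + d * trace_from (T_minus \<T> F) v (mid F)"
      by (rule trace_lincomb[OF assms(1,2) m(1) facet_mid(1)[OF m(1,2)]])
    then show ?thesis using True 1 by (simp add: jump_def algebra_simps)
  next
    case False
    then show ?thesis using 1 by (simp add: jump_def)
  qed
qed

lemma P1_lincomb:
  assumes "u \<in> P1 \<T>" "v \<in> P1 \<T>"
  shows "(\<lambda>x. c * u x + d * v x) \<in> P1 \<T>"
  unfolding P1_def
proof (intro CollectI ballI)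
  fix T assume T: "T \<in> \<T>"
  have "\<forall>x\<in>interior T. c * u x + d * v x = (c *\<^sub>R slope u T + d *\<^sub>R slope v T) \<bullet> x + (c * offset u T + d * offset v T)"
    using assms T by (simp add: P1_coeffs inner_add_left algebra_simps)
  then show "\<exists>a b. \<forall>x\<in>interior T. c * u x + d * v x = a \<bullet> x + b" by blast
qed

lemma CR10_P1: "v \<in> CR10 \<Omega> \<T> \<Longrightarrow> v \<in> P1 \<T>"
  by (simp add: CR10_def)

lemma lin_closed_CR10: "lin_closed (CR10 \<Omega> \<T>)"
proof -
  have z: "(\<lambda>x. 0) \<in> P1 \<T>" unfolding P1_def by (auto intro!: exI[of _ 0])
  have "trace_from T (\<lambda>x. 0) x = 0" if "T \<in> \<T>" "x \<in> T" for T x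
    using trace_eqI[OF that(1) _ that(2), of "\<lambda>x. 0" 0 0] by simp
  then have "jump \<Omega> \<T> (\<lambda>x. 0) F (mid F) = 0" if "F \<in> mesh_faces \<T>" for F
    using T_plus[OF that] T_minus facet_mid(1) by (simp add: jump_def)
  then have "(\<lambda>x. 0) \<in> CR10 \<Omega> \<T>" using z by (simp add: CR10_def)
  then show ?thesis
    unfolding lin_closed_def by (auto simp: CR10_def P1_lincomb jump_lincomb)
qed

lemma CR10_weak_gradient:
  assumes v: "v \<in> P1 \<T>" and T: "T \<in> \<T>"
  shows "has_weak_gradient (interior T) v (\<lambda>_. slope v T)"
proof (rule has_weak_gradient_cong)
  show "slope v T \<bullet> x + offset v T = v x" if "x \<in> interior T" for x using P1_coeffs[OF v T that] by simp
  note b = bounded_interior_mesh[OF T]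
  note m = interior_mesh_measurable[OF T]
  show "has_weak_gradient (interior T) (\<lambda>x. slope v T \<bullet> x + offset v T) (\<lambda>_. slope v T)"
  proof (rule has_weak_gradientI_classical)
    show "((\<lambda>x. slope v T \<bullet> x + offset v T) has_derivative (\<lambda>h. slope v T \<bullet> h)) (at x)" for x
      by (auto intro!: derivative_eq_intros)
    show "(\<lambda>x. slope v T \<bullet> x + offset v T) \<in> L2_space (lebesgue_on (interior T))"
      by (rule continuous_L2_space[OF _ b m]) (intro continuous_intros)
    show "(\<lambda>_. slope v T) \<in> L2_space (lebesgue_on (interior T))"
      by (rule continuous_L2_space[OF _ b m]) (intro continuous_intros)
  qed auto
qed

lemma CR10_finite_dim:
  "\<exists>N. \<forall>m u. (\<forall>i<m. u i \<in> CR10 \<Omega> \<T>) \<longrightarrow> ae_independent (lebesgue_on \<Omega>) m u \<longrightarrow> m \<le> N"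
proof (intro exI allI impI)
  fix m u assume u: "\<forall>i<m. u i \<in> CR10 \<Omega> \<T>" and ind: "ae_independent (lebesgue_on \<Omega>) m u"
  \<comment> \<open>One index per affine coefficient on each simplex; 0 stands for the offset and
    cannot be confused with a basis vector.\<close>
  let ?I = "\<T> \<times> insert 0 (Basis :: 'a set)"
  show "m \<le> card ?I"
  proof (rule ccontr)
    assume "\<not> m \<le> card ?I"
    then have lt: "card ?I < card {..<m}" by simp
    have fin: "finite ?I" using finite_mesh by auto
    define A where "A = (\<lambda>(T, z) j. if z = 0 then offset (u j) T else slope (u j) T \<bullet> z)"
    from homogeneous_system_nontrivial[OF fin finite_lessThan lt, of A]
    obtain c where c: "\<exists>j\<in>{..<m}. c j \<noteq> 0" "\<forall>i\<in>?I. (\<Sum>j<m. A i j * c j) = 0" by blast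
    have "\<forall>T\<in>\<T>. AE x in lebesgue_on (interior T). (\<Sum>i<m. c i * u i x) = 0"
    proof
      fix T assume T: "T \<in> \<T>"
      have off: "(\<Sum>j<m. c j * offset (u j) T) = 0"
        using c(2)[rule_format, of "(T, 0)"] T by (simp add: A_def mult.commute)
      have "(\<Sum>j<m. c j *\<^sub>R slope (u j) T) = 0"
      proof (rule euclidean_eqI)
        fix b :: 'a assume b: "b \<in> Basis"
        have "(\<Sum>j<m. slope (u j) T \<bullet> b * c j) = 0"
          using c(2)[rule_format, of "(T, b)"] T b nonzero_Basis[OF b] by (simp add: A_def)
        then show "(\<Sum>j<m. c j *\<^sub>R slope (u j) T) \<bullet> b = 0 \<bullet> b" by (simp add: inner_sum_left mult.commute)
      qed
      then have sl: "(\<Sum>j<m. c j * (slope (u j) T \<bullet> x)) = 0" for x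
        using inner_sum_left[of "\<lambda>j. c j *\<^sub>R slope (u j) T" "{..<m}" x] by simp
      have "(\<Sum>i<m. c i * u i x) = 0" if "x \<in> interior T" for x
      proof -
        have "(\<Sum>i<m. c i * u i x) = (\<Sum>i<m. c i * (slope (u i) T \<bullet> x) + c i * offset (u i) T)"
          using u T that by (intro sum.cong refl) (simp add: P1_coeffs CR10_P1 distrib_left)
        then show ?thesis using off sl by (simp add: sum.distrib)
      qed
      then show "AE x in lebesgue_on (interior T). (\<Sum>i<m. c i * u i x) = 0" by (intro AE_I2) simp
    qed
    then have "AE x in lebesgue_on \<Omega>. (\<Sum>i<m. c i * u i x) = 0" by (simp add: AE_mesh_iff)
    then show False using ind[unfolded ae_independent_def, THEN spec, of c] c(1) by blast
  qed
qed

section \<open>The Crouzeix--Raviart basis and the interpolation operator\<close>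

text \<open>The explicit basis function, equal to 1 at the barycentre of \<open>F\<close> and 0 at
  those of the other faces. It shows that the choice in \<open>CR_basis\<close> has a
  witness.\<close>

definition CR_hat :: "'a set \<Rightarrow> 'a \<Rightarrow> real" where
  "CR_hat F x = (\<Sum>T\<in>\<T>. indicator (interior T) x *
     (if F facet_of T then 1 - real DIM('a) * bc T (SOME p. p \<in> verts T \<and> F = fc T p) x else 0))"

lemma CR_hat_interior:
  assumes T: "T \<in> \<T>" and x: "x \<in> interior T"
  shows "CR_hat F x = (if F facet_of T then 1 - real DIM('a) * bc T (SOME p. p \<in> verts T \<and> F = fc T p) x else 0)"
proof -
  have "CR_hat F x = (\<Sum>S\<in>\<T>. if S = T then (if F facet_of T then 1 - real DIM('a) * bc T (SOME p. p \<in> verts T \<and> F = fc T p) x else 0) else 0)"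
    unfolding CR_hat_def
  proof (intro sum.cong refl)
    fix S assume S: "S \<in> \<T>"
    show "indicator (interior S) x * (if F facet_of S then 1 - real DIM('a) * bc S (SOME p. p \<in> verts S \<and> F = fc S p) x else 0)
      = (if S = T then (if F facet_of T then 1 - real DIM('a) * bc T (SOME p. p \<in> verts T \<and> F = fc T p) x else 0) else 0)"
    proof (cases "S = T")
      case False
      then have "x \<notin> interior S" using interiors_disjoint[OF S T] x by blast
      then show ?thesis using False by simp
    qed (use x in simp)
  qed
  then show ?thesis using T finite_mesh by simp
qed

lemma CR_hat_coeffs:
  assumes T: "T \<in> \<T>"
  shows "\<exists>a b. (\<forall>x\<in>interior T. CR_hat F x = a \<bullet> x + b) \<and>
    (\<forall>E. E facet_of T \<longrightarrow> a \<bullet> mid E + b = (if E = F then 1 else 0))"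
proof (cases "F facet_of T")
  case True
  interpret full_simplex "verts T" by (rule verts(1)[OF T])
  define p where "p = (SOME p. p \<in> verts T \<and> F = face p)"
  have "\<exists>p. p \<in> verts T \<and> F = face p" using True Tfacet[OF T] by auto
  from someI_ex[OF this] have p: "p \<in> verts T" "F = face p" by (simp_all add: p_def)
  define a b where "a = - (real DIM('a) *\<^sub>R bgrad p)" and "b = 1 - real DIM('a) * snd (bary_coeff p)"
  have ab: "a \<bullet> x + b = 1 - real DIM('a) * bary p x" for x
    by (simp add: a_def b_def bary_def algebra_simps)
  have "a \<bullet> mid E + b = (if E = F then 1 else 0)" if E: "E facet_of T" for E
  proof -
    from E obtain q where q: "q \<in> verts T" "E = face q" unfolding Tfacet[OF T] by (elim bexE)
    have "E = F \<longleftrightarrow> p = q" using face_inj[OF p(1) q(1)] p(2) q(2) by auto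
    then show ?thesis unfolding ab using bary_mid_face[OF q(1) p(1)] q(2) by auto
  qed
  moreover have "\<forall>x\<in>interior T. CR_hat F x = a \<bullet> x + b"
    using CR_hat_interior[OF T] True ab by (simp add: p_def)
  ultimately show ?thesis by blast
next
  case False
  then have "\<forall>x\<in>interior T. CR_hat F x = 0 \<bullet> x + 0" using CR_hat_interior[OF T] by simp
  moreover have "(0::'a) \<bullet> mid E + 0 = (if E = F then 1 else 0::real)" if "E facet_of T" for E
    using that False by auto
  ultimately show ?thesis by blast
qed

lemma CR_basis:
  assumes F: "F \<in> interior_faces \<Omega> \<T>"
  shows "CR_basis \<Omega> \<T> F \<in> CR10 \<Omega> \<T>"
    and "\<And>T E. T \<in> \<T> \<Longrightarrow> E facet_of T \<Longrightarrow> trace_from T (CR_basis \<Omega> \<T> F) (mid E) = (if E = F then 1 else 0)"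
proof -
  have tr: "trace_from T (CR_hat F) (mid E) = (if E = F then 1 else 0)" if T: "T \<in> \<T>" "E facet_of T" for T E
  proof -
    obtain a b where ab: "\<forall>x\<in>interior T. CR_hat F x = a \<bullet> x + b"
      "\<forall>E. E facet_of T \<longrightarrow> a \<bullet> mid E + b = (if E = F then 1 else 0)" using CR_hat_coeffs[OF T(1)] by blast
    have "trace_from T (CR_hat F) (mid E) = a \<bullet> mid E + b"
      using ab(1) by (intro trace_eqI[OF T(1) _ facet_mid(1)[OF T]]) blast
    then show ?thesis using ab(2) T(2) by simp
  qed
  have "CR_hat F \<in> P1 \<T>" unfolding P1_def using CR_hat_coeffs by blast
  moreover have "jump \<Omega> \<T> (CR_hat F) E (mid E) = 0" if E: "E \<in> mesh_faces \<T>" for E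
  proof (cases "E \<in> interior_faces \<Omega> \<T>")
    case True
    then show ?thesis using tr[OF T_plus[OF E]] tr[OF T_minus(1,2)[OF True]] by (simp add: jump_def)
  next
    case False
    then have "E \<noteq> F" using F by blast
    then show ?thesis using tr[OF T_plus[OF E]] False by (simp add: jump_def)
  qed
  ultimately have "CR_hat F \<in> CR10 \<Omega> \<T>" by (simp add: CR10_def)
  with tr have "\<exists>\<psi>. \<psi> \<in> CR10 \<Omega> \<T> \<and>
       (\<forall>T\<in>\<T>. \<forall>E. E facet_of T \<longrightarrow> trace_from T \<psi> (mid E) = (if E = F then 1 else 0))" by blast
  from someI_ex[OF this] have *: "CR_basis \<Omega> \<T> F \<in> CR10 \<Omega> \<T> \<and>
       (\<forall>T\<in>\<T>. \<forall>E. E facet_of T \<longrightarrow> trace_from T (CR_basis \<Omega> \<T> F) (mid E) = (if E = F then 1 else 0))"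
    unfolding CR_basis_def[symmetric] .
  show "CR_basis \<Omega> \<T> F \<in> CR10 \<Omega> \<T>" using * by blast
  show "trace_from T (CR_basis \<Omega> \<T> F) (mid E) = (if E = F then 1 else 0)" if "T \<in> \<T>" "E facet_of T" for T E
    using * that by blast
qed

lemma finite_interior_faces: "finite (interior_faces \<Omega> \<T>)"
proof -
  have "finite (\<Union>T\<in>\<T>. fc T ` verts T)"
    using finite_mesh full_simplex.finite_C[OF verts(1)] by auto
  moreover have "interior_faces \<Omega> \<T> \<subseteq> (\<Union>T\<in>\<T>. fc T ` verts T)"
  proof
    fix F assume "F \<in> interior_faces \<Omega> \<T>"
    then obtain T where T: "T \<in> \<T>" "F facet_of T" by (auto simp: interior_faces_def mesh_faces_def)
    then show "F \<in> (\<Union>T\<in>\<T>. fc T ` verts T)" using Tfacet[OF T(1)] by blast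
  qed
  ultimately show ?thesis by (rule finite_subset[rotated])
qed

lemma I_CR_CR10: "I_CR \<Omega> \<T> v \<in> CR10 \<Omega> \<T>"
  unfolding I_CR_def[abs_def] by (rule lin_closed_sum[OF lin_closed_CR10 finite_interior_faces CR_basis(1)])

text \<open>Test functions vanish on the frontier, and the mean over a face is a limit of their
  averages.\<close>

lemma boundary_face_mean:
  assumes T: "T \<in> \<T>" and E: "E facet_of T" "E \<subseteq> frontier \<Omega>" and v: "v \<in> H10 \<Omega>"
  shows "face_mean \<Omega> E v = 0"
proof -
  interpret full_simplex "verts T" by (rule verts(1)[OF T])
  from E(1) obtain p where p: "p \<in> verts T" "E = face p" unfolding Tfacet[OF T] by (elim bexE)
  obtain \<phi> where \<phi>: "H1_approx \<Omega> \<phi> v" using v by (auto simp: H10_def)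
  have "(\<lambda>j. face_average p (\<phi> j)) \<longlonglongrightarrow> face_mean \<Omega> (face p) v"
    by (rule face_mean_limit[OF p(1) open_\<Omega> bounded_\<Omega> v \<phi>])
  moreover have "face_average p (\<phi> j) = 0" for j
  proof -
    have t: "\<phi> j \<in> test_functions \<Omega>" using \<phi> by (simp add: H1_approx_def)
    have m: "\<phi> j \<in> borel_measurable borel"
      by (rule borel_measurable_continuous_onI[OF smooth_continuous[OF test_functionsD(1)[OF t]]])
    have z: "\<phi> j x = 0" if "x \<in> face p" for x
    proof (rule test_functionsD(5)[OF t])
      show "x \<notin> \<Omega>" using that E(2) p(2) interior_open[OF open_\<Omega>] by (auto simp: frontier_def)
    qed
    have "cyl_integral p (- normal p) (\<phi> j) = cyl_integral p (- normal p) (\<lambda>_. 0)"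
      by (rule cyl_integral_cong) (rule z)
    then show ?thesis
      unfolding face_average_eq[OF p(1) bgrad_normal[OF p(1)] m] by (simp add: cyl_integral_def)
  qed
  ultimately show ?thesis unfolding p(2) by (simp add: LIMSEQ_const_iff)
qed

text \<open>The basis is nodal at the barycentres, so an interior face returns its mean. On a
  boundary face the sum is 0, which by \<open>boundary_face_mean\<close> is again the mean.\<close>

lemma trace_I_CR:
  assumes T: "T \<in> \<T>" and E: "E facet_of T" and v: "v \<in> H10 \<Omega>"
  shows "trace_from T (I_CR \<Omega> \<T> v) (mid E) = face_mean \<Omega> E v"
proof -
  have "trace_from T (I_CR \<Omega> \<T> v) (mid E)
    = (\<Sum>F\<in>interior_faces \<Omega> \<T>. face_mean \<Omega> F v * trace_from T (CR_basis \<Omega> \<T> F) (mid E))"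
    unfolding I_CR_def[abs_def]
    by (rule trace_sum[OF finite_interior_faces CR10_P1[OF CR_basis(1)] T facet_mid(1)[OF T E]])
  also have "\<dots> = (\<Sum>F\<in>interior_faces \<Omega> \<T>. if F = E then face_mean \<Omega> E v else 0)"
    using CR_basis(2)[OF _ T E] by (intro sum.cong) auto
  also have "\<dots> = (if E \<in> interior_faces \<Omega> \<T> then face_mean \<Omega> E v else 0)"
    using finite_interior_faces by simp
  also have "\<dots> = face_mean \<Omega> E v"
  proof (cases "E \<in> interior_faces \<Omega> \<T>")
    case False
    then have "E \<subseteq> frontier \<Omega>" using T E by (auto simp: interior_faces_def mesh_faces_def)
    then show ?thesis using boundary_face_mean[OF T E _ v] False by simp
  qed simp
  finally show ?thesis .
qed

text \<open>Constant \<open>d\<close> is enough: gradients of Crouzeix-Raviart functions are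
  constant on each simplex.\<close>

lemma I_CR_orthogonal:
  assumes T: "T \<in> \<T>" and v: "v \<in> H10 \<Omega>" and g: "has_weak_gradient \<Omega> v g"
  shows "(LINT x|lebesgue_on (interior T). (g x - slope (I_CR \<Omega> \<T> v) T) \<bullet> d) = 0"
proof -
  interpret full_simplex "verts T" by (rule verts(1)[OF T])
  note vT = verts(2)[OF T]
  have sub: "interior (convex hull (verts T)) \<subseteq> \<Omega>" using interior_subset_\<Omega>[OF T] by (simp add: vT[symmetric])
  have w: "slope (I_CR \<Omega> \<T> v) T \<bullet> mid (face P) + offset (I_CR \<Omega> \<T> v) T = face_mean \<Omega> (face P) v" if P: "P \<in> verts T" for P
  proof -
    have "face P facet_of T" using Tfacet[OF T] P by blast
    from trace_I_CR[OF T this v] trace_P1[OF CR10_P1[OF I_CR_CR10] T facet_mid(1)[OF T this]]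
    show ?thesis by simp
  qed
  from interpolation_gradient_orthogonal[OF open_\<Omega> bounded_\<Omega> sub v g w] show ?thesis
    by (simp add: vT[symmetric])
qed

end

section \<open>Definiteness of the discrete energy\<close>

context full_simplex
begin

text \<open>Edges to a third vertex isolate the coefficients; there is one because the dimension is
  at least 2. In dimension 1 the two gradients are opposite.\<close>

lemma bgrad_independent:
  assumes n: "DIM('a) \<ge> 2" and pq: "p \<in> C" "q \<in> C" "p \<noteq> q" and z: "s *\<^sub>R bgrad p + u *\<^sub>R bgrad q = 0"
  shows "s = 0" "u = 0"
proof -
  have "card {p, q} < card C" using n card_C pq by simp
  then have "\<not> C \<subseteq> {p, q}" using card_mono[of "{p, q}" C] by auto
  then obtain r where r: "r \<in> C" "r \<noteq> p" "r \<noteq> q" by blast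
  have "(s *\<^sub>R bgrad p + u *\<^sub>R bgrad q) \<bullet> (p - r) = s" "(s *\<^sub>R bgrad p + u *\<^sub>R bgrad q) \<bullet> (q - r) = u"
    using pq r by (simp_all add: inner_add_left bary_diff bary_vertex)
  then show "s = 0" "u = 0" unfolding z by simp_all
qed

lemma negligible_bary_zero: "p \<in> C \<Longrightarrow> negligible {x. bary p x = 0}"
proof -
  assume "p \<in> C"
  then have "negligible {x. bgrad p \<bullet> x = - snd (bary_coeff p)}"
    using bgrad_nonzero by (intro negligible_hyperplane) simp
  then show ?thesis by (simp add: bary_def eq_neg_iff_add_eq_0)
qed

text \<open>The lines through \<open>a\<close> that meet the subspace where two barycentric coordinates
  vanish fill only a hyperplane.\<close>

lemma negligible_cone_over_skeleton:
  assumes n: "DIM('a) \<ge> 2" and pq: "p \<in> C" "q \<in> C" "p \<noteq> q" and a: "bary p a \<noteq> 0"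
  shows "negligible {z. \<exists>t. bary p (a + t *\<^sub>R (z - a)) = 0 \<and> bary q (a + t *\<^sub>R (z - a)) = 0}"
proof -
  \<comment> \<open>Eliminating t from the two equations leaves one linear equation for
    \<open>z\<close> with normal \<open>h\<close>, which is nonzero since the gradients are
    independent and \<open>bary p a\<close> is not 0.\<close>
  define h where "h = bary p a *\<^sub>R bgrad q + (- bary q a) *\<^sub>R bgrad p"
  have "h \<noteq> 0" using bgrad_independent(1)[OF n pq(2,1) pq(3)[symmetric], of "bary p a" "- bary q a"] a by (auto simp: h_def)
  then have "negligible {z. h \<bullet> z = h \<bullet> a}" by (intro negligible_hyperplane) simp
  moreover have "{z. \<exists>t. bary p (a + t *\<^sub>R (z - a)) = 0 \<and> bary q (a + t *\<^sub>R (z - a)) = 0} \<subseteq> {z. h \<bullet> z = h \<bullet> a}"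
  proof
    fix z assume "z \<in> {z. \<exists>t. bary p (a + t *\<^sub>R (z - a)) = 0 \<and> bary q (a + t *\<^sub>R (z - a)) = 0}"
    then obtain t where "bary p (a + t *\<^sub>R (z - a)) = 0" "bary q (a + t *\<^sub>R (z - a)) = 0" by blast
    then have e: "bary p a = - (t * (bgrad p \<bullet> (z - a)))" "bary q a = - (t * (bgrad q \<bullet> (z - a)))"
      by (simp_all only: bary_add inner_scaleR_right)
    have "h \<bullet> (z - a) = bary p a * (bgrad q \<bullet> (z - a)) - bary q a * (bgrad p \<bullet> (z - a))"
      unfolding h_def inner_add_left inner_scaleR_left by simp
    also have "\<dots> = 0" unfolding e by simp
    finally show "z \<in> {z. h \<bullet> z = h \<bullet> a}" by (simp add: inner_diff_right)
  qed
  ultimately show ?thesis by (rule negligible_subset)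
qed

end

context cr_mesh
begin

text \<open>\<open>jump\<close> refers to the chosen pair \<open>T_plus\<close>,
  \<open>T_minus\<close>; by \<open>at_most_two\<close> any pair of distinct neighbours is that
  pair.\<close>

lemma jump_zero_neighbours:
  assumes v: "v \<in> CR10 \<Omega> \<T>" "\<And>T. T \<in> \<T> \<Longrightarrow> slope v T = 0"
    and T: "T \<in> \<T>" "T' \<in> \<T>" "T \<noteq> T'" and F: "F facet_of T" "F facet_of T'" and nf: "\<not> F \<subseteq> frontier \<Omega>"
  shows "offset v T = offset v T'"
proof -
  have Fi: "F \<in> interior_faces \<Omega> \<T>" using T F nf by (auto simp: interior_faces_def mesh_faces_def)
  note p = T_plus[OF interior_face_mesh_face[OF Fi]] and m = T_minus[OF Fi]
  have tr: "trace_from S v (mid F) = offset v S" if "S \<in> \<T>" "F facet_of S" for S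
    using trace_P1[OF CR10_P1[OF v(1)] that(1) facet_mid(1)[OF that]] v(2)[OF that(1)] by simp
  have "jump \<Omega> \<T> v F (mid F) = 0" using v(1) interior_face_mesh_face[OF Fi] by (simp add: CR10_def)
  then have eq: "offset v (T_plus \<T> F) = offset v (T_minus \<T> F)"
    using Fi tr[OF p] tr[OF m(1,2)] by (simp add: jump_def)
  have "S = T_plus \<T> F \<or> S = T_minus \<T> F" if "S \<in> \<T>" "F facet_of S" for S
    using at_most_two[OF p(1) that(1) m(1) p(2) that(2) m(2) _ m(3)[symmetric]] by blast
  from this[OF T(1) F(1)] this[OF T(2) F(2)] T(3) eq show ?thesis by auto
qed

lemma jump_zero_boundary:
  assumes v: "v \<in> CR10 \<Omega> \<T>" "\<And>T. T \<in> \<T> \<Longrightarrow> slope v T = 0"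
    and T: "T \<in> \<T>" and F: "F facet_of T" "F \<subseteq> frontier \<Omega>" and only: "\<And>T'. T' \<in> \<T> \<Longrightarrow> F facet_of T' \<Longrightarrow> T' = T"
  shows "offset v T = 0"
proof -
  have Fm: "F \<in> mesh_faces \<T>" "F \<notin> interior_faces \<Omega> \<T>" using T F by (auto simp: interior_faces_def mesh_faces_def)
  have "T_plus \<T> F = T" by (rule only[OF T_plus[OF Fm(1)]])
  moreover have "jump \<Omega> \<T> v F (mid F) = 0" using v(1) Fm(1) by (simp add: CR10_def)
  ultimately have "trace_from T v (mid F) = 0" using Fm(2) by (simp add: jump_def)
  then show ?thesis
    using trace_P1[OF CR10_P1[OF v(1)] T facet_mid(1)[OF T F(1)]] v(2)[OF T] by simp
qed

text \<open>The union of the simplices on which the function has a given nonzero value has its frontier in the skeleton of codimension 2,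
  which a generic segment from the inside to the outside avoids.\<close>

lemma CR10_piecewise_constant_zero:
  assumes n: "DIM('a) \<ge> 2" and v: "v \<in> CR10 \<Omega> \<T>" "\<And>T. T \<in> \<T> \<Longrightarrow> slope v T = 0" and T0: "T0 \<in> \<T>"
  shows "offset v T0 = 0"
proof (rule ccontr)
  define c where "c = offset v T0"
  assume "offset v T0 \<noteq> 0"
  then have c: "c \<noteq> 0" by (simp add: c_def)
  define \<S> where "\<S> = {T \<in> \<T>. offset v T = c}"
  define U where "U = \<Union>\<S>"
  have S: "finite \<S>" "\<S> \<subseteq> \<T>" "T0 \<in> \<S>" using finite_mesh T0 by (auto simp: \<S>_def c_def)
  have cU: "compact U" unfolding U_def using S mesh_simplex(1) by (intro compact_Union) auto
  \<comment> \<open>A frontier point of \<open>U\<close> lies on the boundary of some simplex with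
    value \<open>c\<close>. If only one coordinate vanished there, the point would be in the
    relative interior of a facet, which is ruled out below.\<close>
  have fr: "\<exists>T\<in>\<T>. \<exists>p\<in>verts T. \<exists>q\<in>verts T. p \<noteq> q \<and> bc T p y = 0 \<and> bc T q y = 0" if y: "y \<in> frontier U" for y
  proof -
    have "y \<in> U" using y compact_imp_closed[OF cU] by (auto simp: frontier_def)
    then obtain T where T: "T \<in> \<S>" "y \<in> T" by (auto simp: U_def)
    have TT: "T \<in> \<T>" "offset v T = c" using T(1) by (simp_all add: \<S>_def)
    have "T \<subseteq> U" using T(1) by (auto simp: U_def)
    then have "interior T \<subseteq> interior U" by (rule interior_mono)
    then have ni: "y \<notin> interior T" using y by (auto simp: frontier_def)
    interpret full_simplex "verts T" by (rule verts(1)[OF TT(1)])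
    have nn: "\<forall>p\<in>verts T. 0 \<le> bary p y" using T(2) mem_simplex[of y] verts(2)[OF TT(1)] by simp
    obtain p where p: "p \<in> verts T" "\<not> 0 < bary p y"
      using ni mem_interior_simplex[of y] verts(2)[OF TT(1)] by auto
    have py: "bary p y = 0" using nn p by force
    show ?thesis
    proof (cases "\<exists>q\<in>verts T. q \<noteq> p \<and> bary q y = 0")
      case True
      then obtain q where "q \<in> verts T" "p \<noteq> q" "bary q y = 0" by blast
      then show ?thesis using TT(1) p(1) py by blast
    next
      case False
      then have "0 < bary q y" if "q \<in> verts T - {p}" for q using that nn by (force simp: less_le)
      then have yF: "y \<in> rel_interior (face p)" using rel_interior_face[OF p(1)] py by simp
      have F: "face p facet_of T" using Tfacet[OF TT(1)] p(1) by blast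
      \<comment> \<open>Across an interior facet the neighbour has the same value, so the pair
        surrounds \<open>y\<close>; on a boundary facet the jump condition forces the value
        0.\<close>
      have "c = 0 \<or> y \<in> interior U"
      proof (cases "\<exists>T'\<in>\<T>. T' \<noteq> T \<and> face p facet_of T'")
        case True
        then obtain T' where T': "T' \<in> \<T>" "T \<noteq> T'" "face p facet_of T'" by blast
        have yi: "y \<in> interior (T \<union> T')" by (rule interior_of_pair[OF TT(1) T'(1,2) F T'(3) yF])
        have "T \<union> T' \<subseteq> closure \<Omega>" using mesh_subset_closure TT(1) T'(1) by blast
        then have "y \<in> interior (closure \<Omega>)" using interior_mono yi by blast
        then have "y \<in> \<Omega>" using interior_closure_lipschitz_domain[OF dom] by blast
        then have "y \<notin> frontier \<Omega>" using interior_open[OF open_\<Omega>] by (simp add: frontier_def)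
        then have "\<not> face p \<subseteq> frontier \<Omega>" using yF rel_interior_subset by blast
        from jump_zero_neighbours[OF v TT(1) T'(1,2) F T'(3) this] have "T' \<in> \<S>" using T'(1) TT(2) by (simp add: \<S>_def)
        then have "T \<union> T' \<subseteq> U" using T(1) by (auto simp: U_def)
        then show ?thesis using interior_mono yi by blast
      next
        case False
        have "face p \<subseteq> frontier \<Omega>"
        proof (rule ccontr)
          assume "\<not> face p \<subseteq> frontier \<Omega>"
          from second_simplex[OF TT(1) p(1) this] obtain T' where "T' \<in> \<T>" "T' \<noteq> T" "face p facet_of T'" by blast
          then show False using False by blast
        qed
        from jump_zero_boundary[OF v TT(1) F this] False TT(2) show ?thesis by blast
      qed
      then show ?thesis using c y by (simp add: frontier_def)
    qed
  qed
  define I where "I = (SIGMA T:\<T>. {(p, q). p \<in> verts T \<and> q \<in> verts T \<and> p \<noteq> q})"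
  have finI: "finite I"
  proof -
    have "I \<subseteq> (SIGMA T:\<T>. verts T \<times> verts T)" by (auto simp: I_def)
    moreover have "finite (SIGMA T:\<T>. verts T \<times> verts T)"
      using finite_mesh full_simplex.finite_C[OF verts(1)] by auto
    ultimately show ?thesis by (rule finite_subset)
  qed
  have "negligible (\<Union>T\<in>\<T>. \<Union>p\<in>verts T. {x. bc T p x = 0})"
    using finite_mesh full_simplex.finite_C[OF verts(1)] full_simplex.negligible_bary_zero[OF verts(1)]
    by (intro negligible_Union) auto
  then have "negligible ({} \<union> (\<Union>T\<in>\<T>. \<Union>p\<in>verts T. {x. bc T p x = 0}))" by simp
  moreover have "\<not> negligible (interior T0)"
    by (rule open_not_negligible) (use mesh_simplex(3)[OF T0] in auto)
  ultimately have "\<not> interior T0 \<subseteq> (\<Union>T\<in>\<T>. \<Union>p\<in>verts T. {x. bc T p x = 0})"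
    using negligible_subset[of "\<Union>T\<in>\<T>. \<Union>p\<in>verts T. {x. bc T p x = 0}" "interior T0"] by auto
  \<comment> \<open>Off all facet hyperplanes, so that \<open>negligible_cone_over_skeleton\<close>
    applies at \<open>a\<close> to every pair of coordinates.\<close>
  then obtain a where a: "a \<in> interior T0" "a \<notin> (\<Union>T\<in>\<T>. \<Union>p\<in>verts T. {x. bc T p x = 0})" by blast
  define bad where "bad = (\<lambda>(T, p, q). {z. \<exists>t. bc T p (a + t *\<^sub>R (z - a)) = 0 \<and> bc T q (a + t *\<^sub>R (z - a)) = 0})"
  have nb1: "negligible (bad i)" if "i \<in> I" for i
  proof -
    from that obtain T p q where i: "i = (T, p, q)" "T \<in> \<T>" "p \<in> verts T" "q \<in> verts T" "p \<noteq> q" by (auto simp: I_def)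
    have "bc T p a \<noteq> 0" using a(2) i by auto
    from full_simplex.negligible_cone_over_skeleton[OF verts(1)[OF i(2)] n i(3-5) this]
    show "negligible (bad i)" by (simp add: bad_def i(1))
  qed
  then have nb: "negligible (\<Union>i\<in>I. bad i)" using finI by (intro negligible_Union) auto
  \<comment> \<open>\<open>U\<close> is compact, so its complement is open and nonempty and contains
    an endpoint outside the negligible cones.\<close>
  have "\<not> negligible (- U)"
  proof (rule open_not_negligible)
    show "open (- U)" using compact_imp_closed[OF cU] by (simp add: open_Compl)
    show "- U \<noteq> {}" using compact_imp_bounded[OF cU] not_bounded_UNIV by (metis Compl_empty_eq double_complement)
  qed
  then obtain z where z: "z \<notin> U" "z \<notin> (\<Union>i\<in>I. bad i)" using negligible_subset[OF nb, of "- U"] by blast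
  have "a \<in> U" using a(1) interior_subset S(3) by (auto simp: U_def)
  have "closed_segment a z \<inter> frontier U \<noteq> {}"
    by (rule connected_Int_frontier) (use \<open>a \<in> U\<close> z(1) in auto)
  then obtain y where y: "y \<in> closed_segment a z" "y \<in> frontier U" by blast
  then obtain t where t: "y = a + t *\<^sub>R (z - a)" by (auto simp: closed_segment_def algebra_simps)
  obtain T p q where "T \<in> \<T>" "p \<in> verts T" "q \<in> verts T" "p \<noteq> q" "bc T p y = 0" "bc T q y = 0"
    using fr[OF y(2)] by blast
  then have "z \<in> bad (T, p, q)" "(T, p, q) \<in> I" using t by (auto simp: bad_def I_def)
  then show False using z(2) by blast
qed

end

section \<open>The lower bound\<close>

text \<open>The bound \<open>C\<close> keeps the essential supremum finite;
  \<open>real_of_ereal\<close> would turn infinity into 0.\<close>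

lemma Linf_norm_AE:
  assumes f: "f \<in> borel_measurable M" and C: "AE x in M. \<bar>f x\<bar> \<le> C"
  shows "AE x in M. \<bar>f x\<bar> \<le> Linf_norm M f"
proof -
  let ?s = "esssup M (\<lambda>x. ereal \<bar>f x\<bar>)"
  have m: "(\<lambda>x. ereal \<bar>f x\<bar>) \<in> borel_measurable M" using f by measurable
  have "?s \<le> ereal C" using C by (intro esssup_I m) auto
  then have fin: "?s \<noteq> \<infinity>" by auto
  have "AE x in M. ereal \<bar>f x\<bar> \<le> ?s" by (rule esssup_AE)
  then show ?thesis
  proof eventually_elim
    case (elim x)
    then have "?s \<noteq> -\<infinity>" by auto
    then show ?case using elim fin by (cases ?s) (simp_all add: Linf_norm_def)
  qed
qed

lemma sym_form_sum:
  assumes "finite S" "lin_closed D" "\<And>i. i \<in> S \<Longrightarrow> sym_form D (A i)"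
  shows "sym_form D (\<lambda>u v. \<Sum>i\<in>S. A i u v)"
  using assms(1,3)
proof (induction S rule: finite_induct)
  case empty
  then show ?case using assms(2) by (simp add: sym_form_def)
next
  case (insert i S)
  then have "sym_form D (\<lambda>u v. A i u v + (\<Sum>i\<in>S. A i u v))" by (intro sym_form_add) auto
  then show ?case using insert.hyps by simp
qed

section \<open>The eigenvalue problem on the broken Sobolev space\<close>

locale cr_problem = cr_mesh +
  fixes V :: "'a \<Rightarrow> real" and \<kappa> :: real
  assumes dim: "DIM('a) \<ge> 2" and V: "V \<in> Linf_space (lebesgue_on \<Omega>)"
    and V0: "essinf (lebesgue_on \<Omega>) (\<lambda>x. ereal (V x)) = 0" and \<kappa>: "\<kappa> > 0"
    and interp: "\<And>v T. v \<in> H10 \<Omega> \<Longrightarrow> T \<in> \<T> \<Longrightarrow>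
          L2_norm (lebesgue_on T) (\<lambda>x. v x - I_CR \<Omega> \<T> v x)
            \<le> \<kappa> * diameter T *
               L2_norm (lebesgue_on (interior T)) (weak_gradient (interior T) (\<lambda>x. v x - I_CR \<Omega> \<T> v x))"
begin

abbreviation "M \<equiv> lebesgue_on \<Omega>"

lemma V_measurable: "V \<in> borel_measurable M"
  using V by (simp add: Linf_space_def)

lemma V_bounded: "\<exists>C. AE x in M. \<bar>V x\<bar> \<le> C"
proof -
  let ?s = "esssup M (\<lambda>x. ereal \<bar>V x\<bar>)"
  have "?s < \<infinity>" using V by (simp add: Linf_space_def)
  moreover have "AE x in M. ereal \<bar>V x\<bar> \<le> ?s" by (rule esssup_AE)
  ultimately have "AE x in M. \<bar>V x\<bar> \<le> real_of_ereal ?s"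
  proof -
    assume fin: "?s < \<infinity>" and ae: "AE x in M. ereal \<bar>V x\<bar> \<le> ?s"
    from ae show ?thesis
    proof eventually_elim
      case (elim x)
      then have "?s \<noteq> -\<infinity>" by auto
      then show ?case using elim fin by (cases ?s) simp_all
    qed
  qed
  then show ?thesis by blast
qed

lemma V_nonneg: "AE x in M. 0 \<le> V x"
proof -
  have "esssup M (\<lambda>x. - ereal (V x)) = 0" using V0 by (simp add: essinf_def ereal_uminus_eq_reorder)
  moreover have "AE x in M. - ereal (V x) \<le> esssup M (\<lambda>x. - ereal (V x))" by (rule esssup_AE)
  ultimately have "AE x in M. - ereal (V x) \<le> 0" by simp
  then show ?thesis by eventually_elim simp
qed

lemma V_integrable:
  assumes "u \<in> L2_space M" "v \<in> L2_space M"
  shows "integrable M (\<lambda>x. V x * u x * v x)"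
proof -
  obtain C where C: "AE x in M. \<bar>V x\<bar> \<le> C" using V_bounded by blast
  note [measurable] = V_measurable L2_space_measurable[OF assms(1)] L2_space_measurable[OF assms(2)]
  show ?thesis
  proof (rule Bochner_Integration.integrable_bound)
    show "integrable M (\<lambda>x. C * (u x * v x))" by (intro integrable_mult_right L2_space_mult_integrable assms)
    show "(\<lambda>x. V x * u x * v x) \<in> borel_measurable M" by measurable
    show "AE x in M. norm (V x * u x * v x) \<le> norm (C * (u x * v x))"
      using C
    proof eventually_elim
      case (elim x)
      then have "\<bar>V x\<bar> * (\<bar>u x\<bar> * \<bar>v x\<bar>) \<le> \<bar>C\<bar> * (\<bar>u x\<bar> * \<bar>v x\<bar>)" by (intro mult_right_mono) auto
      then show ?case by (simp add: abs_mult mult.assoc)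
    qed
  qed
qed

lemma sym_form_V_inner: "sym_form (L2_space M) (V_inner \<Omega> V)"
proof
  show "lin_closed (L2_space M)" by (rule lin_closed_L2_space)
  show "V_inner \<Omega> V u v = V_inner \<Omega> V v u" for u v by (simp add: V_inner_def mult_ac)
  show "V_inner \<Omega> V (\<lambda>x. c * u x + d * v x) w = c * V_inner \<Omega> V u w + d * V_inner \<Omega> V v w"
    if "u \<in> L2_space M" "v \<in> L2_space M" "w \<in> L2_space M" for u v w c d
  proof -
    have "(\<lambda>x. V x * (c * u x + d * v x) * w x) = (\<lambda>x. c * (V x * u x * w x) + d * (V x * v x * w x))"
      by (auto simp: algebra_simps)
    then show ?thesis using V_integrable[OF that(1,3)] V_integrable[OF that(2,3)] by (simp add: V_inner_def)
  qed
  show "0 \<le> V_inner \<Omega> V u u" for u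
    unfolding V_inner_def
  proof (rule integral_nonneg_AE)
    show "AE x in M. 0 \<le> V x * u x * u x" using V_nonneg by eventually_elim (simp add: mult.assoc)
  qed
qed

text \<open>The broken Sobolev space. It contains both \<open>H10 \<Omega>\<close> and the
  Crouzeix-Raviart space, so the projection and all errors are formed within one form
  domain.\<close>

definition D :: "('a \<Rightarrow> real) set" where
  "D = {u \<in> L2_space M. \<forall>T\<in>\<T>. u \<in> H1 (interior T)}"

lemma D_lin: "lin_closed D"
  unfolding lin_closed_def
proof (intro conjI ballI allI)
  have H: "lin_closed (H1 (interior T))" for T :: "'a set" by (rule lin_closed_H1) simp
  have L: "lin_closed (L2_space M :: ('a \<Rightarrow> real) set)" by (rule lin_closed_L2_space)
  show "(\<lambda>x. 0) \<in> D" using L H by (simp add: D_def lin_closed_def)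
  show "(\<lambda>x. c * u x + d * v x) \<in> D" if "u \<in> D" "v \<in> D" for u v c d
    using that L H by (simp add: D_def lin_closed_def)
qed

abbreviation "A u v \<equiv> a_pw \<T> u v + V_inner \<Omega> V u v"

lemma sym_form_a_pw: "sym_form D (a_pw \<T>)"
proof -
  have "sym_form D (\<lambda>u v. \<Sum>T\<in>\<T>. grad_inner (interior T) u v)"
  proof (rule sym_form_sum[OF finite_mesh D_lin])
    fix T assume T: "T \<in> \<T>"
    have "D \<subseteq> H1 (interior T)" using T by (auto simp: D_def)
    then show "sym_form D (grad_inner (interior T))"
      by (rule sym_form_mono[OF sym_form_grad_inner[OF open_interior] D_lin])
  qed
  then show ?thesis by (simp add: a_pw_def[abs_def])
qed

lemma sym_form_V_D: "sym_form D (V_inner \<Omega> V)"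
  by (rule sym_form_mono[OF sym_form_V_inner D_lin]) (auto simp: D_def)

sublocale form_pair M D "\<lambda>u v. A u v"
proof -
  interpret S: sym_form D "\<lambda>u v. A u v" by (rule sym_form_add[OF sym_form_a_pw sym_form_V_D])
  show "form_pair M D (\<lambda>u v. A u v)"
  proof
    show "u \<in> L2_space M" if "u \<in> D" for u using that by (simp add: D_def)
    show "A u v = 0" if "u \<in> D" "v \<in> D" "AE x in M. u x = 0" for u v
    proof -
      have "grad_inner (interior T) u v = 0" if T: "T \<in> \<T>" for T
        using grad_inner_null[of "interior T" u v] \<open>u \<in> D\<close> \<open>AE x in M. u x = 0\<close> T by (simp add: D_def AE_mesh_iff)
      moreover have "V_inner \<Omega> V u v = 0"
        unfolding V_inner_def
      proof (rule integral_eq_zero_AE)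
        show "AE x in M. V x * u x * v x = 0" using that(3) by eventually_elim simp
      qed
      ultimately show ?thesis by (simp add: a_pw_def)
    qed
  qed
qed

lemma D_I:
  assumes "\<And>T. T \<in> \<T> \<Longrightarrow> u \<in> H1 (interior T)"
  shows "u \<in> D"
proof -
  have "u \<in> L2_space M"
    by (rule L2_space_meshI) (rule has_weak_gradient_L2(1)[OF H1_weak_gradient[OF assms]])
  then show ?thesis using assms by (simp add: D_def)
qed

lemma CR10_D: "CR10 \<Omega> \<T> \<subseteq> D"
  using has_weak_gradient_H1[OF CR10_weak_gradient[OF CR10_P1]] by (auto intro: D_I)

lemma H10_gradient:
  assumes "u \<in> H10 \<Omega>"
  shows "has_weak_gradient \<Omega> u (weak_gradient \<Omega> u)"
    and "\<And>T. T \<in> \<T> \<Longrightarrow> has_weak_gradient (interior T) u (weak_gradient \<Omega> u)"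
proof -
  show 1: "has_weak_gradient \<Omega> u (weak_gradient \<Omega> u)" using assms by (intro H1_weak_gradient) (simp add: H10_def)
  show "has_weak_gradient (interior T) u (weak_gradient \<Omega> u)" if "T \<in> \<T>" for T
    by (rule has_weak_gradient_restrict[OF open_\<Omega> open_interior interior_subset_\<Omega>[OF that] 1])
qed

lemma H10_D: "H10 \<Omega> \<subseteq> D"
  using has_weak_gradient_H1[OF H10_gradient(2)] by (auto intro: D_I)

text \<open>The skeleton is null and the weak gradient restricts to each simplex, so the exact
  energy is the broken one restricted to \<open>H10 \<Omega>\<close>.\<close>

lemma grad_inner_mesh:
  assumes u: "u \<in> H10 \<Omega>" and v: "v \<in> H10 \<Omega>"
  shows "grad_inner \<Omega> u v = a_pw \<T> u v"
proof -
  have i: "integrable M (\<lambda>x. weak_gradient \<Omega> u x \<bullet> weak_gradient \<Omega> v x)"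
    by (rule L2_space_inner_integrable[OF has_weak_gradient_L2(2)[OF H10_gradient(1)[OF u]] has_weak_gradient_L2(2)[OF H10_gradient(1)[OF v]]])
  have "grad_inner \<Omega> u v = (\<Sum>T\<in>\<T>. LINT x|lebesgue_on (interior T). weak_gradient \<Omega> u x \<bullet> weak_gradient \<Omega> v x)"
    unfolding grad_inner_def by (rule integral_mesh(1)[OF i])
  also have "\<dots> = (\<Sum>T\<in>\<T>. grad_inner (interior T) u v)"
    by (intro sum.cong refl) (simp add: grad_inner_eq[OF open_interior H10_gradient(2)[OF u] H10_gradient(2)[OF v]])
  finally show ?thesis by (simp add: a_pw_def)
qed

lemma measure_interior_mesh:
  assumes "T \<in> \<T>"
  shows "(LINT x|lebesgue_on (interior T). c) = full_simplex.vol (verts T) * c" "full_simplex.vol (verts T) > 0"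
  using full_simplex.measure_interior[OF verts(1)[OF assms]] full_simplex.vol_pos[OF verts(1)[OF assms]]
  by (simp_all add: verts(2)[OF assms, symmetric])

text \<open>The potential may vanish, so definiteness must come from the gradients: both parts of
  the energy are nonnegative, hence all slopes are 0, and the jump conditions then remove the
  constants.\<close>

lemma CR10_definite:
  assumes v: "v \<in> CR10 \<Omega> \<T>" and z: "A v v = 0"
  shows "AE x in M. v x = 0"
proof -
  have vD: "v \<in> D" using v CR10_D by blast
  have "a_pw \<T> v v = 0"
    using z sym_form.nonneg[OF sym_form_a_pw vD] sym_form.nonneg[OF sym_form_V_D vD] by linarith
  moreover have gi: "grad_inner (interior T) v v = full_simplex.vol (verts T) * (slope v T \<bullet> slope v T)" if "T \<in> \<T>" for T
    unfolding grad_inner_eq[OF open_interior CR10_weak_gradient[OF CR10_P1[OF v] that] CR10_weak_gradient[OF CR10_P1[OF v] that]]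
    by (rule measure_interior_mesh(1)[OF that])
  ultimately have s: "(\<Sum>T\<in>\<T>. full_simplex.vol (verts T) * (slope v T \<bullet> slope v T)) = 0" by (simp add: a_pw_def)
  have nn: "0 \<le> full_simplex.vol (verts T) * (slope v T \<bullet> slope v T)" if "T \<in> \<T>" for T
    using measure_interior_mesh(2)[OF that] by (intro mult_nonneg_nonneg) auto
  have sl: "slope v T = 0" if T: "T \<in> \<T>" for T
  proof -
    have "full_simplex.vol (verts T) * (slope v T \<bullet> slope v T) = 0"
      using s T by (subst (asm) sum_nonneg_eq_0_iff[OF finite_mesh]) (use nn in auto)
    then show ?thesis using measure_interior_mesh(2)[OF T] by simp
  qed
  have "v x = 0" if "T \<in> \<T>" "x \<in> interior T" for T x
    using P1_coeffs[OF CR10_P1[OF v] that] sl[OF that(1)] CR10_piecewise_constant_zero[OF dim v sl that(1)] by simp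
  then have "\<forall>T\<in>\<T>. AE x in lebesgue_on (interior T). v x = 0" by (intro ballI AE_I2) simp
  then show ?thesis by (simp add: AE_mesh_iff)
qed

definition "\<epsilon> = Linf_norm M (\<lambda>x. \<kappa>\<^sup>2 * (mesh_size \<T> x)\<^sup>2)"

definition "\<delta> = Linf_norm M (\<lambda>x. \<kappa>\<^sup>2 * (mesh_size \<T> x)\<^sup>2 * V x)"

lemma mesh_size_eq:
  assumes T: "T \<in> \<T>" "x \<in> interior T"
  shows "mesh_size \<T> x = diameter T"
proof -
  have "mesh_size \<T> x = (\<Sum>S\<in>\<T>. if S = T then diameter T else 0)"
    unfolding mesh_size_def
  proof (intro sum.cong refl)
    fix S assume S: "S \<in> \<T>"
    show "diameter S * indicator (interior S) x = (if S = T then diameter T else 0)"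
    proof (cases "S = T")
      case False
      then have "x \<notin> interior S" using interiors_disjoint[OF S T(1) _ T(2)] by blast
      then show ?thesis using False by simp
    qed (use T in simp)
  qed
  then show ?thesis using T finite_mesh by simp
qed

lemma mesh_size_bound_sq: "(mesh_size \<T> x)\<^sup>2 \<le> (\<Sum>T\<in>\<T>. diameter T)\<^sup>2"
proof -
  have d: "0 \<le> diameter T" if "T \<in> \<T>" for T
    using diameter_ge_0 compact_imp_bounded[OF mesh_simplex(1)[OF that]] by blast
  have "0 \<le> mesh_size \<T> x" unfolding mesh_size_def using d by (intro sum_nonneg mult_nonneg_nonneg) auto
  moreover have "mesh_size \<T> x \<le> (\<Sum>T\<in>\<T>. diameter T)"
    unfolding mesh_size_def using d by (intro sum_mono) (auto simp: indicator_def)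
  ultimately show ?thesis by (intro power_mono)
qed

lemma mesh_size_measurable: "mesh_size \<T> \<in> borel_measurable M"
proof -
  have "mesh_size \<T> \<in> borel_measurable lebesgue"
    unfolding mesh_size_def[abs_def]
    by (intro borel_measurable_sum borel_measurable_times borel_measurable_const borel_measurable_indicator interior_mesh_measurable)
  then show ?thesis by (rule measurable_restrict_space1)
qed

lemma AE_interior_ex:
  assumes T: "T \<in> \<T>" and P: "AE x in lebesgue_on (interior T). P x"
  shows "\<exists>x\<in>interior T. P x"
proof (rule ccontr)
  assume n: "\<not> ?thesis"
  have "AE x in lebesgue_on (interior T). (1::real) = 0"
    using P AE_space by eventually_elim (use n in auto)
  then have "(LINT x|lebesgue_on (interior T). 1::real) = 0" by (intro integral_eq_zero_AE)
  then show False unfolding measure_interior_mesh(1)[OF T] using measure_interior_mesh(2)[OF T] by simp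
qed

text \<open>\<open>mesh_size\<close> is constant on the interior of \<open>T\<close>, which is not
  null, so the almost everywhere bound can be read off at some point there.\<close>

lemma \<epsilon>_ge:
  assumes T: "T \<in> \<T>"
  shows "\<kappa>\<^sup>2 * (diameter T)\<^sup>2 \<le> \<epsilon>"
proof -
  have "AE x in M. \<bar>\<kappa>\<^sup>2 * (mesh_size \<T> x)\<^sup>2\<bar> \<le> \<epsilon>"
    unfolding \<epsilon>_def
  proof (rule Linf_norm_AE)
    show "(\<lambda>x. \<kappa>\<^sup>2 * (mesh_size \<T> x)\<^sup>2) \<in> borel_measurable M" using mesh_size_measurable by measurable
    show "AE x in M. \<bar>\<kappa>\<^sup>2 * (mesh_size \<T> x)\<^sup>2\<bar> \<le> \<kappa>\<^sup>2 * (\<Sum>T\<in>\<T>. diameter T)\<^sup>2"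
    proof (rule AE_I2)
      fix x
      show "\<bar>\<kappa>\<^sup>2 * (mesh_size \<T> x)\<^sup>2\<bar> \<le> \<kappa>\<^sup>2 * (\<Sum>T\<in>\<T>. diameter T)\<^sup>2"
        using mesh_size_bound_sq[of x] by (simp add: abs_mult mult_left_mono)
    qed
  qed
  then have "AE x in lebesgue_on (interior T). \<bar>\<kappa>\<^sup>2 * (mesh_size \<T> x)\<^sup>2\<bar> \<le> \<epsilon>" using T by (simp add: AE_mesh_iff)
  from AE_interior_ex[OF T this] obtain x where "x \<in> interior T" "\<bar>\<kappa>\<^sup>2 * (mesh_size \<T> x)\<^sup>2\<bar> \<le> \<epsilon>" by blast
  then show ?thesis by (simp add: mesh_size_eq[OF T])
qed

lemma \<delta>_ge: "AE x in M. \<kappa>\<^sup>2 * (mesh_size \<T> x)\<^sup>2 * V x \<le> \<delta>"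
proof -
  obtain C where C: "AE x in M. \<bar>V x\<bar> \<le> C" using V_bounded by blast
  have "AE x in M. \<bar>\<kappa>\<^sup>2 * (mesh_size \<T> x)\<^sup>2 * V x\<bar> \<le> \<delta>"
    unfolding \<delta>_def
  proof (rule Linf_norm_AE)
    show "(\<lambda>x. \<kappa>\<^sup>2 * (mesh_size \<T> x)\<^sup>2 * V x) \<in> borel_measurable M"
      using mesh_size_measurable V_measurable by measurable
    show "AE x in M. \<bar>\<kappa>\<^sup>2 * (mesh_size \<T> x)\<^sup>2 * V x\<bar> \<le> \<kappa>\<^sup>2 * (\<Sum>T\<in>\<T>. diameter T)\<^sup>2 * C"
      using C
    proof eventually_elim
      case (elim x)
      have "(\<kappa>\<^sup>2 * (mesh_size \<T> x)\<^sup>2) * \<bar>V x\<bar> \<le> (\<kappa>\<^sup>2 * (\<Sum>T\<in>\<T>. diameter T)\<^sup>2) * C"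
        by (rule mult_mono[OF mult_left_mono[OF mesh_size_bound_sq] elim]) simp_all
      then show ?case by (simp only: abs_mult abs_power2)
    qed
  qed
  then show ?thesis by eventually_elim linarith
qed

lemma mesh_nonempty: "\<exists>T. T \<in> \<T>"
proof -
  have "\<Union>\<T> \<noteq> {}" using dom by (simp add: Union_mesh bounded_lipschitz_domain_def)
  then show ?thesis by auto
qed

lemma \<epsilon>_\<delta>_nonneg: "0 \<le> \<epsilon>" "0 \<le> \<delta>"
proof -
  obtain T where T: "T \<in> \<T>" using mesh_nonempty by blast
  have "0 \<le> \<kappa>\<^sup>2 * (diameter T)\<^sup>2" by simp
  also note \<epsilon>_ge[OF T]
  finally show "0 \<le> \<epsilon>" .
  have "AE x in M. 0 \<le> \<delta>"
    using \<delta>_ge V_nonneg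
  proof eventually_elim
    case (elim x)
    have "0 \<le> \<kappa>\<^sup>2 * (mesh_size \<T> x)\<^sup>2 * V x" using elim by simp
    then show ?case using elim by linarith
  qed
  then have "AE x in lebesgue_on (interior T). 0 \<le> \<delta>" using T by (simp only: AE_mesh_iff)
  from AE_interior_ex[OF T this] show "0 \<le> \<delta>" by blast
qed

lemma diameter_pos:
  assumes T: "T \<in> \<T>"
  shows "diameter T > 0"
proof -
  interpret full_simplex "verts T" by (rule verts(1)[OF T])
  obtain p where p: "p \<in> verts T" using other_vertex by blast
  obtain q where q: "q \<in> verts T" "q \<noteq> p" using other_vertex by blast
  have "p \<in> convex hull verts T" "q \<in> convex hull verts T" using p q by (simp_all add: hull_inc)
  then have "p \<in> T" "q \<in> T" by (simp_all only: verts(2)[OF T, symmetric])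
  then have "dist p q \<le> diameter T" by (rule diameter_bounded_bound[OF compact_imp_bounded[OF mesh_simplex(1)[OF T]]])
  moreover have "dist p q > 0" using q by simp
  ultimately show ?thesis by linarith
qed

text \<open>The interpolation estimate is posed on the closed simplex, while functions are
  controlled only in its interior. On the null boundary any values are measurable.\<close>

lemma integral_closed_simplex:
  fixes f :: "'a \<Rightarrow> real"
  assumes T: "T \<in> \<T>" and f: "f \<in> borel_measurable (lebesgue_on (interior T))"
  shows "(LINT x|lebesgue_on T. f x) = (LINT x|lebesgue_on (interior T). f x)"
proof -
  have Tm: "T \<in> sets lebesgue" using lmeasurable_compact[OF mesh_simplex(1)[OF T]] by (rule fmeasurableD)
  have ae: "AE x in lebesgue. x \<in> T \<longleftrightarrow> x \<in> interior T"
    using full_simplex.AE_boundary[OF verts(1)[OF T]] by (simp only: verts(2)[OF T, symmetric])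
  have mi: "(\<lambda>x. indicator (interior T) x * f x) \<in> borel_measurable lebesgue"
    using f by (simp add: borel_measurable_restrict_space_iff)
  have "negligible (frontier T)" by (rule negligible_convex_frontier[OF mesh_simplex(2)[OF T]])
  then have N: "frontier T \<in> null_sets lebesgue" by (simp add: negligible_iff_null_sets)
  have mf: "(\<lambda>x. indicator (frontier T) x * f x) \<in> borel_measurable lebesgue"
    by (rule borel_measurable_null_support[OF N]) simp
  have "(\<lambda>x. indicator T x * f x) = (\<lambda>x. indicator (interior T) x * f x + indicator (frontier T) x * f x)"
  proof
    fix x
    have "closure T = T" using mesh_simplex(5)[OF T] by simp
    then show "indicator T x * f x = indicator (interior T) x * f x + indicator (frontier T) x * f x"
      using interior_subset[of T] by (auto simp: frontier_def indicator_def)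
  qed
  then have mT: "(\<lambda>x. indicator T x * f x) \<in> borel_measurable lebesgue" using mi mf by simp
  have "(\<integral>x. indicator T x * f x \<partial>lebesgue) = (\<integral>x. indicator (interior T) x * f x \<partial>lebesgue)"
  proof (rule integral_cong_AE[OF mT mi])
    show "AE x in lebesgue. indicator T x * f x = indicator (interior T) x * f x"
      using ae by eventually_elim (simp add: indicator_def)
  qed
  then show ?thesis using Tm by (simp add: integral_restrict_space)
qed

lemma interpolation_error:
  assumes u: "u \<in> H10 \<Omega>"
  defines "e \<equiv> (\<lambda>x. u x - I_CR \<Omega> \<T> u x)"
  shows "\<And>z. z \<in> CR10 \<Omega> \<T> \<Longrightarrow> a_pw \<T> e z = 0"
    and "L2_inner M e e \<le> \<epsilon> * a_pw \<T> e e"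
    and "V_inner \<Omega> V e e \<le> \<delta> * a_pw \<T> e e"
proof -
  let ?w = "I_CR \<Omega> \<T> u"
  have wg: "has_weak_gradient (interior T) e (\<lambda>x. weak_gradient \<Omega> u x - slope ?w T)" if T: "T \<in> \<T>" for T
    unfolding e_def
    by (rule has_weak_gradient_diff[OF open_interior H10_gradient(2)[OF u T] CR10_weak_gradient[OF CR10_P1[OF I_CR_CR10] T]])
  have eD: "e \<in> D" by (rule D_I) (rule has_weak_gradient_H1[OF wg])
  have eL2: "e \<in> L2_space M" using eD by (simp add: D_def)
  show "a_pw \<T> e z = 0" if z: "z \<in> CR10 \<Omega> \<T>" for z
    unfolding a_pw_def
  proof (rule sum.neutral, rule ballI)
    fix T assume T: "T \<in> \<T>"
    show "grad_inner (interior T) e z = 0"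
      unfolding grad_inner_eq[OF open_interior wg[OF T] CR10_weak_gradient[OF CR10_P1[OF z] T]]
      by (rule I_CR_orthogonal[OF T u H10_gradient(1)[OF u]])
  qed
  have i2: "integrable M (\<lambda>x. e x * e x)" by (rule L2_space_mult_integrable[OF eL2 eL2])
  have gnn: "0 \<le> grad_inner (interior T) e e" for T unfolding grad_inner_def by (intro integral_nonneg_AE) auto
  have loc: "(LINT x|lebesgue_on (interior T). e x * e x) \<le> \<kappa>\<^sup>2 * (diameter T)\<^sup>2 * grad_inner (interior T) e e" if T: "T \<in> \<T>" for T
  proof -
    have em: "e \<in> borel_measurable (lebesgue_on (interior T))"
      by (rule L2_space_measurable[OF has_weak_gradient_L2(1)[OF wg[OF T]]])
    have le: "L2_norm (lebesgue_on T) e \<le> \<kappa> * diameter T * L2_norm (lebesgue_on (interior T)) (weak_gradient (interior T) e)"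
      using interp[OF u T] by (simp add: e_def)
    have "(L2_norm (lebesgue_on T) e)\<^sup>2 \<le> (\<kappa> * diameter T * L2_norm (lebesgue_on (interior T)) (weak_gradient (interior T) e))\<^sup>2"
      by (rule power_mono[OF le]) (simp add: L2_norm_def integral_nonneg_AE)
    moreover have "(L2_norm (lebesgue_on T) e)\<^sup>2 = (LINT x|lebesgue_on T. e x * e x)"
      by (simp add: L2_norm_def integral_nonneg_AE power2_eq_square)
    moreover have "(LINT x|lebesgue_on T. e x * e x) = (LINT x|lebesgue_on (interior T). e x * e x)"
      by (rule integral_closed_simplex[OF T]) (rule borel_measurable_times[OF em em])
    moreover have "(L2_norm (lebesgue_on (interior T)) (weak_gradient (interior T) e))\<^sup>2 = grad_inner (interior T) e e"
      by (simp add: L2_norm_def integral_nonneg_AE grad_inner_def power2_norm_eq_inner)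
    ultimately show ?thesis by (simp add: power_mult_distrib)
  qed
  have "L2_inner M e e = (\<Sum>T\<in>\<T>. LINT x|lebesgue_on (interior T). e x * e x)" by (rule integral_mesh(1)[OF i2])
  also have "\<dots> \<le> (\<Sum>T\<in>\<T>. \<epsilon> * grad_inner (interior T) e e)"
  proof (rule sum_mono)
    fix T assume T: "T \<in> \<T>"
    note loc[OF T]
    also have "\<kappa>\<^sup>2 * (diameter T)\<^sup>2 * grad_inner (interior T) e e \<le> \<epsilon> * grad_inner (interior T) e e"
      by (rule mult_right_mono[OF \<epsilon>_ge[OF T] gnn])
    finally show "(LINT x|lebesgue_on (interior T). e x * e x) \<le> \<epsilon> * grad_inner (interior T) e e" .
  qed
  finally show "L2_inner M e e \<le> \<epsilon> * a_pw \<T> e e" by (simp add: a_pw_def sum_distrib_left)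
  have cancel: "d / c * (c * g) = d * g" if "c > 0" for c d g :: real using that by simp
  have iV: "integrable M (\<lambda>x. V x * e x * e x)" by (rule V_integrable[OF eL2 eL2])
  have "V_inner \<Omega> V e e = (\<Sum>T\<in>\<T>. LINT x|lebesgue_on (interior T). V x * e x * e x)"
    unfolding V_inner_def by (rule integral_mesh(1)[OF iV])
  also have "\<dots> \<le> (\<Sum>T\<in>\<T>. \<delta> * grad_inner (interior T) e e)"
  proof (rule sum_mono)
    fix T assume T: "T \<in> \<T>"
    let ?N = "lebesgue_on (interior T)" and ?c = "\<kappa>\<^sup>2 * (diameter T)\<^sup>2"
    have c: "?c > 0" using diameter_pos[OF T] \<kappa> by simp
    have "AE x in ?N. \<kappa>\<^sup>2 * (mesh_size \<T> x)\<^sup>2 * V x \<le> \<delta>" using \<delta>_ge T by (simp only: AE_mesh_iff)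
    \<comment> \<open>On \<open>T\<close> the mesh size is constant, so the bound by
      \<open>\<delta>\<close> can be divided by \<open>?c\<close>. The same factor \<open>?c\<close>
      in the interpolation estimate cancels it, which is why \<open>\<delta>\<close> contains the
      local mesh size.\<close>
    then have ae: "AE x in ?N. V x * e x * e x \<le> \<delta> / ?c * (e x * e x)"
      using AE_space
    proof eventually_elim
      case (elim x)
      then have "x \<in> interior T" by simp
      from elim(1)[unfolded mesh_size_eq[OF T this]] have "V x \<le> \<delta> / ?c" using c by (simp add: pos_le_divide_eq mult.commute)
      then have "V x * (e x * e x) \<le> \<delta> / ?c * (e x * e x)" by (intro mult_right_mono) auto
      then show ?case by (simp only: mult.assoc)
    qed
    have "(LINT x|?N. V x * e x * e x) \<le> (LINT x|?N. \<delta> / ?c * (e x * e x))"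
      by (rule integral_mono_AE[OF integral_mesh(2)[OF iV T] integrable_mult_right[OF integral_mesh(2)[OF i2 T]] ae])
    also have "\<dots> = \<delta> / ?c * (LINT x|?N. e x * e x)" by simp
    also have "\<dots> \<le> \<delta> / ?c * (?c * grad_inner (interior T) e e)"
      using c \<epsilon>_\<delta>_nonneg(2) by (intro mult_left_mono loc[OF T]) simp
    also have "\<dots> = \<delta> * grad_inner (interior T) e e" by (rule cancel[OF c])
    finally show "(LINT x|?N. V x * e x * e x) \<le> \<delta> * grad_inner (interior T) e e" .
  qed
  finally show "V_inner \<Omega> V e e \<le> \<delta> * a_pw \<T> e e" by (simp add: a_pw_def sum_distrib_left)
qed

theorem lower_bound:
  assumes k: "k \<ge> 1"
  shows "ereal (GLB \<epsilon> \<delta> (CR_eigenvalue \<Omega> \<T> V 1) (CR_eigenvalue \<Omega> \<T> V k)) \<le> exact_eigenvalue \<Omega> V k"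
proof -
  have fd: "finite_dim (CR10 \<Omega> \<T>)" unfolding finite_dim_def by (rule CR10_finite_dim)
  have "ereal (GLB \<epsilon> \<delta> (kth_eigenvalue M (CR10 \<Omega> \<T>) (\<lambda>u v. A u v) 1) (kth_eigenvalue M (CR10 \<Omega> \<T>) (\<lambda>u v. A u v) k))
    \<le> kth_eigenvalue M (H10 \<Omega>) (\<lambda>u v. A u v) k"
  proof (rule GLB_le_kth_eigenvalue[OF sym_form_a_pw sym_form_V_D refl CR10_D lin_closed_CR10 fd _ H10_D
        lin_closed_H10[OF open_\<Omega> bounded_\<Omega>] \<epsilon>_\<delta>_nonneg _ k])
    show "AE x in M. v x = 0" if "v \<in> CR10 \<Omega> \<T>" "A v v = 0" for v by (rule CR10_definite[OF that])
    show "\<exists>w\<in>CR10 \<Omega> \<T>. (\<forall>z\<in>CR10 \<Omega> \<T>. a_pw \<T> (\<lambda>x. u x - w x) z = 0) \<and>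
      L2_inner M (\<lambda>x. u x - w x) (\<lambda>x. u x - w x) \<le> \<epsilon> * a_pw \<T> (\<lambda>x. u x - w x) (\<lambda>x. u x - w x) \<and>
      V_inner \<Omega> V (\<lambda>x. u x - w x) (\<lambda>x. u x - w x) \<le> \<delta> * a_pw \<T> (\<lambda>x. u x - w x) (\<lambda>x. u x - w x)"
      if u: "u \<in> H10 \<Omega>" for u
      using interpolation_error[OF u] I_CR_CR10 by blast
  qed
  \<comment> \<open>The exact form agrees with the broken one on \<open>H10 \<Omega>\<close>, hence
    so do their eigenvalues.\<close>
  moreover have "exact_eigenvalue \<Omega> V k = kth_eigenvalue M (H10 \<Omega>) (\<lambda>u v. A u v) k"
    unfolding exact_eigenvalue_def by (rule kth_eigenvalue_cong) (simp add: grad_inner_mesh)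
  ultimately show ?thesis by (simp add: CR_eigenvalue_def)
qed

end

theorem theorem3p2:
  fixes \<Omega> :: "'a::euclidean_space set"
    and V :: "'a \<Rightarrow> real"
    and \<T> :: "'a set set"
    and \<kappa> :: real
    and k :: nat
  assumes "DIM('a) \<ge> 2"
    and "bounded_lipschitz_domain \<Omega>" and "polyhedral \<Omega>"
    and "V \<in> Linf_space (lebesgue_on \<Omega>)"
    and "essinf (lebesgue_on \<Omega>) (\<lambda>x. ereal (V x)) = 0"
    and "regular_triangulation \<Omega> \<T>"
    and "\<kappa> > 0"
    and "\<And>v T. v \<in> H10 \<Omega> \<Longrightarrow> T \<in> \<T> \<Longrightarrow>
          L2_norm (lebesgue_on T) (\<lambda>x. v x - I_CR \<Omega> \<T> v x)
            \<le> \<kappa> * diameter T *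
               L2_norm (lebesgue_on (interior T)) (weak_gradient (interior T) (\<lambda>x. v x - I_CR \<Omega> \<T> v x))"
    and "k \<ge> 1"
  shows "ereal (GLB (Linf_norm (lebesgue_on \<Omega>) (\<lambda>x. \<kappa>\<^sup>2 * (mesh_size \<T> x)\<^sup>2))
                    (Linf_norm (lebesgue_on \<Omega>) (\<lambda>x. \<kappa>\<^sup>2 * (mesh_size \<T> x)\<^sup>2 * V x))
                    (CR_eigenvalue \<Omega> \<T> V 1)
                    (CR_eigenvalue \<Omega> \<T> V k))
         \<le> exact_eigenvalue \<Omega> V k"
proof -
  interpret cr_problem \<Omega> \<T> V \<kappa> by unfold_locales (use assms in auto)
  from lower_bound[OF assms(9)] show ?thesis by (simp only: \<epsilon>_def \<delta>_def)
qed

end
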